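(* Let $(M,g)$ be a simply connected Lorentzian surface and $E$ a Lorentzian vector bundle of rank 2 on $M$ equipped with a compatible connection. Assume that $M$ and $E$ are oriented (in space and in time), with given spin structures. Let $\Sigma=\Sigma E\otimes\Sigma M$ be the twisted spinor bundle and $D$ its Dirac operator. Let $\vec H\in\Gamma(E)$ be a section of $E$. The following three statements are equivalent: (1) There is a spinor field $\varphi\in\Gamma(\Sigma)$ solution of $D\varphi=\vec H\cdot\varphi$ with $H(\varphi,\varphi)=1$. (2) There is a spinor field $\varphi\in\Gamma(\Sigma)$ with $H(\varphi,\varphi)=1$ solution of $$\nabla_X\varphi=-\frac12\sum_{j=2}^3\epsilon_j\,e_j\cdot B(X,e_j)\cdot\varphi$$ for all $X\in TM$, where $\epsilon_j=g(e_j,e_j)$ and $B:TM\times TM\to E$ is bilinear symmetric with $\frac12\mathrm{tr}_gB=\vec H$. (3) There is an isometric immersion $F$ of $(M,g)$ into $\mathbb{R}^{2,2}$ with normal bundle $E$, second fundamental form $B$ and mean curvature vector $\vec H$. Moreover, $F=\int\xi$, where $\xi$ is the closed 1-form on $M$ with values in $\mathbb{R}^{2,2}$ defined by $\xi(X):=\langle\langle X\cdot\varphi,\varphi\rangle\rangle$ for all $X\in TM$.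
   Context: Algebra. $\mathbb{R}^{2,2}$ is $\mathbb{R}^4$ with metric $-dx_0^2+dx_1^2-dx_2^2+dx_3^2$. $\mathcal{A}=\{u+\sigma v:u,v\in\mathbb{R}\}$, $\sigma^2=1$ (Lorentz numbers), $\mathcal{A}_{\mathbb{C}}=\mathcal{A}\otimes\mathbb{C}$ ($i$ is the imaginary unit of $\mathbb{C}$). $\mathbb{H}^{\mathcal{A}_{\mathbb{C}}}$ is the algebra of quaternions $\zeta=\zeta_01+\zeta_1I+\zeta_2J+\zeta_3K$ with $\zeta_j\in\mathcal{A}_{\mathbb{C}}$, $I^2=J^2=K^2=-1$, $IJ=-JI=K$; $\overline{\zeta}=\zeta_01-\zeta_1I-\zeta_2J-\zeta_3K$, and $\widehat{\zeta}$ is obtained by replacing each coefficient $u+\sigma v$ ($u,v\in\mathbb{C}$) by $u-\sigma v$. $\mathbb{H}_0=\{p_01+ip_1I+p_2J+ip_3K:p_j\in\mathcal{A}\}$, $\mathbb{H}_1=\{iq_01+q_1I+iq_2J+q_3K:q_j\in\mathcal{A}\}$. On $\mathbb{H}_0$, $H(p,p')=p_0p_0'-p_1p_1'+p_2p_2'-p_3p_3'\in\mathcal{A}$. $\mathbb{R}^{2,2}$ is identified with $\{\sigma i x_01+x_1I+ix_2J+x_3K:x_j\in\mathbb{R}\}=\{q\in\mathbb{H}_1:q=-\widehat{\overline q}\}$. Bundles. "Oriented in space and in time" means: oriented, with a continuous choice of a component of the timelike vectors ("future-directed") in each fibre. Positively oriented orthonormal frames are $(e_0,e_1)$ of $E$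 and $(e_2,e_3)$ of $TM$ having the given orientations, with $\langle e_0,e_0\rangle=\langle e_2,e_2\rangle=-1$, $\langle e_1,e_1\rangle=\langle e_3,e_3\rangle=1$, $e_0,e_2$ future-directed; $Q_E,Q_M$ are the bundles of such frames (structure group the identity component $SO(1,1)$), $\tilde Q_E\to Q_E$, $\tilde Q_M\to Q_M$ the spin structures, $\tilde Q=\tilde Q_E\times_M\tilde Q_M$, with structure group $Spin'(1,1)\times Spin''(1,1)$, $Spin'(1,1)=\{\pm(\cosh v+\sigma i\sinh v\,I):v\in\mathbb{R}\}$, $Spin''(1,1)=\{\pm(\cosh u+i\sinh u\,I):u\in\mathbb{R}\}$. $\Sigma=\Sigma E\otimes\Sigma M$ is the vector bundle associated to $\tilde Q$ and the representation $(g_1,g_2)\mapsto(\xi\mapsto g_1g_2\xi)$ on $\mathbb{H}_0$, with the spinorial connection $\nabla=\nabla^{\Sigma E}\otimes id+id\otimes\nabla^{\Sigma M}$. In a local section $\tilde s$ of $\tilde Q$ over $(e_0,e_1,e_2,e_3)$, $\varphi\in\Sigma$ has a coordinate $[\varphi]\in\mathbb{H}_0$, a vector $X=\sum x_je_j\in E\oplus TM$ is represented by $[X]=\sigma i x_01+x_1I+ix_2J+x_3K$, and the Clifford action is $[X\cdot\varphi]=\sigma i\,[X]\widehat{[\varphi]}$ (so $X\cdot X=-\langle X,X\rangle$). The Dirac operator is $D\varphi=-e_2\cdot\nabla_{e_2}\varphi+e_3\cdot\nabla_{e_3}\varphi$. $H(\psi,\psi'):=H([\psi],[\psi'])$ and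 $\langle\langle\psi,\psi'\rangle\rangle:=\sigma i\,\overline{[\psi']}[\psi]\in\mathbb{H}_1$ are well defined on $\Sigma$. $F=\int\xi$ means $dF=\xi$. The mean curvature vector is $\frac12\mathrm{tr}_gB$. "With normal bundle $E$, second fundamental form $B$" means up to a bundle isometry of $E$ with the normal bundle preserving connections and second fundamental forms. *)

theory Defs
  imports "HOL-Analysis.Analysis" "HOL-Library.Function_Algebras"
begin

section \<open>Real vector space of functions\<close>

instantiation "fun" :: (type, real_vector) real_vector
begin

definition scaleR_fun :: "real \<Rightarrow> ('a \<Rightarrow> 'b) \<Rightarrow> 'a \<Rightarrow> 'b"
  where "scaleR_fun r f = (\<lambda>x. r *\<^sub>R f x)"

instance
  by standard (simp_all add: scaleR_fun_def fun_eq_iff scaleR_add_right scaleR_add_left)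

end


section \<open>Lorentz numbers, complexified quaternions and \<open>\<real>\<^sup>2\<^sup>,\<^sup>2\<close>\<close>

text \<open>
  The pair \<open>(u, v)\<close> stands for \<open>u + \<sigma> v\<close> with \<open>\<sigma>\<^sup>2 = 1\<close>, and the quadruple
  \<open>(\<zeta>0, \<zeta>1, \<zeta>2, \<zeta>3)\<close> for \<open>\<zeta>0 1 + \<zeta>1 I + \<zeta>2 J + \<zeta>3 K\<close>. Tuples are used because they
  carry the norm and the real vector space structure needed for differentiation.
\<close>

type_synonym AC = "complex \<times> complex"
type_synonym HAC = "AC \<times> AC \<times> AC \<times> AC"

definition amul :: "AC \<Rightarrow> AC \<Rightarrow> AC"
  where "amul a b = (fst a * fst b + snd a * snd b, fst a * snd b + snd a * fst b)"

definition lorentz_numbers :: "AC set"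
  where "lorentz_numbers = {(complex_of_real u, complex_of_real v) | u v. True}"

fun ascale :: "AC \<Rightarrow> HAC \<Rightarrow> HAC"
  where "ascale a (z0, z1, z2, z3) = (amul a z0, amul a z1, amul a z2, amul a z3)"

fun qmul :: "HAC \<Rightarrow> HAC \<Rightarrow> HAC"  (infixl "\<odot>" 70)
  where "(a0, a1, a2, a3) \<odot> (b0, b1, b2, b3) =
   (amul a0 b0 - amul a1 b1 - amul a2 b2 - amul a3 b3,
    amul a0 b1 + amul a1 b0 + amul a2 b3 - amul a3 b2,
    amul a0 b2 - amul a1 b3 + amul a2 b0 + amul a3 b1,
    amul a0 b3 + amul a1 b2 - amul a2 b1 + amul a3 b0)"

fun qconj :: "HAC \<Rightarrow> HAC"
  where "qconj (z0, z1, z2, z3) = (z0, - z1, - z2, - z3)"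

definition ahat :: "AC \<Rightarrow> AC"
  where "ahat a = (fst a, - snd a)"

fun qhat :: "HAC \<Rightarrow> HAC"
  where "qhat (z0, z1, z2, z3) = (ahat z0, ahat z1, ahat z2, ahat z3)"

definition a_i :: AC where "a_i = (\<i>, 0)"
definition a_sigma_i :: AC where "a_sigma_i = (0, \<i>)"

definition q_one :: HAC where "q_one = ((1, 0), 0, 0, 0)"
definition q_I :: HAC where "q_I = (0, (1, 0), 0, 0)"
definition q_J :: HAC where "q_J = (0, 0, (1, 0), 0)"
definition q_K :: HAC where "q_K = (0, 0, 0, (1, 0))"

definition H0 :: "HAC set"
  where "H0 = {(p0, amul a_i p1, p2, amul a_i p3) | p0 p1 p2 p3.
    {p0, p1, p2, p3} \<subseteq> lorentz_numbers}"

text \<open>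
  \<open>H(p, p') = p0 p0' - p1 p1' + p2 p2' - p3 p3'\<close> on \<open>H0\<close>; the components \<open>p1\<close>, \<open>p3\<close> are
  recovered from the coefficients \<open>i p1\<close>, \<open>i p3\<close> of \<open>I\<close>, \<open>K\<close> by multiplication with \<open>- i\<close>.
\<close>

fun Hform :: "HAC \<Rightarrow> HAC \<Rightarrow> AC"
  where "Hform (z0, z1, z2, z3) (w0, w1, w2, w3) =
    amul z0 w0 - amul (amul (- a_i) z1) (amul (- a_i) w1)
      + amul z2 w2 - amul (amul (- a_i) z3) (amul (- a_i) w3)"

definition ip22 :: "real^4 \<Rightarrow> real^4 \<Rightarrow> real"
  where "ip22 x y = - (x $ 0 * y $ 0) + x $ 1 * y $ 1 - x $ 2 * y $ 2 + x $ 3 * y $ 3"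

definition iota :: "real^4 \<Rightarrow> HAC"
  where "iota x = (x $ 0) *\<^sub>R ascale a_sigma_i q_one + (x $ 1) *\<^sub>R q_I
    + (x $ 2) *\<^sub>R ascale a_i q_J + (x $ 3) *\<^sub>R q_K"

definition isometries22 :: "(real^4^4) set"
  where "isometries22 = {R. \<forall>x y. ip22 (R *v x) (R *v y) = ip22 x y}"

definition Spin1 :: "HAC set"
  where "Spin1 = {s *\<^sub>R (cosh v *\<^sub>R q_one + sinh v *\<^sub>R ascale a_sigma_i q_I) | s v. s = 1 \<or> s = -1}"

definition Spin2 :: "HAC set"
  where "Spin2 = {s *\<^sub>R (cosh u *\<^sub>R q_one + sinh u *\<^sub>R ascale a_i q_I) | s u. s = 1 \<or> s = -1}"


section \<open>Smooth surfaces\<close>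

fun Ck_on :: "nat \<Rightarrow> ('a::real_normed_vector \<Rightarrow> 'b::real_normed_vector) \<Rightarrow> 'a set \<Rightarrow> bool"
  where
    "Ck_on 0 f S \<longleftrightarrow> continuous_on S f"
  | "Ck_on (Suc n) f S \<longleftrightarrow> (\<forall>x\<in>S. f differentiable (at x)) \<and>
       (\<forall>v. Ck_on n (\<lambda>x. frechet_derivative f (at x) v) S)"

text \<open>Meaningful for open \<open>S\<close>.\<close>

definition smooth_on :: "('a::real_normed_vector \<Rightarrow> 'b::real_normed_vector) \<Rightarrow> 'a set \<Rightarrow> bool"
  where "smooth_on f S \<longleftrightarrow> (\<forall>n. Ck_on n f S)"

type_synonym 'm chart = "'m set \<times> ('m \<Rightarrow> real^2)"

definition smooth_atlas :: "'m::topological_space chart set \<Rightarrow> bool"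
  where "smooth_atlas A \<longleftrightarrow>
    (\<forall>(U, c)\<in>A. open U \<and> open (c ` U) \<and> homeomorphism U (c ` U) c (inv_into U c)) \<and>
    (\<forall>p. \<exists>(U, c)\<in>A. p \<in> U) \<and>
    (\<forall>(U, c)\<in>A. \<forall>(V, d)\<in>A. smooth_on (d \<circ> inv_into U c) (c ` (U \<inter> V)))"

definition smooth_fun ::
  "'m::topological_space chart set \<Rightarrow> 'm set \<Rightarrow> ('m \<Rightarrow> 'b::real_normed_vector) \<Rightarrow> bool"
  where "smooth_fun A U f \<longleftrightarrow> (\<forall>(V, c)\<in>A. smooth_on (f \<circ> inv_into V c) (c ` (U \<inter> V)))"

text \<open>
  A tangent vector at \<open>p\<close> assigns to each chart around \<open>p\<close> a coordinate vector, these being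
  related by the differentials of the coordinate changes.
\<close>

type_synonym 'm tvec = "'m chart \<Rightarrow> real^2"

definition charts_at :: "'m chart set \<Rightarrow> 'm \<Rightarrow> 'm chart set"
  where "charts_at A p = {c \<in> A. p \<in> fst c}"

definition transition_deriv :: "'m chart \<Rightarrow> 'm chart \<Rightarrow> 'm \<Rightarrow> real^2 \<Rightarrow> real^2"
  where "transition_deriv c d p =
    frechet_derivative (snd d \<circ> inv_into (fst c) (snd c)) (at (snd c p))"

definition tangent_space :: "'m chart set \<Rightarrow> 'm \<Rightarrow> 'm tvec set"
  where "tangent_space A p = {X.
    (\<forall>c. c \<notin> charts_at A p \<longrightarrow> X c = 0) \<and>
    (\<forall>c\<in>charts_at A p. \<forall>d\<in>charts_at A p. X d = transition_deriv c d p (X c))}"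

definition coord_field :: "'m chart set \<Rightarrow> 'm chart \<Rightarrow> 2 \<Rightarrow> 'm \<Rightarrow> 'm tvec"
  where "coord_field A c j p =
    (\<lambda>d. if d \<in> charts_at A p then transition_deriv c d p (axis j 1) else 0)"

definition mdiff ::
  "'m chart set \<Rightarrow> ('m \<Rightarrow> 'b::real_normed_vector) \<Rightarrow> 'm \<Rightarrow> 'm tvec \<Rightarrow> 'b"
  where "mdiff A f p X = (let c = (SOME c. c \<in> charts_at A p) in
    frechet_derivative (f \<circ> inv_into (fst c) (snd c)) (at (snd c p)) (X c))"

definition lie_bracket ::
  "'m chart set \<Rightarrow> ('m \<Rightarrow> 'm tvec) \<Rightarrow> ('m \<Rightarrow> 'm tvec) \<Rightarrow> 'm \<Rightarrow> 'm tvec"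
  where "lie_bracket A X Y p = (\<lambda>c. if c \<in> charts_at A p then
      frechet_derivative ((\<lambda>q. Y q c) \<circ> inv_into (fst c) (snd c)) (at (snd c p)) (X p c)
    - frechet_derivative ((\<lambda>q. X q c) \<circ> inv_into (fst c) (snd c)) (at (snd c p)) (Y p c)
    else 0)"


section \<open>Lorentzian plane bundles\<close>

text \<open>
  The fibres are planes in one ambient real vector space \<open>'v\<close>; this is no restriction, since
  any family of vector spaces embeds into its direct sum. The smooth structure is given by an
  atlas \<open>frm\<close> of local frames \<open>(U, b1, b2)\<close>. \<open>ori p\<close> is the set of positively oriented ordered
  bases of the fibre, \<open>fut p\<close> the set of future-directed vectors, and
  \<open>nab p X s\<close> is the covariant derivative at \<open>p\<close> of the (local) section \<open>s\<close> along \<open>X\<close>.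
\<close>

record ('m, 'v) plane_bundle =
  fib :: "'m \<Rightarrow> 'v set"
  frm :: "('m set \<times> ('m \<Rightarrow> 'v) \<times> ('m \<Rightarrow> 'v)) set"
  met :: "'m \<Rightarrow> 'v \<Rightarrow> 'v \<Rightarrow> real"
  ori :: "'m \<Rightarrow> ('v \<times> 'v) set"
  fut :: "'m \<Rightarrow> 'v set"
  nab :: "'m \<Rightarrow> 'm tvec \<Rightarrow> ('m \<Rightarrow> 'v) \<Rightarrow> 'v"

definition basis2 :: "'v::real_vector set \<Rightarrow> 'v \<Rightarrow> 'v \<Rightarrow> bool"
  where "basis2 V a b \<longleftrightarrow> a \<noteq> b \<and> independent {a, b} \<and> span {a, b} = V"

definition smooth_section ::
  "'m::topological_space chart set \<Rightarrow> ('m, 'v::real_vector) plane_bundle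
    \<Rightarrow> 'm set \<Rightarrow> ('m \<Rightarrow> 'v) \<Rightarrow> bool"
  where "smooth_section A E U s \<longleftrightarrow> (\<forall>p\<in>U. s p \<in> fib E p) \<and>
    (\<forall>(V, b1, b2)\<in>frm E. \<exists>f1 f2. smooth_fun A (U \<inter> V) f1 \<and> smooth_fun A (U \<inter> V) f2 \<and>
       (\<forall>p\<in>U \<inter> V. s p = f1 p *\<^sub>R b1 p + f2 p *\<^sub>R b2 p))"

definition vector_bundle ::
  "'m::topological_space chart set \<Rightarrow> ('m, 'v::real_vector) plane_bundle \<Rightarrow> bool"
  where "vector_bundle A E \<longleftrightarrow>
    (\<forall>p. subspace (fib E p)) \<and>
    (\<forall>p. \<exists>(U, b1, b2)\<in>frm E. p \<in> U) \<and>
    (\<forall>(U, b1, b2)\<in>frm E. open U \<and> (\<forall>p\<in>U. basis2 (fib E p) (b1 p) (b2 p)) \<and>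
       smooth_section A E U b1 \<and> smooth_section A E U b2)"

definition lorentz_metric ::
  "'m::topological_space chart set \<Rightarrow> ('m, 'v::real_vector) plane_bundle \<Rightarrow> bool"
  where "lorentz_metric A E \<longleftrightarrow>
    (\<forall>p. \<forall>u\<in>fib E p. \<forall>v\<in>fib E p. \<forall>w\<in>fib E p. \<forall>r.
       met E p u v = met E p v u \<and>
       met E p (u + v) w = met E p u w + met E p v w \<and>
       met E p (r *\<^sub>R u) w = r * met E p u w) \<and>
    (\<forall>p. \<exists>a b. basis2 (fib E p) a b \<and>
       met E p a a = -1 \<and> met E p b b = 1 \<and> met E p a b = 0) \<and>
    (\<forall>U s t. open U \<and> smooth_section A E U s \<and> smooth_section A E U t \<longrightarrow>
       smooth_fun A U (\<lambda>p. met E p (s p) (t p)))"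

definition space_orientation ::
  "'m::topological_space chart set \<Rightarrow> ('m, 'v::real_vector) plane_bundle \<Rightarrow> bool"
  where "space_orientation A E \<longleftrightarrow>
    (\<forall>p. \<forall>(a, b)\<in>ori E p. basis2 (fib E p) a b \<and>
       (\<forall>\<alpha> \<beta> \<gamma> \<delta>. (\<alpha> *\<^sub>R a + \<beta> *\<^sub>R b, \<gamma> *\<^sub>R a + \<delta> *\<^sub>R b) \<in> ori E p \<longleftrightarrow> \<alpha> * \<delta> - \<beta> * \<gamma> > 0)) \<and>
    (\<forall>p. \<exists>U s t. open U \<and> p \<in> U \<and> smooth_section A E U s \<and> smooth_section A E U t \<and>
       (\<forall>q\<in>U. (s q, t q) \<in> ori E q))"

text \<open>The component containing a timelike \<open>v\<close> is the set of timelike \<open>w\<close> with \<open>\<langle>v, w\<rangle> < 0\<close>.\<close>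

definition time_orientation ::
  "'m::topological_space chart set \<Rightarrow> ('m, 'v::real_vector) plane_bundle \<Rightarrow> bool"
  where "time_orientation A E \<longleftrightarrow>
    (\<forall>p. \<exists>v\<in>fib E p. met E p v v < 0 \<and>
       fut E p = {w \<in> fib E p. met E p w w < 0 \<and> met E p v w < 0}) \<and>
    (\<forall>p. \<exists>U s. open U \<and> p \<in> U \<and> smooth_section A E U s \<and> (\<forall>q\<in>U. s q \<in> fut E q))"

text \<open>
  A connection, acting on germs of smooth sections. \<open>T\<close> is the tangent bundle; only its fibres
  and its smooth structure are used.
\<close>

definition connection ::
  "'m::topological_space chart set \<Rightarrow> ('m, 'm tvec) plane_bundle
    \<Rightarrow> ('m, 'v::real_vector) plane_bundle \<Rightarrow> bool"
  where "connection A T E \<longleftrightarrow>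
    (\<forall>U s. open U \<and> smooth_section A E U s \<longrightarrow>
       (\<forall>p\<in>U. \<forall>X\<in>fib T p. nab E p X s \<in> fib E p) \<and>
       (\<forall>p\<in>U. \<forall>X\<in>fib T p. \<forall>Y\<in>fib T p. \<forall>r.
          nab E p (X + Y) s = nab E p X s + nab E p Y s \<and>
          nab E p (r *\<^sub>R X) s = r *\<^sub>R nab E p X s) \<and>
       (\<forall>t. smooth_section A E U t \<longrightarrow> (\<forall>p\<in>U. \<forall>X\<in>fib T p.
          nab E p X (\<lambda>q. s q + t q) = nab E p X s + nab E p X t)) \<and>
       (\<forall>f. smooth_fun A U f \<longrightarrow> (\<forall>p\<in>U. \<forall>X\<in>fib T p.
          nab E p X (\<lambda>q. f q *\<^sub>R s q) = mdiff A f p X *\<^sub>R s p + f p *\<^sub>R nab E p X s)) \<and>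
       (\<forall>t. (\<forall>q\<in>U. t q = s q) \<longrightarrow> (\<forall>p\<in>U. \<forall>X\<in>fib T p. nab E p X t = nab E p X s)) \<and>
       (\<forall>X. smooth_section A T U X \<longrightarrow> smooth_section A E U (\<lambda>p. nab E p (X p) s)))"

definition metric_connection ::
  "'m::topological_space chart set \<Rightarrow> ('m, 'm tvec) plane_bundle
    \<Rightarrow> ('m, 'v::real_vector) plane_bundle \<Rightarrow> bool"
  where "metric_connection A T E \<longleftrightarrow> connection A T E \<and>
    (\<forall>U s t. open U \<and> smooth_section A E U s \<and> smooth_section A E U t \<longrightarrow>
       (\<forall>p\<in>U. \<forall>X\<in>fib T p. mdiff A (\<lambda>q. met E q (s q) (t q)) p X =
          met E p (nab E p X s) (t p) + met E p (s p) (nab E p X t)))"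

definition torsion_free ::
  "'m::topological_space chart set \<Rightarrow> ('m, 'm tvec) plane_bundle \<Rightarrow> bool"
  where "torsion_free A T \<longleftrightarrow>
    (\<forall>U X Y. open U \<and> smooth_section A T U X \<and> smooth_section A T U Y \<longrightarrow>
       (\<forall>p\<in>U. nab T p (X p) Y - nab T p (Y p) X = lie_bracket A X Y p))"

text \<open>
  \<open>E\<close> is a Lorentzian plane bundle with compatible connection, oriented in space and in time.
\<close>

definition oriented_lorentz_bundle ::
  "'m::topological_space chart set \<Rightarrow> ('m, 'm tvec) plane_bundle
    \<Rightarrow> ('m, 'v::real_vector) plane_bundle \<Rightarrow> bool"
  where "oriented_lorentz_bundle A T E \<longleftrightarrow>
    vector_bundle A E \<and> lorentz_metric A E \<and> metric_connection A T E \<and>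
    space_orientation A E \<and> time_orientation A E"

text \<open>
  \<open>T\<close> is the tangent bundle of the surface with a Lorentzian metric, space and time orientations
  and the Levi-Civita connection of the metric.
\<close>

definition oriented_lorentz_tangent_bundle ::
  "'m::topological_space chart set \<Rightarrow> ('m, 'm tvec) plane_bundle \<Rightarrow> bool"
  where "oriented_lorentz_tangent_bundle A T \<longleftrightarrow>
    fib T = tangent_space A \<and>
    frm T = {(fst c, coord_field A c 1, coord_field A c 2) | c. c \<in> A} \<and>
    oriented_lorentz_bundle A T T \<and> torsion_free A T"

definition on_frames :: "('m, 'v::real_vector) plane_bundle \<Rightarrow> 'm \<Rightarrow> ('v \<times> 'v) set"
  where "on_frames E p = {(a, b) \<in> ori E p. met E p a a = -1 \<and> met E p b b = 1 \<and>
    met E p a b = 0 \<and> a \<in> fut E p}"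


section \<open>Spin structures\<close>

text \<open>
  \<open>'q\<close> is the total space of a principal bundle with projection \<open>sproj\<close> and right action \<open>sact\<close>,
  whose smooth structure is given by an atlas \<open>ssec\<close> of local sections; \<open>sframe\<close> is the bundle
  map to the bundle of positively oriented orthonormal frames.
\<close>

record ('m, 'v, 'q) spin_bundle =
  sproj :: "'q \<Rightarrow> 'm"
  sact :: "'q \<Rightarrow> HAC \<Rightarrow> 'q"
  ssec :: "('m set \<times> ('m \<Rightarrow> 'q)) set"
  sframe :: "'q \<Rightarrow> 'v \<times> 'v"

definition principal_bundle ::
  "'m::topological_space chart set \<Rightarrow> HAC set \<Rightarrow> ('m, 'v, 'q) spin_bundle \<Rightarrow> bool"
  where "principal_bundle A G P \<longleftrightarrow>
    (\<forall>q. sact P q q_one = q) \<and>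
    (\<forall>q. \<forall>g\<in>G. \<forall>h\<in>G. sact P (sact P q g) h = sact P q (g \<odot> h)) \<and>
    (\<forall>q. \<forall>g\<in>G. sproj P (sact P q g) = sproj P q) \<and>
    (\<forall>q q'. sproj P q = sproj P q' \<longrightarrow> (\<exists>!g. g \<in> G \<and> q' = sact P q g)) \<and>
    (\<forall>p. \<exists>(U, s)\<in>ssec P. p \<in> U) \<and>
    (\<forall>(U, s)\<in>ssec P. open U \<and> (\<forall>p\<in>U. sproj P (s p) = p)) \<and>
    (\<forall>(U, s)\<in>ssec P. \<forall>(V, t)\<in>ssec P. \<exists>g. smooth_fun A (U \<inter> V) g \<and>
       (\<forall>p\<in>U \<inter> V. g p \<in> G \<and> t p = sact P (s p) (g p)))"

definition smooth_spin_section ::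
  "'m::topological_space chart set \<Rightarrow> HAC set \<Rightarrow> ('m, 'v, 'q) spin_bundle
    \<Rightarrow> 'm set \<Rightarrow> ('m \<Rightarrow> 'q) \<Rightarrow> bool"
  where "smooth_spin_section A G P U s \<longleftrightarrow> (\<forall>p\<in>U. sproj P (s p) = p) \<and>
    (\<forall>(V, t)\<in>ssec P. \<exists>g. smooth_fun A (U \<inter> V) g \<and>
       (\<forall>p\<in>U \<inter> V. g p \<in> G \<and> s p = sact P (t p) (g p)))"

text \<open>
  The group \<open>G\<close> is \<open>Spin1\<close> or \<open>Spin2\<close>; it acts on the real span of \<open>w0\<close>, \<open>w1\<close> by
  \<open>x \<mapsto> g x (qhat g)\<inverse>\<close>, where \<open>(qhat g)\<inverse> = qconj (qhat g)\<close>, and this is the double covering of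
  the identity component of \<open>SO(1,1)\<close>. Equivariance of \<open>sframe\<close>: the vector with coordinates
  \<open>x\<close> in the frame of \<open>q g\<close> has coordinates \<open>g x (qhat g)\<inverse>\<close> in the frame of \<open>q\<close>.
\<close>

definition spin_structure ::
  "'m::topological_space chart set \<Rightarrow> ('m, 'v::real_vector) plane_bundle
    \<Rightarrow> HAC set \<Rightarrow> HAC \<Rightarrow> HAC \<Rightarrow> ('m, 'v, 'q) spin_bundle \<Rightarrow> bool"
  where "spin_structure A E G w0 w1 P \<longleftrightarrow>
    principal_bundle A G P \<and>
    (\<forall>q. sframe P q \<in> on_frames E (sproj P q)) \<and>
    (\<forall>(U, s)\<in>ssec P. smooth_section A E U (\<lambda>p. fst (sframe P (s p))) \<and>
       smooth_section A E U (\<lambda>p. snd (sframe P (s p)))) \<and>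
    (\<forall>q. \<forall>g\<in>G. \<forall>x0 x1 y0 y1.
       g \<odot> (x0 *\<^sub>R w0 + x1 *\<^sub>R w1) \<odot> qconj (qhat g) = y0 *\<^sub>R w0 + y1 *\<^sub>R w1 \<longrightarrow>
       x0 *\<^sub>R fst (sframe P (sact P q g)) + x1 *\<^sub>R snd (sframe P (sact P q g)) =
       y0 *\<^sub>R fst (sframe P q) + y1 *\<^sub>R snd (sframe P q))"

record ('m, 'e, 'qe, 'qm) spin_surface =
  atl :: "'m chart set"
  TB :: "('m, 'm tvec) plane_bundle"
  EB :: "('m, 'e) plane_bundle"
  PE :: "('m, 'e, 'qe) spin_bundle"
  PM :: "('m, 'm tvec, 'qm) spin_bundle"

text \<open>
  A Lorentzian surface (without simple connectedness) with a Lorentzian plane bundle with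
  compatible connection, all oriented in space and in time and equipped with spin structures.
\<close>

definition spin_lorentz_surface ::
  "('m::{t2_space, second_countable_topology}, 'e::real_vector, 'qe, 'qm) spin_surface \<Rightarrow> bool"
  where "spin_lorentz_surface S \<longleftrightarrow>
    smooth_atlas (atl S) \<and>
    oriented_lorentz_tangent_bundle (atl S) (TB S) \<and>
    oriented_lorentz_bundle (atl S) (TB S) (EB S) \<and>
    spin_structure (atl S) (EB S) Spin1 (ascale a_sigma_i q_one) q_I (PE S) \<and>
    spin_structure (atl S) (TB S) Spin2 (ascale a_i q_J) q_K (PM S)"


section \<open>The twisted spinor bundle\<close>

text \<open>
  An element of the fibre at \<open>p\<close> of the bundle associated with \<open>PE \<times> PM\<close> and the representation
  \<open>(g1, g2) \<mapsto> (\<xi> \<mapsto> g1 g2 \<xi>)\<close> on \<open>H0\<close> is an equivalence class of pairs \<open>(q, \<xi>)\<close>,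
  \<open>(q g, \<xi>) \<sim> (q, g \<xi>)\<close>. It is the graph of an equivariant function \<open>f\<close> on the fibre of
  \<open>PE \<times> PM\<close> and is represented by this \<open>f\<close>, extended by zero; \<open>f q\<close> is its coordinate in the
  spin frame \<open>q\<close>.
\<close>

type_synonym ('qe, 'qm) spinor = "'qe \<times> 'qm \<Rightarrow> HAC"

definition spin_frames ::
  "('m, 'e, 'qe, 'qm) spin_surface \<Rightarrow> 'm \<Rightarrow> ('qe \<times> 'qm) set"
  where "spin_frames S p = {(q1, q2). sproj (PE S) q1 = p \<and> sproj (PM S) q2 = p}"

definition spinors ::
  "('m, 'e, 'qe, 'qm) spin_surface \<Rightarrow> 'm \<Rightarrow> ('qe, 'qm) spinor set"
  where "spinors S p = {f.
    (\<forall>q. q \<notin> spin_frames S p \<longrightarrow> f q = 0) \<and>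
    (\<forall>q\<in>spin_frames S p. f q \<in> H0) \<and>
    (\<forall>(q1, q2)\<in>spin_frames S p. \<forall>g1\<in>Spin1. \<forall>g2\<in>Spin2.
       f (q1, q2) = g1 \<odot> g2 \<odot> f (sact (PE S) q1 g1, sact (PM S) q2 g2))}"

definition spinor_field ::
  "('m::topological_space, 'e, 'qe, 'qm) spin_surface \<Rightarrow> ('m \<Rightarrow> ('qe, 'qm) spinor) \<Rightarrow> bool"
  where "spinor_field S \<phi> \<longleftrightarrow> (\<forall>p. \<phi> p \<in> spinors S p) \<and>
    (\<forall>(U, s1)\<in>ssec (PE S). \<forall>(V, s2)\<in>ssec (PM S).
       smooth_fun (atl S) (U \<inter> V) (\<lambda>p. \<phi> p (s1 p, s2 p)))"

text \<open>
  \<open>[(v, X)] = \<sigma> i x0 1 + x1 I + i x2 J + x3 K\<close> for \<open>(v, X)\<close> in \<open>E \<oplus> TM\<close> in a spin frame over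
  \<open>(e0, e1, e2, e3)\<close>, where \<open>xj = \<langle>ej, ej\<rangle> \<langle>(v, X), ej\<rangle>\<close>.
\<close>

definition vec_coord ::
  "('m, 'e, 'qe, 'qm) spin_surface \<Rightarrow> 'm \<Rightarrow> 'e \<times> 'm tvec \<Rightarrow> 'qe \<times> 'qm \<Rightarrow> HAC"
  where "vec_coord S p = (\<lambda>(v, X) (q1, q2).
    (let (e0, e1) = sframe (PE S) q1; (e2, e3) = sframe (PM S) q2 in
      (- met (EB S) p v e0) *\<^sub>R ascale a_sigma_i q_one + met (EB S) p v e1 *\<^sub>R q_I
      + (- met (TB S) p X e2) *\<^sub>R ascale a_i q_J + met (TB S) p X e3 *\<^sub>R q_K))"

definition clifford ::
  "('m, 'e, 'qe, 'qm) spin_surface \<Rightarrow> 'm \<Rightarrow> 'e \<times> 'm tvec \<Rightarrow> ('qe, 'qm) spinor \<Rightarrow> ('qe, 'qm) spinor"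
  where "clifford S p v f = (\<lambda>q. if q \<in> spin_frames S p
    then ascale a_sigma_i (vec_coord S p v q \<odot> qhat (f q)) else 0)"

text \<open>
  In local spin sections over orthonormal frames \<open>(e0, e1)\<close>, \<open>(e2, e3)\<close>, the spinorial
  connections are
  \<open>[\<nabla>\<^sub>X \<phi>] = d[\<phi>](X) - \<onehalf> \<langle>\<nabla>\<^sub>X e0, e1\<rangle> [e0\<cdot>e1\<cdot>\<phi>] - \<onehalf> \<langle>\<nabla>\<^sub>X e2, e3\<rangle> [e2\<cdot>e3\<cdot>\<phi>]\<close>,
  where \<open>e0\<cdot>e1\<close> acts as \<open>\<sigma> i I\<close> and \<open>e2\<cdot>e3\<close> as \<open>i I\<close>; the two last terms belong to
  \<open>\<nabla>\<^sup>\<Sigma>\<^sup>E\<close> and \<open>\<nabla>\<^sup>\<Sigma>\<^sup>M\<close>. At a spin frame \<open>q\<close> any smooth local section through \<open>q\<close> is used.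
\<close>

definition spin_nabla ::
  "('m::topological_space, 'e::real_vector, 'qe, 'qm) spin_surface
    \<Rightarrow> 'm \<Rightarrow> 'm tvec \<Rightarrow> ('m \<Rightarrow> ('qe, 'qm) spinor) \<Rightarrow> ('qe, 'qm) spinor"
  where "spin_nabla S p X \<phi> = (\<lambda>q. if q \<in> spin_frames S p then
    (let (s1, s2) = (SOME (s1, s2). (s1 p, s2 p) = q \<and> (\<exists>U. open U \<and> p \<in> U \<and>
           smooth_spin_section (atl S) Spin1 (PE S) U s1 \<and>
           smooth_spin_section (atl S) Spin2 (PM S) U s2));
         e0 = (\<lambda>x. fst (sframe (PE S) (s1 x))); e1 = (\<lambda>x. snd (sframe (PE S) (s1 x)));
         e2 = (\<lambda>x. fst (sframe (PM S) (s2 x))); e3 = (\<lambda>x. snd (sframe (PM S) (s2 x)))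
     in mdiff (atl S) (\<lambda>x. \<phi> x (s1 x, s2 x)) p X
        - (1/2 * met (EB S) p (nab (EB S) p X e0) (e1 p)) *\<^sub>R (ascale a_sigma_i q_I \<odot> \<phi> p q)
        - (1/2 * met (TB S) p (nab (TB S) p X e2) (e3 p)) *\<^sub>R (ascale a_i q_I \<odot> \<phi> p q))
    else 0)"

text \<open>
  A positively oriented orthonormal frame \<open>(e2, e3)\<close> at \<open>p\<close>, for quantities that do not depend
  on its choice.
\<close>

definition tframe :: "('m, 'e, 'qe, 'qm) spin_surface \<Rightarrow> 'm \<Rightarrow> 'm tvec \<times> 'm tvec"
  where "tframe S p = (SOME fr. fr \<in> on_frames (TB S) p)"

definition dirac ::
  "('m::topological_space, 'e::real_vector, 'qe, 'qm) spin_surface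
    \<Rightarrow> ('m \<Rightarrow> ('qe, 'qm) spinor) \<Rightarrow> 'm \<Rightarrow> ('qe, 'qm) spinor"
  where "dirac S \<phi> p = (let (e2, e3) = tframe S p in
    - clifford S p (0, e2) (spin_nabla S p e2 \<phi>) + clifford S p (0, e3) (spin_nabla S p e3 \<phi>))"

text \<open>\<open>H(\<psi>, \<psi>')\<close> and \<open>\<langle>\<langle>\<psi>, \<psi>'\<rangle>\<rangle>\<close>, computed in an arbitrary spin frame.\<close>

definition Hpair ::
  "('m, 'e, 'qe, 'qm) spin_surface \<Rightarrow> 'm \<Rightarrow> ('qe, 'qm) spinor \<Rightarrow> ('qe, 'qm) spinor \<Rightarrow> AC"
  where "Hpair S p f f' = (let q = (SOME q. q \<in> spin_frames S p) in Hform (f q) (f' q))"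

definition qpair ::
  "('m, 'e, 'qe, 'qm) spin_surface \<Rightarrow> 'm \<Rightarrow> ('qe, 'qm) spinor \<Rightarrow> ('qe, 'qm) spinor \<Rightarrow> HAC"
  where "qpair S p f f' = (let q = (SOME q. q \<in> spin_frames S p) in
    ascale a_sigma_i (qconj (f' q) \<odot> f q))"


section \<open>Second fundamental forms, immersions and spinorial equations\<close>

definition symmetric_form ::
  "('m::topological_space, 'e::real_vector, 'qe, 'qm) spin_surface
    \<Rightarrow> ('m \<Rightarrow> 'm tvec \<Rightarrow> 'm tvec \<Rightarrow> 'e) \<Rightarrow> bool"
  where "symmetric_form S B \<longleftrightarrow>
    (\<forall>p. \<forall>X\<in>fib (TB S) p. \<forall>Y\<in>fib (TB S) p. \<forall>Z\<in>fib (TB S) p. \<forall>r.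
       B p X Y \<in> fib (EB S) p \<and> B p X Y = B p Y X \<and>
       B p (X + Y) Z = B p X Z + B p Y Z \<and> B p (r *\<^sub>R X) Z = r *\<^sub>R B p X Z) \<and>
    (\<forall>U X Y. open U \<and> smooth_section (atl S) (TB S) U X \<and> smooth_section (atl S) (TB S) U Y \<longrightarrow>
       smooth_section (atl S) (EB S) U (\<lambda>p. B p (X p) (Y p)))"

definition metric_trace ::
  "('m, 'e::real_vector, 'qe, 'qm) spin_surface \<Rightarrow> ('m \<Rightarrow> 'm tvec \<Rightarrow> 'm tvec \<Rightarrow> 'e) \<Rightarrow> 'm \<Rightarrow> 'e"
  where "metric_trace S B p = (let (e2, e3) = tframe S p in
    met (TB S) p e2 e2 *\<^sub>R B p e2 e2 + met (TB S) p e3 e3 *\<^sub>R B p e3 e3)"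

definition unit_spinor_field ::
  "('m::topological_space, 'e, 'qe, 'qm) spin_surface \<Rightarrow> ('m \<Rightarrow> ('qe, 'qm) spinor) \<Rightarrow> bool"
  where "unit_spinor_field S \<phi> \<longleftrightarrow>
    spinor_field S \<phi> \<and> (\<forall>p. Hpair S p (\<phi> p) (\<phi> p) = (1, 0))"

definition dirac_solution ::
  "('m::topological_space, 'e::real_vector, 'qe, 'qm) spin_surface
    \<Rightarrow> ('m \<Rightarrow> 'e) \<Rightarrow> ('m \<Rightarrow> ('qe, 'qm) spinor) \<Rightarrow> bool"
  where "dirac_solution S h \<phi> \<longleftrightarrow> unit_spinor_field S \<phi> \<and>
    (\<forall>p. dirac S \<phi> p = clifford S p (h p, 0) (\<phi> p))"

definition killing_solution ::
  "('m::topological_space, 'e::real_vector, 'qe, 'qm) spin_surface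
    \<Rightarrow> ('m \<Rightarrow> 'e) \<Rightarrow> ('m \<Rightarrow> 'm tvec \<Rightarrow> 'm tvec \<Rightarrow> 'e) \<Rightarrow> ('m \<Rightarrow> ('qe, 'qm) spinor) \<Rightarrow> bool"
  where "killing_solution S h B \<phi> \<longleftrightarrow> unit_spinor_field S \<phi> \<and> symmetric_form S B \<and>
    (\<forall>p. (1/2) *\<^sub>R metric_trace S B p = h p) \<and>
    (\<forall>p. \<forall>X\<in>fib (TB S) p. spin_nabla S p X \<phi> =
      (let (e2, e3) = tframe S p in - (1/2) *\<^sub>R
        (met (TB S) p e2 e2 *\<^sub>R clifford S p (0, e2) (clifford S p (B p X e2, 0) (\<phi> p))
       + met (TB S) p e3 e3 *\<^sub>R clifford S p (0, e3) (clifford S p (B p X e3, 0) (\<phi> p)))))"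

definition isometric_immersion ::
  "('m::topological_space, 'e, 'qe, 'qm) spin_surface \<Rightarrow> ('m \<Rightarrow> real^4) \<Rightarrow> bool"
  where "isometric_immersion S F \<longleftrightarrow> smooth_fun (atl S) UNIV F \<and>
    (\<forall>p. inj_on (mdiff (atl S) F p) (fib (TB S) p) \<and>
      (\<forall>X\<in>fib (TB S) p. \<forall>Y\<in>fib (TB S) p.
        ip22 (mdiff (atl S) F p X) (mdiff (atl S) F p Y) = met (TB S) p X Y))"

definition normal_space ::
  "('m::topological_space, 'e, 'qe, 'qm) spin_surface \<Rightarrow> ('m \<Rightarrow> real^4) \<Rightarrow> 'm \<Rightarrow> (real^4) set"
  where "normal_space S F p = {n. \<forall>X\<in>fib (TB S) p. ip22 n (mdiff (atl S) F p X) = 0}"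

definition normal_part ::
  "('m::topological_space, 'e, 'qe, 'qm) spin_surface \<Rightarrow> ('m \<Rightarrow> real^4) \<Rightarrow> 'm \<Rightarrow> real^4 \<Rightarrow> real^4"
  where "normal_part S F p w = (THE n. n \<in> normal_space S F p \<and>
    (\<exists>X\<in>fib (TB S) p. w = mdiff (atl S) F p X + n))"

text \<open>
  \<open>\<Psi>\<close> is a bundle isometry from \<open>E\<close> to the normal bundle of \<open>F\<close> that takes the connection of \<open>E\<close>
  to the normal connection and \<open>B\<close> to the second fundamental form
  \<open>(X, Y) \<mapsto> (d(dF(Y))(X))\<^sup>\<bottom>\<close>. The last clause says that \<open>h\<close> is the mean curvature vector.
\<close>

definition immersion_with ::
  "('m::topological_space, 'e::real_vector, 'qe, 'qm) spin_surface
    \<Rightarrow> ('m \<Rightarrow> 'e) \<Rightarrow> ('m \<Rightarrow> 'm tvec \<Rightarrow> 'm tvec \<Rightarrow> 'e)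
    \<Rightarrow> ('m \<Rightarrow> real^4) \<Rightarrow> ('m \<Rightarrow> 'e \<Rightarrow> real^4) \<Rightarrow> bool"
  where "immersion_with S h B F \<Psi> \<longleftrightarrow> isometric_immersion S F \<and> symmetric_form S B \<and>
    (\<forall>p. bij_betw (\<Psi> p) (fib (EB S) p) (normal_space S F p)) \<and>
    (\<forall>p. \<forall>v\<in>fib (EB S) p. \<forall>w\<in>fib (EB S) p. \<forall>r.
       \<Psi> p (v + w) = \<Psi> p v + \<Psi> p w \<and> \<Psi> p (r *\<^sub>R v) = r *\<^sub>R \<Psi> p v \<and>
       ip22 (\<Psi> p v) (\<Psi> p w) = met (EB S) p v w) \<and>
    (\<forall>U s. open U \<and> smooth_section (atl S) (EB S) U s \<longrightarrow>
       smooth_fun (atl S) U (\<lambda>p. \<Psi> p (s p)) \<and>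
       (\<forall>p\<in>U. \<forall>X\<in>fib (TB S) p. \<Psi> p (nab (EB S) p X s) =
          normal_part S F p (mdiff (atl S) (\<lambda>q. \<Psi> q (s q)) p X))) \<and>
    (\<forall>U Y. open U \<and> smooth_section (atl S) (TB S) U Y \<longrightarrow>
       (\<forall>p\<in>U. \<forall>X\<in>fib (TB S) p. \<Psi> p (B p X (Y p)) =
          normal_part S F p (mdiff (atl S) (\<lambda>q. mdiff (atl S) F q (Y q)) p X))) \<and>
    (\<forall>p. (1/2) *\<^sub>R metric_trace S B p = h p)"

text \<open>
  \<open>(\<Psi>, dF)\<close> carries the orientations of \<open>E\<close> and \<open>TM\<close> to those of \<open>\<real>\<^sup>2\<^sup>,\<^sup>2\<close>: frames go to the orbit
  of the standard basis under the identity component of the isometry group.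
\<close>

definition orientation_compatible ::
  "('m::topological_space, 'e::real_vector, 'qe, 'qm) spin_surface
    \<Rightarrow> ('m \<Rightarrow> real^4) \<Rightarrow> ('m \<Rightarrow> 'e \<Rightarrow> real^4) \<Rightarrow> bool"
  where "orientation_compatible S F \<Psi> \<longleftrightarrow>
    (\<forall>p. \<forall>(e0, e1)\<in>on_frames (EB S) p. \<forall>(e2, e3)\<in>on_frames (TB S) p.
      \<exists>R\<in>connected_component_set isometries22 (mat 1).
        \<Psi> p e0 = R *v axis 0 1 \<and> \<Psi> p e1 = R *v axis 1 1 \<and>
        mdiff (atl S) F p e2 = R *v axis 2 1 \<and> mdiff (atl S) F p e3 = R *v axis 3 1)"

definition xi_form ::
  "('m, 'e::real_vector, 'qe, 'qm) spin_surface
    \<Rightarrow> ('m \<Rightarrow> ('qe, 'qm) spinor) \<Rightarrow> 'm \<Rightarrow> 'm tvec \<Rightarrow> HAC"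
  where "xi_form S \<phi> p X = qpair S p (clifford S p (0, X) (\<phi> p)) (\<phi> p)"

definition closed_form ::
  "('m::topological_space, 'e, 'qe, 'qm) spin_surface
    \<Rightarrow> ('m \<Rightarrow> 'm tvec \<Rightarrow> 'b::real_normed_vector) \<Rightarrow> bool"
  where "closed_form S \<omega> \<longleftrightarrow>
    (\<forall>p. \<forall>X\<in>fib (TB S) p. \<forall>Y\<in>fib (TB S) p. \<forall>r.
       \<omega> p (X + Y) = \<omega> p X + \<omega> p Y \<and> \<omega> p (r *\<^sub>R X) = r *\<^sub>R \<omega> p X) \<and>
    (\<forall>U X. open U \<and> smooth_section (atl S) (TB S) U X \<longrightarrow>
       smooth_fun (atl S) U (\<lambda>p. \<omega> p (X p))) \<and>
    (\<forall>U X Y. open U \<and> smooth_section (atl S) (TB S) U X \<and> smooth_section (atl S) (TB S) U Y \<longrightarrow>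
       (\<forall>p\<in>U. mdiff (atl S) (\<lambda>q. \<omega> q (Y q)) p (X p) - mdiff (atl S) (\<lambda>q. \<omega> q (X q)) p (Y p)
          - \<omega> p (lie_bracket (atl S) X Y p) = 0))"

definition is_integral ::
  "('m::topological_space, 'e, 'qe, 'qm) spin_surface
    \<Rightarrow> ('m \<Rightarrow> real^4) \<Rightarrow> ('m \<Rightarrow> 'm tvec \<Rightarrow> HAC) \<Rightarrow> bool"
  where "is_integral S F \<omega> \<longleftrightarrow> smooth_fun (atl S) UNIV F \<and>
    (\<forall>p. \<forall>X\<in>fib (TB S) p. iota (mdiff (atl S) F p X) = \<omega> p X)"

end

theory Submission
  imports Defs
begin

text \<open>
  A unit element \<open>u\<close> of \<open>H0\<close> acts on \<open>\<real>\<^sup>2\<^sup>,\<^sup>2\<close> by the isometry \<open>x \<mapsto> - qconj u x (qhat u)\<close>, called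
  \<open>rho u\<close>, and two unit elements with the same action differ at most by a sign (\<open>rho_isometry\<close>,
  \<open>rho_eq_sign\<close>). A spinor field with \<open>H(\<phi>, \<phi>) = 1\<close> has unit coordinates in all spin frames, so it is
  a square root of a field of isometries \<open>emb \<phi> p : E\<^sub>p \<oplus> T\<^sub>pM \<rightarrow> \<real>\<^sup>2\<^sup>,\<^sup>2\<close>, namely of
  \<open>w \<mapsto> \<langle>\<langle>w\<cdot>\<phi>, \<phi>\<rangle>\<rangle>\<close>. On tangent vectors this field is the form \<open>\<xi>\<close>; if \<open>\<xi> = dF\<close>, then \<open>emb \<phi>\<close>
  is the splitting of \<open>\<real>\<^sup>2\<^sup>,\<^sup>2\<close> into tangent and normal spaces of \<open>F\<close>. All three statements of the
  theorem are conditions on \<open>emb \<phi>\<close>.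

  Killing equation. Differentiating \<open>qconj \<phi> \<phi> = 1\<close> shows that \<open>\<nabla>\<^sub>X\<phi> = a \<phi>\<close> with an imaginary
  element \<open>a\<close> of \<open>H0\<close>, which has six real components. The derivative of \<open>emb \<phi>\<close> along \<open>X\<close>, corrected
  by the connections of \<open>E\<close> and \<open>TM\<close>, is the infinitesimal rotation of \<open>\<real>\<^sup>2\<^sup>,\<^sup>2\<close> belonging to \<open>a\<close>
  (\<open>spin_derivative\<close>), and \<open>a\<close> is determined by this rotation. Hence the Killing equation at \<open>X\<close> says
  that the rotation is the one of the Gauss and Weingarten formulas with second fundamental form \<open>B\<close>
  (\<open>killing_iff_gauss_weingarten\<close>).

  Dirac equation. At a point it consists of eight real equations for the twelve components of
  \<open>\<nabla>\<phi>\<close> along \<open>e2\<close> and \<open>e3\<close>: four say that the components rotating \<open>E\<close> and \<open>TM\<close> in themselves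
  vanish, two that the remaining components form a symmetric \<open>B\<close>, and two that \<open>B\<close> has half trace
  \<open>h\<close>. So the Dirac equation is the Killing equation for some \<open>B\<close>, and the smoothness of \<open>B\<close>
  follows from the Gauss formula (\<open>dirac_imp_killing\<close>, \<open>killing_imp_dirac\<close>).

  From spinors to immersions. By the Gauss formula, the symmetry of \<open>B\<close> and the vanishing of the
  torsion, \<open>\<xi>\<close> is closed, and simple connectivity provides \<open>F\<close> with \<open>dF = \<xi>\<close>. The restriction of
  \<open>emb \<phi>\<close> to \<open>E\<close> identifies \<open>E\<close> with the normal bundle (\<open>killing_immersion\<close>).

  From immersions to spinors. Conversely \<open>\<Psi>\<close> and \<open>dF\<close> form a field of isometries
  \<open>E \<oplus> TM \<rightarrow> \<real>\<^sup>2\<^sup>,\<^sup>2\<close>. It satisfies the Gauss and Weingarten formulas; for their tangential part the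
  argument is the one that makes the Levi-Civita connection unique (\<open>tangential_derivative\<close>). It
  remains to find \<open>\<phi>\<close> with \<open>emb \<phi>\<close> equal to this field. Its values are lifted through the double
  covering \<open>u \<mapsto> rho u\<close>: an explicit smooth lift exists near every isometry that has one
  (\<open>near_id_lift\<close>), and the local lifts, which form a two-sheeted covering of \<open>M\<close>, fit together
  because \<open>M\<close> is simply connected (\<open>global_section\<close>, \<open>spinor_of_isometry\<close>). Only isometries in the
  image of \<open>rho\<close> have a lift. These include the identity component, which is the case of compatible
  orientations; otherwise \<open>F\<close> is first composed with a constant isometry \<open>R\<close> that takes the frame
  at one point to the standard basis.
\<close>

section \<open>Calculus of smooth maps on open sets\<close>

lemma Ck_on_subset: "Ck_on n f S \<Longrightarrow> T \<subseteq> S \<Longrightarrow> Ck_on n f T"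
  by (induction n arbitrary: f) (auto intro: continuous_on_subset)

lemma frechet_derivative_cong_open:
  assumes "open S" "x \<in> S" "\<And>x. x \<in> S \<Longrightarrow> f x = g x"
  shows "frechet_derivative f (at x) = frechet_derivative g (at x)"
proof -
  have "(f has_derivative D) (at x) \<longleftrightarrow> (g has_derivative D) (at x)" for D
    using assms has_derivative_transform_within_open[of f D x UNIV S g]
      has_derivative_transform_within_open[of g D x UNIV S f] by auto
  then show ?thesis by (simp add: frechet_derivative_def)
qed

lemma Ck_on_cong:
  assumes "open S" "\<And>x. x \<in> S \<Longrightarrow> f x = g x" "Ck_on n f S"
  shows "Ck_on n g S"
  using assms(2,3)
proof (induction n arbitrary: f g)
  case 0
  then show ?case using continuous_on_cong by auto
next
  case (Suc n)
  have d: "g differentiable (at x)" if "x \<in> S" for x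
  proof -
    have "(f has_derivative frechet_derivative f (at x)) (at x)"
      using Suc.prems that by (simp add: frechet_derivative_works)
    then show ?thesis
      using has_derivative_transform_within_open[of f _ x UNIV S g] that assms(1) Suc.prems(1)
      unfolding differentiable_def by blast
  qed
  have "Ck_on n (\<lambda>x. frechet_derivative g (at x) v) S" for v
  proof (rule Suc.IH)
    show "frechet_derivative f (at x) v = frechet_derivative g (at x) v" if "x \<in> S" for x
      using frechet_derivative_cong_open[OF assms(1) that, of f g] Suc.prems(1) by simp
  qed (use Suc.prems in auto)
  with d show ?case by simp
qed

lemma Ck_on_local:
  assumes "\<And>x. x \<in> S \<Longrightarrow> \<exists>T. open T \<and> x \<in> T \<and> Ck_on n f T"
  shows "Ck_on n f S"
  using assms
proof (induction n arbitrary: f)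
  case 0
  have "isCont f x" if "x \<in> S" for x
    using 0[OF that] continuous_on_eq_continuous_at by fastforce
  then show ?case by (simp add: continuous_at_imp_continuous_on)
next
  case (Suc n)
  have "f differentiable (at x)" if "x \<in> S" for x
    using Suc.prems[OF that] by auto
  moreover have "Ck_on n (\<lambda>x. frechet_derivative f (at x) v) S" for v
    by (rule Suc.IH) (use Suc.prems in fastforce)
  ultimately show ?case by simp
qed

lemma Ck_on_SucD: "Ck_on (Suc n) f S \<Longrightarrow> Ck_on n f S"
proof (induction n arbitrary: f)
  case 0
  then have "isCont f x" if "x \<in> S" for x
    using that differentiable_imp_continuous_within by auto
  then show ?case by (simp add: continuous_at_imp_continuous_on)
qed auto

lemma Ck_on_continuous: "Ck_on n f S \<Longrightarrow> continuous_on S f"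
  by (induction n) (use Ck_on_SucD in auto)

lemma Ck_on_SucI:
  assumes "open S" "\<And>x. x \<in> S \<Longrightarrow> (f has_derivative D x) (at x)" "\<And>v. Ck_on n (\<lambda>x. D x v) S"
  shows "Ck_on (Suc n) f S"
proof -
  have eq: "D x = frechet_derivative f (at x)" if "x \<in> S" for x
    using assms(2)[OF that] frechet_derivative_at by blast
  have "Ck_on n (\<lambda>x. frechet_derivative f (at x) v) S" for v
    using Ck_on_cong[OF assms(1) _ assms(3)[of v]] eq by simp
  then show ?thesis
    using assms(2) by (auto simp: differentiable_def)
qed

lemma Ck_on_has_derivative:
  "Ck_on (Suc n) f S \<Longrightarrow> x \<in> S \<Longrightarrow> (f has_derivative frechet_derivative f (at x)) (at x)"
  by (simp add: frechet_derivative_works)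

lemma Ck_on_const: "Ck_on n (\<lambda>x. c) S"
  by (induction n arbitrary: c) auto

lemma Ck_on_linear_comp:
  assumes L: "bounded_linear L" and S: "open S" and "Ck_on n f S"
  shows "Ck_on n (\<lambda>x. L (f x)) S"
  using assms(3)
proof (induction n arbitrary: f)
  case 0
  then show ?case using L by (simp add: bounded_linear.continuous_on)
next
  case (Suc n)
  show ?case
    by (rule Ck_on_SucI[OF S bounded_linear.has_derivative[OF L Ck_on_has_derivative[OF Suc.prems]]])
      (use Suc in auto)
qed

lemma Ck_on_add:
  assumes S: "open S" and "Ck_on n f S" "Ck_on n g S"
  shows "Ck_on n (\<lambda>x. f x + g x) S"
  using assms(2,3)
proof (induction n arbitrary: f g)
  case (Suc n)
  show ?case
    by (rule Ck_on_SucI[OF S has_derivative_add[OF Ck_on_has_derivative[OF Suc.prems(1)]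
            Ck_on_has_derivative[OF Suc.prems(2)]]])
      (use Suc in auto)
qed (simp add: continuous_on_add)

lemma Ck_on_bilinear:
  assumes b: "bounded_bilinear b" and S: "open S" and "Ck_on n f S" "Ck_on n g S"
  shows "Ck_on n (\<lambda>x. b (f x) (g x)) S"
  using assms(3,4)
proof (induction n arbitrary: f g)
  case 0
  then show ?case using b by (simp add: bounded_bilinear.continuous_on)
next
  case (Suc n)
  show ?case
  proof (rule Ck_on_SucI[OF S bounded_bilinear.FDERIV[OF b Ck_on_has_derivative[OF Suc.prems(1)]
            Ck_on_has_derivative[OF Suc.prems(2)]]])
    fix v
    show "Ck_on n (\<lambda>x. b (f x) (frechet_derivative g (at x) v)
        + b (frechet_derivative f (at x) v) (g x)) S"
      using Suc.prems[THEN Ck_on_SucD] Suc.prems by (intro Ck_on_add[OF S] Suc.IH) auto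
  qed
qed

lemma Ck_on_sum:
  assumes "open S" "finite I" "\<And>i. i \<in> I \<Longrightarrow> Ck_on n (f i) S"
  shows "Ck_on n (\<lambda>x. \<Sum>i\<in>I. f i x) S"
  using assms(2,3) by (induction I) (auto intro: Ck_on_const Ck_on_add[OF assms(1)])

text \<open>In the chain rule the outer derivative is taken in a direction that varies with the point. Expanding
  this direction in a basis leaves products of functions with derivatives of \<open>f\<close> in constant
  directions, to which the induction hypothesis applies.\<close>

lemma Ck_on_compose:
  fixes f :: "'a::euclidean_space \<Rightarrow> 'b::real_normed_vector"
    and g :: "'c::real_normed_vector \<Rightarrow> 'a"
  assumes S: "open S" and T: "open T" and gS: "\<And>x. x \<in> S \<Longrightarrow> g x \<in> T"
    and "Ck_on n f T" "Ck_on n g S"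
  shows "Ck_on n (\<lambda>x. f (g x)) S"
  using assms(4,5)
proof (induction n arbitrary: f)
  case 0
  then show ?case using continuous_on_compose2[of T f S g] gS by auto
next
  case (Suc n)
  let ?D = "\<lambda>x v. frechet_derivative f (at (g x)) (frechet_derivative g (at x) v)"
  show ?case
  proof (rule Ck_on_SucI[OF S])
    show "((\<lambda>x. f (g x)) has_derivative ?D x) (at x)" if "x \<in> S" for x
      using diff_chain_at[OF Ck_on_has_derivative[OF Suc.prems(2) that]
          Ck_on_has_derivative[OF Suc.prems(1) gS[OF that]]]
      by (simp add: o_def)
    fix v
    have "Ck_on n (\<lambda>x. \<Sum>b\<in>Basis. (frechet_derivative g (at x) v \<bullet> b)
        *\<^sub>R frechet_derivative f (at (g x)) b) S" (is "Ck_on n ?h S")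
    proof (rule Ck_on_sum[OF S])
      fix b :: 'a assume "b \<in> Basis"
      have "Ck_on n (\<lambda>x. frechet_derivative g (at x) v) S" using Suc.prems by simp
      note Ck_on_linear_comp[OF bounded_linear_inner_left S this, of b]
      moreover have "Ck_on n (\<lambda>x. frechet_derivative f (at (g x)) b) S"
        using Suc.IH[of "\<lambda>y. frechet_derivative f (at y) b"] Suc.prems(1) Ck_on_SucD[OF Suc.prems(2)]
        by auto
      ultimately show "Ck_on n (\<lambda>x. (frechet_derivative g (at x) v \<bullet> b)
        *\<^sub>R frechet_derivative f (at (g x)) b) S"
        by (rule Ck_on_bilinear[OF bounded_bilinear_scaleR S])
    qed simp
    then show "Ck_on n (\<lambda>x. ?D x v) S"
    proof (rule Ck_on_cong[OF S, rotated])
      fix x assume "x \<in> S"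
      then have lin: "linear (frechet_derivative f (at (g x)))"
        using Suc.prems(1) gS by (simp add: linear_frechet_derivative)
      have "?D x v = frechet_derivative f (at (g x)) (\<Sum>b\<in>Basis. (frechet_derivative g (at x) v \<bullet> b) *\<^sub>R b)"
        by (simp add: euclidean_representation)
      also have "\<dots> = ?h x" using lin by (simp add: linear_sum linear_cmul)
      finally show "?h x = ?D x v" by simp
    qed
  qed
qed

text \<open>The derivative of \<open>1 / sqrt x\<close> is \<open>- 1/2\<close> times its own third power.\<close>

lemma Ck_on_inverse_sqrt: "Ck_on n (\<lambda>x. 1 / sqrt x) {0<..}"
proof (induction n)
  case 0
  show ?case by (auto intro!: continuous_intros)
next
  case (Suc n)
  let ?r = "\<lambda>x::real. 1 / sqrt x"
  have D: "(?r has_derivative (\<lambda>v. v * (- (1/2) * (?r x * (?r x * ?r x))))) (at x)" if "x > 0" for x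
  proof -
    have "(?r has_field_derivative (- (1/2) * (?r x * (?r x * ?r x)))) (at x)"
      using that by (auto intro!: derivative_eq_intros simp: field_simps)
    then show ?thesis
      unfolding has_field_derivative_def by (rule has_derivative_eq_rhs) (auto simp: fun_eq_iff)
  qed
  show ?case
  proof (rule Ck_on_SucI[OF open_greaterThan])
    show "(?r has_derivative (\<lambda>v. v * (- (1/2) * (?r x * (?r x * ?r x))))) (at x)"
      if "x \<in> {0<..}" for x using D that by simp
  next
    fix v :: real
    note m = Ck_on_bilinear[OF bounded_bilinear_mult open_greaterThan]
    show "Ck_on n (\<lambda>x. v * (- (1/2) * (?r x * (?r x * ?r x)))) {0<..}"
      by (intro m Ck_on_const Suc.IH)
  qed
qed

lemma smooth_onI: "(\<And>n. Ck_on n f S) \<Longrightarrow> smooth_on f S"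
  by (simp add: smooth_on_def)

lemma smooth_onD: "smooth_on f S \<Longrightarrow> Ck_on n f S"
  by (simp add: smooth_on_def)

lemma smooth_on_derivative:
  "smooth_on f S \<Longrightarrow> smooth_on (\<lambda>x. frechet_derivative f (at x) v) S"
  unfolding smooth_on_def by (metis Ck_on.simps(2))

lemma smooth_on_has_derivative:
  "smooth_on f S \<Longrightarrow> x \<in> S \<Longrightarrow> (f has_derivative frechet_derivative f (at x)) (at x)"
  unfolding smooth_on_def using Ck_on_has_derivative by blast

lemma smooth_on_continuous: "smooth_on f S \<Longrightarrow> continuous_on S f"
  unfolding smooth_on_def using Ck_on_continuous by blast

text \<open>The mean value theorem is applied in the direction \<open>v\<close> to the difference of \<open>f\<close> along \<open>w\<close>, and then
  in the direction \<open>w\<close>. The left-hand side is symmetric in \<open>v\<close> and \<open>w\<close>, the right-hand side is a mixed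
  derivative in one of the two orders.\<close>

lemma second_difference_mean_value:
  fixes f :: "'a::real_normed_vector \<Rightarrow> real"
  assumes f: "smooth_on f (ball x r)" and h: "0 < h" "h * (norm v + norm w) < r"
  obtains s t where "0 < s" "s < h" "0 < t" "t < h"
    "f (x + h *\<^sub>R v + h *\<^sub>R w) - f (x + h *\<^sub>R v) - f (x + h *\<^sub>R w) + f x =
      h * h * frechet_derivative (\<lambda>y. frechet_derivative f (at y) v) (at (x + s *\<^sub>R v + t *\<^sub>R w)) w"
proof -
  have inb: "x + s *\<^sub>R v + t *\<^sub>R w \<in> ball x r" if "0 \<le> s" "s \<le> h" "0 \<le> t" "t \<le> h" for s t
  proof -
    have "norm (s *\<^sub>R v + t *\<^sub>R w) \<le> s * norm v + t * norm w"
      using that norm_triangle_ineq[of "s *\<^sub>R v" "t *\<^sub>R w"] by simp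
    also have "\<dots> \<le> h * norm v + h * norm w"
      using that by (intro add_mono mult_right_mono) auto
    finally have "norm (s *\<^sub>R v + t *\<^sub>R w) < r" using h(2) by (simp add: distrib_left)
    moreover have "dist x (x + s *\<^sub>R v + t *\<^sub>R w) = norm (s *\<^sub>R v + t *\<^sub>R w)"
      by (metis add.assoc add_diff_cancel_left' dist_commute dist_norm)
    ultimately show ?thesis by simp
  qed
  have D1: "((\<lambda>s. f (x + s *\<^sub>R v + t *\<^sub>R w)) has_real_derivative
        frechet_derivative f (at (x + s *\<^sub>R v + t *\<^sub>R w)) v) (at s)"
    if "0 \<le> s" "s \<le> h" "0 \<le> t" "t \<le> h" for s t
  proof -
    note d = smooth_on_has_derivative[OF f inb[OF that]]
    have "((\<lambda>s. f (x + s *\<^sub>R v + t *\<^sub>R w)) has_derivative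
        (\<lambda>y. frechet_derivative f (at (x + s *\<^sub>R v + t *\<^sub>R w)) (y *\<^sub>R v))) (at s)"
      by (rule has_derivative_compose[where g = f and f = "\<lambda>s. x + s *\<^sub>R v + t *\<^sub>R w", OF _ d])
        (auto intro!: derivative_eq_intros)
    moreover have "(\<lambda>y. frechet_derivative f (at (x + s *\<^sub>R v + t *\<^sub>R w)) (y *\<^sub>R v))
        = (*) (frechet_derivative f (at (x + s *\<^sub>R v + t *\<^sub>R w)) v)"
      using linear_frechet_derivative[OF differentiableI[OF d]]
      by (simp add: fun_eq_iff linear_cmul)
    ultimately show ?thesis by (simp add: has_field_derivative_def)
  qed
  let ?g = "\<lambda>y. frechet_derivative f (at y) v"
  have g: "smooth_on ?g (ball x r)" using f by (rule smooth_on_derivative)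
  have D2: "((\<lambda>t. ?g (x + s *\<^sub>R v + t *\<^sub>R w)) has_real_derivative
        frechet_derivative ?g (at (x + s *\<^sub>R v + t *\<^sub>R w)) w) (at t)"
    if "0 \<le> s" "s \<le> h" "0 \<le> t" "t \<le> h" for s t
  proof -
    note d = smooth_on_has_derivative[OF g inb[OF that]]
    have "((\<lambda>t. ?g (x + s *\<^sub>R v + t *\<^sub>R w)) has_derivative
        (\<lambda>y. frechet_derivative ?g (at (x + s *\<^sub>R v + t *\<^sub>R w)) (y *\<^sub>R w))) (at t)"
      by (rule has_derivative_compose[where g = "?g" and f = "\<lambda>t. x + s *\<^sub>R v + t *\<^sub>R w", OF _ d])
        (auto intro!: derivative_eq_intros)
    moreover have "(\<lambda>y. frechet_derivative ?g (at (x + s *\<^sub>R v + t *\<^sub>R w)) (y *\<^sub>R w))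
        = (*) (frechet_derivative ?g (at (x + s *\<^sub>R v + t *\<^sub>R w)) w)"
      using linear_frechet_derivative[OF differentiableI[OF d]]
      by (simp add: fun_eq_iff linear_cmul)
    ultimately show ?thesis by (simp add: has_field_derivative_def)
  qed
  have "\<exists>s. 0 < s \<and> s < h \<and> (f (x + h *\<^sub>R v + h *\<^sub>R w) - f (x + h *\<^sub>R v + 0 *\<^sub>R w))
      - (f (x + 0 *\<^sub>R v + h *\<^sub>R w) - f (x + 0 *\<^sub>R v + 0 *\<^sub>R w))
      = (h - 0) * (?g (x + s *\<^sub>R v + h *\<^sub>R w) - ?g (x + s *\<^sub>R v + 0 *\<^sub>R w))"
    by (rule MVT2[OF h(1)]) (intro DERIV_diff D1, use h(1) in auto)
  then obtain s where s: "0 < s" "s < h"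
    "f (x + h *\<^sub>R v + h *\<^sub>R w) - f (x + h *\<^sub>R v) - f (x + h *\<^sub>R w) + f x
      = h * (?g (x + s *\<^sub>R v + h *\<^sub>R w) - ?g (x + s *\<^sub>R v + 0 *\<^sub>R w))"
    by (auto simp: algebra_simps)
  have "\<exists>t. 0 < t \<and> t < h \<and> ?g (x + s *\<^sub>R v + h *\<^sub>R w) - ?g (x + s *\<^sub>R v + 0 *\<^sub>R w)
      = (h - 0) * frechet_derivative ?g (at (x + s *\<^sub>R v + t *\<^sub>R w)) w"
    by (rule MVT2[OF h(1)]) (intro D2, use s in auto)
  then obtain t where "0 < t" "t < h" "?g (x + s *\<^sub>R v + h *\<^sub>R w) - ?g (x + s *\<^sub>R v + 0 *\<^sub>R w)
      = h * frechet_derivative ?g (at (x + s *\<^sub>R v + t *\<^sub>R w)) w" by auto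
  with s that show ?thesis by simp
qed

lemma mixed_partials_commute_real:
  fixes f :: "'a::real_normed_vector \<Rightarrow> real"
  assumes f: "smooth_on f S" and S: "open S" "x \<in> S"
  shows "frechet_derivative (\<lambda>y. frechet_derivative f (at y) v) (at x) w =
    frechet_derivative (\<lambda>y. frechet_derivative f (at y) w) (at x) v" (is "?P x = ?Q x")
proof (rule ccontr)
  assume ne: "?P x \<noteq> ?Q x"
  define e where "e = \<bar>?P x - ?Q x\<bar> / 2"
  have e: "e > 0" using ne by (simp add: e_def)
  obtain r where r: "r > 0" "ball x r \<subseteq> S" using S by (meson openE)
  have fb: "smooth_on f (ball x r)" using f r(2) Ck_on_subset unfolding smooth_on_def by blast
  have cont: "isCont (\<lambda>z. frechet_derivative (\<lambda>y. frechet_derivative f (at y) a) (at z) b) x" for a b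
    using smooth_on_continuous[OF smooth_on_derivative[OF smooth_on_derivative[OF f]]]
      continuous_on_eq_continuous_at[OF S(1)] S(2) by blast
  obtain d1 where d1: "d1 > 0" "\<And>y. dist y x < d1 \<Longrightarrow> dist (?P y) (?P x) < e"
    using cont[of v w] e unfolding continuous_at_eps_delta by blast
  obtain d2 where d2: "d2 > 0" "\<And>y. dist y x < d2 \<Longrightarrow> dist (?Q y) (?Q x) < e"
    using cont[of w v] e unfolding continuous_at_eps_delta by blast
  define d where "d = min r (min d1 d2)"
  define h where "h = d / (norm v + norm w + 1) / 2"
  have pos: "norm v + norm w + 1 > 0" by (simp add: add_nonneg_pos)
  have dpos: "d > 0" using r d1 d2 by (simp add: d_def)
  have h: "h > 0" using dpos pos by (simp add: h_def)
  have "h * (norm v + norm w) \<le> h * (norm v + norm w + 1)" using h by simp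
  also have "\<dots> = d / 2" using pos by (simp add: h_def field_simps)
  finally have hd: "h * (norm v + norm w) < d" using dpos by simp
  have near: "dist (x + s *\<^sub>R a + t *\<^sub>R b) x < d"
    if "0 < s" "s < h" "0 < t" "t < h" "norm a + norm b = norm v + norm w" for s t a b
  proof -
    have "norm (s *\<^sub>R a + t *\<^sub>R b) \<le> s * norm a + t * norm b"
      using that norm_triangle_ineq[of "s *\<^sub>R a" "t *\<^sub>R b"] by simp
    also have "\<dots> \<le> h * norm a + h * norm b"
      using that by (intro add_mono mult_right_mono) auto
    also have "\<dots> < d" using hd that(5) by (simp add: distrib_left[symmetric])
    finally show ?thesis by (simp add: dist_norm add.assoc)
  qed
  \<comment> \<open>Both orders of differentiation are compared with the same second difference: the two mixed
    derivatives coincide at points so close to \<open>x\<close> that each is within \<open>e\<close> of its value at \<open>x\<close>.\<close>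
  have hr: "h * (norm v + norm w) < r" "h * (norm w + norm v) < r"
    using hd by (simp_all add: d_def add.commute)
  let ?D = "f (x + h *\<^sub>R v + h *\<^sub>R w) - f (x + h *\<^sub>R v) - f (x + h *\<^sub>R w) + f x"
  obtain s t where st: "0 < s" "s < h" "0 < t" "t < h" "?D = h * h * ?P (x + s *\<^sub>R v + t *\<^sub>R w)"
    by (rule second_difference_mean_value[OF fb h hr(1)])
  obtain s' t' where st': "0 < s'" "s' < h" "0 < t'" "t' < h"
      "f (x + h *\<^sub>R w + h *\<^sub>R v) - f (x + h *\<^sub>R w) - f (x + h *\<^sub>R v) + f x
        = h * h * ?Q (x + s' *\<^sub>R w + t' *\<^sub>R v)"
    by (rule second_difference_mean_value[OF fb h hr(2)])
  have "f (x + h *\<^sub>R w + h *\<^sub>R v) - f (x + h *\<^sub>R w) - f (x + h *\<^sub>R v) + f x = ?D"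
    by (simp add: algebra_simps)
  then have "h * h * ?P (x + s *\<^sub>R v + t *\<^sub>R w) = h * h * ?Q (x + s' *\<^sub>R w + t' *\<^sub>R v)"
    using st st' by simp
  then have eq: "?P (x + s *\<^sub>R v + t *\<^sub>R w) = ?Q (x + s' *\<^sub>R w + t' *\<^sub>R v)"
    using h by simp
  have P:  "dist (?P (x + s *\<^sub>R v + t *\<^sub>R w)) (?P x) < e"
    using near[of s t v w] st d1(2) by (simp add: d_def)
  have Q: "dist (?Q (x + s' *\<^sub>R w + t' *\<^sub>R v)) (?Q x) < e"
    using near[of s' t' w v] st' d2(2) by (simp add: d_def)
  have "dist (?P x) (?Q x) < e + e"
    by (rule dist_triangle_less_add[OF P[unfolded eq, THEN dist_commute_lessI] Q[THEN dist_commute_lessI]])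
  then show False by (simp add: e_def dist_real_def)
qed

lemma mixed_partials_commute:
  fixes f :: "'a::real_normed_vector \<Rightarrow> 'b::euclidean_space"
  assumes f: "smooth_on f S" and S: "open S" "x \<in> S"
  shows "frechet_derivative (\<lambda>y. frechet_derivative f (at y) v) (at x) w =
    frechet_derivative (\<lambda>y. frechet_derivative f (at y) w) (at x) v"
proof (rule euclidean_eqI)
  fix b :: 'b
  let ?g = "\<lambda>y. f y \<bullet> b"
  have g: "smooth_on ?g S"
    using Ck_on_linear_comp[OF bounded_linear_inner_left S(1)] f by (auto simp: smooth_on_def)
  have comp: "frechet_derivative (\<lambda>y. k y \<bullet> b) (at y) u = frechet_derivative k (at y) u \<bullet> b"
    if "smooth_on k S" "y \<in> S" for k :: "'a \<Rightarrow> 'b" and y u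
    using frechet_derivative_at[OF has_derivative_inner_left[OF smooth_on_has_derivative[OF that]]]
    by metis
  have second: "frechet_derivative (\<lambda>y. frechet_derivative ?g (at y) u) (at x) u' =
      frechet_derivative (\<lambda>y. frechet_derivative f (at y) u) (at x) u' \<bullet> b" for u u'
  proof -
    have "frechet_derivative (\<lambda>y. frechet_derivative ?g (at y) u) (at x) =
        frechet_derivative (\<lambda>y. frechet_derivative f (at y) u \<bullet> b) (at x)"
      by (rule frechet_derivative_cong_open[OF S]) (simp add: comp[OF f])
    then show ?thesis using comp[OF smooth_on_derivative[OF f] S(2)] by metis
  qed
  show "frechet_derivative (\<lambda>y. frechet_derivative f (at y) v) (at x) w \<bullet> b =
    frechet_derivative (\<lambda>y. frechet_derivative f (at y) w) (at x) v \<bullet> b"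
    using mixed_partials_commute_real[OF g S, of v w] second by metis
qed

text \<open>The primitive is \<open>f x = \<integral>\<^sub>0\<^sup>1 \<omega> (x0 + t (x - x0)) (x - x0) dt\<close>. Differentiation under the integral
  sign and closedness turn the derivative of the integrand along \<open>v\<close> into the \<open>t\<close>-derivative of
  \<open>t \<omega> (x0 + t (x - x0)) v\<close>.\<close>

lemma Poincare_lemma_ball:
  fixes \<omega> :: "'a::euclidean_space \<Rightarrow> 'a \<Rightarrow> 'b::euclidean_space"
  assumes lin: "\<And>x. x \<in> ball x0 r \<Longrightarrow> linear (\<omega> x)"
    and smooth: "\<And>v. smooth_on (\<lambda>x. \<omega> x v) (ball x0 r)"
    and closed: "\<And>x v w. x \<in> ball x0 r \<Longrightarrow>
      frechet_derivative (\<lambda>y. \<omega> y v) (at x) w = frechet_derivative (\<lambda>y. \<omega> y w) (at x) v"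
  shows "\<exists>f. smooth_on f (ball x0 r) \<and> (\<forall>x\<in>ball x0 r. (f has_derivative \<omega> x) (at x))"
proof -
  let ?B = "ball x0 r"
  define D where "D = (\<lambda>v x w. frechet_derivative (\<lambda>y. \<omega> y v) (at x) w)"
  have D: "((\<lambda>y. \<omega> y v) has_derivative D v x) (at x)" if "x \<in> ?B" for x v
    using smooth_on_has_derivative[OF smooth that] by (simp add: D_def)
  have Dlin: "linear (D v x)" if "x \<in> ?B" for x v
    using D[OF that] has_derivative_linear by blast
  have Dsym: "D b x v = D v x b" if "x \<in> ?B" for x b v
    using closed[OF that] by (simp add: D_def)
  have cD: "continuous_on ?B (\<lambda>x. D v x w)" for v w
    unfolding D_def by (intro smooth_on_continuous smooth_on_derivative smooth)
  have c\<omega>: "continuous_on ?B (\<lambda>x. \<omega> x v)" for v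
    by (intro smooth_on_continuous smooth)
  define \<gamma> where "\<gamma> = (\<lambda>x t. x0 + t *\<^sub>R (x - x0))"
  have \<gamma>: "\<gamma> x t \<in> ?B" if "x \<in> ?B" "t \<in> {0..1}" for x t
  proof -
    have "\<bar>t\<bar> * norm (x - x0) \<le> 1 * norm (x - x0)" using that by (intro mult_right_mono) auto
    then show ?thesis using that by (simp add: \<gamma>_def dist_norm norm_minus_commute)
  qed
  \<comment> \<open>The integrand is expanded in a basis because only the functions \<open>\<lambda>x. \<omega> x b\<close> with constant \<open>b\<close>
    are known to be differentiable.\<close>
  define g where "g = (\<lambda>x t. \<Sum>b\<in>Basis. ((x - x0) \<bullet> b) *\<^sub>R \<omega> (\<gamma> x t) b)"
  define g' where "g' = (\<lambda>x t v. \<Sum>b\<in>Basis. ((x - x0) \<bullet> b) *\<^sub>R D b (\<gamma> x t) (t *\<^sub>R v)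
    + (v \<bullet> b) *\<^sub>R \<omega> (\<gamma> x t) b)"
  have g': "((\<lambda>x. g x t) has_derivative g' x t) (at x)" if "x \<in> ?B" "t \<in> {0..1}" for x t
  proof -
    have "((\<lambda>x. \<omega> (\<gamma> x t) b) has_derivative (\<lambda>v. D b (\<gamma> x t) (t *\<^sub>R v))) (at x)" for b
      by (rule has_derivative_compose[where g = "\<lambda>y. \<omega> y b" and f = "\<lambda>x. \<gamma> x t", OF _ D[OF \<gamma>[OF that]]])
        (auto simp: \<gamma>_def intro!: derivative_eq_intros)
    then show ?thesis
      unfolding g_def g'_def
      by (intro has_derivative_sum has_derivative_scaleR) (auto intro!: derivative_eq_intros)
  qed
  define G' where "G' = (\<lambda>x t. Blinfun (g' x t))"
  have G': "blinfun_apply (G' x t) = g' x t" if "x \<in> ?B" "t \<in> {0..1}" for x t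
    unfolding G'_def using g'[OF that] by (simp add: bounded_linear_Blinfun_apply has_derivative_bounded_linear)
  have c\<gamma>: "continuous_on (?B \<times> {0..1}) (\<lambda>p. \<gamma> (fst p) (snd p))"
    by (auto simp: \<gamma>_def intro!: continuous_intros)
  have c2: "continuous_on (?B \<times> {0..1}) (\<lambda>p. k (\<gamma> (fst p) (snd p)))"
    if "continuous_on ?B k" for k :: "'a \<Rightarrow> 'b"
    by (rule continuous_on_compose2[OF that c\<gamma>]) (use \<gamma> in auto)
  have cg: "continuous_on (?B \<times> {0..1}) (\<lambda>p. g (fst p) (snd p))"
    unfolding g_def by (intro continuous_intros c2 c\<omega>)
  have cg': "continuous_on (?B \<times> {0..1}) (\<lambda>p. g' (fst p) (snd p) v)" for v
  proof -
    have "continuous_on (?B \<times> {0..1}) (\<lambda>p. \<Sum>b\<in>Basis. ((fst p - x0) \<bullet> b) *\<^sub>R (snd p *\<^sub>R D b (\<gamma> (fst p) (snd p)) v)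
    + (v \<bullet> b) *\<^sub>R \<omega> (\<gamma> (fst p) (snd p)) b)"
      by (intro continuous_intros c2 c\<omega> cD)
    then show ?thesis
      by (rule continuous_on_eq) (auto simp: g'_def linear_cmul[OF Dlin[OF \<gamma>]])
  qed
  have cG': "continuous_on (?B \<times> {0..1}) (\<lambda>(x, t). G' x t)"
  proof (rule continuous_on_blinfun_componentwise)
    fix i :: 'a
    show "continuous_on (?B \<times> {0..1}) (\<lambda>p. blinfun_apply (case p of (x, t) \<Rightarrow> G' x t) i)"
      by (rule continuous_on_eq[OF cg'[of i]]) (auto simp: G')
  qed
  have cslice: "continuous_on {0..1} (\<lambda>t. k (x, t))"
    if "continuous_on (?B \<times> {0..1}) k" "x \<in> ?B" for k :: "'a \<times> real \<Rightarrow> 'c::topological_space" and x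
    by (rule continuous_on_compose2[OF that(1)]) (use that(2) in \<open>auto intro!: continuous_intros\<close>)
  define f where "f = (\<lambda>x. integral {0..1} (g x))"
  have f: "(f has_derivative \<omega> x) (at x)" if x: "x \<in> ?B" for x
  proof -
    have "((\<lambda>x. integral (cbox 0 1) (g x)) has_derivative integral (cbox 0 1) (G' x)) (at x within ?B)"
    proof (rule leibniz_rule)
      show "((\<lambda>x. g x t) has_derivative blinfun_apply (G' x t)) (at x within ?B)"
        if "x \<in> ?B" "t \<in> cbox 0 1" for x t
        using g'[of x t] G'[of x t] that by (auto intro: has_derivative_at_withinI)
      show "g x integrable_on cbox 0 1" if "x \<in> ?B" for x
        using cslice[OF cg that] by (auto intro: integrable_continuous_interval)
    qed (use cG' x in \<open>auto\<close>)
    moreover have "blinfun_apply (integral (cbox 0 1) (G' x)) v = \<omega> x v" for v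
    proof -
      have "continuous_on {0..1} (G' x)" using cslice[OF cG' x] by simp
      then have int: "G' x integrable_on cbox 0 1" by (auto intro: integrable_continuous_interval)
      have "blinfun_apply (integral (cbox 0 1) (G' x)) v = integral (cbox 0 1) (\<lambda>t. blinfun_apply (G' x t) v)"
        using integral_linear[OF int blinfun.bounded_linear_left, of v]
        by (simp add: o_def)
      also have "\<dots> = integral (cbox 0 1) (\<lambda>t. \<omega> (\<gamma> x t) v + t *\<^sub>R D v (\<gamma> x t) (x - x0))"
      proof (rule integral_cong)
        fix t :: real assume t: "t \<in> cbox 0 1"
        then have gb: "\<gamma> x t \<in> ?B" using \<gamma> x by auto
        have "(\<Sum>b\<in>Basis. ((x - x0) \<bullet> b) *\<^sub>R D b (\<gamma> x t) (t *\<^sub>R v)) =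
            t *\<^sub>R (\<Sum>b\<in>Basis. ((x - x0) \<bullet> b) *\<^sub>R D v (\<gamma> x t) b)"
          by (simp add: linear_cmul[OF Dlin[OF gb]] Dsym[OF gb, of _ v] scaleR_sum_right mult.commute)
        also have "\<dots> = t *\<^sub>R D v (\<gamma> x t) (\<Sum>b\<in>Basis. ((x - x0) \<bullet> b) *\<^sub>R b)"
          using Dlin[OF gb] by (simp add: linear_sum linear_cmul)
        also have "\<dots> = t *\<^sub>R D v (\<gamma> x t) (x - x0)" by (simp only: euclidean_representation)
        finally have 1: "(\<Sum>b\<in>Basis. ((x - x0) \<bullet> b) *\<^sub>R D b (\<gamma> x t) (t *\<^sub>R v)) = \<dots>" .
        have "(\<Sum>b\<in>Basis. (v \<bullet> b) *\<^sub>R \<omega> (\<gamma> x t) b) = \<omega> (\<gamma> x t) (\<Sum>b\<in>Basis. (v \<bullet> b) *\<^sub>R b)"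
          using lin[OF gb] by (simp add: linear_sum linear_cmul)
        also have "\<dots> = \<omega> (\<gamma> x t) v" by (simp only: euclidean_representation)
        finally show "blinfun_apply (G' x t) v = \<omega> (\<gamma> x t) v + t *\<^sub>R D v (\<gamma> x t) (x - x0)"
          using 1 G'[of x t] t x by (simp add: g'_def sum.distrib)
      qed
      also have "\<dots> = 1 *\<^sub>R \<omega> (\<gamma> x 1) v - 0 *\<^sub>R \<omega> (\<gamma> x 0) v"
        unfolding interval_cbox[symmetric] cbox_interval
      proof (intro integral_unique fundamental_theorem_of_calculus)
        fix t :: real assume t: "t \<in> {0..1}"
        have "((\<lambda>t. \<omega> (\<gamma> x t) v) has_derivative (\<lambda>s. D v (\<gamma> x t) (s *\<^sub>R (x - x0)))) (at t)"
          by (rule has_derivative_compose[where g = "\<lambda>y. \<omega> y v" and f = "\<lambda>t. \<gamma> x t", OF _ D[OF \<gamma>[OF x t]]])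
            (auto simp: \<gamma>_def intro!: derivative_eq_intros)
        then have "((\<lambda>t. \<omega> (\<gamma> x t) v) has_vector_derivative D v (\<gamma> x t) (x - x0)) (at t within {0..1})"
          by (simp add: has_vector_derivative_def linear_cmul[OF Dlin[OF \<gamma>[OF x t]]] has_derivative_at_withinI)
        from has_vector_derivative_scaleR[OF DERIV_ident this]
        show "((\<lambda>t. t *\<^sub>R \<omega> (\<gamma> x t) v) has_vector_derivative
            \<omega> (\<gamma> x t) v + t *\<^sub>R D v (\<gamma> x t) (x - x0)) (at t within {0..1})"
          by (simp add: add.commute)
      qed simp
      finally show ?thesis by (simp add: \<gamma>_def)
    qed
    ultimately have "(f has_derivative \<omega> x) (at x within ?B)"
      unfolding f_def cbox_interval by (auto intro: has_derivative_eq_rhs)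
    then show ?thesis using x at_within_open[of x ?B] by auto
  qed
  have "Ck_on n f ?B" for n
  proof (cases n)
    case 0
    have "isCont f x" if "x \<in> ?B" for x using f[OF that] has_derivative_continuous by blast
    then show ?thesis using 0 by (simp add: continuous_at_imp_continuous_on)
  next
    case (Suc m)
    show ?thesis unfolding Suc
      using smooth by (intro Ck_on_SucI[OF open_ball f]) (auto simp: smooth_on_def)
  qed
  then have "smooth_on f ?B \<and> (\<forall>x\<in>?B. (f has_derivative \<omega> x) (at x))"
    using f by (simp add: smooth_on_def)
  then show ?thesis by blast
qed

section \<open>Smooth functions on a manifold\<close>

abbreviation chart_inv :: "'m chart \<Rightarrow> real^2 \<Rightarrow> 'm"
  where "chart_inv c \<equiv> inv_into (fst c) (snd c)"

locale atlas =
  fixes A :: "'m::t2_space chart set"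
  assumes smooth_atlas: "smooth_atlas A"
begin

lemma chart_open: "c \<in> A \<Longrightarrow> open (fst c)"
  using smooth_atlas unfolding smooth_atlas_def by fastforce

lemma chart_homeo: "c \<in> A \<Longrightarrow> homeomorphism (fst c) (snd c ` fst c) (snd c) (chart_inv c)"
  using smooth_atlas unfolding smooth_atlas_def by fastforce

lemma chart_image_open:
  assumes "c \<in> A" "open W"
  shows "open (snd c ` (W \<inter> fst c))"
proof -
  have o: "open (snd c ` fst c)"
    using assms(1) smooth_atlas unfolding smooth_atlas_def by fastforce
  have "openin (top_of_set (fst c)) (W \<inter> fst c)"
    using assms by (metis Int_commute openin_open_Int)
  with chart_homeo[OF assms(1)] have "openin (top_of_set (snd c ` fst c)) (snd c ` (W \<inter> fst c))"
    by (rule homeomorphism_imp_open_map)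
  with o show ?thesis by (simp add: openin_open_eq)
qed

lemma chart_inv [simp]: "c \<in> A \<Longrightarrow> p \<in> fst c \<Longrightarrow> chart_inv c (snd c p) = p"
  using chart_homeo homeomorphism_apply1 by metis

lemma chart_at: "\<exists>c. c \<in> charts_at A p"
  using smooth_atlas unfolding smooth_atlas_def charts_at_def by fastforce

lemma charts_atD: "c \<in> charts_at A p \<Longrightarrow> c \<in> A" "c \<in> charts_at A p \<Longrightarrow> p \<in> fst c"
  by (auto simp: charts_at_def)

lemma transition_smooth:
  "c \<in> A \<Longrightarrow> d \<in> A \<Longrightarrow> smooth_on (snd d \<circ> chart_inv c) (snd c ` (fst c \<inter> fst d))"
  using smooth_atlas unfolding smooth_atlas_def by fastforce

lemma smooth_fun_iff:
  "smooth_fun A U f \<longleftrightarrow> (\<forall>c\<in>A. smooth_on (\<lambda>x. f (chart_inv c x)) (snd c ` (U \<inter> fst c)))"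
  unfolding smooth_fun_def by (fastforce simp: o_def)

lemma smooth_funD:
  "smooth_fun A U f \<Longrightarrow> c \<in> A \<Longrightarrow> smooth_on (\<lambda>x. f (chart_inv c x)) (snd c ` (U \<inter> fst c))"
  by (simp add: smooth_fun_iff)

lemma smooth_fun_subset: "smooth_fun A U f \<Longrightarrow> V \<subseteq> U \<Longrightarrow> smooth_fun A V f"
  unfolding smooth_fun_iff smooth_on_def by (meson Ck_on_subset Int_mono image_mono order_refl)

lemma smooth_fun_cong:
  assumes "open U" "\<And>p. p \<in> U \<Longrightarrow> f p = g p" "smooth_fun A U f"
  shows "smooth_fun A U g"
  unfolding smooth_fun_iff
proof (intro ballI smooth_onI)
  fix c n assume c: "c \<in> A"
  show "Ck_on n (\<lambda>x. g (chart_inv c x)) (snd c ` (U \<inter> fst c))"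
    by (rule Ck_on_cong[OF chart_image_open[OF c assms(1)] _ smooth_onD[OF smooth_funD[OF assms(3) c]]])
      (use c assms(2) in auto)
qed

lemma smooth_fun_local:
  assumes "\<And>p. p \<in> U \<Longrightarrow> \<exists>W. open W \<and> p \<in> W \<and> smooth_fun A W f"
  shows "smooth_fun A U f"
  unfolding smooth_fun_iff
proof (intro ballI smooth_onI Ck_on_local)
  fix c n x assume c: "c \<in> A" and "x \<in> snd c ` (U \<inter> fst c)"
  then obtain p where p: "p \<in> U" "p \<in> fst c" "x = snd c p" by auto
  obtain W where W: "open W" "p \<in> W" "smooth_fun A W f" using assms[OF p(1)] by auto
  show "\<exists>T. open T \<and> x \<in> T \<and> Ck_on n (\<lambda>x. f (chart_inv c x)) T"
    using chart_image_open[OF c W(1)] smooth_onD[OF smooth_funD[OF W(3) c]] p W(2) by blast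
qed

lemma smooth_fun_const: "smooth_fun A U (\<lambda>p. k)"
  unfolding smooth_fun_iff smooth_on_def by (simp add: Ck_on_const)

lemma smooth_fun_linear:
  assumes "bounded_linear L" "open U" "smooth_fun A U f"
  shows "smooth_fun A U (\<lambda>p. L (f p))"
  unfolding smooth_fun_iff
  using Ck_on_linear_comp[OF assms(1) chart_image_open[OF _ assms(2)] smooth_onD[OF smooth_funD[OF assms(3)]]]
  by (simp add: smooth_on_def)

lemma smooth_fun_bilinear:
  assumes "bounded_bilinear b" "open U" "smooth_fun A U f" "smooth_fun A U g"
  shows "smooth_fun A U (\<lambda>p. b (f p) (g p))"
  unfolding smooth_fun_iff
  using Ck_on_bilinear[OF assms(1) chart_image_open[OF _ assms(2)] smooth_onD[OF smooth_funD[OF assms(3)]]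
      smooth_onD[OF smooth_funD[OF assms(4)]]]
  by (simp add: smooth_on_def)

lemma smooth_fun_add:
  assumes "open U" "smooth_fun A U f" "smooth_fun A U g"
  shows "smooth_fun A U (\<lambda>p. f p + g p)"
  unfolding smooth_fun_iff
  using Ck_on_add[OF chart_image_open[OF _ assms(1)] smooth_onD[OF smooth_funD[OF assms(2)]]
      smooth_onD[OF smooth_funD[OF assms(3)]]]
  by (simp add: smooth_on_def)

lemma smooth_fun_minus: "open U \<Longrightarrow> smooth_fun A U f \<Longrightarrow> smooth_fun A U (\<lambda>p. - f p)"
  by (rule smooth_fun_linear[OF bounded_linear_minus[OF bounded_linear_ident]])

lemma smooth_fun_diff:
  assumes "open U" "smooth_fun A U f" "smooth_fun A U g"
  shows "smooth_fun A U (\<lambda>p. f p - g p)"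
  using smooth_fun_add[OF assms(1,2) smooth_fun_minus[OF assms(1,3)]] by simp

lemmas smooth_fun_scaleR = smooth_fun_bilinear[OF bounded_bilinear_scaleR]
lemmas smooth_fun_mult =
  smooth_fun_bilinear[OF bounded_bilinear_mult[where 'a = real]]

lemma smooth_fun_compose:
  fixes f :: "'m \<Rightarrow> 'a::euclidean_space" and \<phi> :: "'a \<Rightarrow> 'b::real_normed_vector"
  assumes "open U" "open T" "\<And>p. p \<in> U \<Longrightarrow> f p \<in> T" "smooth_on \<phi> T" "smooth_fun A U f"
  shows "smooth_fun A U (\<lambda>p. \<phi> (f p))"
  unfolding smooth_fun_iff
proof (intro ballI smooth_onI)
  fix c n assume c: "c \<in> A"
  show "Ck_on n (\<lambda>x. \<phi> (f (chart_inv c x))) (snd c ` (U \<inter> fst c))"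
    by (rule Ck_on_compose[OF chart_image_open[OF c assms(1)] assms(2) _ smooth_onD[OF assms(4)]
          smooth_onD[OF smooth_funD[OF assms(5) c]]]) (use c assms(3) in auto)
qed

lemma smooth_fun_inverse_sqrt:
  assumes "open U" "\<And>p. p \<in> U \<Longrightarrow> f p > (0::real)" "smooth_fun A U f"
  shows "smooth_fun A U (\<lambda>p. 1 / sqrt (f p))"
  by (rule smooth_fun_compose[OF assms(1) open_greaterThan _ smooth_onI[OF Ck_on_inverse_sqrt] assms(3)])
    (use assms(2) in auto)

text \<open>Smoothness in the other charts follows by composing with the coordinate changes.\<close>

lemma smooth_fun_chart:
  assumes c: "c \<in> A" and U: "open U" and f: "smooth_on (\<lambda>x. f (chart_inv c x)) (snd c ` (U \<inter> fst c))"
  shows "smooth_fun A (U \<inter> fst c) f"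
  unfolding smooth_fun_iff
proof (intro ballI smooth_onI)
  fix d n assume d: "d \<in> A"
  have o: "open (snd d ` (U \<inter> fst c \<inter> fst d))"
    using U c d by (intro chart_image_open open_Int chart_open)
  have "Ck_on n (\<lambda>x. f (chart_inv c ((snd c \<circ> chart_inv d) x))) (snd d ` (U \<inter> fst c \<inter> fst d))"
  proof (rule Ck_on_compose[OF o chart_image_open[OF c U] _ smooth_onD[OF f]])
    show "Ck_on n (snd c \<circ> chart_inv d) (snd d ` (U \<inter> fst c \<inter> fst d))"
      by (rule Ck_on_subset[OF smooth_onD[OF transition_smooth[OF d c]]]) auto
  qed (use d in auto)
  then show "Ck_on n (\<lambda>x. f (chart_inv d x)) (snd d ` (U \<inter> fst c \<inter> fst d))"
    by (rule Ck_on_cong[OF o, rotated]) (use c d in auto)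
qed

lemma smooth_fun_continuous:
  assumes "open U" "smooth_fun A U f"
  shows "continuous_on U f"
proof -
  have "isCont f p" if p: "p \<in> U" for p
  proof -
    obtain c where c: "c \<in> A" "p \<in> fst c" using chart_at charts_atD by metis
    have "continuous_on (U \<inter> fst c) (\<lambda>q. f (chart_inv c (snd c q)))"
      using smooth_on_continuous[OF smooth_funD[OF assms(2) c(1)]]
        homeomorphism_cont1[OF chart_homeo[OF c(1)]]
      by (rule continuous_on_compose2[OF _ continuous_on_subset]) auto
    then have "continuous_on (U \<inter> fst c) f"
      by (rule continuous_on_eq) (use c in auto)
    then show ?thesis
      using continuous_on_eq_continuous_at[of "U \<inter> fst c"] assms(1) chart_open[OF c(1)] p c(2) by auto
  qed
  then show ?thesis by (simp add: continuous_at_imp_continuous_on)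
qed

subsection \<open>Directional derivatives\<close>

lemma chart_has_derivative:
  assumes "smooth_fun A U f" "p \<in> U" "c \<in> charts_at A p"
  shows "((\<lambda>x. f (chart_inv c x)) has_derivative
    frechet_derivative (\<lambda>x. f (chart_inv c x)) (at (snd c p))) (at (snd c p))"
  using smooth_on_has_derivative[OF smooth_funD[OF assms(1)]] assms(2,3) by (auto simp: charts_at_def)

definition some_chart :: "'m \<Rightarrow> 'm chart"
  where "some_chart p = (SOME c. c \<in> charts_at A p)"

lemma some_chart: "some_chart p \<in> charts_at A p"
  unfolding some_chart_def using chart_at by (rule someI_ex)

lemma some_chart_inv [simp]: "chart_inv (some_chart p) (snd (some_chart p) p) = p"
  using some_chart charts_atD chart_inv by metis

lemma mdiff_eq: "mdiff A f p X =
    frechet_derivative (\<lambda>x. f (chart_inv (some_chart p) x)) (at (snd (some_chart p) p)) (X (some_chart p))"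
  by (simp add: mdiff_def some_chart_def o_def Let_def)

lemmas some_chart_has_derivative = chart_has_derivative[OF _ _ some_chart]

lemma mdiffI:
  assumes "((\<lambda>x. f (chart_inv (some_chart p) x)) has_derivative D) (at (snd (some_chart p) p))"
  shows "mdiff A f p X = D (X (some_chart p))"
  using frechet_derivative_at[OF assms] by (simp add: mdiff_eq)

lemma mdiff_cong:
  assumes "open U" "p \<in> U" "\<And>q. q \<in> U \<Longrightarrow> f q = g q"
  shows "mdiff A f p X = mdiff A g p X"
  unfolding mdiff_eq
proof (rule fun_cong[where x = "X (some_chart p)"], rule frechet_derivative_cong_open)
  let ?c = "some_chart p"
  have c: "?c \<in> A" "p \<in> fst ?c" using some_chart charts_atD by blast+
  show "open (snd ?c ` (U \<inter> fst ?c))" by (rule chart_image_open[OF c(1) assms(1)])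
  show "snd ?c p \<in> snd ?c ` (U \<inter> fst ?c)" using assms c by auto
  show "f (chart_inv ?c x) = g (chart_inv ?c x)" if "x \<in> snd ?c ` (U \<inter> fst ?c)" for x
    using that assms(3) c(1) by auto
qed

lemma mdiff_const [simp]: "mdiff A (\<lambda>q. k) p X = 0"
  by (simp add: mdiff_eq)

lemma mdiff_linear_comp:
  assumes "bounded_linear L" "smooth_fun A U f" "p \<in> U"
  shows "mdiff A (\<lambda>q. L (f q)) p X = L (mdiff A f p X)"
  using mdiffI[OF bounded_linear.has_derivative[OF assms(1) some_chart_has_derivative[OF assms(2,3)]]]
  by (simp add: mdiff_eq)

lemma mdiff_bilinear:
  assumes "bounded_bilinear b" "smooth_fun A U f" "smooth_fun A U g" "p \<in> U"
  shows "mdiff A (\<lambda>q. b (f q) (g q)) p X = b (f p) (mdiff A g p X) + b (mdiff A f p X) (g p)"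
  using mdiffI[OF bounded_bilinear.FDERIV[OF assms(1) some_chart_has_derivative[OF assms(2,4)]
        some_chart_has_derivative[OF assms(3,4)]]]
  by (simp add: mdiff_eq)

lemma mdiff_add:
  assumes "smooth_fun A U f" "smooth_fun A U g" "p \<in> U"
  shows "mdiff A (\<lambda>q. f q + g q) p X = mdiff A f p X + mdiff A g p X"
  using mdiffI[OF has_derivative_add[OF some_chart_has_derivative[OF assms(1,3)]
        some_chart_has_derivative[OF assms(2,3)]]]
  by (simp add: mdiff_eq)

lemmas mdiff_minus = mdiff_linear_comp[OF bounded_linear_minus[OF bounded_linear_ident]]

lemma mdiff_diff:
  assumes "smooth_fun A U f" "smooth_fun A U g" "p \<in> U"
  shows "mdiff A (\<lambda>q. f q - g q) p X = mdiff A f p X - mdiff A g p X"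
  using mdiffI[OF has_derivative_diff[OF some_chart_has_derivative[OF assms(1,3)]
        some_chart_has_derivative[OF assms(2,3)]]]
  by (simp add: mdiff_eq)

lemmas mdiff_scaleR = mdiff_bilinear[OF bounded_bilinear_scaleR]

lemma mdiff_direction:
  assumes "smooth_fun A U f" "p \<in> U"
  shows "mdiff A f p (X + Y) = mdiff A f p X + mdiff A f p Y"
    and "mdiff A f p (r *\<^sub>R X) = r *\<^sub>R mdiff A f p X"
proof -
  have "linear (frechet_derivative (\<lambda>x. f (chart_inv (some_chart p) x)) (at (snd (some_chart p) p)))"
    using some_chart_has_derivative[OF assms] has_derivative_linear by blast
  then show "mdiff A f p (X + Y) = mdiff A f p X + mdiff A f p Y"
    "mdiff A f p (r *\<^sub>R X) = r *\<^sub>R mdiff A f p X"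
    by (simp_all add: mdiff_eq scaleR_fun_def linear_add linear_cmul)
qed

text \<open>The definition of \<open>mdiff\<close> uses a chosen chart. For a tangent vector the chain rule shows that any
  other chart gives the same value.\<close>

lemma mdiff_chart:
  assumes f: "smooth_fun A U f" "open U" "p \<in> U" and X: "X \<in> tangent_space A p"
    and c: "c \<in> charts_at A p"
  shows "mdiff A f p X = frechet_derivative (\<lambda>x. f (chart_inv c x)) (at (snd c p)) (X c)"
proof -
  let ?d = "some_chart p"
  note cA = charts_atD[OF c] and dA = charts_atD[OF some_chart[of p]]
  let ?t = "snd ?d \<circ> chart_inv c"
  have t: "(?t has_derivative transition_deriv c ?d p) (at (snd c p))"
    unfolding transition_deriv_def
    by (rule smooth_on_has_derivative[OF transition_smooth[OF cA(1) dA(1)]]) (use cA dA in auto)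
  have tp: "?t (snd c p) = snd ?d p" using cA by simp
  note diff_chain_at[OF t, unfolded tp, OF some_chart_has_derivative[OF f(1,3)]]
  then have D: "((\<lambda>x. f (chart_inv ?d (?t x))) has_derivative
      (\<lambda>v. frechet_derivative (\<lambda>x. f (chart_inv ?d x)) (at (snd ?d p)) (transition_deriv c ?d p v)))
      (at (snd c p))" by (simp add: o_def)
  have D': "((\<lambda>x. f (chart_inv c x)) has_derivative
      (\<lambda>v. frechet_derivative (\<lambda>x. f (chart_inv ?d x)) (at (snd ?d p)) (transition_deriv c ?d p v)))
      (at (snd c p))"
    by (rule has_derivative_transform_within_open[OF D chart_image_open[OF cA(1) chart_open[OF dA(1)]]])
      (use cA dA in auto)
  have "frechet_derivative (\<lambda>x. f (chart_inv c x)) (at (snd c p)) (X c) =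
      frechet_derivative (\<lambda>x. f (chart_inv ?d x)) (at (snd ?d p)) (transition_deriv c ?d p (X c))"
    by (simp only: frechet_derivative_at[OF D', symmetric])
  moreover have "X ?d = transition_deriv c ?d p (X c)"
    using X c some_chart[of p] unfolding tangent_space_def by blast
  ultimately show ?thesis by (simp only: mdiff_eq)
qed

lemma smooth_chart_derivative:
  assumes "smooth_fun A U f" "open U" "c \<in> A"
  shows "smooth_fun A (U \<inter> fst c) (\<lambda>p. frechet_derivative (\<lambda>x. f (chart_inv c x)) (at (snd c p)) v)"
proof (rule smooth_fun_chart[OF assms(3,2)], rule smooth_onI)
  fix n
  show "Ck_on n (\<lambda>x. frechet_derivative (\<lambda>x. f (chart_inv c x)) (at (snd c (chart_inv c x))) v)
      (snd c ` (U \<inter> fst c))"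
    by (rule Ck_on_cong[OF chart_image_open[OF assms(3,2)] _
          smooth_onD[OF smooth_on_derivative[OF smooth_funD[OF assms(1,3)]]]])
      (use assms(3) in auto)
qed

end

section \<open>Local sections over simply connected spaces\<close>

text \<open>A family of local sections \<open>(U, f)\<close> with values in \<open>val p\<close>, such as the primitives of a closed
  one-form or the spinor lifts of a field of isometries. By \<open>ext\<close> and \<open>agree\<close> the pairs \<open>(p, v)\<close> with
  \<open>v \<in> val p\<close> form a covering space of the base whose sheets are the graphs of the members of the family;
  so over a simply connected base every value extends to a global section. The covering is not
  constructed as a topological space: a continuous lift of a map \<open>\<theta>\<close> to it is a function that agrees
  locally with members of the family, composed with \<open>\<theta>\<close>.\<close>

locale local_sections =
  fixes Fam :: "('m::t2_space set \<times> ('m \<Rightarrow> 'v)) set" and val :: "'m \<Rightarrow> 'v set"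
  assumes dom_open: "(U, f) \<in> Fam \<Longrightarrow> open U"
    and val: "(U, f) \<in> Fam \<Longrightarrow> p \<in> U \<Longrightarrow> f p \<in> val p"
    and ext: "\<exists>U. open U \<and> p \<in> U \<and> path_connected U \<and>
      (\<forall>p'\<in>U. \<forall>v\<in>val p'. \<exists>f. (U, f) \<in> Fam \<and> f p' = v)"
    and agree: "(U, f) \<in> Fam \<Longrightarrow> (V, g) \<in> Fam \<Longrightarrow> p \<in> U \<Longrightarrow> p \<in> V \<Longrightarrow>
      \<exists>W. open W \<and> p \<in> W \<and> W \<subseteq> U \<inter> V \<and> (\<forall>q\<in>W. (f q = g q) = (f p = g p))"
begin

definition lift :: "('k::topological_space \<Rightarrow> 'm) \<Rightarrow> 'k set \<Rightarrow> ('k \<Rightarrow> 'v) \<Rightarrow> bool"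
  where "lift \<theta> K g \<longleftrightarrow> (\<forall>k\<in>K. \<exists>U f W. (U, f) \<in> Fam \<and> open W \<and> k \<in> W \<and>
    (\<forall>k'\<in>W \<inter> K. \<theta> k' \<in> U \<and> g k' = f (\<theta> k')))"

lemma lift_val:
  assumes "lift \<theta> K g" "k \<in> K"
  shows "g k \<in> val (\<theta> k)"
proof -
  obtain U f W where W: "(U, f) \<in> Fam" "k \<in> W" "\<forall>k'\<in>W \<inter> K. \<theta> k' \<in> U \<and> g k' = f (\<theta> k')"
    using assms unfolding lift_def by blast
  then show ?thesis using val[OF W(1), of "\<theta> k"] assms(2) by simp
qed

lemma lift_reparam:
  assumes "lift \<theta> K g" "continuous_on K' r" "\<And>k. k \<in> K' \<Longrightarrow> r k \<in> K"
    "\<And>k. k \<in> K' \<Longrightarrow> \<theta>' k = \<theta> (r k)"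
  shows "lift \<theta>' K' (\<lambda>k. g (r k))"
  unfolding lift_def
proof
  fix k assume k: "k \<in> K'"
  obtain U f W where W: "(U, f) \<in> Fam" "open W" "r k \<in> W"
    "\<forall>k'\<in>W \<inter> K. \<theta> k' \<in> U \<and> g k' = f (\<theta> k')"
    using bspec[OF assms(1)[unfolded lift_def] assms(3)[OF k]] by blast
  obtain W' where W': "open W'" "W' \<inter> K' = r -` W \<inter> K'"
    using assms(2) W(2) unfolding continuous_on_open_invariant by blast
  show "\<exists>U f W. (U, f) \<in> Fam \<and> open W \<and> k \<in> W \<and>
      (\<forall>k'\<in>W \<inter> K'. \<theta>' k' \<in> U \<and> g (r k') = f (\<theta>' k'))"
    by (rule exI[of _ U], rule exI[of _ f], rule exI[of _ W']) (use W W' k assms(3,4) in auto)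
qed

text \<open>By \<open>agree\<close> the set where two lifts coincide is open and closed.\<close>

lemma lift_unique:
  assumes \<theta>: "continuous_on K \<theta>" and K: "connected K" and g: "lift \<theta> K g" and g': "lift \<theta> K g'"
    and k: "k \<in> K" "k' \<in> K" and eq: "g k = g' k"
  shows "g k' = g' k'"
proof -
  have "(g k = g' k) = (g k' = g' k')"
  proof (rule connected_local_const[OF K k])
    show "\<forall>a\<in>K. \<forall>\<^sub>F b in at a within K. (g a = g' a) = (g b = g' b)"
    proof
      fix a assume a: "a \<in> K"
      obtain U f W where W: "(U, f) \<in> Fam" "open W" "a \<in> W"
        "\<forall>k'\<in>W \<inter> K. \<theta> k' \<in> U \<and> g k' = f (\<theta> k')" using g a unfolding lift_def by blast
      obtain U' f' W' where W': "(U', f') \<in> Fam" "open W'" "a \<in> W'"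
        "\<forall>k'\<in>W' \<inter> K. \<theta> k' \<in> U' \<and> g' k' = f' (\<theta> k')" using g' a unfolding lift_def by blast
      have a': "\<theta> a \<in> U" "\<theta> a \<in> U'" using W(3,4) W'(3,4) a by auto
      obtain V where V: "open V" "\<theta> a \<in> V" "\<forall>q\<in>V. (f q = f' q) = (f (\<theta> a) = f' (\<theta> a))"
        using agree[OF W(1) W'(1) a'] by blast
      obtain V' where V': "open V'" "V' \<inter> K = \<theta> -` V \<inter> K"
        using \<theta> V(1) unfolding continuous_on_open_invariant by blast
      have eqs: "g b = f (\<theta> b)" "g' b = f' (\<theta> b)" if "b \<in> K" "b \<in> W \<inter> W' \<inter> V'" for b
        using W(4) W'(4) that by auto
      have "\<theta> b \<in> V" if "b \<in> K" "b \<in> W \<inter> W' \<inter> V'" for b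
        using V'(2) that by auto
      then have inV: "(f (\<theta> b) = f' (\<theta> b)) = (f (\<theta> a) = f' (\<theta> a))"
        if "b \<in> K" "b \<in> W \<inter> W' \<inter> V'" for b
        using V(3) that by blast
      have aW: "a \<in> W \<inter> W' \<inter> V'" using W(3) W'(3) V(2) V'(2) a by auto
      have "(g a = g' a) = (g b = g' b)" if "b \<in> K" "b \<in> W \<inter> W' \<inter> V'" for b
        using inV[OF that] unfolding eqs[OF that] eqs[OF a aW] by (rule sym)
      then have "\<forall>b\<in>K. b \<in> W \<inter> W' \<inter> V' \<longrightarrow> (g a = g' a) = (g b = g' b)"
        by blast
      moreover have "open (W \<inter> W' \<inter> V')" "a \<in> W \<inter> W' \<inter> V'"
        using W W' V V' a by auto
      ultimately show "\<forall>\<^sub>F b in at a within K. (g a = g' a) = (g b = g' b)"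
        unfolding eventually_at_topological by blast
    qed
  qed
  with eq show ?thesis by simp
qed

definition liftable :: "('k::topological_space \<Rightarrow> 'm) \<Rightarrow> 'k set \<Rightarrow> bool"
  where "liftable \<theta> K \<longleftrightarrow> (\<forall>k\<in>K. \<forall>v\<in>val (\<theta> k). \<exists>g. lift \<theta> K g \<and> g k = v)"

text \<open>The two lifts agree on the connected set \<open>K1 \<inter> K2\<close> since they agree at \<open>k0\<close>. Near a point outside
  one of the two closed sets only the other lift matters.\<close>

lemma lift_union:
  assumes \<theta>: "continuous_on UNIV \<theta>"
    and K: "closed K1" "closed K2" "connected (K1 \<inter> K2)" "k0 \<in> K1 \<inter> K2"
    and g: "lift \<theta> K1 g1" "lift \<theta> K2 g2" "g1 k0 = g2 k0"
  shows "lift \<theta> (K1 \<union> K2) (\<lambda>k. if k \<in> K1 then g1 k else g2 k)" (is "lift _ _ ?g")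
proof -
  have "lift \<theta> (K1 \<inter> K2) g1" "lift \<theta> (K1 \<inter> K2) g2"
    using lift_reparam[OF g(1), of "K1 \<inter> K2" "\<lambda>k. k" \<theta>] lift_reparam[OF g(2), of "K1 \<inter> K2" "\<lambda>k. k" \<theta>]
    by (auto simp: continuous_on_id)
  then have eq: "g1 k = g2 k" if "k \<in> K1 \<inter> K2" for k
    using lift_unique[OF continuous_on_subset[OF \<theta>] K(3), of g1 g2 k0 k] K(4) g(3) that by auto
  show ?thesis
    unfolding lift_def
  proof
    fix k assume "k \<in> K1 \<union> K2"
    then consider "k \<in> K1 \<inter> K2" | "k \<in> K1 - K2" | "k \<in> K2 - K1" by blast
    then show "\<exists>U f W. (U, f) \<in> Fam \<and> open W \<and> k \<in> W \<and>
        (\<forall>k'\<in>W \<inter> (K1 \<union> K2). \<theta> k' \<in> U \<and> ?g k' = f (\<theta> k'))"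
    proof cases
      case 1
      obtain U f W where W: "(U, f) \<in> Fam" "open W" "k \<in> W"
        "\<forall>k'\<in>W \<inter> K1. \<theta> k' \<in> U \<and> g1 k' = f (\<theta> k')" using g(1) 1 unfolding lift_def by blast
      obtain U' f' W' where W': "(U', f') \<in> Fam" "open W'" "k \<in> W'"
        "\<forall>k'\<in>W' \<inter> K2. \<theta> k' \<in> U' \<and> g2 k' = f' (\<theta> k')" using g(2) 1 unfolding lift_def by blast
      have "f (\<theta> k) = f' (\<theta> k)" using eq[OF 1] W W' 1 by auto
      moreover have "\<theta> k \<in> U" "\<theta> k \<in> U'" using W(3,4) W'(3,4) 1 by auto
      ultimately obtain V where V: "open V" "\<theta> k \<in> V" "V \<subseteq> U" "\<forall>q\<in>V. f q = f' q"
        using agree[OF W(1) W'(1), of "\<theta> k"] by blast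
      have "open (\<theta> -` V)" using \<theta> V(1) by (simp add: open_vimage)
      then show ?thesis
        using W W' V 1 by (intro exI[of _ U] exI[of _ f] exI[of _ "W \<inter> W' \<inter> \<theta> -` V"]) auto
    next
      case 2
      obtain U f W where W: "(U, f) \<in> Fam" "open W" "k \<in> W"
        "\<forall>k'\<in>W \<inter> K1. \<theta> k' \<in> U \<and> g1 k' = f (\<theta> k')" using g(1) 2 unfolding lift_def by blast
      then show ?thesis
        using 2 K by (intro exI[of _ U] exI[of _ f] exI[of _ "W \<inter> - K2"]) auto
    next
      case 3
      obtain U f W where W: "(U, f) \<in> Fam" "open W" "k \<in> W"
        "\<forall>k'\<in>W \<inter> K2. \<theta> k' \<in> U \<and> g2 k' = f (\<theta> k')" using g(2) 3 unfolding lift_def by blast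
      then show ?thesis
        using 3 K by (intro exI[of _ U] exI[of _ f] exI[of _ "W \<inter> - K1"]) auto
    qed
  qed
qed

lemma liftable_union:
  assumes \<theta>: "continuous_on UNIV \<theta>"
    and K: "closed K1" "closed K2" "connected (K1 \<inter> K2)" "K1 \<inter> K2 \<noteq> {}"
    and l: "liftable \<theta> K1" "liftable \<theta> K2"
  shows "liftable \<theta> (K1 \<union> K2)"
  unfolding liftable_def
proof (intro ballI)
  fix k v assume k: "k \<in> K1 \<union> K2" and v: "v \<in> val (\<theta> k)"
  obtain k0 where k0: "k0 \<in> K1 \<inter> K2" using K(4) by blast
  have *: "\<exists>g. lift \<theta> (K \<union> L) g \<and> g k = v"
    if KL: "closed K" "closed L" "connected (K \<inter> L)" "k0 \<in> K \<inter> L" "liftable \<theta> K" "liftable \<theta> L" "k \<in> K"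
    for K L
  proof -
    obtain g1 where g1: "lift \<theta> K g1" "g1 k = v" using KL v unfolding liftable_def by blast
    then have "g1 k0 \<in> val (\<theta> k0)" using lift_val KL by blast
    then obtain g2 where g2: "lift \<theta> L g2" "g2 k0 = g1 k0" using KL unfolding liftable_def by blast
    show ?thesis
      using lift_union[OF \<theta> KL(1-4) g1(1) g2(1)] g1(2) g2(2) KL(7) by auto
  qed
  show "\<exists>g. lift \<theta> (K1 \<union> K2) g \<and> g k = v"
  proof (cases "k \<in> K1")
    case True
    then show ?thesis using *[of K1 K2] K l k0 by blast
  next
    case False
    then show ?thesis using *[of K2 K1] K l k0 k by (auto simp: Int_commute Un_commute)
  qed
qed

lemma liftable_local:
  assumes \<theta>: "continuous_on UNIV \<theta>"
  shows "\<exists>W. open W \<and> k \<in> W \<and> (\<forall>K\<subseteq>W. liftable \<theta> K)"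
proof -
  obtain U where U: "open U" "\<theta> k \<in> U"
    "\<forall>p'\<in>U. \<forall>v\<in>val p'. \<exists>f. (U, f) \<in> Fam \<and> f p' = v" using ext by blast
  have "liftable \<theta> K" if "K \<subseteq> \<theta> -` U" for K
    unfolding liftable_def
  proof (intro ballI)
    fix l v assume "l \<in> K" "v \<in> val (\<theta> l)"
    then obtain f where f: "(U, f) \<in> Fam" "f (\<theta> l) = v" using U(3) \<open>K \<subseteq> \<theta> -` U\<close> by blast
    have "lift \<theta> K (\<lambda>k. f (\<theta> k))"
      unfolding lift_def using f(1) that by (intro ballI exI[of _ U] exI[of _ f] exI[of _ UNIV]) auto
    then show "\<exists>g. lift \<theta> K g \<and> g l = v" using f(2) by blast
  qed
  moreover have "open (\<theta> -` U)" using \<theta> U(1) by (simp add: open_vimage)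
  ultimately show ?thesis using U(2) by blast
qed

text \<open>Bisection of the vertical side: small rectangles lie in a neighbourhood with liftings, and two
  rectangles with a common side are glued.\<close>

lemma liftable_strip:
  fixes \<theta> :: "real \<times> real \<Rightarrow> 'm"
  assumes \<theta>: "continuous_on UNIV \<theta>" and cd: "c \<le> d"
  shows "\<exists>e>0. \<forall>a b. a \<le> s \<and> s \<le> b \<and> b - a < e \<longrightarrow> liftable \<theta> ({a..b} \<times> {c..d})"
  using cd
proof (induction rule: Bolzano)
  case (trans x y z)
  obtain e1 where e1: "e1 > 0" "\<And>a b. a \<le> s \<and> s \<le> b \<and> b - a < e1 \<Longrightarrow> liftable \<theta> ({a..b} \<times> {x..y})"
    using trans(1) by blast
  obtain e2 where e2: "e2 > 0" "\<And>a b. a \<le> s \<and> s \<le> b \<and> b - a < e2 \<Longrightarrow> liftable \<theta> ({a..b} \<times> {y..z})"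
    using trans(2) by blast
  have "liftable \<theta> ({a..b} \<times> {x..z})" if ab: "a \<le> s" "s \<le> b" "b - a < min e1 e2" for a b
  proof -
    have I: "{a..b} \<times> {x..y} \<inter> {a..b} \<times> {y..z} = {a..b} \<times> {y}"
      using trans(3,4) by auto
    have U: "{a..b} \<times> {x..y} \<union> {a..b} \<times> {y..z} = {a..b} \<times> {x..z}"
      using trans(3,4) by auto
    show ?thesis
      unfolding U[symmetric]
      by (rule liftable_union[OF \<theta>]) (use ab e1(2) e2(2) in \<open>auto simp: I closed_Times connected_Times\<close>)
  qed
  then show ?case using e1(1) e2(1) by (intro exI[of _ "min e1 e2"]) auto
next
  case (local t)
  obtain W where W: "open W" "(s, t) \<in> W" "\<forall>K\<subseteq>W. liftable \<theta> K" using liftable_local[OF \<theta>] by blast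
  obtain S T where ST: "open S" "open T" "s \<in> S" "t \<in> T" "S \<times> T \<subseteq> W"
    using open_prod_elim[OF W(1,2)] by (metis mem_Sigma_iff)
  obtain e1 where e1: "e1 > 0" "ball s e1 \<subseteq> S" using ST by (meson openE)
  obtain e2 where e2: "e2 > 0" "ball t e2 \<subseteq> T" using ST by (meson openE)
  have "liftable \<theta> ({a..b} \<times> {x..y})"
    if "a \<le> s \<and> s \<le> b \<and> b - a < e1" "x \<le> t \<and> t \<le> y \<and> y - x < e2" for a b x y
  proof -
    have "{a..b} \<subseteq> ball s e1" "{x..y} \<subseteq> ball t e2" using that by (auto simp: dist_real_def)
    then have "{a..b} \<times> {x..y} \<subseteq> W" using e1(2) e2(2) ST(5) by blast
    then show ?thesis using W(3) by blast
  qed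
  then show ?case using e1(1) e2(1) by blast
qed

lemma liftable_rectangle:
  fixes \<theta> :: "real \<times> real \<Rightarrow> 'm"
  assumes \<theta>: "continuous_on UNIV \<theta>" and "a \<le> b" "c \<le> d"
  shows "liftable \<theta> ({a..b} \<times> {c..d})"
  using assms(2)
proof (induction rule: Bolzano)
  case (trans x y z)
  have I: "{x..y} \<times> {c..d} \<inter> {y..z} \<times> {c..d} = {y} \<times> {c..d}"
    using trans(3,4) by auto
  have U: "{x..y} \<times> {c..d} \<union> {y..z} \<times> {c..d} = {x..z} \<times> {c..d}"
    using trans(3,4) by auto
  show ?case
    unfolding U[symmetric]
    by (rule liftable_union[OF \<theta>]) (use trans assms(3) in \<open>auto simp: I closed_Times connected_Times\<close>)
next
  case (local s)
  then show ?case using liftable_strip[OF \<theta> assms(3), of s] by blast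
qed

text \<open>Composition with the retraction of the line onto \<open>{0..1}\<close> extends paths and homotopies to maps
  that are continuous everywhere.\<close>

definition clamp01 :: "real \<Rightarrow> real" where "clamp01 t = max 0 (min 1 t)"

lemma clamp01: "clamp01 t \<in> {0..1}" "t \<in> {0..1} \<Longrightarrow> clamp01 t = t" "continuous_on S clamp01"
  by (auto simp: clamp01_def[abs_def] intro!: continuous_intros)

text \<open>The path is regarded as a map on a degenerate rectangle.\<close>

lemma path_lift:
  assumes "path \<gamma>" "v \<in> val (\<gamma> 0)"
  shows "\<exists>g. lift \<gamma> {0..1} g \<and> g 0 = v"
proof -
  let ?\<theta> = "\<lambda>p::real \<times> real. \<gamma> (clamp01 (snd p))"
  have "continuous_on UNIV ?\<theta>"
    using assms(1) unfolding path_def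
    by (rule continuous_on_compose2)
      (use clamp01(1) in \<open>auto intro: continuous_on_compose2[OF clamp01(3)[of UNIV] continuous_on_snd[OF continuous_on_id]]\<close>)
  from liftable_rectangle[OF this, of 0 0 0 1]
  have "\<forall>v\<in>val (?\<theta> (0, 0)). \<exists>g. lift ?\<theta> ({0..0} \<times> {0..1}) g \<and> g (0, 0) = v"
    unfolding liftable_def by (rule bspec) auto
  then obtain g where g: "lift ?\<theta> ({0..0} \<times> {0..1}) g" "g (0, 0) = v"
    using assms(2) by (auto simp: clamp01)
  have "lift \<gamma> {0..1} (\<lambda>t. g (0, t))"
    by (rule lift_reparam[OF g(1)]) (auto simp: clamp01 intro!: continuous_intros)
  then show ?thesis using g(2) by blast
qed

lemma lift_path_unique:
  assumes "path \<gamma>" "lift \<gamma> {0..1} g" "lift \<gamma> {0..1} g'" "s \<in> {0..1}" "t \<in> {0..1}" "g s = g' s"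
  shows "g t = g' t"
  using lift_unique[OF _ _ assms(2-6)] assms(1) by (simp add: path_def)

text \<open>A contraction of the loop is lifted to the unit square. The lift is constant along the side that is
  mapped to the base point, and the two adjacent sides are mapped to one and the same path; so their
  lifts, which agree at one end, agree at the other.\<close>

lemma lift_loop_closed:
  assumes sc: "simply_connected (UNIV :: 'm set)" and \<gamma>: "path \<gamma>" "\<gamma> 1 = \<gamma> 0"
    and g: "lift \<gamma> {0..1} g"
  shows "g 1 = g 0"
proof -
  let ?a = "\<gamma> 0"
  have "homotopic_loops UNIV \<gamma> (\<lambda>t. ?a)"
    using sc \<gamma> unfolding simply_connected_def
    by (auto simp: pathstart_def pathfinish_def path_def)
  then obtain h where h: "continuous_on ({0..1::real} \<times> {0..1::real}) h" "\<forall>x\<in>{0..1}. h (0, x) = \<gamma> x"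
    "\<forall>x\<in>{0..1}. h (1, x) = ?a" "\<forall>t\<in>{0..1}. h (t, 1) = h (t, 0)"
    by (auto simp: homotopic_loops pathstart_def pathfinish_def)
  let ?\<theta> = "\<lambda>p. h (clamp01 (fst p), clamp01 (snd p))"
  have "continuous_on UNIV ?\<theta>"
    by (rule continuous_on_compose2[OF h(1)])
      (use clamp01(1) in \<open>auto simp: clamp01_def[abs_def] intro!: continuous_intros\<close>)
  from liftable_rectangle[OF this, of 0 1 0 1]
  have "\<forall>v\<in>val (?\<theta> (0, 0)). \<exists>g. lift ?\<theta> ({0..1} \<times> {0..1}) g \<and> g (0, 0) = v"
    unfolding liftable_def by (rule bspec) auto
  then obtain G where G: "lift ?\<theta> ({0..1} \<times> {0..1}) G" "G (0, 0) = g 0"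
    using lift_val[OF g, of 0] h(2) by (auto simp: clamp01)
  have p: "path (\<lambda>s. h (s, 0))" "path (\<lambda>s. ?a)"
    unfolding path_def by (auto intro!: continuous_on_compose2[OF h(1)] continuous_intros)
  have lefts: "lift \<gamma> {0..1} (\<lambda>t. G (0, t))"
    by (rule lift_reparam[OF G(1)]) (auto simp: clamp01 h(2) intro!: continuous_intros)
  have left: "G (0, 1) = g 1"
    using lift_path_unique[OF \<gamma>(1) lefts g, of 0 1] G(2) by simp
  have right: "lift (\<lambda>t. ?a) {0..1} (\<lambda>t. G (1, t))"
    by (rule lift_reparam[OF G(1)]) (auto simp: clamp01 h(3) intro!: continuous_intros)
  have "lift (\<lambda>t::real. ?a) {0..1} (\<lambda>t. G (1, 0))"
    by (rule lift_reparam[OF G(1), of _ "\<lambda>t. (1, 0)"]) (auto simp: clamp01 h(3) intro!: continuous_intros)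
  then have right': "G (1, 1) = G (1, 0)"
    using lift_path_unique[OF p(2) right, of _ 0 1] by simp
  have bot: "lift (\<lambda>s. h (s, 0)) {0..1} (\<lambda>s. G (s, 0))"
    by (rule lift_reparam[OF G(1)]) (auto simp: clamp01 intro!: continuous_intros)
  have top: "lift (\<lambda>s. h (s, 0)) {0..1} (\<lambda>s. G (s, 1))"
    by (rule lift_reparam[OF G(1)]) (use h(4) in \<open>auto simp: clamp01 intro!: continuous_intros\<close>)
  have "G (0, 1) = G (0, 0)"
    using lift_path_unique[OF p(1) top bot, of 1 0] right' by simp
  then show ?thesis using left G(2) by simp
qed

text \<open>The first path followed by the reverse of the second is a loop, and its lift closes up.\<close>

lemma lift_endpoint_unique:
  assumes sc: "simply_connected (UNIV :: 'm set)"
    and \<gamma>: "path \<gamma>" "path \<gamma>'" "\<gamma> 0 = \<gamma>' 0" "\<gamma> 1 = \<gamma>' 1"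
    and g: "lift \<gamma> {0..1} g" "lift \<gamma>' {0..1} g'" "g 0 = g' 0"
  shows "g 1 = g' 1"
proof -
  let ?l = "\<gamma> +++ reversepath \<gamma>'"
  have "path (reversepath \<gamma>')" using \<gamma>(2) by simp
  then have l: "path ?l" 
    using \<gamma> by (intro path_join_imp) (auto simp: pathstart_def pathfinish_def reversepath_def)
  have l0: "?l 0 = \<gamma> 0" "?l 1 = \<gamma>' 0" by (simp_all add: joinpaths_def reversepath_def)
  have "g 0 \<in> val (?l 0)" using lift_val[OF g(1), of 0] l0 by simp
  then obtain L where L: "lift ?l {0..1} L" "L 0 = g 0" using path_lift[OF l] by blast
  have L1: "L 1 = g 0" using lift_loop_closed[OF sc l _ L(1)] l0 \<gamma>(3) L(2) by simp
  have a: "lift \<gamma> {0..1} (\<lambda>t. L (t / 2))"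
    by (rule lift_reparam[OF L(1)]) (auto simp: joinpaths_def intro!: continuous_intros)
  have "\<gamma>' k = ?l (1 - k / 2)" if "k \<in> {0..1}" for k
  proof (cases "k = 1")
    case True
    then show ?thesis using \<gamma>(4) by (simp add: joinpaths_def)
  next
    case False
    then show ?thesis using that by (simp add: joinpaths_def reversepath_def)
  qed
  then have b: "lift \<gamma>' {0..1} (\<lambda>t. L (1 - t / 2))"
    by (intro lift_reparam[OF L(1)]) (auto intro!: continuous_intros)
  have "L (1/2) = g 1" using lift_path_unique[OF \<gamma>(1) a g(1), of 0 1] L(2) by simp
  moreover have "L (1/2) = g' 1"
    using lift_path_unique[OF \<gamma>(2) b g(2), of 0 1] L1 g(3) by simp
  ultimately show ?thesis by simp
qed

text \<open>The value at \<open>p\<close> is the end point of the lift of any path from \<open>p0\<close> to \<open>p\<close>. Simple connectivity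
  makes it independent of the path, and near \<open>p\<close> the path may be continued inside a path-connected
  neighbourhood on which a member of the family extends the value at \<open>p\<close>.\<close>

theorem global_section:
  assumes sc: "simply_connected (UNIV :: 'm set)" and v0: "v0 \<in> val p0"
  obtains F where "F p0 = v0" "\<And>p. \<exists>U f. (U, f) \<in> Fam \<and> p \<in> U \<and> (\<forall>q\<in>U. F q = f q)"
proof -
  define R where "R p w \<longleftrightarrow> (\<exists>\<gamma> g. path \<gamma> \<and> \<gamma> 0 = p0 \<and> \<gamma> 1 = p \<and> lift \<gamma> {0..1} g \<and> g 0 = v0 \<and> g 1 = w)"
    for p w
  have R_ex: "\<exists>w. R p w" for p
  proof -
    \<comment> \<open>A homotopy between constant loops traces a path between their base points.\<close>
    have "homotopic_loops UNIV (\<lambda>t. p0) (\<lambda>t. p)"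
      using sc unfolding simply_connected_def by (auto simp: pathstart_def pathfinish_def path_def)
    then obtain h where h: "continuous_on ({0..1::real} \<times> {0..1::real}) h" "\<forall>x\<in>{0..1}. h (0, x) = p0"
      "\<forall>x\<in>{0..1}. h (1, x) = p"
      by (auto simp: homotopic_loops pathstart_def pathfinish_def)
    have \<gamma>: "path (\<lambda>s. h (s, 0))"
      unfolding path_def by (auto intro!: continuous_on_compose2[OF h(1)] continuous_intros)
    have "h (0, 0) = p0" "h (1, 0) = p" using h by auto
    then show ?thesis unfolding R_def using path_lift[OF \<gamma>, of v0] v0 \<gamma> by metis
  qed
  have R_unique: "w = w'" if "R p w" "R p w'" for p w w'
    using that lift_endpoint_unique[OF sc] unfolding R_def by metis
  define F where "F p = (SOME w. R p w)" for p
  have RF: "R p (F p)" for p unfolding F_def using R_ex by (rule someI_ex)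
  have F: "F p = w" if "R p w" for p w using R_unique[OF RF that] .
  show ?thesis
  proof
    have "path (\<lambda>t. p0)" by (simp add: path_def)
    from path_lift[OF this, of v0] v0
    obtain g where g: "lift (\<lambda>t. p0) {0..1::real} g" "g 0 = v0" by blast
    have "lift (\<lambda>t. p0) {0..1::real} (\<lambda>t. g 0)"
      by (rule lift_reparam[OF g(1)]) (auto intro!: continuous_intros)
    with g(2) show "F p0 = v0"
      by (intro F) (auto simp: R_def path_def intro!: exI[of _ "\<lambda>t. p0"] exI[of _ "\<lambda>t. v0"])
  next
    fix p
    obtain \<gamma> g where \<gamma>: "path \<gamma>" "\<gamma> 0 = p0" "\<gamma> 1 = p" "lift \<gamma> {0..1} g" "g 0 = v0" "g 1 = F p"
      using RF[of p] unfolding R_def by blast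
    obtain U where U: "open U" "p \<in> U" "path_connected U"
      "\<forall>p'\<in>U. \<forall>v\<in>val p'. \<exists>f. (U, f) \<in> Fam \<and> f p' = v" using ext by blast
    have "F p \<in> val p" using lift_val[OF \<gamma>(4), of 1] \<gamma> by simp
    then obtain f where f: "(U, f) \<in> Fam" "f p = F p" using U by blast
    have "F q = f q" if q: "q \<in> U" for q
    proof -
      obtain \<sigma> where \<sigma>: "path \<sigma>" "path_image \<sigma> \<subseteq> U" "\<sigma> 0 = p" "\<sigma> 1 = q"
        using U(2,3) q unfolding path_connected_def pathstart_def pathfinish_def by metis
      let ?l = "\<gamma> +++ \<sigma>"
      have l: "path ?l" using \<gamma> \<sigma> by (intro path_join_imp) (auto simp: pathstart_def pathfinish_def)
      have l0: "?l 0 = p0" "?l 1 = q" using \<gamma>(2) \<sigma>(4) by (simp_all add: joinpaths_def)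
      obtain L where L: "lift ?l {0..1} L" "L 0 = v0" using path_lift[OF l, of v0] l0 v0 by auto
      have a: "lift \<gamma> {0..1} (\<lambda>t. L (t / 2))"
        by (rule lift_reparam[OF L(1)]) (auto simp: joinpaths_def intro!: continuous_intros)
      have "\<sigma> k = ?l (1/2 + k / 2)" if "k \<in> {0..1}" for k
      proof (cases "k = 0")
        case True
        then show ?thesis using \<gamma>(3) \<sigma>(3) by (simp add: joinpaths_def)
      next
        case False
        then show ?thesis using that by (simp add: joinpaths_def field_simps)
      qed
      then have b: "lift \<sigma> {0..1} (\<lambda>t. L (1/2 + t / 2))"
        by (intro lift_reparam[OF L(1)]) (auto intro!: continuous_intros)
      have c: "lift \<sigma> {0..1} (\<lambda>t. f (\<sigma> t))"
        unfolding lift_def using f(1) \<sigma>(2)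
        by (intro ballI exI[of _ U] exI[of _ f] exI[of _ UNIV]) (auto simp: path_image_def)
      have "L (1/2) = F p" using lift_path_unique[OF \<gamma>(1) a \<gamma>(4), of 0 1] L(2) \<gamma>(5,6) by simp
      then have "L 1 = f q"
        using lift_path_unique[OF \<sigma>(1) b c, of 0 1] f(2) \<sigma> by simp
      moreover have "R q (L 1)" unfolding R_def using l l0 L by blast
      ultimately show ?thesis using F by simp
    qed
    then show "\<exists>U f. (U, f) \<in> Fam \<and> p \<in> U \<and> (\<forall>q\<in>U. F q = f q)" using f(1) U(2) by blast
  qed
qed

end

section \<open>Lorentzian plane bundles\<close>

lemma basis2_coeffs:
  assumes "basis2 V a b" "v \<in> V"
  shows "\<exists>x y. v = x *\<^sub>R a + y *\<^sub>R b"
proof -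
  have "v \<in> span {a, b}" using assms by (simp add: basis2_def)
  then obtain x where "v - x *\<^sub>R a \<in> span {b}" by (auto simp: span_insert)
  then obtain y where "v - x *\<^sub>R a = y *\<^sub>R b" by (auto simp: span_singleton)
  then have "v = x *\<^sub>R a + y *\<^sub>R b" by (simp add: algebra_simps)
  then show ?thesis by blast
qed

lemma basis2_unique:
  assumes "basis2 V a b" "x *\<^sub>R a + y *\<^sub>R b = x' *\<^sub>R a + y' *\<^sub>R b"
  shows "x = x' \<and> y = y'"
proof -
  have ne: "a \<noteq> b" "independent {a, b}" using assms(1) by (auto simp: basis2_def)
  have 0: "(x - x') *\<^sub>R a + (y - y') *\<^sub>R b = 0"
    using assms(2) by (simp add: algebra_simps)
  have "(\<Sum>v\<in>{a, b}. (if v = a then x - x' else y - y') *\<^sub>R v) = 0"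
    using ne(1) 0 by simp
  with ne show ?thesis
    using independentD[OF ne(2), of "{a, b}" "\<lambda>v. if v = a then x - x' else y - y'" a]
      independentD[OF ne(2), of "{a, b}" "\<lambda>v. if v = a then x - x' else y - y'" b]
    by auto
qed

locale tangent = atlas A for A :: "'m::t2_space chart set" +
  fixes T :: "('m, 'm tvec) plane_bundle"
  assumes tangent_bundle: "oriented_lorentz_tangent_bundle A T"
begin

lemma fib_T: "fib T = tangent_space A"
  using tangent_bundle by (simp add: oriented_lorentz_tangent_bundle_def)

end

locale lorentz_bundle = tangent A T for A :: "'m::t2_space chart set" and T +
  fixes V :: "('m, 'v::real_vector) plane_bundle"
  assumes V: "oriented_lorentz_bundle A T V"
begin

lemma V_vb: "vector_bundle A V" and V_lm: "lorentz_metric A V" and V_mc: "metric_connection A T V"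
    and V_so: "space_orientation A V" and V_to: "time_orientation A V"
  using V by (auto simp: oriented_lorentz_bundle_def)

lemma fib_subspace: "subspace (fib V p)"
  using V_vb by (simp add: vector_bundle_def)

lemmas fib_closed = subspace_add[OF fib_subspace] subspace_scale[OF fib_subspace]
  subspace_diff[OF fib_subspace] subspace_neg[OF fib_subspace] subspace_0[OF fib_subspace]

lemma met_sym: "u \<in> fib V p \<Longrightarrow> v \<in> fib V p \<Longrightarrow> met V p u v = met V p v u"
  using V_lm unfolding lorentz_metric_def by blast

lemma met_add:
  "u \<in> fib V p \<Longrightarrow> v \<in> fib V p \<Longrightarrow> w \<in> fib V p \<Longrightarrow> met V p (u + v) w = met V p u w + met V p v w"
  using V_lm unfolding lorentz_metric_def by blast

lemma met_scale:
  "u \<in> fib V p \<Longrightarrow> w \<in> fib V p \<Longrightarrow> met V p (r *\<^sub>R u) w = r * met V p u w"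
  using V_lm unfolding lorentz_metric_def by blast

lemma met_add_right:
  "u \<in> fib V p \<Longrightarrow> v \<in> fib V p \<Longrightarrow> w \<in> fib V p \<Longrightarrow> met V p w (u + v) = met V p w u + met V p w v"
  by (simp add: met_sym[of w] met_add fib_closed)

lemma met_scale_right:
  "u \<in> fib V p \<Longrightarrow> w \<in> fib V p \<Longrightarrow> met V p w (r *\<^sub>R u) = r * met V p w u"
  by (simp add: met_sym[of w] met_scale fib_closed)

lemma met_zero: "w \<in> fib V p \<Longrightarrow> met V p 0 w = 0" "w \<in> fib V p \<Longrightarrow> met V p w 0 = 0"
  using met_scale[of 0 p w 0] met_scale_right[of 0 p w 0] fib_closed by auto

lemmas met_simps = met_add met_scale met_add_right met_scale_right met_zero fib_closed

lemma met_smooth: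
  "open U \<Longrightarrow> smooth_section A V U s \<Longrightarrow> smooth_section A V U t \<Longrightarrow>
    smooth_fun A U (\<lambda>p. met V p (s p) (t p))"
  using V_lm unfolding lorentz_metric_def by blast

lemma on_framesD:
  assumes "(a, b) \<in> on_frames V p"
  shows "basis2 (fib V p) a b" "a \<in> fib V p" "b \<in> fib V p"
    "met V p a a = -1" "met V p b b = 1" "met V p a b = 0" "met V p b a = 0"
proof -
  have o: "(a, b) \<in> ori V p" using assms by (simp add: on_frames_def)
  with V_so show b: "basis2 (fib V p) a b" by (fastforce simp: space_orientation_def)
  then show f: "a \<in> fib V p" "b \<in> fib V p" by (auto simp: basis2_def intro: span_base)
  show "met V p a a = -1" "met V p b b = 1" "met V p a b = 0"
    using assms by (auto simp: on_frames_def)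
  then show "met V p b a = 0" using met_sym f by metis
qed

lemma frame_expansion:
  assumes ab: "(a, b) \<in> on_frames V p" and v: "v \<in> fib V p"
  shows "v = (- met V p v a) *\<^sub>R a + met V p v b *\<^sub>R b"
proof -
  note f = on_framesD[OF ab]
  obtain x y where xy: "v = x *\<^sub>R a + y *\<^sub>R b" using basis2_coeffs[OF f(1) v] by blast
  have "met V p v a = - x" "met V p v b = y"
    unfolding xy using f by (simp_all add: met_simps)
  then show ?thesis using xy by simp
qed

lemma frame_met_eqI:
  assumes "(a, b) \<in> on_frames V p" "v \<in> fib V p" "w \<in> fib V p"
    "met V p v a = met V p w a" "met V p v b = met V p w b"
  shows "v = w"
  using frame_expansion[OF assms(1,2)] frame_expansion[OF assms(1,3)] assms(4,5) by simp

subsection \<open>Smooth sections\<close>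

lemma smooth_section_fib: "smooth_section A V U s \<Longrightarrow> p \<in> U \<Longrightarrow> s p \<in> fib V p"
  by (simp add: smooth_section_def)

lemma frm_open: "(W, b1, b2) \<in> frm V \<Longrightarrow> open W"
  and frm_basis: "(W, b1, b2) \<in> frm V \<Longrightarrow> p \<in> W \<Longrightarrow> basis2 (fib V p) (b1 p) (b2 p)"
  and frm_smooth: "(W, b1, b2) \<in> frm V \<Longrightarrow> smooth_section A V W b1"
    "(W, b1, b2) \<in> frm V \<Longrightarrow> smooth_section A V W b2"
  and frm_cover: "\<exists>W b1 b2. (W, b1, b2) \<in> frm V \<and> p \<in> W"
  using V_vb unfolding vector_bundle_def by fastforce+

lemma smooth_section_coeffs:
  assumes "smooth_section A V U s" "(W, b1, b2) \<in> frm V"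
  obtains f1 f2 where "smooth_fun A (U \<inter> W) f1" "smooth_fun A (U \<inter> W) f2"
    "\<And>p. p \<in> U \<inter> W \<Longrightarrow> s p = f1 p *\<^sub>R b1 p + f2 p *\<^sub>R b2 p"
proof -
  have "case (W, b1, b2) of (W, b1, b2) \<Rightarrow> \<exists>f1 f2. smooth_fun A (U \<inter> W) f1 \<and>
      smooth_fun A (U \<inter> W) f2 \<and> (\<forall>p\<in>U \<inter> W. s p = f1 p *\<^sub>R b1 p + f2 p *\<^sub>R b2 p)"
    using assms unfolding smooth_section_def by (elim conjE) (rule bspec)
  then show ?thesis using that by auto
qed

lemma smooth_sectionI:
  assumes "\<And>p. p \<in> U \<Longrightarrow> s p \<in> fib V p"
    and "\<And>W b1 b2. (W, b1, b2) \<in> frm V \<Longrightarrow> \<exists>f1 f2. smooth_fun A (U \<inter> W) f1 \<and> smooth_fun A (U \<inter> W) f2 \<and>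
       (\<forall>p\<in>U \<inter> W. s p = f1 p *\<^sub>R b1 p + f2 p *\<^sub>R b2 p)"
  shows "smooth_section A V U s"
  unfolding smooth_section_def using assms by auto

lemma smooth_section_subset:
  assumes "smooth_section A V U s" "W \<subseteq> U"
  shows "smooth_section A V W s"
proof (rule smooth_sectionI)
  show "s p \<in> fib V p" if "p \<in> W" for p using smooth_section_fib assms that by blast
  fix Z b1 b2 assume Z: "(Z, b1, b2) \<in> frm V"
  obtain f1 f2 where f: "smooth_fun A (U \<inter> Z) f1" "smooth_fun A (U \<inter> Z) f2"
    "\<And>p. p \<in> U \<inter> Z \<Longrightarrow> s p = f1 p *\<^sub>R b1 p + f2 p *\<^sub>R b2 p"
    using smooth_section_coeffs[OF assms(1) Z] by metis
  have "smooth_fun A (W \<inter> Z) f1" "smooth_fun A (W \<inter> Z) f2"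
    by (rule smooth_fun_subset[OF f(1)], use assms(2) in blast)
      (rule smooth_fun_subset[OF f(2)], use assms(2) in blast)
  then show "\<exists>f1 f2. smooth_fun A (W \<inter> Z) f1 \<and> smooth_fun A (W \<inter> Z) f2 \<and>
       (\<forall>p\<in>W \<inter> Z. s p = f1 p *\<^sub>R b1 p + f2 p *\<^sub>R b2 p)" using f(3) assms(2) by blast
qed

lemma smooth_section_combination:
  assumes U: "open U" and s: "smooth_section A V U s" "smooth_section A V U t"
    and xy: "smooth_fun A U x" "smooth_fun A U y"
  shows "smooth_section A V U (\<lambda>p. x p *\<^sub>R s p + y p *\<^sub>R t p)"
proof (rule smooth_sectionI)
  show "x p *\<^sub>R s p + y p *\<^sub>R t p \<in> fib V p" if "p \<in> U" for p
    using smooth_section_fib[OF s(1) that] smooth_section_fib[OF s(2) that] by (simp add: fib_closed)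
next
  fix W b1 b2 assume W: "(W, b1, b2) \<in> frm V"
  obtain f1 f2 where f: "smooth_fun A (U \<inter> W) f1" "smooth_fun A (U \<inter> W) f2"
    "\<And>p. p \<in> U \<inter> W \<Longrightarrow> s p = f1 p *\<^sub>R b1 p + f2 p *\<^sub>R b2 p"
    using smooth_section_coeffs[OF s(1) W] by metis
  obtain g1 g2 where g: "smooth_fun A (U \<inter> W) g1" "smooth_fun A (U \<inter> W) g2"
    "\<And>p. p \<in> U \<inter> W \<Longrightarrow> t p = g1 p *\<^sub>R b1 p + g2 p *\<^sub>R b2 p"
    using smooth_section_coeffs[OF s(2) W] by metis
  have o: "open (U \<inter> W)" using U frm_open[OF W] by auto
  have xy': "smooth_fun A (U \<inter> W) x" "smooth_fun A (U \<inter> W) y"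
    using xy smooth_fun_subset by (metis Int_lower1)+
  show "\<exists>f1 f2. smooth_fun A (U \<inter> W) f1 \<and> smooth_fun A (U \<inter> W) f2 \<and>
       (\<forall>p\<in>U \<inter> W. x p *\<^sub>R s p + y p *\<^sub>R t p = f1 p *\<^sub>R b1 p + f2 p *\<^sub>R b2 p)"
    by (intro exI[of _ "\<lambda>p. x p * f1 p + y p * g1 p"] exI[of _ "\<lambda>p. x p * f2 p + y p * g2 p"]
        conjI ballI smooth_fun_add smooth_fun_mult o xy' f(1,2) g(1,2))
      (simp add: f(3) g(3) algebra_simps)
qed

lemma smooth_section_scale:
  "open U \<Longrightarrow> smooth_section A V U s \<Longrightarrow> smooth_fun A U x \<Longrightarrow> smooth_section A V U (\<lambda>p. x p *\<^sub>R s p)"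
  using smooth_section_combination[of U s s x "\<lambda>p. 0"] by (simp add: smooth_fun_const)

text \<open>The coefficients with respect to a frame of the bundle atlas are unique, so those of the local
  expressions fit together.\<close>

lemma smooth_section_local:
  assumes "\<And>p. p \<in> U \<Longrightarrow> \<exists>W. open W \<and> p \<in> W \<and> smooth_section A V W s"
  shows "smooth_section A V U s"
proof (rule smooth_sectionI)
  show "s p \<in> fib V p" if "p \<in> U" for p using assms[OF that] smooth_section_fib by blast
next
  fix W b1 b2 assume W: "(W, b1, b2) \<in> frm V"
  define c where "c p = (SOME xy. s p = fst xy *\<^sub>R b1 p + snd xy *\<^sub>R b2 p)" for p
  have c: "c p = (x, y)" if "p \<in> W" "s p = x *\<^sub>R b1 p + y *\<^sub>R b2 p" for p x y
  proof -
    have "s p = fst (c p) *\<^sub>R b1 p + snd (c p) *\<^sub>R b2 p"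
      unfolding c_def by (rule someI[of _ "(x, y)"]) (simp add: that)
    from basis2_unique[OF frm_basis[OF W that(1)] trans[OF this[symmetric] that(2)]]
    show ?thesis by (simp add: prod_eq_iff)
  qed
  have loc: "\<exists>Y. open Y \<and> p \<in> Y \<and> smooth_fun A Y (\<lambda>p. fst (c p)) \<and> smooth_fun A Y (\<lambda>p. snd (c p)) \<and>
      (\<forall>q\<in>Y. s q = fst (c q) *\<^sub>R b1 q + snd (c q) *\<^sub>R b2 q)"
    if p: "p \<in> U \<inter> W" for p
  proof -
    obtain Z where Z: "open Z" "p \<in> Z" "smooth_section A V Z s" using assms p by blast
    obtain f1 f2 where f: "smooth_fun A (Z \<inter> W) f1" "smooth_fun A (Z \<inter> W) f2"
      "\<And>p. p \<in> Z \<inter> W \<Longrightarrow> s p = f1 p *\<^sub>R b1 p + f2 p *\<^sub>R b2 p"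
      using smooth_section_coeffs[OF Z(3) W] by metis
    have o: "open (Z \<inter> W)" using Z frm_open[OF W] by auto
    have cq: "c q = (f1 q, f2 q)" if "q \<in> Z \<inter> W" for q using c f(3) that by blast
    have "smooth_fun A (Z \<inter> W) (\<lambda>p. fst (c p))" "smooth_fun A (Z \<inter> W) (\<lambda>p. snd (c p))"
      using smooth_fun_cong[OF o _ f(1), of "\<lambda>p. fst (c p)"]
        smooth_fun_cong[OF o _ f(2), of "\<lambda>p. snd (c p)"] cq by auto
    then show ?thesis
      using o Z(2) p cq f(3) by (intro exI[of _ "Z \<inter> W"]) auto
  qed
  have "smooth_fun A (U \<inter> W) (\<lambda>p. fst (c p))" "smooth_fun A (U \<inter> W) (\<lambda>p. snd (c p))"
    by (rule smooth_fun_local, use loc in blast)+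
  then show "\<exists>f1 f2. smooth_fun A (U \<inter> W) f1 \<and> smooth_fun A (U \<inter> W) f2 \<and>
       (\<forall>p\<in>U \<inter> W. s p = f1 p *\<^sub>R b1 p + f2 p *\<^sub>R b2 p)"
    using loc by blast
qed

lemma smooth_section_cong:
  assumes "\<And>p. p \<in> U \<Longrightarrow> s p = t p" "smooth_section A V U s"
  shows "smooth_section A V U t"
proof (rule smooth_sectionI)
  show "t p \<in> fib V p" if "p \<in> U" for p using smooth_section_fib[OF assms(2) that] assms(1) that by simp
  fix W b1 b2 assume W: "(W, b1, b2) \<in> frm V"
  obtain f1 f2 where f: "smooth_fun A (U \<inter> W) f1" "smooth_fun A (U \<inter> W) f2"
    "\<And>p. p \<in> U \<inter> W \<Longrightarrow> s p = f1 p *\<^sub>R b1 p + f2 p *\<^sub>R b2 p"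
    using smooth_section_coeffs[OF assms(2) W] by metis
  then show "\<exists>f1 f2. smooth_fun A (U \<inter> W) f1 \<and> smooth_fun A (U \<inter> W) f2 \<and>
       (\<forall>p\<in>U \<inter> W. t p = f1 p *\<^sub>R b1 p + f2 p *\<^sub>R b2 p)" using assms(1) by auto
qed

subsection \<open>The metric connection\<close>

lemma V_conn: "connection A T V"
  using V_mc by (simp add: metric_connection_def)

lemma
  assumes U: "open U" "smooth_section A V U s"
  shows nab_fib: "p \<in> U \<Longrightarrow> X \<in> fib T p \<Longrightarrow> nab V p X s \<in> fib V p"
    and nab_dir_add: "p \<in> U \<Longrightarrow> X \<in> fib T p \<Longrightarrow> Y \<in> fib T p \<Longrightarrow>
      nab V p (X + Y) s = nab V p X s + nab V p Y s"
    and nab_dir_scale: "p \<in> U \<Longrightarrow> X \<in> fib T p \<Longrightarrow> nab V p (r *\<^sub>R X) s = r *\<^sub>R nab V p X s"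
    and nab_add: "smooth_section A V U t \<Longrightarrow> p \<in> U \<Longrightarrow> X \<in> fib T p \<Longrightarrow>
      nab V p X (\<lambda>q. s q + t q) = nab V p X s + nab V p X t"
    and nab_scale: "smooth_fun A U f \<Longrightarrow> p \<in> U \<Longrightarrow> X \<in> fib T p \<Longrightarrow>
      nab V p X (\<lambda>q. f q *\<^sub>R s q) = mdiff A f p X *\<^sub>R s p + f p *\<^sub>R nab V p X s"
    and nab_cong: "(\<And>q. q \<in> U \<Longrightarrow> t q = s q) \<Longrightarrow> p \<in> U \<Longrightarrow> X \<in> fib T p \<Longrightarrow> nab V p X t = nab V p X s"
    and nab_smooth: "smooth_section A T U Z \<Longrightarrow> smooth_section A V U (\<lambda>p. nab V p (Z p) s)"
proof -
  note c = V_conn[unfolded connection_def, THEN spec, THEN spec, THEN mp, OF conjI[OF U]]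
  note c1 = c[THEN conjunct1] and d1 = c[THEN conjunct2]
  note c2 = d1[THEN conjunct1] and d2 = d1[THEN conjunct2]
  note c3 = d2[THEN conjunct1] and d3 = d2[THEN conjunct2]
  note c4 = d3[THEN conjunct1] and d4 = d3[THEN conjunct2]
  note c5 = d4[THEN conjunct1] and c6 = d4[THEN conjunct2]
  show "p \<in> U \<Longrightarrow> X \<in> fib T p \<Longrightarrow> nab V p X s \<in> fib V p"
    using c1 by blast
  show "p \<in> U \<Longrightarrow> X \<in> fib T p \<Longrightarrow> Y \<in> fib T p \<Longrightarrow>
      nab V p (X + Y) s = nab V p X s + nab V p Y s"
    using c2 by blast
  show "p \<in> U \<Longrightarrow> X \<in> fib T p \<Longrightarrow> nab V p (r *\<^sub>R X) s = r *\<^sub>R nab V p X s"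
    using c2 by blast
  show "smooth_section A V U t \<Longrightarrow> p \<in> U \<Longrightarrow> X \<in> fib T p \<Longrightarrow>
      nab V p X (\<lambda>q. s q + t q) = nab V p X s + nab V p X t"
    using c3 by blast
  show "smooth_fun A U f \<Longrightarrow> p \<in> U \<Longrightarrow> X \<in> fib T p \<Longrightarrow>
      nab V p X (\<lambda>q. f q *\<^sub>R s q) = mdiff A f p X *\<^sub>R s p + f p *\<^sub>R nab V p X s"
    using c4 by blast
  show "(\<And>q. q \<in> U \<Longrightarrow> t q = s q) \<Longrightarrow> p \<in> U \<Longrightarrow> X \<in> fib T p \<Longrightarrow> nab V p X t = nab V p X s"
    using c5 by blast
  show "smooth_section A T U Z \<Longrightarrow> smooth_section A V U (\<lambda>p. nab V p (Z p) s)"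
    using c6 by blast
qed

lemma nab_metric:
  assumes "open U" "smooth_section A V U s" "smooth_section A V U t" "p \<in> U" "X \<in> fib T p"
  shows "mdiff A (\<lambda>q. met V q (s q) (t q)) p X = met V p (nab V p X s) (t p) + met V p (s p) (nab V p X t)"
  using V_mc assms unfolding metric_connection_def by blast

text \<open>Differentiating the constant products of the frame vectors shows that the connection matrix lies in
  the Lie algebra of \<open>SO(1,1)\<close>, so a single coefficient describes it.\<close>

lemma nab_frame:
  assumes U: "open U" and e: "smooth_section A V U e0" "smooth_section A V U e1"
    and on: "\<And>q. q \<in> U \<Longrightarrow> (e0 q, e1 q) \<in> on_frames V q" and p: "p \<in> U" "X \<in> fib T p"
  shows "nab V p X e0 = met V p (nab V p X e0) (e1 p) *\<^sub>R e1 p"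
    and "nab V p X e1 = met V p (nab V p X e0) (e1 p) *\<^sub>R e0 p"
proof -
  note f = on_framesD[OF on[OF p(1)]]
  have n: "nab V p X e0 \<in> fib V p" "nab V p X e1 \<in> fib V p"
    using nab_fib[OF U] e p by auto
  have c: "mdiff A (\<lambda>q. met V q (s q) (t q)) p X = 0" if "\<And>q. q \<in> U \<Longrightarrow> met V q (s q) (t q) = k" for s t k
    using mdiff_cong[OF U p(1), of "\<lambda>q. met V q (s q) (t q)" "\<lambda>q. k" X] that by simp
  have "met V p (nab V p X e0) (e0 p) = 0"
    using nab_metric[OF U e(1) e(1) p] c[of e0 e0 "-1"] on_framesD(4)[OF on] met_sym[OF n(1) f(2)] by simp
  moreover have "met V p (nab V p X e1) (e1 p) = 0"
    using nab_metric[OF U e(2) e(2) p] c[of e1 e1 1] on_framesD(5)[OF on] met_sym[OF n(2) f(3)] by simp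
  moreover have "met V p (nab V p X e1) (e0 p) = - met V p (nab V p X e0) (e1 p)"
    using nab_metric[OF U e p] c[of e0 e1 0] on_framesD(6)[OF on] met_sym[OF n(2) f(2)] by simp
  ultimately show "nab V p X e0 = met V p (nab V p X e0) (e1 p) *\<^sub>R e1 p"
    "nab V p X e1 = met V p (nab V p X e0) (e1 p) *\<^sub>R e0 p"
    using frame_expansion[OF on[OF p(1)] n(1)] frame_expansion[OF on[OF p(1)] n(2)] by simp_all
qed

end

section \<open>Coordinate fields and primitives of closed one-forms\<close>

context tangent
begin

sublocale TT: lorentz_bundle A T T
  using tangent_bundle by unfold_locales (simp add: oriented_lorentz_tangent_bundle_def)

lemma coord_frame: "c \<in> A \<Longrightarrow> (fst c, coord_field A c 1, coord_field A c 2) \<in> frm T"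
  using tangent_bundle unfolding oriented_lorentz_tangent_bundle_def by blast

lemma coord_smooth: "c \<in> A \<Longrightarrow> smooth_section A T (fst c) (coord_field A c j)"
  using TT.frm_smooth[OF coord_frame, of c] exhaust_2[of j] by auto

lemma coord_fib: "c \<in> A \<Longrightarrow> p \<in> fst c \<Longrightarrow> coord_field A c j p \<in> fib T p"
  using TT.smooth_section_fib[OF coord_smooth] by blast

lemma coord_component: "c \<in> A \<Longrightarrow> p \<in> fst c \<Longrightarrow> coord_field A c j p c = axis j 1"
proof -
  assume c: "c \<in> A" "p \<in> fst c"
  have "transition_deriv c c p = frechet_derivative (\<lambda>x. x) (at (snd c p))"
    unfolding transition_deriv_def
    by (rule frechet_derivative_cong_open[OF chart_image_open[OF c(1) open_UNIV]]) (use c in auto)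
  then show ?thesis using c by (simp add: coord_field_def charts_at_def)
qed

text \<open>The vector field with constant coordinates \<open>v\<close> in the chart \<open>c\<close>. Identities that are tensorial need
  to be checked for such fields only, and these commute.\<close>

definition chart_vec :: "'m chart \<Rightarrow> real^2 \<Rightarrow> 'm \<Rightarrow> 'm tvec"
  where "chart_vec c v p = v $ 1 *\<^sub>R coord_field A c 1 p + v $ 2 *\<^sub>R coord_field A c 2 p"

lemma chart_vec_fib: "c \<in> A \<Longrightarrow> p \<in> fst c \<Longrightarrow> chart_vec c v p \<in> fib T p"
  unfolding chart_vec_def by (intro TT.fib_closed(1,2) coord_fib)

lemma chart_vec_component: "c \<in> A \<Longrightarrow> p \<in> fst c \<Longrightarrow> chart_vec c v p c = v"
  by (simp add: chart_vec_def scaleR_fun_def coord_component vec_eq_iff forall_2 axis_def)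

lemma chart_vec_smooth: "c \<in> A \<Longrightarrow> smooth_section A T (fst c) (chart_vec c v)"
  unfolding chart_vec_def[abs_def]
  by (intro TT.smooth_section_combination chart_open coord_smooth smooth_fun_const)

lemma tangent_expansion:
  assumes c: "c \<in> A" "p \<in> fst c" and X: "X \<in> fib T p"
  shows "X = chart_vec c (X c) p"
proof -
  obtain x y where xy: "X = x *\<^sub>R coord_field A c 1 p + y *\<^sub>R coord_field A c 2 p"
    using basis2_coeffs[OF TT.frm_basis[OF coord_frame[OF c(1)] c(2)] X] by blast
  have "X c $ 1 = x \<and> X c $ 2 = y"
    unfolding xy by (simp add: scaleR_fun_def coord_component c axis_def)
  then show ?thesis using xy by (simp add: chart_vec_def)
qed

lemma mdiff_chart_vec:
  assumes "smooth_fun A U f" "open U" "p \<in> U" "c \<in> A" "p \<in> fst c"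
  shows "mdiff A f p (chart_vec c v p) = frechet_derivative (\<lambda>x. f (chart_inv c x)) (at (snd c p)) v"
  using mdiff_chart[OF assms(1-3), of "chart_vec c v p" c] chart_vec_fib[OF assms(4,5)]
    chart_vec_component[OF assms(4,5)] assms(4,5) by (simp add: fib_T charts_at_def)

lemma mdiff_along_smooth:
  assumes f: "smooth_fun A U f" and U: "open U" and Y: "smooth_section A T U Y"
  shows "smooth_fun A U (\<lambda>q. mdiff A f q (Y q))"
proof (rule smooth_fun_local)
  fix p assume p: "p \<in> U"
  obtain c where c: "c \<in> A" "p \<in> fst c" using chart_at charts_atD by metis
  obtain f1 f2 where f12: "smooth_fun A (U \<inter> fst c) f1" "smooth_fun A (U \<inter> fst c) f2"
    "\<And>p. p \<in> U \<inter> fst c \<Longrightarrow> Y p = f1 p *\<^sub>R coord_field A c 1 p + f2 p *\<^sub>R coord_field A c 2 p"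
    using TT.smooth_section_coeffs[OF Y coord_frame[OF c(1)]] by metis
  have o: "open (U \<inter> fst c)" using U chart_open[OF c(1)] by auto
  let ?D = "\<lambda>j q. frechet_derivative (\<lambda>x. f (chart_inv c x)) (at (snd c q)) (axis j 1)"
  have D: "smooth_fun A (U \<inter> fst c) (?D j)" for j by (rule smooth_chart_derivative[OF f U c(1)])
  have coord: "coord_field A c j q = chart_vec c (axis j 1) q" if "q \<in> fst c" for j q
    using tangent_expansion[OF c(1) that coord_fib[OF c(1) that]] coord_component[OF c(1) that] by simp
  have eq: "mdiff A f q (Y q) = f1 q *\<^sub>R ?D 1 q + f2 q *\<^sub>R ?D 2 q" if q: "q \<in> U \<inter> fst c" for q
    using q mdiff_chart_vec[OF f U, of q c] c
    by (simp add: f12(3) mdiff_direction[OF f] coord)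
  have sm: "smooth_fun A (U \<inter> fst c) (\<lambda>q. f1 q *\<^sub>R ?D 1 q + f2 q *\<^sub>R ?D 2 q)"
    by (intro smooth_fun_add smooth_fun_scaleR o f12(1,2) D)
  have "smooth_fun A (U \<inter> fst c) (\<lambda>q. mdiff A f q (Y q))"
    by (rule smooth_fun_cong[OF o eq[symmetric] sm])
  then show "\<exists>W. open W \<and> p \<in> W \<and> smooth_fun A W (\<lambda>q. mdiff A f q (Y q))"
    using o p c by blast
qed

lemma mdiff_mixed:
  fixes f :: "'m \<Rightarrow> 'b::euclidean_space"
  assumes f: "smooth_fun A U f" "open U" "p \<in> U" and c: "c \<in> A" "p \<in> fst c"
  shows "mdiff A (\<lambda>q. mdiff A f q (chart_vec c v q)) p (chart_vec c w p) =
    mdiff A (\<lambda>q. mdiff A f q (chart_vec c w q)) p (chart_vec c v p)"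
proof -
  let ?S = "snd c ` (U \<inter> fst c)"
  let ?f = "\<lambda>x. f (chart_inv c x)"
  have o: "open (U \<inter> fst c)" and oS: "open ?S"
    using f chart_open[OF c(1)] chart_image_open[OF c(1)] by auto
  have pS: "snd c p \<in> ?S" using f c by auto
  have *: "mdiff A (\<lambda>q. mdiff A f q (chart_vec c v q)) p (chart_vec c w p) =
      frechet_derivative (\<lambda>y. frechet_derivative ?f (at y) v) (at (snd c p)) w" for v w
  proof -
    have sm: "smooth_fun A (U \<inter> fst c) (\<lambda>q. mdiff A f q (chart_vec c v q))"
      by (rule mdiff_along_smooth[OF smooth_fun_subset[OF f(1)] o])
        (auto intro: TT.smooth_section_subset[OF chart_vec_smooth[OF c(1)]])
    have "mdiff A (\<lambda>q. mdiff A f q (chart_vec c v q)) p (chart_vec c w p) =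
      frechet_derivative (\<lambda>x. mdiff A f (chart_inv c x) (chart_vec c v (chart_inv c x))) (at (snd c p)) w"
      using mdiff_chart_vec[OF sm o _ c] f c by simp
    also have "\<dots> = frechet_derivative (\<lambda>y. frechet_derivative ?f (at y) v) (at (snd c p)) w"
    proof (rule fun_cong[where x = w], rule frechet_derivative_cong_open[OF oS pS])
      fix x assume "x \<in> ?S"
      then obtain q where "q \<in> U" "q \<in> fst c" "x = snd c q" by auto
      then show "mdiff A f (chart_inv c x) (chart_vec c v (chart_inv c x)) = frechet_derivative ?f (at x) v"
        using mdiff_chart_vec[OF f(1,2) _ c(1)] c(1) by simp
    qed
    finally show ?thesis .
  qed
  show ?thesis
    unfolding * by (rule mixed_partials_commute[OF smooth_funD[OF f(1) c(1)] oS pS])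
qed

text \<open>A tangent vector vanishes if its coordinates in one chart do, and in \<open>c\<close> the two fields are
  constant. The second claim is then the vanishing of the torsion.\<close>

lemma lie_bracket_chart_vec:
  assumes c: "c \<in> A" "p \<in> fst c"
  shows "lie_bracket A (chart_vec c v) (chart_vec c w) p = 0"
    and "nab T p (chart_vec c v p) (chart_vec c w) = nab T p (chart_vec c w p) (chart_vec c v)"
proof -
  let ?b = "lie_bracket A (chart_vec c v) (chart_vec c w) p"
  note o = chart_open[OF c(1)] and s = chart_vec_smooth[OF c(1)] and f = chart_vec_fib[OF c]
  have eq: "nab T p (chart_vec c v p) (chart_vec c w) - nab T p (chart_vec c w p) (chart_vec c v) = ?b"
    using tangent_bundle o s c(2)
    unfolding oriented_lorentz_tangent_bundle_def torsion_free_def by blast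
  have fib: "?b \<in> fib T p"
    unfolding eq[symmetric] by (intro TT.fib_closed(3) TT.nab_fib[OF o s c(2)] f)
  have z: "frechet_derivative ((\<lambda>q. chart_vec c u q c) \<circ> chart_inv c) (at (snd c p)) = (\<lambda>x. 0)" for u
  proof -
    have "frechet_derivative ((\<lambda>q. chart_vec c u q c) \<circ> chart_inv c) (at (snd c p)) =
        frechet_derivative (\<lambda>x. u) (at (snd c p))"
      by (rule frechet_derivative_cong_open[OF chart_image_open[OF c(1) open_UNIV]])
        (use c chart_vec_component[OF c(1)] in auto)
    then show ?thesis by simp
  qed
  have "?b c = 0" by (simp add: lie_bracket_def z)
  then show "?b = 0"
    using tangent_expansion[OF c fib] by (simp add: chart_vec_def)
  with eq show "nab T p (chart_vec c v p) (chart_vec c w) = nab T p (chart_vec c w p) (chart_vec c v)"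
    by simp
qed

lemma chart_ball:
  assumes U: "open U" "p \<in> U" and c: "c \<in> A" "p \<in> fst c"
  obtains r where "r > 0" "ball (snd c p) r \<subseteq> snd c ` (U \<inter> fst c)"
    "open (chart_inv c ` ball (snd c p) r)" "p \<in> chart_inv c ` ball (snd c p) r"
    "chart_inv c ` ball (snd c p) r \<subseteq> U \<inter> fst c" "path_connected (chart_inv c ` ball (snd c p) r)"
    "snd c ` (chart_inv c ` ball (snd c p) r) = ball (snd c p) r"
proof -
  have "snd c p \<in> snd c ` (U \<inter> fst c)" using U c by auto
  then obtain r where r: "r > 0" "ball (snd c p) r \<subseteq> snd c ` (U \<inter> fst c)"
    using chart_image_open[OF c(1) U(1)] by (meson openE)
  let ?N = "chart_inv c ` ball (snd c p) r"
  have sub: "?N \<subseteq> U \<inter> fst c" using r(2) c(1) by force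
  note h = homeomorphism_symD[OF chart_homeo[OF c(1)]]
  have "openin (top_of_set (snd c ` fst c)) (ball (snd c p) r)"
    by (rule open_subset) (use r(2) in blast, simp)
  then have "openin (top_of_set (fst c)) ?N"
    using homeomorphism_imp_open_map[OF h] by blast
  then have o: "open ?N" using chart_open[OF c(1)] by (simp add: openin_open_eq)
  have "continuous_on (ball (snd c p) r) (chart_inv c)"
    by (rule continuous_on_subset[OF homeomorphism_cont1[OF h]]) (use r(2) in blast)
  then have "path_connected ?N"
    by (rule path_connected_continuous_image) (simp add: convex_imp_path_connected)
  moreover have "snd c (chart_inv c x) = x" if "x \<in> ball (snd c p) r" for x
    using homeomorphism_apply2[OF chart_homeo[OF c(1)]] r(2) that by blast
  then have "snd c ` ?N = ball (snd c p) r" by (simp add: image_image)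
  moreover have "p \<in> ?N" using r(1) c by (intro image_eqI[of _ _ "snd c p"]) auto
  ultimately show ?thesis using that[of r] r o sub by blast
qed

lemma locally_constant:
  assumes f: "smooth_fun A U f" "open U" and z: "\<And>q X. q \<in> U \<Longrightarrow> X \<in> fib T q \<Longrightarrow> mdiff A f q X = 0"
    and p: "p \<in> U"
  shows "\<exists>W. open W \<and> p \<in> W \<and> W \<subseteq> U \<and> (\<forall>q\<in>W. f q = f p)"
proof -
  obtain c where c: "c \<in> A" "p \<in> fst c" using chart_at charts_atD by metis
  obtain r where r: "r > 0" "ball (snd c p) r \<subseteq> snd c ` (U \<inter> fst c)"
    "open (chart_inv c ` ball (snd c p) r)" "p \<in> chart_inv c ` ball (snd c p) r"
    "chart_inv c ` ball (snd c p) r \<subseteq> U \<inter> fst c"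
    using chart_ball[OF f(2) p c] by metis
  let ?f = "\<lambda>x. f (chart_inv c x)"
  have D: "(?f has_derivative (\<lambda>v. 0)) (at x)" if "x \<in> ball (snd c p) r" for x
  proof -
    have "x \<in> snd c ` (U \<inter> fst c)" using that r(2) by blast
    then obtain q where q: "q \<in> U" "q \<in> fst c" "x = snd c q" by blast
    have "frechet_derivative ?f (at x) = (\<lambda>v. 0)"
    proof
      fix v show "frechet_derivative ?f (at x) v = 0"
      using mdiff_chart_vec[OF f q(1) c(1) q(2), of v] z[OF q(1) chart_vec_fib[OF c(1) q(2)]] q(3) by simp
    qed
    then show ?thesis
      using smooth_on_has_derivative[OF smooth_funD[OF f(1) c(1)] subsetD[OF r(2) that]] by simp
  qed
  have "?f x = ?f (snd c p)" if "x \<in> ball (snd c p) r" for x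
    using has_derivative_zero_unique_connected[of "ball (snd c p) r" ?f x "snd c p"]
      D that r(1) by (auto simp: has_derivative_at_withinI)
  then have "\<forall>q\<in>chart_inv c ` ball (snd c p) r. f q = f p" using c by auto
  then show ?thesis using r(3-5) by blast
qed

text \<open>On coordinate balls the Poincare lemma yields primitives. They are unique up to constants, hence the
  local primitives form a family of local sections with arbitrary values, and a global member exists.\<close>

theorem closed_form_primitive:
  fixes \<omega> :: "'m \<Rightarrow> 'm tvec \<Rightarrow> 'b::euclidean_space"
  assumes sc: "simply_connected (UNIV :: 'm set)"
    and add: "\<And>p X Y. X \<in> fib T p \<Longrightarrow> Y \<in> fib T p \<Longrightarrow> \<omega> p (X + Y) = \<omega> p X + \<omega> p Y"
    and scale: "\<And>p X r. X \<in> fib T p \<Longrightarrow> \<omega> p (r *\<^sub>R X) = r *\<^sub>R \<omega> p X"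
    and smooth: "\<And>U X. open U \<Longrightarrow> smooth_section A T U X \<Longrightarrow> smooth_fun A U (\<lambda>p. \<omega> p (X p))"
    and closed: "\<And>c p v w. c \<in> A \<Longrightarrow> p \<in> fst c \<Longrightarrow>
      mdiff A (\<lambda>q. \<omega> q (chart_vec c v q)) p (chart_vec c w p) =
      mdiff A (\<lambda>q. \<omega> q (chart_vec c w q)) p (chart_vec c v p)"
  shows "\<exists>F. smooth_fun A UNIV F \<and> (\<forall>p. \<forall>X\<in>fib T p. mdiff A F p X = \<omega> p X)"
proof -
  define Fam where "Fam = {(U, f). open U \<and> smooth_fun A U f \<and>
    (\<forall>p\<in>U. \<forall>X\<in>fib T p. mdiff A f p X = \<omega> p X)}"
  have ext: "\<exists>U. open U \<and> p \<in> U \<and> path_connected U \<and>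
      (\<forall>p'\<in>U. \<forall>v\<in>UNIV. \<exists>f. (U, f) \<in> Fam \<and> f p' = v)" for p
  proof -
    obtain c where c: "c \<in> A" "p \<in> fst c" using chart_at charts_atD by metis
    let ?B = "ball (snd c p)"
    obtain r where r: "r > 0" "?B r \<subseteq> snd c ` (UNIV \<inter> fst c)"
      "open (chart_inv c ` ?B r)" "p \<in> chart_inv c ` ?B r"
      "chart_inv c ` ?B r \<subseteq> UNIV \<inter> fst c" "path_connected (chart_inv c ` ?B r)"
      "snd c ` (chart_inv c ` ?B r) = ?B r"
      using chart_ball[OF open_UNIV UNIV_I c] by metis
    let ?N = "chart_inv c ` ?B r"
    let ?w = "\<lambda>x v. \<omega> (chart_inv c x) (chart_vec c v (chart_inv c x))"
    have inB: "\<exists>q\<in>fst c. x = snd c q" if "x \<in> ?B r" for x using r(2) that by auto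
    note o = chart_open[OF c(1)]
    have sm: "smooth_fun A (fst c) (\<lambda>q. \<omega> q (chart_vec c v q))" for v
      by (rule smooth[OF o chart_vec_smooth[OF c(1)]])
    have lin: "linear (?w x)" if "x \<in> ?B r" for x
    proof -
      obtain q where q: "q \<in> fst c" "x = snd c q" using inB \<open>x \<in> ?B r\<close> by blast
      show ?thesis
      proof (rule linearI)
        fix v v' :: "real^2" and t :: real
        have "chart_vec c (v + v') q = chart_vec c v q + chart_vec c v' q"
          by (simp add: chart_vec_def algebra_simps)
        then show "?w x (v + v') = ?w x v + ?w x v'"
          using q c(1) add[OF chart_vec_fib[OF c(1) q(1)] chart_vec_fib[OF c(1) q(1)]] by simp
        have "chart_vec c (t *\<^sub>R v) q = t *\<^sub>R chart_vec c v q"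
          by (simp add: chart_vec_def algebra_simps)
        then show "?w x (t *\<^sub>R v) = t *\<^sub>R ?w x v"
          using q c(1) scale[OF chart_vec_fib[OF c(1) q(1)]] by simp
      qed
    qed
    have "\<exists>f. smooth_on f (?B r) \<and> (\<forall>x\<in>?B r. (f has_derivative ?w x) (at x))"
    proof (rule Poincare_lemma_ball[OF lin])
      show "smooth_on (\<lambda>x. ?w x v) (?B r)" for v
        by (rule smooth_onI, rule Ck_on_subset[OF smooth_onD[OF smooth_funD[OF sm c(1)]]])
          (use r(2) in auto)
      fix x v w assume "x \<in> ?B r"
      then obtain q where q: "q \<in> fst c" "x = snd c q" using inB by blast
      show "frechet_derivative (\<lambda>y. ?w y v) (at x) w = frechet_derivative (\<lambda>y. ?w y w) (at x) v"
        using closed[OF c(1) q(1), of v w] mdiff_chart_vec[OF sm o q(1) c(1) q(1)] q(2) by simp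
    qed
    then obtain g where g: "smooth_on g (?B r)" "\<And>x. x \<in> ?B r \<Longrightarrow> (g has_derivative ?w x) (at x)"
      by blast
    let ?f = "\<lambda>q. g (snd c q)"
    have Nc: "?N \<inter> fst c = ?N" using r(5) by blast
    have scinv: "snd c (chart_inv c x) = x" if "x \<in> ?B r" for x
      using inB[OF that] c(1) by auto
    have fsm: "smooth_fun A ?N ?f"
    proof -
      have "smooth_fun A (?N \<inter> fst c) ?f"
      proof (rule smooth_fun_chart[OF c(1) r(3)], rule smooth_onI)
        fix n
        show "Ck_on n (\<lambda>x. ?f (chart_inv c x)) (snd c ` (?N \<inter> fst c))"
          unfolding Nc r(7)
          by (rule Ck_on_cong[OF open_ball _ smooth_onD[OF g(1)]]) (simp add: scinv)
      qed
      then show ?thesis by (simp only: Nc)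
    qed
    have fd: "mdiff A ?f q X = \<omega> q X" if q: "q \<in> ?N" and X: "X \<in> fib T q" for q X
    proof -
      have qc: "q \<in> fst c" "snd c q \<in> ?B r" using q r(5) scinv by auto
      have "mdiff A ?f q X = frechet_derivative (\<lambda>x. ?f (chart_inv c x)) (at (snd c q)) (X c)"
        using mdiff_chart[OF fsm r(3) q] X c(1) qc(1) by (simp add: fib_T charts_at_def)
      also have "frechet_derivative (\<lambda>x. ?f (chart_inv c x)) (at (snd c q)) = frechet_derivative g (at (snd c q))"
        by (rule frechet_derivative_cong_open[OF open_ball qc(2)]) (simp add: scinv)
      also have "\<dots> = ?w (snd c q)" using frechet_derivative_at[OF g(2)[OF qc(2)]] by simp
      also have "?w (snd c q) (X c) = \<omega> q X"
        using tangent_expansion[OF c(1) qc(1) X] c(1) qc(1) by simp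
      finally show ?thesis .
    qed
    have "(?N, \<lambda>q. ?f q + k) \<in> Fam" for k
      unfolding Fam_def using r(3) fsm fd
      by (auto intro!: smooth_fun_add smooth_fun_const simp: mdiff_add[OF fsm smooth_fun_const])
    then have "\<forall>p'\<in>?N. \<forall>v\<in>UNIV. \<exists>f. (?N, f) \<in> Fam \<and> f p' = v"
    proof (intro ballI)
      fix p' :: 'm and v :: 'b
      show "\<exists>f. (?N, f) \<in> Fam \<and> f p' = v"
        using \<open>\<And>k. (?N, \<lambda>q. ?f q + k) \<in> Fam\<close>[of "v - ?f p'"]
        by (intro exI[of _ "\<lambda>q. ?f q + (v - ?f p')"]) simp
    qed
    then show ?thesis using r(3,4,6) by blast
  qed
  have agree: "\<exists>W. open W \<and> p \<in> W \<and> W \<subseteq> U \<inter> V \<and> (\<forall>q\<in>W. (f q = g q) = (f p = g p))"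
    if "(U, f) \<in> Fam" "(V, g) \<in> Fam" "p \<in> U" "p \<in> V" for U V f g p
  proof -
    have sm: "smooth_fun A (U \<inter> V) f" "smooth_fun A (U \<inter> V) g" "open (U \<inter> V)"
      using that smooth_fun_subset[of U f "U \<inter> V"] smooth_fun_subset[of V g "U \<inter> V"]
      by (auto simp: Fam_def)
    have "mdiff A (\<lambda>q. f q - g q) q X = 0" if "q \<in> U \<inter> V" "X \<in> fib T q" for q X
      using mdiff_diff[OF sm(1,2) that(1)] that \<open>(U, f) \<in> Fam\<close> \<open>(V, g) \<in> Fam\<close> by (auto simp: Fam_def)
    from locally_constant[OF smooth_fun_diff[OF sm(3,1,2)] sm(3) this] that(3,4)
    obtain W where W: "open W" "p \<in> W" "W \<subseteq> U \<inter> V" "\<forall>q\<in>W. f q - g q = f p - g p" by blast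
    have "(f q = g q) = (f p = g p)" if "q \<in> W" for q
      using bspec[OF W(4) that] by (metis eq_iff_diff_eq_0)
    then show ?thesis using W(1-3) by blast
  qed
  interpret local_sections Fam "\<lambda>p. UNIV"
  proof
    show "(U, f) \<in> Fam \<Longrightarrow> open U" for U f by (simp add: Fam_def)
  qed (use ext agree in auto)
  obtain F where F: "\<And>p. \<exists>U f. (U, f) \<in> Fam \<and> p \<in> U \<and> (\<forall>q\<in>U. F q = f q)"
    by (rule global_section[OF sc UNIV_I]) (rule that, assumption)
  have F': "\<exists>U. open U \<and> p \<in> U \<and> smooth_fun A U F \<and> (\<forall>X\<in>fib T p. mdiff A F p X = \<omega> p X)" for p
  proof -
    obtain U f where U: "(U, f) \<in> Fam" "p \<in> U" "\<forall>q\<in>U. F q = f q" using F by blast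
    then have f: "open U" "smooth_fun A U f" "\<forall>X\<in>fib T p. mdiff A f p X = \<omega> p X" by (auto simp: Fam_def)
    have "smooth_fun A U F" by (rule smooth_fun_cong[OF f(1) _ f(2)]) (use U in auto)
    moreover have "mdiff A F p X = mdiff A f p X" for X by (rule mdiff_cong[OF f(1) U(2)]) (use U in auto)
    ultimately show ?thesis using f U(2) by auto
  qed
  have "smooth_fun A UNIV F" by (rule smooth_fun_local) (use F' in blast)
  then show ?thesis using F' by blast
qed

end

section \<open>The quaternion algebra\<close>

lemma amul_pair: "amul (a, b) (c, d) = (a * c + b * d, a * d + b * c)"
  by (simp add: amul_def)

lemma amul_commute: "amul a b = amul b a"
  by (simp add: amul_def algebra_simps)

lemma amul_assoc: "amul (amul a b) c = amul a (amul b c)"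
  by (simp add: amul_def algebra_simps)

lemma amul_left_commute: "amul a (amul b c) = amul b (amul a c)"
  by (metis amul_assoc amul_commute)

lemma amul_distrib:
  "amul a (b + c) = amul a b + amul a c" "amul (a + b) c = amul a c + amul b c"
  "amul a (b - c) = amul a b - amul a c" "amul (a - b) c = amul a c - amul b c"
  "amul (- a) b = - amul a b" "amul a (- b) = - amul a b"
  "amul 0 a = 0" "amul a 0 = 0" "amul (1, 0) a = a" "amul a (1, 0) = a"
  "amul (r *\<^sub>R a) b = r *\<^sub>R amul a b" "amul a (r *\<^sub>R b) = r *\<^sub>R amul a b"
  by (simp_all add: amul_def prod_eq_iff algebra_simps scaleR_conv_of_real)

lemmas amul_simps = amul_commute amul_left_commute amul_assoc amul_distrib

lemma qmul_assoc: "(x \<odot> y) \<odot> z = x \<odot> (y \<odot> z)"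
proof -
  obtain a0 a1 a2 a3 b0 b1 b2 b3 c0 c1 c2 c3
    where "x = (a0, a1, a2, a3)" "y = (b0, b1, b2, b3)" "z = (c0, c1, c2, c3)"
    by (cases x rule: prod_cases4; cases y rule: prod_cases4; cases z rule: prod_cases4) auto
  then show ?thesis by (simp add: amul_distrib amul_assoc algebra_simps)
qed

lemma qmul_one [simp]: "q_one \<odot> x = x" "x \<odot> q_one = x"
  by (cases x rule: prod_cases4, simp add: q_one_def amul_distrib)+

lemma qmul_linear: "linear (\<lambda>x. x \<odot> y)" "linear (\<lambda>y. x \<odot> y)"
proof -
  show "linear (\<lambda>x. x \<odot> y)"
  proof (rule linearI)
    fix x z :: HAC and r :: real
    show "(x + z) \<odot> y = x \<odot> y + z \<odot> y"
      by (cases x rule: prod_cases4; cases z rule: prod_cases4; cases y rule: prod_cases4)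
        (simp add: amul_distrib algebra_simps)
    show "(r *\<^sub>R x) \<odot> y = r *\<^sub>R (x \<odot> y)"
      by (cases x rule: prod_cases4; cases y rule: prod_cases4) (simp add: amul_distrib algebra_simps)
  qed
  show "linear (\<lambda>y. x \<odot> y)"
  proof (rule linearI)
    fix y z :: HAC and r :: real
    show "x \<odot> (y + z) = x \<odot> y + x \<odot> z"
      by (cases x rule: prod_cases4; cases z rule: prod_cases4; cases y rule: prod_cases4)
        (simp add: amul_distrib algebra_simps)
    show "x \<odot> (r *\<^sub>R y) = r *\<^sub>R (x \<odot> y)"
      by (cases x rule: prod_cases4; cases y rule: prod_cases4) (simp add: amul_distrib algebra_simps)
  qed
qed

lemma bounded_bilinear_qmul: "bounded_bilinear (\<odot>)"
  using qmul_linear by (simp add: bilinear_conv_bounded_bilinear[symmetric] bilinear_def)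

interpretation qmul: bounded_bilinear "(\<odot>)"
  by (rule bounded_bilinear_qmul)

lemmas qmul_simps = qmul.add_left qmul.add_right qmul.diff_left qmul.diff_right qmul.minus_left
  qmul.minus_right qmul.scaleR_left qmul.scaleR_right qmul.zero_left qmul.zero_right qmul_assoc

lemma bounded_linear_qconj: "bounded_linear qconj"
  unfolding linear_conv_bounded_linear[symmetric]
proof (rule linearI)
  fix x y :: HAC and r :: real
  show "qconj (x + y) = qconj x + qconj y"
    by (cases x rule: prod_cases4; cases y rule: prod_cases4) simp
  show "qconj (r *\<^sub>R x) = r *\<^sub>R qconj x" by (cases x rule: prod_cases4) simp
qed

lemma ahat_simps: "ahat (a + b) = ahat a + ahat b" "ahat (r *\<^sub>R a) = r *\<^sub>R ahat a" "ahat (- a) = - ahat a"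
  "ahat (a - b) = ahat a - ahat b" "ahat (ahat a) = a" "ahat (amul a b) = amul (ahat a) (ahat b)"
  by (simp_all add: ahat_def amul_def prod_eq_iff)

lemma bounded_linear_qhat: "bounded_linear qhat"
  unfolding linear_conv_bounded_linear[symmetric]
proof (rule linearI)
  fix x y :: HAC and r :: real
  show "qhat (x + y) = qhat x + qhat y"
    by (cases x rule: prod_cases4; cases y rule: prod_cases4) (simp add: ahat_simps)
  show "qhat (r *\<^sub>R x) = r *\<^sub>R qhat x" by (cases x rule: prod_cases4) (simp add: ahat_simps)
qed

lemma qconj_linear: "qconj (x + y) = qconj x + qconj y" "qconj (x - y) = qconj x - qconj y"
    "qconj (- x) = - qconj x" "qconj (r *\<^sub>R x) = r *\<^sub>R qconj x" "qconj 0 = 0"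
  using bounded_linear_qconj linear_simps[OF bounded_linear_qconj] by (auto simp: bounded_linear.linear linear_0)

lemma qhat_linear: "qhat (x + y) = qhat x + qhat y" "qhat (x - y) = qhat x - qhat y"
    "qhat (- x) = - qhat x" "qhat (r *\<^sub>R x) = r *\<^sub>R qhat x" "qhat 0 = 0"
  using bounded_linear_qhat linear_simps[OF bounded_linear_qhat] by (auto simp: bounded_linear.linear linear_0)

lemma qconj_qmul: "qconj (x \<odot> y) = qconj y \<odot> qconj x"
proof -
  obtain a0 a1 a2 a3 b0 b1 b2 b3 where "x = (a0, a1, a2, a3)" "y = (b0, b1, b2, b3)"
    by (cases x rule: prod_cases4; cases y rule: prod_cases4) auto
  then show ?thesis by (simp add: amul_distrib amul_commute[of b0] amul_commute[of b1]
        amul_commute[of b2] amul_commute[of b3] algebra_simps)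
qed

lemma qhat_qmul: "qhat (x \<odot> y) = qhat x \<odot> qhat y"
proof -
  obtain a0 a1 a2 a3 b0 b1 b2 b3 where "x = (a0, a1, a2, a3)" "y = (b0, b1, b2, b3)"
    by (cases x rule: prod_cases4; cases y rule: prod_cases4) auto
  then show ?thesis by (simp add: ahat_simps)
qed

lemma qconj_qconj [simp]: "qconj (qconj x) = x" by (cases x rule: prod_cases4) simp
lemma qhat_qhat [simp]: "qhat (qhat x) = x" by (cases x rule: prod_cases4) (simp add: ahat_simps)
lemma qhat_qconj: "qhat (qconj x) = qconj (qhat x)" by (cases x rule: prod_cases4) (simp add: ahat_simps)
lemma qconj_one [simp]: "qconj q_one = q_one" by (simp add: q_one_def)
lemma qhat_one [simp]: "qhat q_one = q_one" by (simp add: q_one_def ahat_def zero_prod_def)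

lemma ascale_qmul: "ascale a x \<odot> y = ascale a (x \<odot> y)" "x \<odot> ascale a y = ascale a (x \<odot> y)"
proof -
  obtain a0 a1 a2 a3 b0 b1 b2 b3 where "x = (a0, a1, a2, a3)" "y = (b0, b1, b2, b3)"
    by (cases x rule: prod_cases4; cases y rule: prod_cases4) auto
  then show "ascale a x \<odot> y = ascale a (x \<odot> y)" "x \<odot> ascale a y = ascale a (x \<odot> y)"
    by (simp_all add: amul_simps)
qed

lemma ascale_linear: "linear (ascale a)"
proof (rule linearI)
  fix x y :: HAC and r :: real
  show "ascale a (x + y) = ascale a x + ascale a y"
    by (cases x rule: prod_cases4; cases y rule: prod_cases4) (simp add: amul_distrib)
  show "ascale a (r *\<^sub>R x) = r *\<^sub>R ascale a x"
    by (cases x rule: prod_cases4) (simp add: amul_distrib)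
qed

lemmas ascale_simps = linear_add[OF ascale_linear] linear_diff[OF ascale_linear]
  linear_cmul[OF ascale_linear] linear_neg[OF ascale_linear] linear_0[OF ascale_linear]

lemma ascale_ascale: "ascale a (ascale b x) = ascale (amul a b) x"
  by (cases x rule: prod_cases4) (simp add: amul_assoc)

lemma ascale_conj: "qconj (ascale a x) = ascale a (qconj x)"
  by (cases x rule: prod_cases4) (simp add: amul_distrib)

lemma ascale_hat: "qhat (ascale a x) = ascale (ahat a) (qhat x)"
  by (cases x rule: prod_cases4) (simp add: ahat_simps)

lemma amul_minus_one: "amul (-1, 0) b = - b"
  by (cases b) (simp add: amul_pair)

lemma ascale_one: "ascale (1, 0) x = x" "ascale (-1, 0) x = - x" "ascale (- a) x = - ascale a x"
  by (cases x rule: prod_cases4, simp only: ascale.simps amul_minus_one amul_distrib uminus_Pair)+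

lemma amul_sigma_i: "amul a_sigma_i a_sigma_i = (-1, 0)" "amul a_i a_i = (-1, 0)"
  "ahat a_sigma_i = - a_sigma_i" "ahat a_i = a_i"
  by (simp_all add: amul_def a_sigma_i_def a_i_def ahat_def)

subsection \<open>The subspaces \<open>H0\<close> and \<open>\<real>\<^sup>2\<^sup>,\<^sup>2\<close>\<close>

text \<open>Real coordinates on \<open>H0\<close>: the \<open>k\<close>-th Lorentz number is \<open>uk + \<sigma> vk\<close>. In these coordinates identities
  in \<open>H0\<close> become polynomial identities over the reals.\<close>

definition h0 :: "real \<Rightarrow> real \<Rightarrow> real \<Rightarrow> real \<Rightarrow> real \<Rightarrow> real \<Rightarrow> real \<Rightarrow> real \<Rightarrow> HAC"
  where "h0 u0 v0 u1 v1 u2 v2 u3 v3 =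
    ((of_real u0, of_real v0), (\<i> * of_real u1, \<i> * of_real v1),
     (of_real u2, of_real v2), (\<i> * of_real u3, \<i> * of_real v3))"

lemma H0_iff: "x \<in> H0 \<longleftrightarrow> (\<exists>u0 v0 u1 v1 u2 v2 u3 v3. x = h0 u0 v0 u1 v1 u2 v2 u3 v3)"
proof
  assume "x \<in> H0"
  then obtain p0 p1 p2 p3 where x: "x = (p0, amul a_i p1, p2, amul a_i p3)"
    "{p0, p1, p2, p3} \<subseteq> lorentz_numbers" by (auto simp: H0_def)
  then obtain u0 v0 u1 v1 u2 v2 u3 v3 where "p0 = (complex_of_real u0, complex_of_real v0)"
    "p1 = (complex_of_real u1, complex_of_real v1)" "p2 = (complex_of_real u2, complex_of_real v2)"
    "p3 = (complex_of_real u3, complex_of_real v3)" by (auto simp: lorentz_numbers_def)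
  then have "x = h0 u0 v0 u1 v1 u2 v2 u3 v3" by (simp add: x(1) h0_def amul_pair a_i_def)
  then show "\<exists>u0 v0 u1 v1 u2 v2 u3 v3. x = h0 u0 v0 u1 v1 u2 v2 u3 v3" by blast
next
  assume "\<exists>u0 v0 u1 v1 u2 v2 u3 v3. x = h0 u0 v0 u1 v1 u2 v2 u3 v3"
  then obtain u0 v0 u1 v1 u2 v2 u3 v3 where x: "x = h0 u0 v0 u1 v1 u2 v2 u3 v3" by blast
  show "x \<in> H0"
    unfolding H0_def x h0_def
    by (rule CollectI, rule exI[of _ "(of_real u0, of_real v0)"], rule exI[of _ "(of_real u1, of_real v1)"],
        rule exI[of _ "(of_real u2, of_real v2)"], rule exI[of _ "(of_real u3, of_real v3)"])
      (auto simp: amul_pair a_i_def lorentz_numbers_def)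
qed

lemma H0E:
  assumes "x \<in> H0"
  obtains u0 v0 u1 v1 u2 v2 u3 v3 where "x = h0 u0 v0 u1 v1 u2 v2 u3 v3"
  using assms H0_iff by blast

lemma h0_in [simp]: "h0 u0 v0 u1 v1 u2 v2 u3 v3 \<in> H0"
  using H0_iff by blast

lemma h0_inject: "h0 u0 v0 u1 v1 u2 v2 u3 v3 = h0 u0' v0' u1' v1' u2' v2' u3' v3' \<longleftrightarrow>
  u0 = u0' \<and> v0 = v0' \<and> u1 = u1' \<and> v1 = v1' \<and> u2 = u2' \<and> v2 = v2' \<and> u3 = u3' \<and> v3 = v3'"
  by (auto simp: h0_def)

lemma h0_ops:
  "h0 a0 b0 a1 b1 a2 b2 a3 b3 + h0 c0 d0 c1 d1 c2 d2 c3 d3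
    = h0 (a0 + c0) (b0 + d0) (a1 + c1) (b1 + d1) (a2 + c2) (b2 + d2) (a3 + c3) (b3 + d3)"
  "- h0 a0 b0 a1 b1 a2 b2 a3 b3 = h0 (- a0) (- b0) (- a1) (- b1) (- a2) (- b2) (- a3) (- b3)"
  "r *\<^sub>R h0 a0 b0 a1 b1 a2 b2 a3 b3 = h0 (r * a0) (r * b0) (r * a1) (r * b1) (r * a2) (r * b2) (r * a3) (r * b3)"
  "qconj (h0 a0 b0 a1 b1 a2 b2 a3 b3) = h0 a0 b0 (- a1) (- b1) (- a2) (- b2) (- a3) (- b3)"
  "qhat (h0 a0 b0 a1 b1 a2 b2 a3 b3) = h0 a0 (- b0) a1 (- b1) a2 (- b2) a3 (- b3)"
  "q_one = h0 1 0 0 0 0 0 0 0" "0 = h0 0 0 0 0 0 0 0 0"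
  by (simp_all add: h0_def ahat_def scaleR_conv_of_real algebra_simps q_one_def zero_prod_def)

lemma h0_mult:
  "h0 a0 b0 a1 b1 a2 b2 a3 b3 \<odot> h0 c0 d0 c1 d1 c2 d2 c3 d3 = h0
    (a0*c0 + b0*d0 + a1*c1 + b1*d1 - a2*c2 - b2*d2 + a3*c3 + b3*d3)
    (a0*d0 + b0*c0 + a1*d1 + b1*c1 - a2*d2 - b2*c2 + a3*d3 + b3*c3)
    (a0*c1 + b0*d1 + a1*c0 + b1*d0 + a2*c3 + b2*d3 - a3*c2 - b3*d2)
    (a0*d1 + b0*c1 + a1*d0 + b1*c0 + a2*d3 + b2*c3 - a3*d2 - b3*c2)
    (a0*c2 + b0*d2 + a1*c3 + b1*d3 + a2*c0 + b2*d0 - a3*c1 - b3*d1)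
    (a0*d2 + b0*c2 + a1*d3 + b1*c3 + a2*d0 + b2*c0 - a3*d1 - b3*c1)
    (a0*c3 + b0*d3 + a1*c2 + b1*d2 - a2*c1 - b2*d1 + a3*c0 + b3*d0)
    (a0*d3 + b0*c3 + a1*d2 + b1*c2 - a2*d1 - b2*c1 + a3*d0 + b3*c0)"
  by (simp add: h0_def amul_pair complex_eq_iff algebra_simps)

lemma H0_closed: "x \<in> H0 \<Longrightarrow> y \<in> H0 \<Longrightarrow> x \<odot> y \<in> H0" "x \<in> H0 \<Longrightarrow> y \<in> H0 \<Longrightarrow> x + y \<in> H0"
  "x \<in> H0 \<Longrightarrow> - x \<in> H0" "x \<in> H0 \<Longrightarrow> r *\<^sub>R x \<in> H0" "x \<in> H0 \<Longrightarrow> qconj x \<in> H0" "x \<in> H0 \<Longrightarrow> qhat x \<in> H0"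
  "q_one \<in> H0" "0 \<in> H0"
  by (auto elim!: H0E simp: h0_mult h0_ops)

definition unitH0 :: "HAC \<Rightarrow> bool"
  where "unitH0 u \<longleftrightarrow> u \<in> H0 \<and> qconj u \<odot> u = q_one \<and> u \<odot> qconj u = q_one"

text \<open>On \<open>H0\<close> the product \<open>qconj u \<odot> u\<close> is the Lorentz number \<open>H(u, u)\<close>.\<close>

lemma Hform_unit: "u \<in> H0 \<Longrightarrow> Hform u u = (1, 0) \<longleftrightarrow> unitH0 u"
proof (elim H0E)
  fix u0 v0 u1 v1 u2 v2 u3 v3 assume u: "u = h0 u0 v0 u1 v1 u2 v2 u3 v3"
  have "Hform u u = (of_real (u0 * u0 + v0 * v0 - u1 * u1 - v1 * v1 + u2 * u2 + v2 * v2 - u3 * u3 - v3 * v3),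
      of_real (2 * (u0 * v0 - u1 * v1 + u2 * v2 - u3 * v3)))"
    by (simp add: u h0_def amul_pair a_i_def complex_eq_iff algebra_simps)
  then have "Hform u u = (1, 0) \<longleftrightarrow> u0 * u0 + v0 * v0 - u1 * u1 - v1 * v1 + u2 * u2 + v2 * v2 - u3 * u3 - v3 * v3 = 1
      \<and> u0 * v0 - u1 * v1 + u2 * v2 - u3 * v3 = 0"
    by (simp only: prod.inject of_real_eq_1_iff of_real_eq_0_iff mult_eq_0_iff) simp
  then show "Hform u u = (1, 0) \<longleftrightarrow> unitH0 u"
    by (simp add: unitH0_def u h0_ops h0_mult h0_inject) (auto simp: algebra_simps)
qed

lemma unitH0_H0: "unitH0 u \<Longrightarrow> u \<in> H0"
  by (simp add: unitH0_def)

lemma unitH0I: "u \<in> H0 \<Longrightarrow> qconj u \<odot> u = q_one \<Longrightarrow> u \<odot> qconj u = q_one \<Longrightarrow> unitH0 u"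
  by (simp add: unitH0_def)

lemma unitH0_simps [simp]:
  assumes "unitH0 u"
  shows "qconj u \<odot> u = q_one" "u \<odot> qconj u = q_one" "u \<odot> (qconj u \<odot> x) = x" "qconj u \<odot> (u \<odot> x) = x"
    "qhat u \<odot> qconj (qhat u) = q_one" "qconj (qhat u) \<odot> qhat u = q_one"
    "qhat u \<odot> (qconj (qhat u) \<odot> x) = x" "qconj (qhat u) \<odot> (qhat u \<odot> x) = x"
proof -
  show *: "qconj u \<odot> u = q_one" "u \<odot> qconj u = q_one" using assms by (auto simp: unitH0_def)
  then show "u \<odot> (qconj u \<odot> x) = x" "qconj u \<odot> (u \<odot> x) = x" by (simp_all add: qmul_assoc[symmetric])
  show **: "qhat u \<odot> qconj (qhat u) = q_one" "qconj (qhat u) \<odot> qhat u = q_one"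
    using arg_cong[OF *(1), of qhat] arg_cong[OF *(2), of qhat] by (simp_all add: qhat_qmul qhat_qconj)
  then show "qhat u \<odot> (qconj (qhat u) \<odot> x) = x" "qconj (qhat u) \<odot> (qhat u \<odot> x) = x"
    by (simp_all add: qmul_assoc[symmetric])
qed

lemma unitH0_closed: "unitH0 u \<Longrightarrow> unitH0 v \<Longrightarrow> unitH0 (u \<odot> v)" "unitH0 u \<Longrightarrow> unitH0 (qconj u)"
  "unitH0 u \<Longrightarrow> unitH0 (- u)" "unitH0 q_one"
  by (rule unitH0I; simp add: H0_closed unitH0_H0 qconj_qmul qmul_assoc qconj_linear qmul.minus_left qmul.minus_right)+

definition quad :: "real \<Rightarrow> real \<Rightarrow> real \<Rightarrow> real \<Rightarrow> real^4"
  where "quad a b c d = (\<chi> i. if i = 0 then a else if i = 1 then b else if i = 2 then c else d)"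

lemma quad_nth [simp]: "quad a b c d $ 0 = a" "quad a b c d $ 1 = b" "quad a b c d $ 2 = c" "quad a b c d $ 3 = d"
  by (simp_all add: quad_def)

lemma forall_index4: "(\<forall>i::4. P i) \<longleftrightarrow> P 0 \<and> P 1 \<and> P 2 \<and> P 3"
proof -
  have "(4::4) = 0" by simp
  then show ?thesis using forall_4[of P] by metis
qed

lemma vec4_eq: "x = y \<longleftrightarrow> x $ 0 = y $ 0 \<and> x $ 1 = y $ 1 \<and> x $ 2 = y $ 2 \<and> x $ 3 = y $ (3::4)"
  by (simp add: vec_eq_iff forall_index4)

lemma quad_eta: "x = quad (x $ 0) (x $ 1) (x $ 2) (x $ 3)"
  by (simp add: vec4_eq)

lemma axis4: "axis 0 1 = quad 1 0 0 0" "axis 1 1 = quad 0 1 0 0" "axis 2 1 = quad 0 0 1 0" "axis 3 1 = quad 0 0 0 1"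
  by (simp_all add: vec4_eq axis_def)

lemma iota_eq: "iota x = ((0, \<i> * of_real (x $ 0)), (of_real (x $ 1), 0), (\<i> * of_real (x $ 2), 0), (of_real (x $ 3), 0))"
  by (simp add: iota_def q_one_def q_I_def q_J_def q_K_def a_i_def a_sigma_i_def amul_pair zero_prod_def
      scaleR_conv_of_real mult.commute)

lemma iota_linear: "linear iota"
  by (rule linearI) (simp_all add: iota_eq complex_eq_iff algebra_simps)

lemmas iota_simps = linear_add[OF iota_linear] linear_diff[OF iota_linear]
  linear_cmul[OF iota_linear] linear_neg[OF iota_linear] linear_0[OF iota_linear]

lemma bounded_linear_iota: "bounded_linear iota"
  using iota_linear by (simp add: linear_conv_bounded_linear)

definition iota_inv :: "HAC \<Rightarrow> real^4"
  where "iota_inv z = quad (Im (snd (fst z))) (Re (fst (fst (snd z)))) (Im (fst (fst (snd (snd z)))))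
    (Re (fst (snd (snd (snd z)))))"

lemma iota_inv_iota [simp]: "iota_inv (iota x) = x"
  by (simp add: iota_inv_def iota_eq vec4_eq)

lemma iota_inject: "iota x = iota y \<longleftrightarrow> x = y"
  by (metis iota_inv_iota)

lemma bounded_linear_iota_inv: "bounded_linear iota_inv"
  unfolding linear_conv_bounded_linear[symmetric]
  by (rule linearI) (auto simp: iota_inv_def vec4_eq)

lemma iota_iota_inv: "z \<in> range iota \<Longrightarrow> iota (iota_inv z) = z"
  by auto

lemma iota_axes: "iota (quad 1 0 0 0) = ascale a_sigma_i q_one" "iota (quad 0 1 0 0) = q_I"
  "iota (quad 0 0 1 0) = ascale a_i q_J" "iota (quad 0 0 0 1) = q_K"
  by (simp_all add: iota_def)

text \<open>This description of \<open>\<real>\<^sup>2\<^sup>,\<^sup>2\<close> inside the quaternions is visibly preserved by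
  \<open>z \<mapsto> qconj u \<odot> z \<odot> qhat u\<close>.\<close>

lemma range_iota_iff: "z \<in> range iota \<longleftrightarrow> (\<exists>h\<in>H0. z = ascale a_i h) \<and> qconj (qhat z) = - z"
proof
  assume "z \<in> range iota"
  then obtain x where z: "z = iota x" by blast
  have "z = ascale a_i (h0 0 (x $ 0) (- x $ 1) 0 (x $ 2) 0 (- x $ 3) 0)"
    by (simp add: z iota_eq h0_def a_i_def amul_pair complex_eq_iff)
  moreover have "qconj (qhat z) = - z" by (simp add: z iota_eq ahat_def zero_prod_def)
  ultimately show "(\<exists>h\<in>H0. z = ascale a_i h) \<and> qconj (qhat z) = - z" using h0_in by blast
next
  assume "(\<exists>h\<in>H0. z = ascale a_i h) \<and> qconj (qhat z) = - z"
  then obtain h where h: "h \<in> H0" "z = ascale a_i h" "qconj (qhat z) = - z" by blast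
  from h(1) obtain u0 v0 u1 v1 u2 v2 u3 v3 where u: "h = h0 u0 v0 u1 v1 u2 v2 u3 v3" by (rule H0E)
  have "z = iota (quad v0 (- u1) u2 (- u3))"
    using h(3) unfolding h(2) u by (simp add: iota_eq h0_def a_i_def amul_pair complex_eq_iff ahat_def)
  then show "z \<in> range iota" by blast
qed

lemma iota_conj_hat: "qconj (qhat (iota x)) = - iota x" "qhat (iota x) = - qconj (iota x)"
  "qconj (iota x) = - qhat (iota x)"
  by (simp_all add: iota_eq ahat_def zero_prod_def)

lemma iota_sandwich: "u \<in> H0 \<Longrightarrow> qconj u \<odot> iota x \<odot> qhat u \<in> range iota"
proof -
  assume u: "u \<in> H0"
  obtain h where h: "h \<in> H0" "iota x = ascale a_i h" using range_iota_iff[of "iota x"] by blast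
  show ?thesis
    unfolding range_iota_iff
  proof
    show "\<exists>h\<in>H0. qconj u \<odot> iota x \<odot> qhat u = ascale a_i h"
      using u h by (intro bexI[of _ "qconj u \<odot> h \<odot> qhat u"]) (auto simp: ascale_qmul H0_closed)
    show "qconj (qhat (qconj u \<odot> iota x \<odot> qhat u)) = - (qconj u \<odot> iota x \<odot> qhat u)"
      by (simp add: qconj_qmul qhat_qmul qhat_qconj iota_conj_hat(1) qmul_simps)
  qed
qed

lemma iota_clifford: "iota x \<odot> qhat (iota y) + iota y \<odot> qhat (iota x) = (- 2 * ip22 x y) *\<^sub>R q_one"
  by (simp add: iota_eq ahat_def amul_pair q_one_def ip22_def zero_prod_def complex_eq_iff algebra_simps)

text \<open>In a spin frame in which \<open>\<phi>\<close> has the coordinate \<open>u\<close> and \<open>w\<close> the coordinates \<open>x\<close>, this is the vector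
  \<open>\<langle>\<langle>w\<cdot>\<phi>, \<phi>\<rangle>\<rangle>\<close>; the sign is the square of the factor \<open>\<sigma> i\<close> that occurs in the Clifford action
  and in the pairing.\<close>

definition rho :: "HAC \<Rightarrow> real^4 \<Rightarrow> real^4"
  where "rho u x = iota_inv (- (qconj u \<odot> iota x \<odot> qhat u))"

lemma iota_rho: "u \<in> H0 \<Longrightarrow> iota (rho u x) = - (qconj u \<odot> iota x \<odot> qhat u)"
  unfolding rho_def
proof (rule iota_iota_inv)
  assume "u \<in> H0"
  then obtain y where "qconj u \<odot> iota x \<odot> qhat u = iota y" using iota_sandwich by blast
  then have "- (qconj u \<odot> iota x \<odot> qhat u) = iota (- y)" by (simp add: iota_simps)
  then show "- (qconj u \<odot> iota x \<odot> qhat u) \<in> range iota" by blast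
qed

lemma rho_linear: "linear (rho u)"
  unfolding rho_def
  by (rule linearI) (simp_all add: iota_simps qmul_simps bounded_linear_iota_inv[THEN bounded_linear.linear]
      linear_add linear_cmul linear_diff linear_neg)

lemmas rho_simps = linear_add[OF rho_linear] linear_diff[OF rho_linear]
  linear_cmul[OF rho_linear] linear_neg[OF rho_linear] linear_0[OF rho_linear]

text \<open>The metric is recovered from products by the Clifford relation \<open>iota_clifford\<close>, and \<open>rho u\<close>
  conjugates the products \<open>iota x \<odot> qhat (iota y)\<close> by \<open>u\<close>.\<close>

lemma rho_isometry:
  assumes "unitH0 u"
  shows "ip22 (rho u x) (rho u y) = ip22 x y"
proof -
  have u: "u \<in> H0" using assms by (rule unitH0_H0)
  have *: "iota (rho u x) \<odot> qhat (iota (rho u y)) = qconj u \<odot> (iota x \<odot> qhat (iota y)) \<odot> u" for x y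
    by (simp add: iota_rho[OF u] qhat_linear qhat_qmul qhat_qconj qmul_simps assms)
  have "(- 2 * ip22 (rho u x) (rho u y)) *\<^sub>R q_one
      = qconj u \<odot> (iota x \<odot> qhat (iota y) + iota y \<odot> qhat (iota x)) \<odot> u"
    unfolding iota_clifford[symmetric] * by (simp add: qmul_simps)
  also have "\<dots> = (- 2 * ip22 x y) *\<^sub>R q_one"
    unfolding iota_clifford by (simp add: qmul_simps assms)
  finally show ?thesis by (simp add: q_one_def zero_prod_def)
qed

lemma rho_inverse: "unitH0 u \<Longrightarrow> rho u (rho (qconj u) y) = y" "unitH0 u \<Longrightarrow> rho (qconj u) (rho u y) = y"
proof -
  have *: "rho u (rho (qconj u) y) = y" if u: "unitH0 u" for u
  proof -
    have "iota (rho u (rho (qconj u) y)) = iota y"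
      using u by (simp add: iota_rho unitH0_H0 unitH0_closed qmul_simps qhat_qconj)
    then show ?thesis by (simp only: iota_inject)
  qed
  then show "unitH0 u \<Longrightarrow> rho u (rho (qconj u) y) = y" "unitH0 u \<Longrightarrow> rho (qconj u) (rho u y) = y"
    using *[of "qconj u"] unitH0_closed(2) by auto
qed

lemma rho_inj: "unitH0 u \<Longrightarrow> rho u x = rho u y \<Longrightarrow> x = y"
  by (metis rho_inverse(2))

lemma rho_surj: "unitH0 u \<Longrightarrow> \<exists>x. rho u x = y"
  using rho_inverse(1) by blast

subsection \<open>Imaginary elements and their action on \<open>\<real>\<^sup>2\<^sup>,\<^sup>2\<close>\<close>

lemma imaginary_H0: "a \<in> H0 \<Longrightarrow> qconj a = - a \<Longrightarrow> \<exists>a1 b1 a2 b2 a3 b3. a = h0 0 0 a1 b1 a2 b2 a3 b3"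
  by (elim H0E) (auto simp: h0_ops h0_inject)

text \<open>The infinitesimal action of an imaginary element of \<open>H0\<close> on \<open>\<real>\<^sup>2\<^sup>,\<^sup>2\<close>, as the next lemma shows. The
  components \<open>b1\<close> and \<open>a1\<close> generate the rotations of the planes of the first two and of the last two
  coordinates, the other four mix the two planes.\<close>

definition imag_action :: "real \<Rightarrow> real \<Rightarrow> real \<Rightarrow> real \<Rightarrow> real \<Rightarrow> real \<Rightarrow> real^4 \<Rightarrow> real^4"
  where "imag_action a1 b1 a2 b2 a3 b3 x = quad
    (2 * (b1 * x $ 1 + b2 * x $ 2 + b3 * x $ 3)) (2 * (b1 * x $ 0 - a2 * x $ 3 - a3 * x $ 2))
    (2 * (a1 * x $ 3 - b2 * x $ 0 - a3 * x $ 1)) (2 * (a1 * x $ 2 + a2 * x $ 1 + b3 * x $ 0))"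

lemma imag_action_h0:
  "iota x \<odot> qhat (h0 0 0 a1 b1 a2 b2 a3 b3) - h0 0 0 a1 b1 a2 b2 a3 b3 \<odot> iota x = iota (imag_action a1 b1 a2 b2 a3 b3 x)"
  by (simp add: imag_action_def h0_def iota_eq ahat_def amul_pair zero_prod_def complex_eq_iff algebra_simps)

text \<open>The element of the Clifford algebra that multiplies \<open>\<phi>\<close> on the right-hand side of the Killing
  equation, where \<open>(b20, b21)\<close> and \<open>(b30, b31)\<close> are the coordinates of \<open>B(X, e2)\<close> and \<open>B(X, e3)\<close>.\<close>

lemma killing_element:
  "- (1/2) *\<^sub>R (- (ascale a_i q_J \<odot> qhat (iota (quad b20 b21 0 0))) + q_K \<odot> qhat (iota (quad b30 b31 0 0)))
    = h0 0 0 0 0 (- b31 / 2) (b20 / 2) (- b21 / 2) (b30 / 2)"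
  by (simp add: h0_def iota_eq ahat_def amul_pair zero_prod_def complex_eq_iff algebra_simps
      q_J_def q_K_def a_i_def)

text \<open>The Dirac equation at a point, where \<open>h0 0 0 a1 b1 a2 b2 a3 b3\<close> and \<open>h0 0 0 c1 d1 c2 d2 c3 d3\<close>
  represent the derivatives along \<open>e2\<close> and \<open>e3\<close>, and \<open>(x, y)\<close> are the coordinates of the mean curvature
  vector.\<close>

lemma dirac_element:
  "- (ascale a_i q_J \<odot> qhat (h0 0 0 a1 b1 a2 b2 a3 b3)) + q_K \<odot> qhat (h0 0 0 c1 d1 c2 d2 c3 d3)
      = iota (quad x y 0 0) \<longleftrightarrow>
    a1 = 0 \<and> b1 = 0 \<and> c1 = 0 \<and> d1 = 0 \<and> d3 - b2 = x \<and> a2 = c3 \<and> a3 - c2 = y \<and> b3 = d2"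
  by (auto simp: h0_def iota_eq ahat_def amul_pair zero_prod_def complex_eq_iff algebra_simps
      q_J_def q_K_def a_i_def)

section \<open>Spin frames\<close>

lemma hyperbola_param:
  assumes "a * a - b * b = (1::real)"
  shows "\<exists>s v. (s = 1 \<or> s = -1) \<and> a = s * cosh v \<and> b = s * sinh v"
proof -
  let ?s = "if a > 0 then 1 else -1 :: real"
  let ?v = "arsinh (?s * b)"
  have "cosh ?v * cosh ?v = 1 + b * b"
    using cosh_square_eq[of ?v] by (auto simp: power2_eq_square)
  then have sq: "(cosh ?v)\<^sup>2 = (?s * a)\<^sup>2" using assms by (auto simp: power2_eq_square)
  have "?s * a \<ge> 0" by auto
  then have "cosh ?v = ?s * a"
    using sq by (metis power2_eq_imp_eq cosh_real_nonneg)
  then show ?thesis by (intro exI[of _ ?s] exI[of _ ?v]) (auto split: if_splits)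
qed

lemma Spin1_iff: "g \<in> Spin1 \<longleftrightarrow> (\<exists>a b. g = h0 a 0 0 b 0 0 0 0 \<and> a * a - b * b = 1)"
proof -
  have eq: "s *\<^sub>R (cosh v *\<^sub>R q_one + sinh v *\<^sub>R ascale a_sigma_i q_I) = h0 (s * cosh v) 0 0 (s * sinh v) 0 0 0 0"
    for s v
    by (simp add: h0_def q_one_def q_I_def a_sigma_i_def amul_pair zero_prod_def scaleR_conv_of_real)
  show ?thesis
  proof
    assume "g \<in> Spin1"
    then obtain s v where g: "g = h0 (s * cosh v) 0 0 (s * sinh v) 0 0 0 0" "s = 1 \<or> s = -1"
      by (auto simp: Spin1_def eq)
    have "s * cosh v * (s * cosh v) - s * sinh v * (s * sinh v) = 1"
      using g(2) cosh_square_eq[of v] by (auto simp: power2_eq_square)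
    then show "\<exists>a b. g = h0 a 0 0 b 0 0 0 0 \<and> a * a - b * b = 1" using g(1) by blast
  next
    assume "\<exists>a b. g = h0 a 0 0 b 0 0 0 0 \<and> a * a - b * b = 1"
    then obtain a b where g: "g = h0 a 0 0 b 0 0 0 0" "a * a - b * b = 1" by blast
    from hyperbola_param[OF g(2)] obtain s v where "s = 1 \<or> s = -1" "a = s * cosh v" "b = s * sinh v"
      by blast
    then show "g \<in> Spin1" unfolding Spin1_def eq using g(1) by blast
  qed
qed

lemma Spin2_iff: "g \<in> Spin2 \<longleftrightarrow> (\<exists>a b. g = h0 a 0 b 0 0 0 0 0 \<and> a * a - b * b = 1)"
proof -
  have eq: "s *\<^sub>R (cosh v *\<^sub>R q_one + sinh v *\<^sub>R ascale a_i q_I) = h0 (s * cosh v) 0 (s * sinh v) 0 0 0 0 0"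
    for s v
    by (simp add: h0_def q_one_def q_I_def a_i_def amul_pair zero_prod_def scaleR_conv_of_real)
  show ?thesis
  proof
    assume "g \<in> Spin2"
    then obtain s v where g: "g = h0 (s * cosh v) 0 (s * sinh v) 0 0 0 0 0" "s = 1 \<or> s = -1"
      by (auto simp: Spin2_def eq)
    have "s * cosh v * (s * cosh v) - s * sinh v * (s * sinh v) = 1"
      using g(2) cosh_square_eq[of v] by (auto simp: power2_eq_square)
    then show "\<exists>a b. g = h0 a 0 b 0 0 0 0 0 \<and> a * a - b * b = 1" using g(1) by blast
  next
    assume "\<exists>a b. g = h0 a 0 b 0 0 0 0 0 \<and> a * a - b * b = 1"
    then obtain a b where g: "g = h0 a 0 b 0 0 0 0 0" "a * a - b * b = 1" by blast
    from hyperbola_param[OF g(2)] obtain s v where "s = 1 \<or> s = -1" "a = s * cosh v" "b = s * sinh v"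
      by blast
    then show "g \<in> Spin2" unfolding Spin2_def eq using g(1) by blast
  qed
qed

lemma Spin_unit: "g \<in> Spin1 \<Longrightarrow> unitH0 g" "g \<in> Spin2 \<Longrightarrow> unitH0 g"
  by (auto simp: Spin1_iff Spin2_iff h0_mult h0_ops h0_inject intro!: unitH0I)

lemma Spin_one: "q_one \<in> Spin1" "q_one \<in> Spin2"
  by (auto simp: Spin1_iff Spin2_iff h0_ops h0_inject)

lemma Spin_mult: "g \<in> Spin1 \<Longrightarrow> h \<in> Spin1 \<Longrightarrow> g \<odot> h \<in> Spin1" "g \<in> Spin2 \<Longrightarrow> h \<in> Spin2 \<Longrightarrow> g \<odot> h \<in> Spin2"
proof -
  have alg: "(a * c + b * d) * (a * c + b * d) - (a * d + b * c) * (a * d + b * c) = 1"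
    if "a * a - b * b = 1" "c * c - d * d = 1" for a b c d :: real
  proof -
    have "(a * c + b * d) * (a * c + b * d) - (a * d + b * c) * (a * d + b * c)
        = (a * a - b * b) * (c * c - d * d)" by (simp add: algebra_simps)
    then show ?thesis using that by simp
  qed
  show "g \<in> Spin1 \<Longrightarrow> h \<in> Spin1 \<Longrightarrow> g \<odot> h \<in> Spin1" "g \<in> Spin2 \<Longrightarrow> h \<in> Spin2 \<Longrightarrow> g \<odot> h \<in> Spin2"
    using alg by (auto simp: Spin1_iff Spin2_iff h0_mult h0_inject)
qed

lemma Spin_conj: "g \<in> Spin1 \<Longrightarrow> qconj g \<in> Spin1" "g \<in> Spin2 \<Longrightarrow> qconj g \<in> Spin2"
  by (auto simp: Spin1_iff Spin2_iff h0_ops h0_inject)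

lemma Spin_commute: "g \<in> Spin1 \<Longrightarrow> h \<in> Spin2 \<Longrightarrow> g \<odot> h = h \<odot> g"
  by (auto simp: Spin1_iff Spin2_iff h0_mult h0_inject)

text \<open>The spin group of the normal plane acts on the coordinates of that plane and leaves those of the
  tangent plane alone; \<open>Spin2_action\<close> is the same with the planes exchanged.\<close>

lemma Spin1_action:
  assumes "g \<in> Spin1"
  shows "\<exists>y0 y1. g \<odot> iota (quad x0 x1 0 0) \<odot> qconj (qhat g) = iota (quad y0 y1 0 0)"
    and "g \<odot> iota (quad 0 0 x2 x3) \<odot> qconj (qhat g) = iota (quad 0 0 x2 x3)"
proof -
  obtain a b where g: "g = h0 a 0 0 b 0 0 0 0" "a * a - b * b = 1" using assms Spin1_iff by blast
  have "g \<odot> iota (quad x0 x1 0 0) \<odot> qconj (qhat g) =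
    iota (quad ((a * a + b * b) * x0 - 2 * a * b * x1) ((a * a + b * b) * x1 - 2 * a * b * x0) 0 0)"
    by (simp add: g(1) h0_def iota_eq amul_pair ahat_def zero_prod_def complex_eq_iff algebra_simps)
  then show "\<exists>y0 y1. g \<odot> iota (quad x0 x1 0 0) \<odot> qconj (qhat g) = iota (quad y0 y1 0 0)" by blast
  have "g \<odot> iota (quad 0 0 x2 x3) \<odot> qconj (qhat g) = iota ((a * a - b * b) *\<^sub>R quad 0 0 x2 x3)"
    by (simp add: g(1) h0_def iota_eq amul_pair ahat_def zero_prod_def complex_eq_iff algebra_simps)
  then show "g \<odot> iota (quad 0 0 x2 x3) \<odot> qconj (qhat g) = iota (quad 0 0 x2 x3)"
    using g(2) by simp
qed

lemma Spin2_action: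
  assumes "g \<in> Spin2"
  shows "\<exists>y2 y3. g \<odot> iota (quad 0 0 x2 x3) \<odot> qconj (qhat g) = iota (quad 0 0 y2 y3)"
    and "g \<odot> iota (quad x0 x1 0 0) \<odot> qconj (qhat g) = iota (quad x0 x1 0 0)"
proof -
  obtain a b where g: "g = h0 a 0 b 0 0 0 0 0" "a * a - b * b = 1" using assms Spin2_iff by blast
  have "g \<odot> iota (quad 0 0 x2 x3) \<odot> qconj (qhat g) =
    iota (quad 0 0 ((a * a + b * b) * x2 - 2 * a * b * x3) ((a * a + b * b) * x3 - 2 * a * b * x2))"
    by (simp add: g(1) h0_def iota_eq amul_pair ahat_def zero_prod_def complex_eq_iff algebra_simps)
  then show "\<exists>y2 y3. g \<odot> iota (quad 0 0 x2 x3) \<odot> qconj (qhat g) = iota (quad 0 0 y2 y3)" by blast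
  have "g \<odot> iota (quad x0 x1 0 0) \<odot> qconj (qhat g) = iota ((a * a - b * b) *\<^sub>R quad x0 x1 0 0)"
    by (simp add: g(1) h0_def iota_eq amul_pair ahat_def zero_prod_def complex_eq_iff algebra_simps)
  then show "g \<odot> iota (quad x0 x1 0 0) \<odot> qconj (qhat g) = iota (quad x0 x1 0 0)"
    using g(2) by simp
qed

lemma iota_split:
  "x0 *\<^sub>R ascale a_sigma_i q_one + x1 *\<^sub>R q_I = iota (quad x0 x1 0 0)"
  "x2 *\<^sub>R ascale a_i q_J + x3 *\<^sub>R q_K = iota (quad 0 0 x2 x3)"
  "iota (quad x0 x1 0 0) + iota (quad 0 0 x2 x3) = iota (quad x0 x1 x2 x3)"
proof -
  show "iota (quad x0 x1 0 0) + iota (quad 0 0 x2 x3) = iota (quad x0 x1 x2 x3)"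
    unfolding iota_simps(1)[symmetric] iota_inject by (simp add: vec4_eq)
qed (simp_all add: iota_def)

text \<open>Common setting of the two spin structures. The functionals \<open>L0\<close> and \<open>L1\<close> read off the coefficients
  of \<open>w0\<close> and \<open>w1\<close>; their being bounded linear makes the frames of smooth spin sections smooth.\<close>

locale spin_bundle = lorentz_bundle A T V for A :: "'m::t2_space chart set" and T
    and V :: "('m, 'v::real_vector) plane_bundle" +
  fixes P :: "('m, 'v, 'q) spin_bundle" and G :: "HAC set" and w0 w1 :: HAC and L0 L1 :: "HAC \<Rightarrow> real"
  assumes spin: "spin_structure A V G w0 w1 P"
    and G_one: "q_one \<in> G" and G_mult: "g \<in> G \<Longrightarrow> h \<in> G \<Longrightarrow> g \<odot> h \<in> G" and G_conj: "g \<in> G \<Longrightarrow> qconj g \<in> G"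
    and G_unit: "g \<in> G \<Longrightarrow> unitH0 g"
    and L: "bounded_linear L0" "bounded_linear L1"
    and L_coords: "g \<in> G \<Longrightarrow> g \<odot> (x0 *\<^sub>R w0 + x1 *\<^sub>R w1) \<odot> qconj (qhat g) =
      L0 (g \<odot> (x0 *\<^sub>R w0 + x1 *\<^sub>R w1) \<odot> qconj (qhat g)) *\<^sub>R w0
      + L1 (g \<odot> (x0 *\<^sub>R w0 + x1 *\<^sub>R w1) \<odot> qconj (qhat g)) *\<^sub>R w1"
begin

lemma pb: "principal_bundle A G P"
  using spin by (simp add: spin_structure_def)

lemma sact_one: "sact P q q_one = q"
  using pb by (simp add: principal_bundle_def)

lemma sact_mult: "g \<in> G \<Longrightarrow> h \<in> G \<Longrightarrow> sact P (sact P q g) h = sact P q (g \<odot> h)"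
  using pb by (simp add: principal_bundle_def)

lemma sact_proj: "g \<in> G \<Longrightarrow> sproj P (sact P q g) = sproj P q"
  using pb by (simp add: principal_bundle_def)

lemma sact_ex1: "sproj P q = sproj P q' \<Longrightarrow> \<exists>!g. g \<in> G \<and> q' = sact P q g"
  using pb by (simp add: principal_bundle_def)

lemma sact_transitive: "sproj P q = sproj P q' \<Longrightarrow> \<exists>g\<in>G. q' = sact P q g"
  using sact_ex1 by blast

lemma sact_inject:
  assumes "g \<in> G" "h \<in> G" "sact P q g = sact P q h"
  shows "g = h"
  using sact_ex1[OF sact_proj[OF assms(1), symmetric]] assms by blast

lemma ssec_cover: "\<exists>U s. (U, s) \<in> ssec P \<and> p \<in> U"
proof -
  have "\<exists>(U, s)\<in>ssec P. p \<in> U" using pb by (simp add: principal_bundle_def)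
  then show ?thesis by blast
qed

lemma ssec_proj:
  assumes "(U, s) \<in> ssec P"
  shows "open U" "p \<in> U \<Longrightarrow> sproj P (s p) = p"
proof -
  have "\<forall>(U, s)\<in>ssec P. open U \<and> (\<forall>p\<in>U. sproj P (s p) = p)"
    using pb by (simp add: principal_bundle_def)
  from bspec[OF this assms] show "open U" "p \<in> U \<Longrightarrow> sproj P (s p) = p" by auto
qed

lemma ssec_transition:
  assumes "(U, s) \<in> ssec P" "(W, t) \<in> ssec P"
  shows "\<exists>g. smooth_fun A (U \<inter> W) g \<and> (\<forall>p\<in>U \<inter> W. g p \<in> G \<and> t p = sact P (s p) (g p))"
proof -
  have "\<forall>(U, s)\<in>ssec P. \<forall>(W, t)\<in>ssec P. \<exists>g. smooth_fun A (U \<inter> W) g \<and>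
       (\<forall>p\<in>U \<inter> W. g p \<in> G \<and> t p = sact P (s p) (g p))"
    using pb unfolding principal_bundle_def by (elim conjE) assumption
  from bspec[OF this assms(1)] have "\<forall>(W, t)\<in>ssec P. \<exists>g. smooth_fun A (U \<inter> W) g \<and>
       (\<forall>p\<in>U \<inter> W. g p \<in> G \<and> t p = sact P (s p) (g p))" by simp
  from bspec[OF this assms(2)] show ?thesis by simp
qed

lemma frame_on: "sframe P q \<in> on_frames V (sproj P q)"
  using spin by (simp add: spin_structure_def)

lemma ssec_frame_smooth:
  assumes "(U, s) \<in> ssec P"
  shows "smooth_section A V U (\<lambda>p. fst (sframe P (s p)))" "smooth_section A V U (\<lambda>p. snd (sframe P (s p)))"
proof -
  have "\<forall>(U, s)\<in>ssec P. smooth_section A V U (\<lambda>p. fst (sframe P (s p))) \<and>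
       smooth_section A V U (\<lambda>p. snd (sframe P (s p)))"
    using spin by (simp add: spin_structure_def)
  from bspec[OF this assms] show "smooth_section A V U (\<lambda>p. fst (sframe P (s p)))"
    "smooth_section A V U (\<lambda>p. snd (sframe P (s p)))" by auto
qed

lemma frame_action:
  "g \<in> G \<Longrightarrow> g \<odot> (x0 *\<^sub>R w0 + x1 *\<^sub>R w1) \<odot> qconj (qhat g) = y0 *\<^sub>R w0 + y1 *\<^sub>R w1 \<Longrightarrow>
     x0 *\<^sub>R fst (sframe P (sact P q g)) + x1 *\<^sub>R snd (sframe P (sact P q g)) =
       y0 *\<^sub>R fst (sframe P q) + y1 *\<^sub>R snd (sframe P q)"
  using spin unfolding spin_structure_def by blast

lemma fibre_nonempty: "\<exists>q. sproj P q = p"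
  using ssec_cover ssec_proj(2) by metis

lemma spin_sectionI:
  assumes "\<And>p. p \<in> U \<Longrightarrow> sproj P (s p) = p"
    and "\<And>W t. (W, t) \<in> ssec P \<Longrightarrow> \<exists>g. smooth_fun A (U \<inter> W) g \<and> (\<forall>p\<in>U \<inter> W. g p \<in> G \<and> s p = sact P (t p) (g p))"
  shows "smooth_spin_section A G P U s"
  unfolding smooth_spin_section_def using assms by auto

lemma spin_sectionD:
  assumes "smooth_spin_section A G P U s"
  shows "p \<in> U \<Longrightarrow> sproj P (s p) = p"
    and "(W, t) \<in> ssec P \<Longrightarrow> \<exists>g. smooth_fun A (U \<inter> W) g \<and> (\<forall>p\<in>U \<inter> W. g p \<in> G \<and> s p = sact P (t p) (g p))"
proof -
  show "p \<in> U \<Longrightarrow> sproj P (s p) = p" using assms by (simp add: smooth_spin_section_def)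
  have *: "\<forall>(W, t)\<in>ssec P. \<exists>g. smooth_fun A (U \<inter> W) g \<and> (\<forall>p\<in>U \<inter> W. g p \<in> G \<and> s p = sact P (t p) (g p))"
    using assms unfolding smooth_spin_section_def by (elim conjE) assumption
  assume "(W, t) \<in> ssec P"
  from bspec[OF * this] show "\<exists>g. smooth_fun A (U \<inter> W) g \<and> (\<forall>p\<in>U \<inter> W. g p \<in> G \<and> s p = sact P (t p) (g p))"
    by simp
qed

lemma spin_section_subset:
  assumes "smooth_spin_section A G P U s" "W \<subseteq> U"
  shows "smooth_spin_section A G P W s"
proof (rule spin_sectionI)
  show "sproj P (s p) = p" if "p \<in> W" for p using spin_sectionD(1)[OF assms(1)] assms(2) that by blast
  fix V t assume "(V, t) \<in> ssec P"
  then obtain g where g: "smooth_fun A (U \<inter> V) g" "\<forall>p\<in>U \<inter> V. g p \<in> G \<and> s p = sact P (t p) (g p)"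
    using spin_sectionD(2)[OF assms(1)] by blast
  have "smooth_fun A (W \<inter> V) g" by (rule smooth_fun_subset[OF g(1)]) (use assms(2) in blast)
  then show "\<exists>g. smooth_fun A (W \<inter> V) g \<and> (\<forall>p\<in>W \<inter> V. g p \<in> G \<and> s p = sact P (t p) (g p))"
    using g(2) assms(2) by blast
qed

text \<open>A section of the atlas is moved through \<open>q\<close> by a constant element of the group.\<close>

lemma spin_section_through:
  assumes "sproj P q = p"
  shows "\<exists>U s. open U \<and> p \<in> U \<and> s p = q \<and> smooth_spin_section A G P U s"
proof -
  obtain U t where t: "(U, t) \<in> ssec P" "p \<in> U" using ssec_cover by blast
  note U = ssec_proj(1)[OF t(1)]
  obtain k where k: "k \<in> G" "q = sact P (t p) k"
    using sact_transitive[of "t p" q] ssec_proj(2)[OF t] assms by auto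
  have "smooth_spin_section A G P U (\<lambda>x. sact P (t x) k)"
  proof (rule spin_sectionI)
    show "sproj P (sact P (t x) k) = x" if "x \<in> U" for x
      using that k(1) ssec_proj(2)[OF t(1)] by (simp add: sact_proj)
    fix W t' assume W: "(W, t') \<in> ssec P"
    obtain g where g: "smooth_fun A (W \<inter> U) g" "\<forall>p\<in>W \<inter> U. g p \<in> G \<and> t p = sact P (t' p) (g p)"
      using ssec_transition[OF W t(1)] by blast
    have "smooth_fun A (U \<inter> W) (\<lambda>x. g x \<odot> k)"
      using g(1) U ssec_proj(1)[OF W]
      by (intro smooth_fun_bilinear[OF bounded_bilinear_qmul] smooth_fun_const) (auto simp: Int_commute)
    moreover have "g x \<odot> k \<in> G \<and> sact P (t x) k = sact P (t' x) (g x \<odot> k)" if "x \<in> U \<inter> W" for x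
      using that g(2) k(1) by (simp add: G_mult sact_mult)
    ultimately show "\<exists>g. smooth_fun A (U \<inter> W) g \<and>
        (\<forall>p\<in>U \<inter> W. g p \<in> G \<and> sact P (t p) k = sact P (t' p) (g p))"
      by (intro exI[of _ "\<lambda>x. g x \<odot> k"]) simp
  qed
  with U t(2) k(2) show ?thesis
    by (intro exI[of _ U] exI[of _ "\<lambda>x. sact P (t x) k"]) simp
qed

text \<open>Compared with a section of the atlas, the frame changes by the coefficients of the smooth function
  \<open>x \<mapsto> g x w (qhat (g x))\<inverse>\<close>.\<close>

lemma spin_section_frame:
  assumes s: "smooth_spin_section A G P U s" and U: "open U"
  shows "smooth_section A V U (\<lambda>p. fst (sframe P (s p)))"
    and "smooth_section A V U (\<lambda>p. snd (sframe P (s p)))"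
proof -
  have *: "smooth_section A V U (\<lambda>p. x0 *\<^sub>R fst (sframe P (s p)) + x1 *\<^sub>R snd (sframe P (s p)))" for x0 x1
  proof (rule smooth_section_local)
    fix p assume p: "p \<in> U"
    obtain W t where t: "(W, t) \<in> ssec P" "p \<in> W" using ssec_cover by blast
    obtain g where g: "smooth_fun A (U \<inter> W) g" "\<forall>p\<in>U \<inter> W. g p \<in> G \<and> s p = sact P (t p) (g p)"
      using spin_sectionD(2)[OF s t(1)] by blast
    have o: "open (U \<inter> W)" using U ssec_proj(1)[OF t(1)] by auto
    let ?z = "\<lambda>p. g p \<odot> (x0 *\<^sub>R w0 + x1 *\<^sub>R w1) \<odot> qconj (qhat (g p))"
    have z: "smooth_fun A (U \<inter> W) ?z"
      by (intro smooth_fun_bilinear[OF bounded_bilinear_qmul o] smooth_fun_const g(1)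
          smooth_fun_linear[OF bounded_linear_qconj o] smooth_fun_linear[OF bounded_linear_qhat o])
    have sm: "smooth_section A V (U \<inter> W)
        (\<lambda>p. L0 (?z p) *\<^sub>R fst (sframe P (t p)) + L1 (?z p) *\<^sub>R snd (sframe P (t p)))"
      by (intro smooth_section_combination[OF o] smooth_fun_linear[OF L(1) o z] smooth_fun_linear[OF L(2) o z]
          smooth_section_subset[OF ssec_frame_smooth(1)[OF t(1)]] smooth_section_subset[OF ssec_frame_smooth(2)[OF t(1)]])
        auto
    have eq: "L0 (?z p) *\<^sub>R fst (sframe P (t p)) + L1 (?z p) *\<^sub>R snd (sframe P (t p)) =
        x0 *\<^sub>R fst (sframe P (s p)) + x1 *\<^sub>R snd (sframe P (s p))" if "p \<in> U \<inter> W" for p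
      using frame_action[OF _ L_coords, of "g p"] g(2) that by simp
    have "smooth_section A V (U \<inter> W) (\<lambda>p. x0 *\<^sub>R fst (sframe P (s p)) + x1 *\<^sub>R snd (sframe P (s p)))"
      by (rule smooth_section_cong[OF eq sm])
    then show "\<exists>W. open W \<and> p \<in> W \<and>
        smooth_section A V W (\<lambda>p. x0 *\<^sub>R fst (sframe P (s p)) + x1 *\<^sub>R snd (sframe P (s p)))"
      using o p t(2) by blast
  qed
  show "smooth_section A V U (\<lambda>p. fst (sframe P (s p)))" "smooth_section A V U (\<lambda>p. snd (sframe P (s p)))"
    using *[of 1 0] *[of 0 1] by simp_all
qed

lemma frame_coords_action:
  assumes g: "g \<in> G" and v: "v \<in> fib V (sproj P q)"
  shows "(- met V (sproj P q) v (fst (sframe P q))) *\<^sub>R w0 + met V (sproj P q) v (snd (sframe P q)) *\<^sub>R w1 =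
    g \<odot> ((- met V (sproj P q) v (fst (sframe P (sact P q g)))) *\<^sub>R w0
       + met V (sproj P q) v (snd (sframe P (sact P q g))) *\<^sub>R w1) \<odot> qconj (qhat g)"
proof -
  let ?p = "sproj P q" and ?q' = "sact P q g"
  have fr: "(fst (sframe P q), snd (sframe P q)) \<in> on_frames V ?p" using frame_on[of q] by simp
  have fr': "(fst (sframe P ?q'), snd (sframe P ?q')) \<in> on_frames V ?p"
    using frame_on[of ?q'] by (simp add: sact_proj[OF g])
  let ?x0 = "- met V ?p v (fst (sframe P ?q'))" and ?x1 = "met V ?p v (snd (sframe P ?q'))"
  let ?z = "g \<odot> (?x0 *\<^sub>R w0 + ?x1 *\<^sub>R w1) \<odot> qconj (qhat g)"
  have "v = ?x0 *\<^sub>R fst (sframe P ?q') + ?x1 *\<^sub>R snd (sframe P ?q')"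
    using frame_expansion[OF fr' v] .
  also have "\<dots> = L0 ?z *\<^sub>R fst (sframe P q) + L1 ?z *\<^sub>R snd (sframe P q)"
    by (rule frame_action[OF g L_coords[OF g]])
  finally have e: "v = L0 ?z *\<^sub>R fst (sframe P q) + L1 ?z *\<^sub>R snd (sframe P q)" .
  have "- met V ?p v (fst (sframe P q)) = L0 ?z \<and> met V ?p v (snd (sframe P q)) = L1 ?z"
    by (rule basis2_unique[OF on_framesD(1)[OF fr]])
      (use e frame_expansion[OF fr v] in \<open>metis\<close>)
  then show ?thesis using L_coords[OF g, of ?x0 ?x1] by simp
qed

end

section \<open>Unit spinor fields as isometries\<close>

locale spin_surface =
  fixes S :: "('m::{t2_space, second_countable_topology}, 'e::real_vector, 'qe, 'qm) spin_surface"
  assumes spin_lorentz_surface: "spin_lorentz_surface S"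
begin

sublocale tangent "atl S" "TB S"
  using spin_lorentz_surface by unfold_locales (auto simp: spin_lorentz_surface_def)

sublocale PE: spin_bundle "atl S" "TB S" "EB S" "PE S" Spin1 "ascale a_sigma_i q_one" q_I
  "\<lambda>z. iota_inv z $ 0" "\<lambda>z. iota_inv z $ 1"
proof (intro spin_bundle.intro spin_bundle_axioms.intro lorentz_bundle.intro lorentz_bundle_axioms.intro
    tangent_axioms)
  show "oriented_lorentz_bundle (atl S) (TB S) (EB S)"
    using spin_lorentz_surface by (auto simp: spin_lorentz_surface_def oriented_lorentz_tangent_bundle_def)
  show "spin_structure (atl S) (EB S) Spin1 (ascale a_sigma_i q_one) q_I (PE S)"
    using spin_lorentz_surface by (auto simp: spin_lorentz_surface_def)
  show "bounded_linear (\<lambda>z. iota_inv z $ 0)" "bounded_linear (\<lambda>z. iota_inv z $ 1)"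
    by (intro bounded_linear_compose[OF bounded_linear_vec_nth] bounded_linear_iota_inv)+
  show "g \<odot> (x0 *\<^sub>R ascale a_sigma_i q_one + x1 *\<^sub>R q_I) \<odot> qconj (qhat g) =
      iota_inv (g \<odot> (x0 *\<^sub>R ascale a_sigma_i q_one + x1 *\<^sub>R q_I) \<odot> qconj (qhat g)) $ 0 *\<^sub>R ascale a_sigma_i q_one
      + iota_inv (g \<odot> (x0 *\<^sub>R ascale a_sigma_i q_one + x1 *\<^sub>R q_I) \<odot> qconj (qhat g)) $ 1 *\<^sub>R q_I"
    if "g \<in> Spin1" for g x0 x1
    using Spin1_action(1)[OF that, of x0 x1] by (auto simp: iota_split)
qed (auto intro: Spin_one Spin_mult Spin_conj Spin_unit)

sublocale PM: spin_bundle "atl S" "TB S" "TB S" "PM S" Spin2 "ascale a_i q_J" q_K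
  "\<lambda>z. iota_inv z $ 2" "\<lambda>z. iota_inv z $ 3"
proof (intro spin_bundle.intro spin_bundle_axioms.intro lorentz_bundle.intro lorentz_bundle_axioms.intro
    tangent_axioms)
  show "oriented_lorentz_bundle (atl S) (TB S) (TB S)"
    using spin_lorentz_surface by (auto simp: spin_lorentz_surface_def oriented_lorentz_tangent_bundle_def)
  show "spin_structure (atl S) (TB S) Spin2 (ascale a_i q_J) q_K (PM S)"
    using spin_lorentz_surface by (auto simp: spin_lorentz_surface_def)
  show "bounded_linear (\<lambda>z. iota_inv z $ 2)" "bounded_linear (\<lambda>z. iota_inv z $ 3)"
    by (intro bounded_linear_compose[OF bounded_linear_vec_nth] bounded_linear_iota_inv)+
  show "g \<odot> (x0 *\<^sub>R ascale a_i q_J + x1 *\<^sub>R q_K) \<odot> qconj (qhat g) =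
      iota_inv (g \<odot> (x0 *\<^sub>R ascale a_i q_J + x1 *\<^sub>R q_K) \<odot> qconj (qhat g)) $ 2 *\<^sub>R ascale a_i q_J
      + iota_inv (g \<odot> (x0 *\<^sub>R ascale a_i q_J + x1 *\<^sub>R q_K) \<odot> qconj (qhat g)) $ 3 *\<^sub>R q_K"
    if "g \<in> Spin2" for g x0 x1
    using Spin2_action(1)[OF that, of x0 x1] by (auto simp: iota_split)
qed (auto intro: Spin_one Spin_mult Spin_conj Spin_unit)

lemma spin_framesD:
  assumes "(q1, q2) \<in> spin_frames S p"
  shows "sproj (PE S) q1 = p" "sproj (PM S) q2 = p"
    "(fst (sframe (PE S) q1), snd (sframe (PE S) q1)) \<in> on_frames (EB S) p"
    "(fst (sframe (PM S) q2), snd (sframe (PM S) q2)) \<in> on_frames (TB S) p"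
proof -
  show p: "sproj (PE S) q1 = p" "sproj (PM S) q2 = p" using assms by (auto simp: spin_frames_def)
  show "(fst (sframe (PE S) q1), snd (sframe (PE S) q1)) \<in> on_frames (EB S) p"
    "(fst (sframe (PM S) q2), snd (sframe (PM S) q2)) \<in> on_frames (TB S) p"
    using PE.frame_on[of q1] PM.frame_on[of q2] p by auto
qed

lemma spin_frames_nonempty: "\<exists>q. q \<in> spin_frames S p"
  using PE.fibre_nonempty[of p] PM.fibre_nonempty[of p] by (auto simp: spin_frames_def)

text \<open>The coordinates of \<open>w\<close> in the frame below the spin frame \<open>q\<close>.\<close>

definition cvec :: "'m \<Rightarrow> 'e \<times> 'm tvec \<Rightarrow> 'qe \<times> 'qm \<Rightarrow> real^4"
  where "cvec p w q = quad
    (- met (EB S) p (fst w) (fst (sframe (PE S) (fst q)))) (met (EB S) p (fst w) (snd (sframe (PE S) (fst q))))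
    (- met (TB S) p (snd w) (fst (sframe (PM S) (snd q)))) (met (TB S) p (snd w) (snd (sframe (PM S) (snd q))))"

lemma vec_coord_cvec: "vec_coord S p w q = iota (cvec p w q)"
  by (cases w, cases q) (simp add: vec_coord_def cvec_def iota_def Let_def split_beta)

text \<open>Each of the two spin groups acts on the coordinates of its own plane and fixes the others, so the
  two transformation rules combine.\<close>

lemma cvec_action:
  assumes q: "(q1, q2) \<in> spin_frames S p" and g: "g1 \<in> Spin1" "g2 \<in> Spin2"
    and w: "v \<in> fib (EB S) p" "X \<in> fib (TB S) p"
  shows "iota (cvec p (v, X) (q1, q2)) =
    (g1 \<odot> g2) \<odot> iota (cvec p (v, X) (sact (PE S) q1 g1, sact (PM S) q2 g2)) \<odot> qconj (qhat (g1 \<odot> g2))"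
proof -
  note p = spin_framesD(1,2)[OF q]
  let ?c = "cvec p (v, X) (q1, q2)" and ?c' = "cvec p (v, X) (sact (PE S) q1 g1, sact (PM S) q2 g2)"
  have 1: "iota (quad (?c $ 0) (?c $ 1) 0 0) = g1 \<odot> iota (quad (?c' $ 0) (?c' $ 1) 0 0) \<odot> qconj (qhat g1)"
    using PE.frame_coords_action[OF g(1), of v q1] w p by (simp only: cvec_def iota_split quad_nth fst_conv snd_conv)
  have 2: "iota (quad 0 0 (?c $ 2) (?c $ 3)) = g2 \<odot> iota (quad 0 0 (?c' $ 2) (?c' $ 3)) \<odot> qconj (qhat g2)"
    using PM.frame_coords_action[OF g(2), of X q2] w p by (simp only: cvec_def iota_split quad_nth fst_conv snd_conv)
  have "iota ?c = iota (quad (?c $ 0) (?c $ 1) 0 0) + iota (quad 0 0 (?c $ 2) (?c $ 3))"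
    by (simp add: iota_split quad_eta[symmetric])
  also have "iota (quad (?c $ 0) (?c $ 1) 0 0) =
      g2 \<odot> (g1 \<odot> iota (quad (?c' $ 0) (?c' $ 1) 0 0) \<odot> qconj (qhat g1)) \<odot> qconj (qhat g2)"
    using Spin2_action(2)[OF g(2), of "?c $ 0" "?c $ 1"] 1 by simp
  also have "\<dots> = (g1 \<odot> g2) \<odot> iota (quad (?c' $ 0) (?c' $ 1) 0 0) \<odot> qconj (qhat (g1 \<odot> g2))"
    unfolding Spin_commute[OF g] by (simp add: qmul_assoc qhat_qmul qconj_qmul)
  also have "iota (quad 0 0 (?c $ 2) (?c $ 3)) =
      g1 \<odot> (g2 \<odot> iota (quad 0 0 (?c' $ 2) (?c' $ 3)) \<odot> qconj (qhat g2)) \<odot> qconj (qhat g1)"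
    using Spin1_action(2)[OF g(1), of "?c $ 2" "?c $ 3"] 2 by simp
  also have "\<dots> = (g1 \<odot> g2) \<odot> iota (quad 0 0 (?c' $ 2) (?c' $ 3)) \<odot> qconj (qhat (g1 \<odot> g2))"
    by (simp add: qmul_assoc qhat_qmul qconj_qmul)
  also have "(g1 \<odot> g2) \<odot> iota (quad (?c' $ 0) (?c' $ 1) 0 0) \<odot> qconj (qhat (g1 \<odot> g2)) + \<dots> =
      (g1 \<odot> g2) \<odot> (iota (quad (?c' $ 0) (?c' $ 1) 0 0) + iota (quad 0 0 (?c' $ 2) (?c' $ 3)))
        \<odot> qconj (qhat (g1 \<odot> g2))"
    by (simp only: qmul.add_left qmul.add_right)
  also have "iota (quad (?c' $ 0) (?c' $ 1) 0 0) + iota (quad 0 0 (?c' $ 2) (?c' $ 3)) = iota ?c'"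
    by (simp add: iota_split quad_eta[symmetric])
  finally show ?thesis .
qed

definition fibre :: "'m \<Rightarrow> ('e \<times> 'm tvec) set"
  where "fibre p = fib (EB S) p \<times> fib (TB S) p"

lemma fibre_closed: "w \<in> fibre p \<Longrightarrow> w' \<in> fibre p \<Longrightarrow> w + w' \<in> fibre p" "w \<in> fibre p \<Longrightarrow> r *\<^sub>R w \<in> fibre p"
  by (auto simp: fibre_def PE.fib_closed TT.fib_closed)

lemma cvec_linear:
  assumes q: "q \<in> spin_frames S p"
  shows "w \<in> fibre p \<Longrightarrow> w' \<in> fibre p \<Longrightarrow> cvec p (w + w') q = cvec p w q + cvec p w' q"
    and "w \<in> fibre p \<Longrightarrow> cvec p (r *\<^sub>R w) q = r *\<^sub>R cvec p w q"
proof -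
  obtain q1 q2 where q': "q = (q1, q2)" by (cases q)
  note f = PE.on_framesD[OF spin_framesD(3)[OF q[unfolded q']]] TT.on_framesD[OF spin_framesD(4)[OF q[unfolded q']]]
  show "w \<in> fibre p \<Longrightarrow> w' \<in> fibre p \<Longrightarrow> cvec p (w + w') q = cvec p w q + cvec p w' q"
    "w \<in> fibre p \<Longrightarrow> cvec p (r *\<^sub>R w) q = r *\<^sub>R cvec p w q"
    using f by (auto simp: cvec_def q' vec4_eq fibre_def PE.met_simps TT.met_simps)
qed

lemma cvec_expand:
  assumes q: "(q1, q2) \<in> spin_frames S p"
  shows "x0 *\<^sub>R fst (sframe (PE S) q1) + x1 *\<^sub>R snd (sframe (PE S) q1) \<in> fib (EB S) p"
    "x2 *\<^sub>R fst (sframe (PM S) q2) + x3 *\<^sub>R snd (sframe (PM S) q2) \<in> fib (TB S) p"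
    "cvec p (x0 *\<^sub>R fst (sframe (PE S) q1) + x1 *\<^sub>R snd (sframe (PE S) q1),
       x2 *\<^sub>R fst (sframe (PM S) q2) + x3 *\<^sub>R snd (sframe (PM S) q2)) (q1, q2) = quad x0 x1 x2 x3"
  using PE.on_framesD[OF spin_framesD(3)[OF q]] TT.on_framesD[OF spin_framesD(4)[OF q]]
  by (auto simp: cvec_def vec4_eq PE.met_simps TT.met_simps)

lemma cvec_surj:
  assumes "q \<in> spin_frames S p"
  shows "\<exists>w\<in>fibre p. cvec p w q = x"
  using cvec_expand[of "fst q" "snd q" p] assms quad_eta[of x] unfolding fibre_def
  by (metis SigmaI prod.collapse)

lemma cvec_ip:
  assumes q: "(q1, q2) \<in> spin_frames S p" and w: "(v, X) \<in> fibre p" "(v', X') \<in> fibre p"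
  shows "ip22 (cvec p (v, X) (q1, q2)) (cvec p (v', X') (q1, q2)) = met (EB S) p v v' + met (TB S) p X X'"
proof -
  let ?e0 = "fst (sframe (PE S) q1)" and ?e1 = "snd (sframe (PE S) q1)"
    and ?e2 = "fst (sframe (PM S) q2)" and ?e3 = "snd (sframe (PM S) q2)"
  note f = spin_framesD(3,4)[OF q]
  note f' = PE.on_framesD[OF f(1)] TT.on_framesD[OF f(2)]
  have vX: "v \<in> fib (EB S) p" "v' \<in> fib (EB S) p" "X \<in> fib (TB S) p" "X' \<in> fib (TB S) p"
    using w by (auto simp: fibre_def)
  have "met (EB S) p v v' = met (EB S) p v ((- met (EB S) p v' ?e0) *\<^sub>R ?e0 + met (EB S) p v' ?e1 *\<^sub>R ?e1)"
    using PE.frame_expansion[OF f(1) vX(2)] by simp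
  moreover have "met (TB S) p X X' = met (TB S) p X ((- met (TB S) p X' ?e2) *\<^sub>R ?e2 + met (TB S) p X' ?e3 *\<^sub>R ?e3)"
    using TT.frame_expansion[OF f(2) vX(4)] by simp
  ultimately show ?thesis
    using f' vX by (simp add: PE.met_simps TT.met_simps ip22_def cvec_def del: scaleR_minus_left)
qed

lemma cvec_inj:
  assumes q: "q \<in> spin_frames S p" and w: "w \<in> fibre p" "w' \<in> fibre p" and eq: "cvec p w q = cvec p w' q"
  shows "w = w'"
proof -
  obtain q1 q2 v X v' X' where q': "q = (q1, q2)" "w = (v, X)" "w' = (v', X')"
    by (cases q, cases w, cases w')
  note f = spin_framesD(3,4)[OF q[unfolded q']]
  have "v = v'" using PE.frame_met_eqI[OF f(1)] w eq by (auto simp: q' fibre_def cvec_def vec4_eq)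
  moreover have "X = X'" using TT.frame_met_eqI[OF f(2)] w eq by (auto simp: q' fibre_def cvec_def vec4_eq)
  ultimately show ?thesis by (simp add: q')
qed

subsection \<open>Spinors\<close>

lemma spin_frames_action:
  assumes "(q1, q2) \<in> spin_frames S p" "(q1', q2') \<in> spin_frames S p"
  obtains g1 g2 where "g1 \<in> Spin1" "g2 \<in> Spin2" "q1' = sact (PE S) q1 g1" "q2' = sact (PM S) q2 g2"
  using PE.sact_transitive[of q1 q1'] PM.sact_transitive[of q2 q2'] spin_framesD(1,2)[OF assms(1)]
    spin_framesD(1,2)[OF assms(2)] by metis

lemma spinor_action:
  assumes "f \<in> spinors S p" "(q1, q2) \<in> spin_frames S p" "g1 \<in> Spin1" "g2 \<in> Spin2"
  shows "f (q1, q2) = g1 \<odot> g2 \<odot> f (sact (PE S) q1 g1, sact (PM S) q2 g2)"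
proof -
  have "\<forall>(q1, q2)\<in>spin_frames S p. \<forall>g1\<in>Spin1. \<forall>g2\<in>Spin2.
       f (q1, q2) = g1 \<odot> g2 \<odot> f (sact (PE S) q1 g1, sact (PM S) q2 g2)"
    using assms(1) by (simp add: spinors_def)
  from bspec[OF this assms(2)] assms(3,4) show ?thesis by simp
qed

lemma spinor_H0: "f \<in> spinors S p \<Longrightarrow> q \<in> spin_frames S p \<Longrightarrow> f q \<in> H0"
  by (simp add: spinors_def)

lemma spinor_zero: "f \<in> spinors S p \<Longrightarrow> q \<notin> spin_frames S p \<Longrightarrow> f q = 0"
  unfolding spinors_def by blast

lemma some_frame: "(SOME q. q \<in> spin_frames S p) \<in> spin_frames S p"
  using spin_frames_nonempty by (rule someI_ex)

lemma spinor_unit_frames: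
  assumes f: "f \<in> spinors S p" and q: "q \<in> spin_frames S p" "q' \<in> spin_frames S p" and u: "unitH0 (f q')"
  shows "unitH0 (f q)"
proof -
  obtain q1 q2 q1' q2' where q': "q = (q1, q2)" "q' = (q1', q2')" by (cases q, cases q')
  obtain g1 g2 where g: "g1 \<in> Spin1" "g2 \<in> Spin2" "q1' = sact (PE S) q1 g1" "q2' = sact (PM S) q2 g2"
    using spin_frames_action q unfolding q' by metis
  show ?thesis
    using spinor_action[OF f q(1)[unfolded q'] g(1,2)] u g Spin_unit
    by (simp add: q' unitH0_closed)
qed

lemma Hpair_unit:
  assumes f: "f \<in> spinors S p"
  shows "Hpair S p f f = (1, 0) \<longleftrightarrow> (\<forall>q\<in>spin_frames S p. unitH0 (f q))"
proof -
  let ?q = "SOME q. q \<in> spin_frames S p"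
  have "Hpair S p f f = (1, 0) \<longleftrightarrow> unitH0 (f ?q)"
    using Hform_unit[OF spinor_H0[OF f some_frame]] by (simp add: Hpair_def Let_def)
  then show ?thesis using spinor_unit_frames[OF f _ some_frame] some_frame by blast
qed

text \<open>The field of maps \<open>w \<mapsto> \<langle>\<langle>w\<cdot>\<phi>, \<phi>\<rangle>\<rangle>\<close> from \<open>E \<oplus> TM\<close> to \<open>\<real>\<^sup>2\<^sup>,\<^sup>2\<close>, which extends \<open>\<xi>\<close>. Everything about
  a unit spinor field is expressed through it.\<close>

definition emb :: "('m \<Rightarrow> ('qe, 'qm) spinor) \<Rightarrow> 'm \<Rightarrow> 'e \<times> 'm tvec \<Rightarrow> real^4"
  where "emb \<phi> p w = iota_inv (qpair S p (clifford S p w (\<phi> p)) (\<phi> p))"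

text \<open>The elements by which the coordinates of the spinor and of the vector change cancel.\<close>

lemma rho_frame_independent:
  assumes f: "f \<in> spinors S p" and q: "q \<in> spin_frames S p" "q' \<in> spin_frames S p" and w: "w \<in> fibre p"
  shows "rho (f q) (cvec p w q) = rho (f q') (cvec p w q')"
proof -
  obtain q1 q2 q1' q2' v X where q': "q = (q1, q2)" "q' = (q1', q2')" "w = (v, X)"
    by (cases q, cases q', cases w)
  obtain g1 g2 where g: "g1 \<in> Spin1" "g2 \<in> Spin2" "q1' = sact (PE S) q1 g1" "q2' = sact (PM S) q2 g2"
    using spin_frames_action q unfolding q' by metis
  have u: "unitH0 (g1 \<odot> g2)" using g Spin_unit unitH0_closed by blast
  have fq: "f q = (g1 \<odot> g2) \<odot> f q'" using spinor_action[OF f q(1)[unfolded q'] g(1,2)] g by (simp add: q')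
  have c: "iota (cvec p w q) = (g1 \<odot> g2) \<odot> iota (cvec p w q') \<odot> qconj (qhat (g1 \<odot> g2))"
    using cvec_action[OF q(1)[unfolded q'] g(1,2)] w g by (simp add: q' fibre_def)
  have "qconj (f q) \<odot> iota (cvec p w q) \<odot> qhat (f q) = qconj (f q') \<odot> iota (cvec p w q') \<odot> qhat (f q')"
    unfolding fq c qconj_qmul[of "g1 \<odot> g2" "f q'"] qhat_qmul[of "g1 \<odot> g2" "f q'"]
    using u by (simp add: qmul_assoc[of _ _ "qconj (qhat (g1 \<odot> g2))"] qmul_assoc[of "qconj (f q')"]
        qmul_assoc[of "iota x" for x] qmul_assoc[of "iota x \<odot> y" for x y] qmul_assoc[of "g1 \<odot> g2"])
  then show ?thesis by (simp add: rho_def)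
qed

lemma qpair_emb:
  assumes f: "\<phi> p \<in> spinors S p" and w: "w \<in> fibre p"
  shows "q \<in> spin_frames S p \<Longrightarrow> emb \<phi> p w = rho (\<phi> p q) (cvec p w q)"
    and "qpair S p (clifford S p w (\<phi> p)) (\<phi> p) = iota (emb \<phi> p w)"
proof -
  let ?q = "SOME q. q \<in> spin_frames S p"
  have "qpair S p (clifford S p w (\<phi> p)) (\<phi> p) = - (qconj (\<phi> p ?q) \<odot> iota (cvec p w ?q) \<odot> qhat (\<phi> p ?q))"
    using some_frame by (simp add: qpair_def clifford_def Let_def vec_coord_cvec ascale_qmul ascale_ascale
        amul_sigma_i ascale_one qmul_assoc)
  also have "\<dots> = iota (rho (\<phi> p ?q) (cvec p w ?q))"
    by (rule iota_rho[OF spinor_H0[OF f some_frame], symmetric])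
  finally have e: "qpair S p (clifford S p w (\<phi> p)) (\<phi> p) = iota (rho (\<phi> p ?q) (cvec p w ?q))" .
  then show "qpair S p (clifford S p w (\<phi> p)) (\<phi> p) = iota (emb \<phi> p w)"
    by (simp add: emb_def)
  show "emb \<phi> p w = rho (\<phi> p q) (cvec p w q)" if "q \<in> spin_frames S p"
    unfolding emb_def e using rho_frame_independent[OF f that some_frame w] by simp
qed

lemma unit_spinorD:
  assumes "unit_spinor_field S \<phi>"
  shows "\<phi> p \<in> spinors S p" "q \<in> spin_frames S p \<Longrightarrow> unitH0 (\<phi> p q)"
proof -
  show s: "\<phi> p \<in> spinors S p" using assms by (simp add: unit_spinor_field_def spinor_field_def)
  then show "q \<in> spin_frames S p \<Longrightarrow> unitH0 (\<phi> p q)"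
    using Hpair_unit[OF s] assms by (simp add: unit_spinor_field_def)
qed

lemma
  assumes \<phi>: "unit_spinor_field S \<phi>"
  shows emb_add: "w \<in> fibre p \<Longrightarrow> w' \<in> fibre p \<Longrightarrow> emb \<phi> p (w + w') = emb \<phi> p w + emb \<phi> p w'"
    and emb_scale: "w \<in> fibre p \<Longrightarrow> emb \<phi> p (r *\<^sub>R w) = r *\<^sub>R emb \<phi> p w"
    and emb_isometry: "(v, X) \<in> fibre p \<Longrightarrow> (v', X') \<in> fibre p \<Longrightarrow>
      ip22 (emb \<phi> p (v, X)) (emb \<phi> p (v', X')) = met (EB S) p v v' + met (TB S) p X X'"
    and emb_inj: "w \<in> fibre p \<Longrightarrow> w' \<in> fibre p \<Longrightarrow> emb \<phi> p w = emb \<phi> p w' \<Longrightarrow> w = w'"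
    and emb_surj: "\<exists>w\<in>fibre p. emb \<phi> p w = x"
proof -
  obtain q where q: "q \<in> spin_frames S p" using spin_frames_nonempty by blast
  note e = qpair_emb(1)[where \<phi> = \<phi>, OF unit_spinorD(1)[OF \<phi>] _ q] and u = unit_spinorD(2)[OF \<phi> q]
  show "emb \<phi> p (w + w') = emb \<phi> p w + emb \<phi> p w'" if "w \<in> fibre p" "w' \<in> fibre p"
    using that by (simp add: e fibre_closed cvec_linear[OF q] rho_simps)
  show "emb \<phi> p (r *\<^sub>R w) = r *\<^sub>R emb \<phi> p w" if "w \<in> fibre p"
    using that by (simp add: e fibre_closed cvec_linear[OF q] rho_simps)
  show "ip22 (emb \<phi> p (v, X)) (emb \<phi> p (v', X')) = met (EB S) p v v' + met (TB S) p X X'"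
    if "(v, X) \<in> fibre p" "(v', X') \<in> fibre p"
    using that cvec_ip[of "fst q" "snd q"] q by (simp add: e rho_isometry[OF u])
  show "w = w'" if "w \<in> fibre p" "w' \<in> fibre p" "emb \<phi> p w = emb \<phi> p w'"
    using cvec_inj[OF q that(1,2)] rho_inj[OF u] that by (simp add: e)
  show "\<exists>w\<in>fibre p. emb \<phi> p w = x"
  proof -
    obtain y where y: "rho (\<phi> p q) y = x" using rho_surj[OF u] by blast
    obtain w where "w \<in> fibre p" "cvec p w q = y" using cvec_surj[OF q] by blast
    then show ?thesis using e y by metis
  qed
qed

end

lemma quad_linear_comb: "quad a b c d = a *\<^sub>R quad 1 0 0 0 + b *\<^sub>R quad 0 1 0 0 + c *\<^sub>R quad 0 0 1 0 + d *\<^sub>R quad 0 0 0 1"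
  by (simp add: vec4_eq)

lemma (in atlas) smooth_fun_quad:
  assumes "open U" "smooth_fun A U a" "smooth_fun A U b" "smooth_fun A U c" "smooth_fun A U d"
  shows "smooth_fun A U (\<lambda>x. quad (a x) (b x) (c x) (d x))"
  unfolding quad_linear_comb[of "a x" "b x" "c x" "d x" for x]
  by (intro smooth_fun_add smooth_fun_scaleR smooth_fun_const assms)

lemma (in atlas) mdiff_quad:
  assumes U: "open U" "p \<in> U" and s: "smooth_fun A U a" "smooth_fun A U b" "smooth_fun A U c" "smooth_fun A U d"
  shows "mdiff A (\<lambda>x. quad (a x) (b x) (c x) (d x)) p X =
    quad (mdiff A a p X) (mdiff A b p X) (mdiff A c p X) (mdiff A d p X)"
proof -
  have *: "mdiff A (\<lambda>x. f x *\<^sub>R k) p X = mdiff A f p X *\<^sub>R k" if "smooth_fun A U f" for f and k :: "real^4"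
    using mdiff_scaleR[OF that smooth_fun_const U(2), of k X] by simp
  have sm: "smooth_fun A U (\<lambda>x. f x *\<^sub>R k)" if "smooth_fun A U f" for f and k :: "real^4"
    by (intro smooth_fun_scaleR U that smooth_fun_const)
  show ?thesis
    unfolding quad_linear_comb[of "a x" "b x" "c x" "d x" for x]
      quad_linear_comb[of "mdiff A a p X" "mdiff A b p X" "mdiff A c p X" "mdiff A d p X"]
    using s by (simp add: mdiff_add[where U = U] smooth_fun_add sm U *)
qed

text \<open>A linear retraction onto \<open>H0\<close>; composing with it shows that derivatives of functions with values in
  \<open>H0\<close> have values in \<open>H0\<close>.\<close>

definition H0_projection :: "HAC \<Rightarrow> HAC"
  where "H0_projection z = h0 (Re (fst (fst z))) (Re (snd (fst z))) (Im (fst (fst (snd z)))) (Im (snd (fst (snd z))))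
    (Re (fst (fst (snd (snd z))))) (Re (snd (fst (snd (snd z))))) (Im (fst (snd (snd (snd z))))) (Im (snd (snd (snd (snd z)))))"

lemma H0_projection: "z \<in> H0 \<Longrightarrow> H0_projection z = z" "H0_projection z \<in> H0" "bounded_linear H0_projection"
proof -
  show "z \<in> H0 \<Longrightarrow> H0_projection z = z" by (elim H0E) (simp add: H0_projection_def h0_def)
  show "H0_projection z \<in> H0" by (simp add: H0_projection_def)
  show "bounded_linear H0_projection"
    unfolding linear_conv_bounded_linear[symmetric]
    by (rule linearI) (simp_all add: H0_projection_def h0_ops)
qed

context spin_surface
begin

lemma spinor_coord_smooth:
  assumes \<phi>: "spinor_field S \<phi>" and U: "open U"
    and s: "smooth_spin_section (atl S) Spin1 (PE S) U s1" "smooth_spin_section (atl S) Spin2 (PM S) U s2"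
  shows "smooth_fun (atl S) U (\<lambda>x. \<phi> x (s1 x, s2 x))"
proof (rule smooth_fun_local)
  fix p assume p: "p \<in> U"
  obtain W1 t1 where t1: "(W1, t1) \<in> ssec (PE S)" "p \<in> W1" using PE.ssec_cover by blast
  obtain W2 t2 where t2: "(W2, t2) \<in> ssec (PM S)" "p \<in> W2" using PM.ssec_cover by blast
  obtain g1 where g1: "smooth_fun (atl S) (U \<inter> W1) g1" "\<forall>p\<in>U \<inter> W1. g1 p \<in> Spin1 \<and> s1 p = sact (PE S) (t1 p) (g1 p)"
    using PE.spin_sectionD(2)[OF s(1) t1(1)] by blast
  obtain g2 where g2: "smooth_fun (atl S) (U \<inter> W2) g2" "\<forall>p\<in>U \<inter> W2. g2 p \<in> Spin2 \<and> s2 p = sact (PM S) (t2 p) (g2 p)"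
    using PM.spin_sectionD(2)[OF s(2) t2(1)] by blast
  let ?W = "U \<inter> W1 \<inter> W2"
  have o: "open ?W" using U PE.ssec_proj(1)[OF t1(1)] PM.ssec_proj(1)[OF t2(1)] by auto
  have "\<forall>(U, s1)\<in>ssec (PE S). \<forall>(V, s2)\<in>ssec (PM S). smooth_fun (atl S) (U \<inter> V) (\<lambda>p. \<phi> p (s1 p, s2 p))"
    using \<phi> by (simp add: spinor_field_def)
  from bspec[OF this t1(1)] t2(1) have "smooth_fun (atl S) (W1 \<inter> W2) (\<lambda>p. \<phi> p (t1 p, t2 p))" by auto
  then have sm: "smooth_fun (atl S) ?W (\<lambda>p. \<phi> p (t1 p, t2 p))" by (rule smooth_fun_subset) auto
  have "smooth_fun (atl S) ?W g1" "smooth_fun (atl S) ?W g2"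
    by (rule smooth_fun_subset[OF g1(1)], blast) (rule smooth_fun_subset[OF g2(1)], blast)
  then have sm': "smooth_fun (atl S) ?W (\<lambda>x. qconj (g1 x \<odot> g2 x) \<odot> \<phi> x (t1 x, t2 x))"
    by (intro smooth_fun_bilinear[OF bounded_bilinear_qmul o] smooth_fun_linear[OF bounded_linear_qconj o] sm)
  have eq: "qconj (g1 x \<odot> g2 x) \<odot> \<phi> x (t1 x, t2 x) = \<phi> x (s1 x, s2 x)" if "x \<in> ?W" for x
  proof -
    have x: "(t1 x, t2 x) \<in> spin_frames S x"
      using that PE.ssec_proj(2)[OF t1(1)] PM.ssec_proj(2)[OF t2(1)] by (auto simp: spin_frames_def)
    have g: "g1 x \<in> Spin1" "g2 x \<in> Spin2" using that g1(2) g2(2) by auto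
    have "unitH0 (g1 x \<odot> g2 x)" using g Spin_unit unitH0_closed by blast
    then show ?thesis
      using spinor_action[of "\<phi> x" x, OF _ x g] \<phi> that g1(2) g2(2)
      by (simp add: spinor_field_def qmul_assoc[of "g1 x \<odot> g2 x", symmetric])
  qed
  have "smooth_fun (atl S) ?W (\<lambda>x. \<phi> x (s1 x, s2 x))"
    by (rule smooth_fun_cong[OF o eq sm'])
  then show "\<exists>W. open W \<and> p \<in> W \<and> smooth_fun (atl S) W (\<lambda>x. \<phi> x (s1 x, s2 x))"
    using o p t1(2) t2(2) by blast
qed

text \<open>The sections are those selected by the choice operator in the definition of \<open>spin_nabla\<close>, on a common
  domain.\<close>

lemma spin_nabla_section:
  assumes q: "q \<in> spin_frames S p"
  obtains U s1 s2 where "open U" "p \<in> U" "smooth_spin_section (atl S) Spin1 (PE S) U s1"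
    "smooth_spin_section (atl S) Spin2 (PM S) U s2" "(s1 p, s2 p) = q"
    "\<And>X \<phi>. spin_nabla S p X \<phi> q = mdiff (atl S) (\<lambda>x. \<phi> x (s1 x, s2 x)) p X
        - (1/2 * met (EB S) p (nab (EB S) p X (\<lambda>x. fst (sframe (PE S) (s1 x)))) (snd (sframe (PE S) (s1 p))))
            *\<^sub>R (ascale a_sigma_i q_I \<odot> \<phi> p q)
        - (1/2 * met (TB S) p (nab (TB S) p X (\<lambda>x. fst (sframe (PM S) (s2 x)))) (snd (sframe (PM S) (s2 p))))
            *\<^sub>R (ascale a_i q_I \<odot> \<phi> p q)"
proof -
  define P where "P = (\<lambda>(s1, s2). (s1 p, s2 p) = q \<and> (\<exists>U. open U \<and> p \<in> U \<and>
           smooth_spin_section (atl S) Spin1 (PE S) U s1 \<and> smooth_spin_section (atl S) Spin2 (PM S) U s2))"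
  obtain q1 q2 where q': "q = (q1, q2)" by (cases q)
  obtain U1 s1 where s1: "open U1" "p \<in> U1" "s1 p = q1" "smooth_spin_section (atl S) Spin1 (PE S) U1 s1"
    using PE.spin_section_through spin_framesD(1)[OF q[unfolded q']] by blast
  obtain U2 s2 where s2: "open U2" "p \<in> U2" "s2 p = q2" "smooth_spin_section (atl S) Spin2 (PM S) U2 s2"
    using PM.spin_section_through spin_framesD(2)[OF q[unfolded q']] by blast
  have "P (s1, s2)"
    unfolding P_def using s1 s2 PE.spin_section_subset[OF s1(4), of "U1 \<inter> U2"]
      PM.spin_section_subset[OF s2(4), of "U1 \<inter> U2"]
    by (auto simp: q' intro!: exI[of _ "U1 \<inter> U2"])
  then have Pk: "P (Eps P)" by (rule someI)
  obtain t1 t2 where t: "Eps P = (t1, t2)" by (cases "Eps P")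
  obtain U where U: "open U" "p \<in> U" "smooth_spin_section (atl S) Spin1 (PE S) U t1"
    "smooth_spin_section (atl S) Spin2 (PM S) U t2" "(t1 p, t2 p) = q"
    using Pk unfolding t by (auto simp: P_def)
  show ?thesis
  proof (rule that[OF U])
    fix X \<phi>
    show "spin_nabla S p X \<phi> q = mdiff (atl S) (\<lambda>x. \<phi> x (t1 x, t2 x)) p X
        - (1/2 * met (EB S) p (nab (EB S) p X (\<lambda>x. fst (sframe (PE S) (t1 x)))) (snd (sframe (PE S) (t1 p))))
            *\<^sub>R (ascale a_sigma_i q_I \<odot> \<phi> p q)
        - (1/2 * met (TB S) p (nab (TB S) p X (\<lambda>x. fst (sframe (PM S) (t2 x)))) (snd (sframe (PM S) (t2 p))))
            *\<^sub>R (ascale a_i q_I \<odot> \<phi> p q)"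
      unfolding spin_nabla_def P_def[symmetric] t using q by (simp add: Let_def)
  qed
qed

lemma spin_frame_sections:
  assumes U: "open U" and s: "smooth_spin_section (atl S) Spin1 (PE S) U s1"
    "smooth_spin_section (atl S) Spin2 (PM S) U s2"
  shows "x \<in> U \<Longrightarrow> (s1 x, s2 x) \<in> spin_frames S x"
    and "smooth_section (atl S) (EB S) U v \<Longrightarrow> smooth_section (atl S) (TB S) U Y \<Longrightarrow>
      smooth_fun (atl S) U (\<lambda>x. cvec x (v x, Y x) (s1 x, s2 x))"
proof -
  show "x \<in> U \<Longrightarrow> (s1 x, s2 x) \<in> spin_frames S x"
    using PE.spin_sectionD(1)[OF s(1)] PM.spin_sectionD(1)[OF s(2)] by (simp add: spin_frames_def)
  assume "smooth_section (atl S) (EB S) U v" "smooth_section (atl S) (TB S) U Y"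
  then show "smooth_fun (atl S) U (\<lambda>x. cvec x (v x, Y x) (s1 x, s2 x))"
    unfolding cvec_def fst_conv snd_conv
    by (intro smooth_fun_quad smooth_fun_minus PE.met_smooth TT.met_smooth U
        PE.spin_section_frame[OF s(1) U] PM.spin_section_frame[OF s(2) U])
qed

lemma rho_smooth:
  assumes U: "open U" and "smooth_fun (atl S) U f" "smooth_fun (atl S) U c"
  shows "smooth_fun (atl S) U (\<lambda>x. rho (f x) (c x))"
  unfolding rho_def
  by (intro smooth_fun_linear[OF bounded_linear_iota_inv] smooth_fun_minus U assms
      smooth_fun_bilinear[OF bounded_bilinear_qmul] smooth_fun_linear[OF bounded_linear_qconj]
      smooth_fun_linear[OF bounded_linear_qhat] smooth_fun_linear[OF bounded_linear_iota])

lemma emb_smooth: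
  assumes \<phi>: "unit_spinor_field S \<phi>" and U: "open U"
    and w: "smooth_section (atl S) (EB S) U v" "smooth_section (atl S) (TB S) U Y"
  shows "smooth_fun (atl S) U (\<lambda>x. emb \<phi> x (v x, Y x))"
proof (rule smooth_fun_local)
  fix p assume p: "p \<in> U"
  obtain q where "q \<in> spin_frames S p" using spin_frames_nonempty by blast
  then obtain U' s1 s2 where s: "open U'" "p \<in> U'" "smooth_spin_section (atl S) Spin1 (PE S) U' s1"
    "smooth_spin_section (atl S) Spin2 (PM S) U' s2"
    by (rule spin_nabla_section)
  let ?W = "U \<inter> U'"
  have o: "open ?W" using U s by auto
  have sf: "spinor_field S \<phi>" using \<phi> by (simp add: unit_spinor_field_def)
  have f: "smooth_fun (atl S) ?W (\<lambda>x. \<phi> x (s1 x, s2 x))"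
    by (rule smooth_fun_subset[OF spinor_coord_smooth[OF sf s(1,3,4)]]) auto
  have "smooth_fun (atl S) ?W (\<lambda>x. met (EB S) x (v x) (fst (sframe (PE S) (s1 x))))"
      "smooth_fun (atl S) ?W (\<lambda>x. met (EB S) x (v x) (snd (sframe (PE S) (s1 x))))"
      "smooth_fun (atl S) ?W (\<lambda>x. met (TB S) x (Y x) (fst (sframe (PM S) (s2 x))))"
      "smooth_fun (atl S) ?W (\<lambda>x. met (TB S) x (Y x) (snd (sframe (PM S) (s2 x))))"
    by (intro PE.met_smooth TT.met_smooth o PE.smooth_section_subset[OF w(1)] TT.smooth_section_subset[OF w(2)]
        PE.smooth_section_subset[OF PE.spin_section_frame(1)[OF s(3,1)]]
        PE.smooth_section_subset[OF PE.spin_section_frame(2)[OF s(3,1)]]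
        TT.smooth_section_subset[OF PM.spin_section_frame(1)[OF s(4,1)]]
        TT.smooth_section_subset[OF PM.spin_section_frame(2)[OF s(4,1)]]; blast)+
  then have c: "smooth_fun (atl S) ?W (\<lambda>x. cvec x (v x, Y x) (s1 x, s2 x))"
    unfolding cvec_def fst_conv snd_conv by (intro smooth_fun_quad smooth_fun_minus o)
  have "smooth_fun (atl S) ?W (\<lambda>x. emb \<phi> x (v x, Y x))"
  proof (rule smooth_fun_cong[OF o _ rho_smooth[OF o f c]])
    fix x assume x: "x \<in> ?W"
    have "(v x, Y x) \<in> fibre x"
      using x PE.smooth_section_fib[OF w(1)] TT.smooth_section_fib[OF w(2)] by (simp add: fibre_def)
    then show "rho (\<phi> x (s1 x, s2 x)) (cvec x (v x, Y x) (s1 x, s2 x)) = emb \<phi> x (v x, Y x)"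
      using qpair_emb(1)[where \<phi> = \<phi>, OF unit_spinorD(1)[OF \<phi>] _ spin_frame_sections(1)[OF s(1,3,4)]] x
      by simp
  qed
  then show "\<exists>W. open W \<and> p \<in> W \<and> smooth_fun (atl S) W (\<lambda>x. emb \<phi> x (v x, Y x))"
    using o p s(2) by blast
qed

text \<open>Differentiating the coordinates covariantly leaves the covariant derivatives of the frame vectors,
  which are given by the two connection forms \<open>\<omega>\<close> and \<open>\<eta>\<close>.\<close>

lemma cvec_derivative:
  assumes U: "open U" "p \<in> U" and X: "X \<in> fib (TB S) p"
    and s: "smooth_spin_section (atl S) Spin1 (PE S) U s1" "smooth_spin_section (atl S) Spin2 (PM S) U s2"
    and w: "smooth_section (atl S) (EB S) U v" "smooth_section (atl S) (TB S) U Y"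
  defines "\<omega> \<equiv> met (EB S) p (nab (EB S) p X (\<lambda>x. fst (sframe (PE S) (s1 x)))) (snd (sframe (PE S) (s1 p)))"
    and "\<eta> \<equiv> met (TB S) p (nab (TB S) p X (\<lambda>x. fst (sframe (PM S) (s2 x)))) (snd (sframe (PM S) (s2 p)))"
    and "c \<equiv> cvec p (v p, Y p) (s1 p, s2 p)"
  shows "mdiff (atl S) (\<lambda>x. cvec x (v x, Y x) (s1 x, s2 x)) p X =
    cvec p (nab (EB S) p X v, nab (TB S) p X Y) (s1 p, s2 p)
      - quad (\<omega> * c $ 1) (\<omega> * c $ 0) (\<eta> * c $ 3) (\<eta> * c $ 2)"
proof -
  let ?e0 = "\<lambda>x. fst (sframe (PE S) (s1 x))" and ?e1 = "\<lambda>x. snd (sframe (PE S) (s1 x))"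
  let ?e2 = "\<lambda>x. fst (sframe (PM S) (s2 x))" and ?e3 = "\<lambda>x. snd (sframe (PM S) (s2 x))"
  note q = spin_frame_sections(1)[OF U(1) s]
  note e = PE.spin_section_frame[OF s(1) U(1)] PM.spin_section_frame[OF s(2) U(1)]
  note on1 = spin_framesD(3)[OF q] and on2 = spin_framesD(4)[OF q]
  have n: "nab (EB S) p X ?e0 = \<omega> *\<^sub>R ?e1 p" "nab (EB S) p X ?e1 = \<omega> *\<^sub>R ?e0 p"
    "nab (TB S) p X ?e2 = \<eta> *\<^sub>R ?e3 p" "nab (TB S) p X ?e3 = \<eta> *\<^sub>R ?e2 p"
    unfolding \<omega>_def \<eta>_def
    using PE.nab_frame[OF U(1) e(1,2) on1 U(2) X] TT.nab_frame[OF U(1) e(3,4) on2 U(2) X] by auto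
  note f = PE.on_framesD[OF on1[OF U(2)]] TT.on_framesD[OF on2[OF U(2)]]
  have vY: "v p \<in> fib (EB S) p" "Y p \<in> fib (TB S) p"
    using PE.smooth_section_fib[OF w(1) U(2)] TT.smooth_section_fib[OF w(2) U(2)] .
  have m: "smooth_fun (atl S) U (\<lambda>x. met (EB S) x (v x) (?e0 x))" "smooth_fun (atl S) U (\<lambda>x. met (EB S) x (v x) (?e1 x))"
    "smooth_fun (atl S) U (\<lambda>x. met (TB S) x (Y x) (?e2 x))" "smooth_fun (atl S) U (\<lambda>x. met (TB S) x (Y x) (?e3 x))"
    by (intro PE.met_smooth TT.met_smooth U(1) w e)+
  have "mdiff (atl S) (\<lambda>x. met (EB S) x (v x) (?e0 x)) p X = met (EB S) p (nab (EB S) p X v) (?e0 p) + \<omega> * c $ 1"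
    using PE.nab_metric[OF U(1) w(1) e(1) U(2) X] vY f
    by (simp add: PE.met_scale_right n c_def cvec_def)
  moreover have "mdiff (atl S) (\<lambda>x. met (EB S) x (v x) (?e1 x)) p X = met (EB S) p (nab (EB S) p X v) (?e1 p) - \<omega> * c $ 0"
    using PE.nab_metric[OF U(1) w(1) e(2) U(2) X] vY f
    by (simp add: PE.met_scale_right n c_def cvec_def)
  moreover have "mdiff (atl S) (\<lambda>x. met (TB S) x (Y x) (?e2 x)) p X = met (TB S) p (nab (TB S) p X Y) (?e2 p) + \<eta> * c $ 3"
    using TT.nab_metric[OF U(1) w(2) e(3) U(2) X] vY f
    by (simp add: TT.met_scale_right n c_def cvec_def)
  moreover have "mdiff (atl S) (\<lambda>x. met (TB S) x (Y x) (?e3 x)) p X = met (TB S) p (nab (TB S) p X Y) (?e3 p) - \<eta> * c $ 2"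
    using TT.nab_metric[OF U(1) w(2) e(4) U(2) X] vY f
    by (simp add: TT.met_scale_right n c_def cvec_def)
  moreover have "mdiff (atl S) (\<lambda>x. cvec x (v x, Y x) (s1 x, s2 x)) p X = quad
      (- mdiff (atl S) (\<lambda>x. met (EB S) x (v x) (?e0 x)) p X) (mdiff (atl S) (\<lambda>x. met (EB S) x (v x) (?e1 x)) p X)
      (- mdiff (atl S) (\<lambda>x. met (TB S) x (Y x) (?e2 x)) p X) (mdiff (atl S) (\<lambda>x. met (TB S) x (Y x) (?e3 x)) p X)"
    unfolding cvec_def fst_conv snd_conv
    using mdiff_quad[OF U smooth_fun_minus[OF U(1) m(1)] m(2) smooth_fun_minus[OF U(1) m(3)] m(4), of X]
    by (simp add: mdiff_minus[OF m(1) U(2)] mdiff_minus[OF m(3) U(2)])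
  ultimately show ?thesis
    by (simp add: vec4_eq cvec_def)
qed

lemma spin_nabla_linear:
  assumes \<phi>: "spinor_field S \<phi>" and q: "q \<in> spin_frames S p"
    and X: "X \<in> fib (TB S) p" "Y \<in> fib (TB S) p"
  shows "spin_nabla S p (X + Y) \<phi> q = spin_nabla S p X \<phi> q + spin_nabla S p Y \<phi> q"
    and "spin_nabla S p (r *\<^sub>R X) \<phi> q = r *\<^sub>R spin_nabla S p X \<phi> q"
proof -
  obtain U s1 s2 where s: "open U" "p \<in> U" "smooth_spin_section (atl S) Spin1 (PE S) U s1"
    "smooth_spin_section (atl S) Spin2 (PM S) U s2" "(s1 p, s2 p) = q"
    "\<And>X \<phi>. spin_nabla S p X \<phi> q = mdiff (atl S) (\<lambda>x. \<phi> x (s1 x, s2 x)) p X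
        - (1/2 * met (EB S) p (nab (EB S) p X (\<lambda>x. fst (sframe (PE S) (s1 x)))) (snd (sframe (PE S) (s1 p))))
            *\<^sub>R (ascale a_sigma_i q_I \<odot> \<phi> p q)
        - (1/2 * met (TB S) p (nab (TB S) p X (\<lambda>x. fst (sframe (PM S) (s2 x)))) (snd (sframe (PM S) (s2 p))))
            *\<^sub>R (ascale a_i q_I \<odot> \<phi> p q)"
    by (rule spin_nabla_section[OF q], rule that) assumption+
  note e = PE.spin_section_frame[OF s(3,1)] PM.spin_section_frame[OF s(4,1)]
  note sm = spinor_coord_smooth[OF \<phi> s(1,3,4)]
  have q': "(s1 p, s2 p) \<in> spin_frames S p" using s(5) q by simp
  note f = PE.on_framesD[OF spin_framesD(3)[OF q']] TT.on_framesD[OF spin_framesD(4)[OF q']]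
  note nf = PE.nab_fib[OF s(1) e(1) s(2) X(1)] PE.nab_fib[OF s(1) e(1) s(2) X(2)]
    TT.nab_fib[OF s(1) e(3) s(2) X(1)] TT.nab_fib[OF s(1) e(3) s(2) X(2)]
  show "spin_nabla S p (X + Y) \<phi> q = spin_nabla S p X \<phi> q + spin_nabla S p Y \<phi> q"
    unfolding s(6) mdiff_direction(1)[OF sm s(2)] PE.nab_dir_add[OF s(1) e(1) s(2) X]
      TT.nab_dir_add[OF s(1) e(3) s(2) X] PE.met_add[OF nf(1,2) f(3)] TT.met_add[OF nf(3,4) f(10)]
    by (simp add: algebra_simps)
  show "spin_nabla S p (r *\<^sub>R X) \<phi> q = r *\<^sub>R spin_nabla S p X \<phi> q"
    unfolding s(6) mdiff_direction(2)[OF sm s(2)] PE.nab_dir_scale[OF s(1) e(1) s(2) X(1)]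
      TT.nab_dir_scale[OF s(1) e(3) s(2) X(1)] PE.met_scale[OF nf(1) f(3)] TT.met_scale[OF nf(3) f(10)]
    by (simp add: algebra_simps)
qed

text \<open>The coordinate \<open>f\<close> of the spinor takes unit values, so its derivative is \<open>M \<odot> f\<close> with an imaginary
  \<open>M\<close>. The connection terms of the spinor derivative change the components \<open>n1\<close> and \<open>m1\<close> of \<open>M\<close> by
  \<open>- \<omega> / 2\<close> and \<open>- \<eta> / 2\<close>; by \<open>cvec_derivative\<close> the same correction arises when the derivative of
  \<open>rho (f x)\<close> applied to the coordinates of \<open>(v, Y)\<close> is written with covariant derivatives.\<close>

lemma spin_derivative:
  assumes \<phi>: "unit_spinor_field S \<phi>" and q: "q \<in> spin_frames S p" and X: "X \<in> fib (TB S) p"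
  obtains a1 b1 a2 b2 a3 b3 where
    "spin_nabla S p X \<phi> q = h0 0 0 a1 b1 a2 b2 a3 b3 \<odot> \<phi> p q"
    "\<And>U v Y. open U \<Longrightarrow> p \<in> U \<Longrightarrow> smooth_section (atl S) (EB S) U v \<Longrightarrow> smooth_section (atl S) (TB S) U Y \<Longrightarrow>
      mdiff (atl S) (\<lambda>x. emb \<phi> x (v x, Y x)) p X = rho (\<phi> p q)
        (cvec p (nab (EB S) p X v, nab (TB S) p X Y) q + imag_action a1 b1 a2 b2 a3 b3 (cvec p (v p, Y p) q))"
proof -
  obtain U s1 s2 where s: "open U" "p \<in> U" "smooth_spin_section (atl S) Spin1 (PE S) U s1"
    "smooth_spin_section (atl S) Spin2 (PM S) U s2" "(s1 p, s2 p) = q"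
    "\<And>X \<phi>. spin_nabla S p X \<phi> q = mdiff (atl S) (\<lambda>x. \<phi> x (s1 x, s2 x)) p X
        - (1/2 * met (EB S) p (nab (EB S) p X (\<lambda>x. fst (sframe (PE S) (s1 x)))) (snd (sframe (PE S) (s1 p))))
            *\<^sub>R (ascale a_sigma_i q_I \<odot> \<phi> p q)
        - (1/2 * met (TB S) p (nab (TB S) p X (\<lambda>x. fst (sframe (PM S) (s2 x)))) (snd (sframe (PM S) (s2 p))))
            *\<^sub>R (ascale a_i q_I \<odot> \<phi> p q)"
    by (rule spin_nabla_section[OF q], rule that) assumption+
  define \<omega> where "\<omega> = met (EB S) p (nab (EB S) p X (\<lambda>x. fst (sframe (PE S) (s1 x)))) (snd (sframe (PE S) (s1 p)))"
  define \<eta> where "\<eta> = met (TB S) p (nab (TB S) p X (\<lambda>x. fst (sframe (PM S) (s2 x)))) (snd (sframe (PM S) (s2 p)))"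
  define f where "f = (\<lambda>x. \<phi> x (s1 x, s2 x))"
  define u where "u = \<phi> p q"
  define G where "G = h0 0 0 (\<eta> / 2) (\<omega> / 2) 0 0 0 0"
  define df where "df = mdiff (atl S) f p X"
  define M where "M = df \<odot> qconj u"
  have sf: "spinor_field S \<phi>" using \<phi> by (simp add: unit_spinor_field_def)
  have fs: "smooth_fun (atl S) U f" unfolding f_def by (rule spinor_coord_smooth[OF sf s(1,3,4)])
  have fu: "unitH0 (f x)" if "x \<in> U" for x
    unfolding f_def by (rule unit_spinorD(2)[OF \<phi> spin_frame_sections(1)[OF s(1,3,4) that]])
  have fp: "f p = u" by (simp add: f_def u_def s(5))
  have u: "unitH0 u" "u \<in> H0" using fu[OF s(2)] unitH0_H0 by (auto simp: fp)
  have "mdiff (atl S) (\<lambda>x. H0_projection (f x)) p X = mdiff (atl S) f p X"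
    by (rule mdiff_cong[OF s(1,2)]) (simp add: H0_projection(1) unitH0_H0[OF fu])
  then have dfH: "df \<in> H0"
    using mdiff_linear_comp[OF H0_projection(3) fs s(2), of X] H0_projection(2) by (metis df_def)
  \<comment> \<open>Differentiating \<open>qconj (f x) \<odot> f x = q_one\<close> yields \<open>qconj M = - M\<close>.\<close>
  have "mdiff (atl S) (\<lambda>x. qconj (f x) \<odot> f x) p X = mdiff (atl S) (\<lambda>x. q_one) p X"
    by (rule mdiff_cong[OF s(1,2)]) (simp add: unitH0_simps[OF fu])
  then have "qconj u \<odot> df + qconj df \<odot> u = 0"
    using mdiff_bilinear[OF bounded_bilinear_qmul smooth_fun_linear[OF bounded_linear_qconj s(1) fs] fs s(2), of X]
      mdiff_linear_comp[OF bounded_linear_qconj fs s(2), of X] by (simp add: df_def fp)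
  then have "u \<odot> (qconj u \<odot> df + qconj df \<odot> u) \<odot> qconj u = 0" by (simp add: qmul_simps)
  then have "M + u \<odot> qconj df = 0" using u(1) by (simp add: M_def qmul_simps)
  moreover have "qconj M = u \<odot> qconj df" by (simp add: M_def qconj_qmul)
  ultimately have M: "qconj M = - M" by (simp add: eq_neg_iff_add_eq_0 add.commute)
  have MH: "M \<in> H0" unfolding M_def by (intro H0_closed dfH u)
  have dfM: "df = M \<odot> u" using u(1) by (simp add: M_def qmul_assoc)
  obtain m1 n1 m2 n2 m3 n3 where m: "M = h0 0 0 m1 n1 m2 n2 m3 n3"
    using imaginary_H0[OF MH M] by blast
  have GI: "ascale a_sigma_i q_I = h0 0 0 0 1 0 0 0 0" "ascale a_i q_I = h0 0 0 1 0 0 0 0 0"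
    by (simp_all add: h0_def q_I_def a_sigma_i_def a_i_def amul_pair zero_prod_def)
  have "spin_nabla S p X \<phi> q = df - (\<omega> / 2) *\<^sub>R (h0 0 0 0 1 0 0 0 0 \<odot> u) - (\<eta> / 2) *\<^sub>R (h0 0 0 1 0 0 0 0 0 \<odot> u)"
    unfolding s(6) df_def f_def \<omega>_def \<eta>_def u_def GI by simp
  also have "\<dots> = (M - ((\<omega> / 2) *\<^sub>R h0 0 0 0 1 0 0 0 0 + (\<eta> / 2) *\<^sub>R h0 0 0 1 0 0 0 0 0)) \<odot> u"
    unfolding dfM by (simp add: qmul.diff_left qmul.add_left qmul.scaleR_left)
  also have "M - ((\<omega> / 2) *\<^sub>R h0 0 0 0 1 0 0 0 0 + (\<eta> / 2) *\<^sub>R h0 0 0 1 0 0 0 0 0) =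
      h0 0 0 (m1 - \<eta> / 2) (n1 - \<omega> / 2) m2 n2 m3 n3"
    unfolding m by (simp add: h0_ops(1-3) diff_conv_add_uminus del: add_uminus_conv_diff)
  finally have nabla: "spin_nabla S p X \<phi> q = h0 0 0 (m1 - \<eta> / 2) (n1 - \<omega> / 2) m2 n2 m3 n3 \<odot> \<phi> p q"
    by (simp add: u_def)
  have deriv: "mdiff (atl S) (\<lambda>x. emb \<phi> x (v x, Y x)) p X = rho (\<phi> p q)
        (cvec p (nab (EB S) p X v, nab (TB S) p X Y) q
          + imag_action (m1 - \<eta> / 2) (n1 - \<omega> / 2) m2 n2 m3 n3 (cvec p (v p, Y p) q))"
    if W: "open W" "p \<in> W" and w: "smooth_section (atl S) (EB S) W v" "smooth_section (atl S) (TB S) W Y"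
    for W v Y
  proof -
    let ?W = "U \<inter> W"
    have o: "open ?W" "p \<in> ?W" using s W by auto
    have s': "smooth_spin_section (atl S) Spin1 (PE S) ?W s1" "smooth_spin_section (atl S) Spin2 (PM S) ?W s2"
      by (rule PE.spin_section_subset[OF s(3)], blast) (rule PM.spin_section_subset[OF s(4)], blast)
    have w': "smooth_section (atl S) (EB S) ?W v" "smooth_section (atl S) (TB S) ?W Y"
      by (rule PE.smooth_section_subset[OF w(1)], blast) (rule TT.smooth_section_subset[OF w(2)], blast)
    define c where "c = (\<lambda>x. cvec x (v x, Y x) (s1 x, s2 x))"
    let ?n = "cvec p (nab (EB S) p X v, nab (TB S) p X Y) q"
    define dc where "dc = mdiff (atl S) c p X"
    have cs: "smooth_fun (atl S) ?W c" unfolding c_def by (rule spin_frame_sections(2)[OF o(1) s' w'])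
    have dc: "dc = ?n - quad (\<omega> * c p $ 1) (\<omega> * c p $ 0) (\<eta> * c p $ 3) (\<eta> * c p $ 2)"
      unfolding dc_def c_def \<omega>_def \<eta>_def s(5)[symmetric] by (rule cvec_derivative[OF o X s' w'])
    have fs': "smooth_fun (atl S) ?W f" by (rule smooth_fun_subset[OF fs]) auto
    have ic: "smooth_fun (atl S) ?W (\<lambda>x. iota (c x))" by (rule smooth_fun_linear[OF bounded_linear_iota o(1) cs])
    have qf: "smooth_fun (atl S) ?W (\<lambda>x. qconj (f x))" by (rule smooth_fun_linear[OF bounded_linear_qconj o(1) fs'])
    have hf: "smooth_fun (atl S) ?W (\<lambda>x. qhat (f x))" by (rule smooth_fun_linear[OF bounded_linear_qhat o(1) fs'])
    have qic: "smooth_fun (atl S) ?W (\<lambda>x. qconj (f x) \<odot> iota (c x))"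
      by (rule smooth_fun_bilinear[OF bounded_bilinear_qmul o(1) qf ic])
    have prod: "smooth_fun (atl S) ?W (\<lambda>x. qconj (f x) \<odot> iota (c x) \<odot> qhat (f x))"
      by (rule smooth_fun_bilinear[OF bounded_bilinear_qmul o(1) qic hf])
    have "mdiff (atl S) (\<lambda>x. emb \<phi> x (v x, Y x)) p X
        = mdiff (atl S) (\<lambda>x. iota_inv (- (qconj (f x) \<odot> iota (c x) \<odot> qhat (f x)))) p X"
    proof (rule mdiff_cong[OF o])
      fix x assume x: "x \<in> ?W"
      have "(v x, Y x) \<in> fibre x"
        using x PE.smooth_section_fib[OF w(1)] TT.smooth_section_fib[OF w(2)] by (simp add: fibre_def)
      then show "emb \<phi> x (v x, Y x) = iota_inv (- (qconj (f x) \<odot> iota (c x) \<odot> qhat (f x)))"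
        using qpair_emb(1)[where \<phi> = \<phi>, OF unit_spinorD(1)[OF \<phi>] _ spin_frame_sections(1)[OF o(1) s' x]]
        by (simp add: c_def f_def rho_def)
    qed
    also have "\<dots> = iota_inv (- mdiff (atl S) (\<lambda>x. qconj (f x) \<odot> iota (c x) \<odot> qhat (f x)) p X)"
      using mdiff_linear_comp[OF bounded_linear_iota_inv smooth_fun_minus[OF o(1) prod] o(2)]
        mdiff_minus[OF prod o(2)] by simp
    also have "mdiff (atl S) (\<lambda>x. qconj (f x) \<odot> iota (c x) \<odot> qhat (f x)) p X =
        qconj u \<odot> iota (c p) \<odot> qhat df + (qconj u \<odot> iota dc + qconj df \<odot> iota (c p)) \<odot> qhat u"
      unfolding mdiff_bilinear[OF bounded_bilinear_qmul qic hf o(2)]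
        mdiff_bilinear[OF bounded_bilinear_qmul qf ic o(2)]
        mdiff_linear_comp[OF bounded_linear_iota cs o(2)] mdiff_linear_comp[OF bounded_linear_qconj fs' o(2)]
        mdiff_linear_comp[OF bounded_linear_qhat fs' o(2)] fp df_def dc_def ..
    also have "\<dots> = qconj u \<odot> (iota dc + (iota (c p) \<odot> qhat M - M \<odot> iota (c p))) \<odot> qhat u"
      unfolding dfM qconj_qmul qhat_qmul M by (simp add: qmul_simps)
    also have "iota (c p) \<odot> qhat M - M \<odot> iota (c p) = iota (imag_action m1 n1 m2 n2 m3 n3 (c p))"
      unfolding m by (rule imag_action_h0)
    also have "iota dc + iota (imag_action m1 n1 m2 n2 m3 n3 (c p)) = iota (dc + imag_action m1 n1 m2 n2 m3 n3 (c p))"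
      by (simp add: iota_simps)
    also have "dc + imag_action m1 n1 m2 n2 m3 n3 (c p) = ?n + imag_action (m1 - \<eta> / 2) (n1 - \<omega> / 2) m2 n2 m3 n3 (c p)"
      unfolding dc by (simp add: vec4_eq imag_action_def algebra_simps)
    finally show ?thesis by (simp add: rho_def u_def c_def s(5))
  qed
  show ?thesis by (rule that[OF nabla deriv])
qed

end

section \<open>The Dirac equation and the Gauss-Weingarten equations\<close>

text \<open>A change of frame preserves the inverse metric, and the two sides are its contractions with \<open>f\<close> in the
  two frames.\<close>

lemma (in lorentz_bundle) trace_frame_independent:
  fixes f :: "'v \<Rightarrow> 'v \<Rightarrow> 'w::real_vector"
  assumes fr: "(a, b) \<in> on_frames V p" "(a', b') \<in> on_frames V p"
    and lin: "\<And>u v w. u \<in> fib V p \<Longrightarrow> v \<in> fib V p \<Longrightarrow> w \<in> fib V p \<Longrightarrow> f (u + v) w = f u w + f v w"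
      "\<And>u v w. u \<in> fib V p \<Longrightarrow> v \<in> fib V p \<Longrightarrow> w \<in> fib V p \<Longrightarrow> f w (u + v) = f w u + f w v"
      "\<And>u w r. u \<in> fib V p \<Longrightarrow> w \<in> fib V p \<Longrightarrow> f (r *\<^sub>R u) w = r *\<^sub>R f u w"
      "\<And>u w r. u \<in> fib V p \<Longrightarrow> w \<in> fib V p \<Longrightarrow> f w (r *\<^sub>R u) = r *\<^sub>R f w u"
  shows "- f a' a' + f b' b' = - f a a + f b b"
proof -
  note o = on_framesD[OF fr(1)] and o' = on_framesD[OF fr(2)]
  define \<alpha> \<beta> \<gamma> \<delta> where "\<alpha> = - met V p a' a" and "\<beta> = met V p a' b" and "\<gamma> = - met V p b' a" and "\<delta> = met V p b' b"
  have a': "a' = \<alpha> *\<^sub>R a + \<beta> *\<^sub>R b" and b': "b' = \<gamma> *\<^sub>R a + \<delta> *\<^sub>R b"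
    using frame_expansion[OF fr(1) o'(2)] frame_expansion[OF fr(1) o'(3)]
    by (simp_all add: \<alpha>_def \<beta>_def \<gamma>_def \<delta>_def)
  have a: "a = \<alpha> *\<^sub>R a' + (- \<gamma>) *\<^sub>R b'" and b: "b = (- \<beta>) *\<^sub>R a' + \<delta> *\<^sub>R b'"
    using frame_expansion[OF fr(2) o(2)] frame_expansion[OF fr(2) o(3)]
      met_sym[OF o(2) o'(2)] met_sym[OF o(2) o'(3)] met_sym[OF o(3) o'(2)] met_sym[OF o(3) o'(3)]
    by (simp_all add: \<alpha>_def \<beta>_def \<gamma>_def \<delta>_def)
  have "met V p a a = - \<alpha> * \<alpha> + \<gamma> * \<gamma>"
    by (subst (1 2) a) (simp add: met_simps o' del: scaleR_minus_left)
  then have 1: "- (\<alpha> * \<alpha>) + \<gamma> * \<gamma> = -1" using o by simp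
  have "met V p b b = - \<beta> * \<beta> + \<delta> * \<delta>"
    by (subst (1 2) b) (simp add: met_simps o' del: scaleR_minus_left)
  then have 2: "- (\<beta> * \<beta>) + \<delta> * \<delta> = 1" using o by simp
  have "met V p a b = \<alpha> * \<beta> - \<gamma> * \<delta>"
    by (subst a, subst b) (simp add: met_simps o' del: scaleR_minus_left)
  then have 3: "- (\<alpha> * \<beta>) + \<gamma> * \<delta> = 0" using o by simp
  have e: "f (x *\<^sub>R a + y *\<^sub>R b) (x *\<^sub>R a + y *\<^sub>R b) =
      (x * x) *\<^sub>R f a a + (x * y) *\<^sub>R (f a b + f b a) + (y * y) *\<^sub>R f b b" for x y
    using o(2,3) by (simp add: lin fib_closed algebra_simps)
  have "- f a' a' + f b' b' = (- (\<alpha> * \<alpha>) + \<gamma> * \<gamma>) *\<^sub>R f a a + (- (\<alpha> * \<beta>) + \<gamma> * \<delta>) *\<^sub>R (f a b + f b a)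
      + (- (\<beta> * \<beta>) + \<delta> * \<delta>) *\<^sub>R f b b"
    unfolding a' b' e by (simp add: algebra_simps)
  then show ?thesis unfolding 1 2 3 by simp
qed

lemma (in lorentz_bundle) zero_section:
  assumes "open U"
  shows "smooth_section A V U (\<lambda>p. 0)" "p \<in> U \<Longrightarrow> X \<in> fib T p \<Longrightarrow> nab V p X (\<lambda>p. 0) = 0"
proof -
  show s: "smooth_section A V U (\<lambda>p. 0)"
  proof (rule smooth_sectionI)
    fix W b1 b2 assume "(W, b1, b2) \<in> frm V"
    show "\<exists>f1 f2. smooth_fun A (U \<inter> W) f1 \<and> smooth_fun A (U \<inter> W) f2 \<and>
        (\<forall>p\<in>U \<inter> W. 0 = f1 p *\<^sub>R b1 p + f2 p *\<^sub>R b2 p)"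
      by (rule exI[of _ "\<lambda>p. 0"], rule exI[of _ "\<lambda>p. 0"]) (simp add: smooth_fun_const)
  qed (simp add: fib_closed)
  show "p \<in> U \<Longrightarrow> X \<in> fib T p \<Longrightarrow> nab V p X (\<lambda>p. 0) = 0"
    using nab_scale[OF assms s smooth_fun_const[of U 0], of p X] by simp
qed

context spin_surface
begin

lemma tframe_on: "(fst (tframe S p), snd (tframe S p)) \<in> on_frames (TB S) p"
proof -
  obtain q where "sproj (PM S) q = p" using PM.fibre_nonempty by blast
  then have "\<exists>fr. fr \<in> on_frames (TB S) p" using PM.frame_on[of q] by blast
  then have "tframe S p \<in> on_frames (TB S) p" unfolding tframe_def by (rule someI_ex)
  then show ?thesis by simp
qed

text \<open>The part of \<open>symmetric_form\<close> that concerns a single point. The form belonging to a solution of the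
  Dirac equation is first found point by point, and its smoothness is proved afterwards.\<close>

definition normal_form :: "('m \<Rightarrow> 'm tvec \<Rightarrow> 'm tvec \<Rightarrow> 'e) \<Rightarrow> 'm \<Rightarrow> bool"
  where "normal_form B p \<longleftrightarrow> (\<forall>X\<in>fib (TB S) p. \<forall>Y\<in>fib (TB S) p. \<forall>Z\<in>fib (TB S) p. \<forall>r.
       B p X Y \<in> fib (EB S) p \<and> B p X Y = B p Y X \<and>
       B p (X + Y) Z = B p X Z + B p Y Z \<and> B p (r *\<^sub>R X) Z = r *\<^sub>R B p X Z)"

lemma normal_formD:
  assumes "normal_form B p"
  shows "X \<in> fib (TB S) p \<Longrightarrow> Y \<in> fib (TB S) p \<Longrightarrow> B p X Y \<in> fib (EB S) p"
    and "X \<in> fib (TB S) p \<Longrightarrow> Y \<in> fib (TB S) p \<Longrightarrow> B p X Y = B p Y X"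
    and "X \<in> fib (TB S) p \<Longrightarrow> Y \<in> fib (TB S) p \<Longrightarrow> Z \<in> fib (TB S) p \<Longrightarrow> B p (X + Y) Z = B p X Z + B p Y Z"
    and "X \<in> fib (TB S) p \<Longrightarrow> Y \<in> fib (TB S) p \<Longrightarrow> Z \<in> fib (TB S) p \<Longrightarrow> B p Z (X + Y) = B p Z X + B p Z Y"
    and "X \<in> fib (TB S) p \<Longrightarrow> Z \<in> fib (TB S) p \<Longrightarrow> B p (r *\<^sub>R X) Z = r *\<^sub>R B p X Z"
    and "X \<in> fib (TB S) p \<Longrightarrow> Z \<in> fib (TB S) p \<Longrightarrow> B p Z (r *\<^sub>R X) = r *\<^sub>R B p Z X"
proof -
  note n = assms[unfolded normal_form_def, rule_format]
  show 1: "X \<in> fib (TB S) p \<Longrightarrow> Y \<in> fib (TB S) p \<Longrightarrow> B p X Y \<in> fib (EB S) p" for X Y using n by blast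
  show sym: "X \<in> fib (TB S) p \<Longrightarrow> Y \<in> fib (TB S) p \<Longrightarrow> B p X Y = B p Y X" for X Y using n by blast
  show add: "X \<in> fib (TB S) p \<Longrightarrow> Y \<in> fib (TB S) p \<Longrightarrow> Z \<in> fib (TB S) p \<Longrightarrow> B p (X + Y) Z = B p X Z + B p Y Z"
    for X Y Z using n by blast
  show sc: "X \<in> fib (TB S) p \<Longrightarrow> Z \<in> fib (TB S) p \<Longrightarrow> B p (r *\<^sub>R X) Z = r *\<^sub>R B p X Z" for X Z r using n by blast
  show "X \<in> fib (TB S) p \<Longrightarrow> Y \<in> fib (TB S) p \<Longrightarrow> Z \<in> fib (TB S) p \<Longrightarrow> B p Z (X + Y) = B p Z X + B p Z Y"
    using sym[of Z "X + Y"] sym[of Z X] sym[of Z Y] add[of X Y Z] TT.fib_closed(1)[of X p Y] by simp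
  show "X \<in> fib (TB S) p \<Longrightarrow> Z \<in> fib (TB S) p \<Longrightarrow> B p Z (r *\<^sub>R X) = r *\<^sub>R B p Z X"
    using sym[of Z "r *\<^sub>R X"] sym[of Z X] sc[of X Z r] TT.fib_closed(2)[of X p r] by simp
qed

lemma metric_trace_frame:
  assumes B: "normal_form B p" and fr: "(e2, e3) \<in> on_frames (TB S) p"
  shows "metric_trace S B p = - B p e2 e2 + B p e3 e3"
proof -
  note t = TT.on_framesD[OF tframe_on[of p]]
  have "metric_trace S B p = - B p (fst (tframe S p)) (fst (tframe S p)) + B p (snd (tframe S p)) (snd (tframe S p))"
    using t by (simp add: metric_trace_def split_beta Let_def)
  also have "\<dots> = - B p e2 e2 + B p e3 e3"
    by (rule TT.trace_frame_independent[where f = "B p", OF fr tframe_on])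
      (blast intro: normal_formD(3-6)[OF B])+
  finally show ?thesis .
qed

lemma clifford_clifford:
  "q \<in> spin_frames S p \<Longrightarrow> clifford S p w (clifford S p w' f) q = iota (cvec p w q) \<odot> qhat (iota (cvec p w' q)) \<odot> f q"
  by (simp add: clifford_def vec_coord_cvec ascale_qmul ascale_hat qhat_qmul amul_sigma_i ascale_ascale
      ascale_one qmul_assoc ascale_simps qmul.minus_right)

definition killing_rhs :: "('m \<Rightarrow> 'm tvec \<Rightarrow> 'm tvec \<Rightarrow> 'e) \<Rightarrow> ('m \<Rightarrow> ('qe, 'qm) spinor) \<Rightarrow> 'm \<Rightarrow> 'm tvec \<Rightarrow> ('qe, 'qm) spinor"
  where "killing_rhs B \<phi> p X = (let (e2, e3) = tframe S p in - (1/2) *\<^sub>R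
        (met (TB S) p e2 e2 *\<^sub>R clifford S p (0, e2) (clifford S p (B p X e2, 0) (\<phi> p))
       + met (TB S) p e3 e3 *\<^sub>R clifford S p (0, e3) (clifford S p (B p X e3, 0) (\<phi> p))))"

lemma cvec_simps:
  assumes "(q1, q2) \<in> spin_frames S p"
  shows "cvec p (0, fst (sframe (PM S) q2)) (q1, q2) = quad 0 0 1 0"
    "cvec p (0, snd (sframe (PM S) q2)) (q1, q2) = quad 0 0 0 1"
    "cvec p (fst (sframe (PE S) q1), 0) (q1, q2) = quad 1 0 0 0"
    "cvec p (snd (sframe (PE S) q1), 0) (q1, q2) = quad 0 1 0 0"
    "v \<in> fib (EB S) p \<Longrightarrow> cvec p (v, 0) (q1, q2) $ 2 = 0" "v \<in> fib (EB S) p \<Longrightarrow> cvec p (v, 0) (q1, q2) $ 3 = 0"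
    "Y \<in> fib (TB S) p \<Longrightarrow> cvec p (0, Y) (q1, q2) $ 0 = 0" "Y \<in> fib (TB S) p \<Longrightarrow> cvec p (0, Y) (q1, q2) $ 1 = 0"
  using PE.on_framesD[OF spin_framesD(3)[OF assms]] TT.on_framesD[OF spin_framesD(4)[OF assms]]
  by (simp_all add: cvec_def vec4_eq PE.met_zero TT.met_zero)

text \<open>The right-hand side of the Killing equation is a trace, so the frame \<open>tframe\<close> may be replaced by the
  one below the spin frame in which coordinates are taken.\<close>

lemma killing_rhs_frame:
  assumes q: "(q1, q2) \<in> spin_frames S p" and B: "normal_form B p" and X: "X \<in> fib (TB S) p"
  defines "b2 \<equiv> cvec p (B p X (fst (sframe (PM S) q2)), 0) (q1, q2)"
    and "b3 \<equiv> cvec p (B p X (snd (sframe (PM S) q2)), 0) (q1, q2)"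
  shows "killing_rhs B \<phi> p X (q1, q2) =
    h0 0 0 0 0 (- (b3 $ 1) / 2) (b2 $ 0 / 2) (- (b2 $ 1) / 2) (b3 $ 0 / 2) \<odot> \<phi> p (q1, q2)"
proof -
  let ?q = "(q1, q2)"
  let ?e2 = "fst (sframe (PM S) q2)" and ?e3 = "snd (sframe (PM S) q2)"
  let ?t2 = "fst (tframe S p)" and ?t3 = "snd (tframe S p)"
  let ?f = "\<lambda>e e'. iota (cvec p (0, e) ?q) \<odot> qhat (iota (cvec p (B p X e', 0) ?q))"
  note t = TT.on_framesD[OF tframe_on[of p]]
  note fr = spin_framesD(4)[OF q]
  note f = TT.on_framesD[OF fr]
  have BX: "(B p X Y, 0) \<in> fibre p" if "Y \<in> fib (TB S) p" for Y
    using normal_formD(1)[OF B X that] by (simp add: fibre_def TT.fib_closed)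
  have Y0: "(0, Y) \<in> fibre p" if "Y \<in> fib (TB S) p" for Y
    using that by (simp add: fibre_def PE.fib_closed)
  have tr: "- ?f ?t2 ?t2 + ?f ?t3 ?t3 = - ?f ?e2 ?e2 + ?f ?e3 ?e3"
  proof (rule TT.trace_frame_independent[where f = ?f, OF fr tframe_on])
    fix u v w and r :: real assume uvw: "u \<in> fib (TB S) p" "w \<in> fib (TB S) p"
    show "?f (r *\<^sub>R u) w = r *\<^sub>R ?f u w"
      using cvec_linear(2)[OF q Y0[OF uvw(1)], of r] by (simp add: iota_simps qmul_simps)
    show "?f w (r *\<^sub>R u) = r *\<^sub>R ?f w u"
      using cvec_linear(2)[OF q BX[OF uvw(1)], of r] normal_formD(6)[OF B uvw(1) X]
      by (simp add: iota_simps qmul_simps qhat_linear)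
    assume v: "v \<in> fib (TB S) p"
    show "?f (u + v) w = ?f u w + ?f v w"
      using cvec_linear(1)[OF q Y0[OF uvw(1)] Y0[OF v]] by (simp add: iota_simps qmul_simps)
    show "?f w (u + v) = ?f w u + ?f w v"
      using cvec_linear(1)[OF q BX[OF uvw(1)] BX[OF v]] normal_formD(4)[OF B uvw(1) v X]
      by (simp add: iota_simps qmul_simps qhat_linear)
  qed
  have "killing_rhs B \<phi> p X ?q = - (1/2) *\<^sub>R (- ?f ?t2 ?t2 + ?f ?t3 ?t3) \<odot> \<phi> p ?q"
    using t by (simp add: killing_rhs_def split_beta Let_def scaleR_fun_def clifford_clifford[OF q] qmul_simps)
  also have "\<dots> = - (1/2) *\<^sub>R (- ?f ?e2 ?e2 + ?f ?e3 ?e3) \<odot> \<phi> p ?q"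
    unfolding tr ..
  also have "- (1/2) *\<^sub>R (- ?f ?e2 ?e2 + ?f ?e3 ?e3) =
      h0 0 0 0 0 (- (b3 $ 1) / 2) (b2 $ 0 / 2) (- (b2 $ 1) / 2) (b3 $ 0 / 2)"
  proof -
    have "b2 = quad (b2 $ 0) (b2 $ 1) 0 0" "b3 = quad (b3 $ 0) (b3 $ 1) 0 0"
      using cvec_simps(5,6)[OF q normal_formD(1)[OF B X f(2)]] cvec_simps(5,6)[OF q normal_formD(1)[OF B X f(3)]]
      by (simp_all add: vec4_eq b2_def b3_def)
    then show ?thesis
      unfolding cvec_simps(1,2)[OF q] b2_def[symmetric] b3_def[symmetric] iota_axes
      using killing_element by metis
  qed
  finally show ?thesis .
qed

text \<open>The Gauss formula prescribes both components of the derivative of a tangential field. Of the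
  Weingarten formula only the normal component is prescribed: the tangential one is then determined by
  the Gauss formula, because the field is isometric.\<close>

definition gauss_weingarten :: "('m \<Rightarrow> 'm tvec \<Rightarrow> 'm tvec \<Rightarrow> 'e) \<Rightarrow> ('m \<Rightarrow> 'e \<times> 'm tvec \<Rightarrow> real^4) \<Rightarrow> 'm \<Rightarrow> 'm tvec \<Rightarrow> bool"
  where "gauss_weingarten B \<Phi> p X \<longleftrightarrow>
    (\<forall>U Y. open U \<and> p \<in> U \<and> smooth_section (atl S) (TB S) U Y \<longrightarrow>
      mdiff (atl S) (\<lambda>x. \<Phi> x (0, Y x)) p X = \<Phi> p (B p X (Y p), nab (TB S) p X Y)) \<and>
    (\<forall>U v. open U \<and> p \<in> U \<and> smooth_section (atl S) (EB S) U v \<longrightarrow>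
      (\<exists>W\<in>fib (TB S) p. mdiff (atl S) (\<lambda>x. \<Phi> x (v x, 0)) p X = \<Phi> p (nab (EB S) p X v, W)))"

text \<open>By \<open>spin_derivative\<close> both sides are conditions on the same six numbers. Those of the frame rotations,
  \<open>a1\<close> and \<open>b1\<close>, have to vanish, and the other four are the coordinates of \<open>B(X, e2)\<close> and \<open>B(X, e3)\<close>.\<close>

lemma killing_iff_gauss_weingarten:
  assumes \<phi>: "unit_spinor_field S \<phi>" and q: "q \<in> spin_frames S p" and B: "normal_form B p"
    and X: "X \<in> fib (TB S) p"
  shows "spin_nabla S p X \<phi> q = killing_rhs B \<phi> p X q \<longleftrightarrow> gauss_weingarten B (emb \<phi>) p X"
proof -
  obtain q1 q2 where q': "q = (q1, q2)" by (cases q)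
  note q1 = q[unfolded q']
  let ?e0 = "fst (sframe (PE S) q1)" and ?e1 = "snd (sframe (PE S) q1)"
  let ?e2 = "fst (sframe (PM S) q2)" and ?e3 = "snd (sframe (PM S) q2)"
  note f = PE.on_framesD[OF spin_framesD(3)[OF q1]] TT.on_framesD[OF spin_framesD(4)[OF q1]]
  note u = unit_spinorD(2)[OF \<phi> q]
  note emb = qpair_emb(1)[where \<phi> = \<phi>, OF unit_spinorD(1)[OF \<phi>] _ q]
  define b2 where "b2 = cvec p (B p X ?e2, 0) q"
  define b3 where "b3 = cvec p (B p X ?e3, 0) q"
  have b0: "b2 $ 2 = 0" "b2 $ 3 = 0" "b3 $ 2 = 0" "b3 $ 3 = 0"
    using cvec_simps(5,6)[OF q1 normal_formD(1)[OF B X f(9)]] cvec_simps(5,6)[OF q1 normal_formD(1)[OF B X f(10)]]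
    by (simp_all add: b2_def b3_def q')
  obtain a1 b1 a2 b2' a3 b3' where a: "spin_nabla S p X \<phi> q = h0 0 0 a1 b1 a2 b2' a3 b3' \<odot> \<phi> p q"
    and d: "\<And>U v Y. open U \<Longrightarrow> p \<in> U \<Longrightarrow> smooth_section (atl S) (EB S) U v \<Longrightarrow> smooth_section (atl S) (TB S) U Y \<Longrightarrow>
      mdiff (atl S) (\<lambda>x. emb \<phi> x (v x, Y x)) p X = rho (\<phi> p q)
        (cvec p (nab (EB S) p X v, nab (TB S) p X Y) q + imag_action a1 b1 a2 b2' a3 b3' (cvec p (v p, Y p) q))"
    by (rule spin_derivative[OF \<phi> q X], rule that) assumption+
  let ?i = "imag_action a1 b1 a2 b2' a3 b3'"
  have rhs: "killing_rhs B \<phi> p X q = h0 0 0 0 0 (- (b3 $ 1) / 2) (b2 $ 0 / 2) (- (b2 $ 1) / 2) (b3 $ 0 / 2) \<odot> \<phi> p q"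
    unfolding q' b2_def b3_def by (rule killing_rhs_frame[OF q1 B X])
  have cancel: "x = y" if "x \<odot> \<phi> p q = y \<odot> \<phi> p q" for x y
  proof -
    have "x \<odot> \<phi> p q \<odot> qconj (\<phi> p q) = y \<odot> \<phi> p q \<odot> qconj (\<phi> p q)" using that by simp
    then show ?thesis using u by (simp add: qmul_assoc)
  qed
  have kill: "spin_nabla S p X \<phi> q = killing_rhs B \<phi> p X q \<longleftrightarrow>
      a1 = 0 \<and> b1 = 0 \<and> a2 = - (b3 $ 1) / 2 \<and> b2' = b2 $ 0 / 2 \<and> a3 = - (b2 $ 1) / 2 \<and> b3' = b3 $ 0 / 2"
    unfolding a rhs using cancel h0_inject by metis
  have tang: "mdiff (atl S) (\<lambda>x. emb \<phi> x (0, Y x)) p X = rho (\<phi> p q)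
      (cvec p (0, nab (TB S) p X Y) q + ?i (cvec p (0, Y p) q))"
    if "open U" "p \<in> U" "smooth_section (atl S) (TB S) U Y" for U Y
    using d[OF that(1,2) PE.zero_section(1)[OF that(1)] that(3)] PE.zero_section(2)[OF that(1,2) X] by simp
  have norm: "mdiff (atl S) (\<lambda>x. emb \<phi> x (v x, 0)) p X = rho (\<phi> p q)
      (cvec p (nab (EB S) p X v, 0) q + ?i (cvec p (v p, 0) q))"
    if "open U" "p \<in> U" "smooth_section (atl S) (EB S) U v" for U v
    using d[OF that TT.zero_section(1)[OF that(1)]] TT.zero_section(2)[OF that(1,2) X] by simp
  have split: "cvec p (v, Y) q = cvec p (v, 0) q + cvec p (0, Y) q" if "v \<in> fib (EB S) p" "Y \<in> fib (TB S) p" for v Y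
    using cvec_linear(1)[OF q, of "(v, 0)" "(0, Y)"] that by (simp add: fibre_def PE.fib_closed TT.fib_closed)
  show ?thesis
  proof
    assume "spin_nabla S p X \<phi> q = killing_rhs B \<phi> p X q"
    with kill have k: "a1 = 0" "b1 = 0" "a2 = - (b3 $ 1) / 2" "b2' = b2 $ 0 / 2" "a3 = - (b2 $ 1) / 2" "b3' = b3 $ 0 / 2"
      by auto
    show "gauss_weingarten B (emb \<phi>) p X"
      unfolding gauss_weingarten_def
    proof (intro conjI allI impI; elim conjE)
      fix U Y assume U: "open U" "p \<in> U" and Y: "smooth_section (atl S) (TB S) U Y"
      have Yp: "Y p \<in> fib (TB S) p" and nY: "nab (TB S) p X Y \<in> fib (TB S) p"
        using TT.smooth_section_fib[OF Y U(2)] TT.nab_fib[OF U(1) Y U(2) X] .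
      have BY: "B p X (Y p) \<in> fib (EB S) p" by (rule normal_formD(1)[OF B X Yp])
      define y2 where "y2 = cvec p (0, Y p) q $ 2"
      define y3 where "y3 = cvec p (0, Y p) q $ 3"
      have "Y p = y2 *\<^sub>R ?e2 + y3 *\<^sub>R ?e3"
        using TT.frame_expansion[OF spin_framesD(4)[OF q1] Yp] by (simp add: y2_def y3_def cvec_def q')
      then have "B p X (Y p) = y2 *\<^sub>R B p X ?e2 + y3 *\<^sub>R B p X ?e3"
        using normal_formD(4,6)[OF B] X f by (simp add: TT.fib_closed)
      then have "(B p X (Y p), 0 :: 'm tvec) = y2 *\<^sub>R (B p X ?e2, 0) + y3 *\<^sub>R (B p X ?e3, 0)" by simp
      moreover have Bf: "(B p X ?e2, 0) \<in> fibre p" "(B p X ?e3, 0) \<in> fibre p"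
        using normal_formD(1)[OF B X f(9)] normal_formD(1)[OF B X f(10)]
        by (simp_all add: fibre_def TT.fib_closed)
      ultimately have cB: "cvec p (B p X (Y p), 0) q = y2 *\<^sub>R b2 + y3 *\<^sub>R b3"
        using Bf cvec_linear(1)[OF q fibre_closed(2)[OF Bf(1)] fibre_closed(2)[OF Bf(2)], of y2 y3]
        unfolding b2_def b3_def by (simp only: cvec_linear(2)[OF q])
      have cY: "cvec p (0, Y p) q = quad 0 0 y2 y3"
        using cvec_simps(7,8)[OF q1 Yp] by (simp add: vec4_eq y2_def y3_def q')
      have "?i (cvec p (0, Y p) q) = cvec p (B p X (Y p), 0) q"
        unfolding cB cY by (simp add: imag_action_def k vec4_eq b0)
      then show "mdiff (atl S) (\<lambda>x. emb \<phi> x (0, Y x)) p X = emb \<phi> p (B p X (Y p), nab (TB S) p X Y)"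
        using tang[OF U Y] emb[of "(B p X (Y p), nab (TB S) p X Y)"] BY nY split[OF BY nY]
        by (simp add: fibre_def add.commute)
    next
      fix U v assume U: "open U" "p \<in> U" and v: "smooth_section (atl S) (EB S) U v"
      have vp: "v p \<in> fib (EB S) p" and nv: "nab (EB S) p X v \<in> fib (EB S) p"
        using PE.smooth_section_fib[OF v U(2)] PE.nab_fib[OF U(1) v U(2) X] .
      define y where "y = ?i (cvec p (v p, 0) q)"
      define W where "W = y $ 2 *\<^sub>R ?e2 + y $ 3 *\<^sub>R ?e3"
      have W: "W \<in> fib (TB S) p" unfolding W_def using f by (simp add: TT.fib_closed)
      have "cvec p (0, W) q = quad 0 0 (y $ 2) (y $ 3)"
        using cvec_expand(3)[OF q1, of 0 0 "y $ 2" "y $ 3"] by (simp add: W_def q')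
      also have "\<dots> = y" by (simp add: y_def imag_action_def vec4_eq k cvec_simps(5,6)[OF q1 vp] q')
      finally have cW: "cvec p (0, W) q = y" .
      have "mdiff (atl S) (\<lambda>x. emb \<phi> x (v x, 0)) p X = emb \<phi> p (nab (EB S) p X v, W)"
        using norm[OF U v] emb[of "(nab (EB S) p X v, W)"] nv W split[OF nv W] cW
        by (simp add: fibre_def y_def)
      then show "\<exists>W\<in>fib (TB S) p. mdiff (atl S) (\<lambda>x. emb \<phi> x (v x, 0)) p X = emb \<phi> p (nab (EB S) p X v, W)"
        using W by blast
    qed
  next
    assume gw: "gauss_weingarten B (emb \<phi>) p X"
    obtain U1 s1 where s1: "open U1" "p \<in> U1" "s1 p = q1" "smooth_spin_section (atl S) Spin1 (PE S) U1 s1"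
      using PE.spin_section_through spin_framesD(1)[OF q1] by blast
    obtain U2 s2 where s2: "open U2" "p \<in> U2" "s2 p = q2" "smooth_spin_section (atl S) Spin2 (PM S) U2 s2"
      using PM.spin_section_through spin_framesD(2)[OF q1] by blast
    have T: "?i (cvec p (0, Y p) q) = cvec p (B p X (Y p), 0) q"
      if Y: "smooth_section (atl S) (TB S) U2 Y" for Y
    proof -
      have Yp: "Y p \<in> fib (TB S) p" and nY: "nab (TB S) p X Y \<in> fib (TB S) p"
        using TT.smooth_section_fib[OF Y s2(2)] TT.nab_fib[OF s2(1) Y s2(2) X] .
      have BY: "B p X (Y p) \<in> fib (EB S) p" by (rule normal_formD(1)[OF B X Yp])
      have "rho (\<phi> p q) (cvec p (0, nab (TB S) p X Y) q + ?i (cvec p (0, Y p) q)) = emb \<phi> p (B p X (Y p), nab (TB S) p X Y)"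
        unfolding tang[OF s2(1,2) Y, symmetric]
        using gw[unfolded gauss_weingarten_def, THEN conjunct1, THEN spec[of _ U2], THEN spec[of _ Y]] s2(1,2) Y
        by simp
      also have "\<dots> = rho (\<phi> p q) (cvec p (0, nab (TB S) p X Y) q + cvec p (B p X (Y p), 0) q)"
        using emb[of "(B p X (Y p), nab (TB S) p X Y)"] BY nY split[OF BY nY] by (simp add: fibre_def add.commute)
      finally have "cvec p (0, nab (TB S) p X Y) q + ?i (cvec p (0, Y p) q)
          = cvec p (0, nab (TB S) p X Y) q + cvec p (B p X (Y p), 0) q" by (rule rho_inj[OF u])
      then show ?thesis by simp
    qed
    have "?i (quad 0 0 1 0) = b2"
      using T[OF PM.spin_section_frame(1)[OF s2(4,1)]] cvec_simps(1)[OF q1] s2(3) by (simp add: b2_def q')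
    moreover have "?i (quad 0 0 0 1) = b3"
      using T[OF PM.spin_section_frame(2)[OF s2(4,1)]] cvec_simps(2)[OF q1] s2(3) by (simp add: b3_def q')
    moreover have "?i (quad 1 0 0 0) $ 1 = 0"
    proof -
      let ?v = "\<lambda>x. fst (sframe (PE S) (s1 x))"
      note v = PE.spin_section_frame(1)[OF s1(4,1)]
      have nv: "nab (EB S) p X ?v \<in> fib (EB S) p" using PE.nab_fib[OF s1(1) v s1(2) X] .
      obtain W where W: "W \<in> fib (TB S) p"
        "mdiff (atl S) (\<lambda>x. emb \<phi> x (?v x, 0)) p X = emb \<phi> p (nab (EB S) p X ?v, W)"
        using gw[unfolded gauss_weingarten_def, THEN conjunct2, THEN spec[of _ U1], THEN spec[of _ ?v]] s1(1,2) v
        by blast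
      have "rho (\<phi> p q) (cvec p (nab (EB S) p X ?v, 0) q + ?i (cvec p (?v p, 0) q))
          = rho (\<phi> p q) (cvec p (nab (EB S) p X ?v, 0) q + cvec p (0, W) q)"
        using norm[OF s1(1,2) v] W(2) emb[of "(nab (EB S) p X ?v, W)"] nv W(1) split[OF nv W(1)]
        by (simp add: fibre_def)
      then have "cvec p (nab (EB S) p X ?v, 0) q + ?i (cvec p (?v p, 0) q)
          = cvec p (nab (EB S) p X ?v, 0) q + cvec p (0, W) q" by (rule rho_inj[OF u])
      then have "?i (cvec p (?v p, 0) q) = cvec p (0, W) q" by simp
      then show ?thesis using cvec_simps(3)[OF q1] cvec_simps(8)[OF q1 W(1)] s1(3) by (simp add: q')
    qed
    ultimately show "spin_nabla S p X \<phi> q = killing_rhs B \<phi> p X q"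
      unfolding kill by (auto simp: imag_action_def vec4_eq b0)
  qed
qed

lemma symmetric_form_normal: "symmetric_form S B \<Longrightarrow> normal_form B p"
  unfolding symmetric_form_def normal_form_def by blast

lemma killing_solution_iff:
  "killing_solution S h B \<phi> \<longleftrightarrow> unit_spinor_field S \<phi> \<and> symmetric_form S B \<and>
    (\<forall>p. (1/2) *\<^sub>R metric_trace S B p = h p) \<and> (\<forall>p. \<forall>X\<in>fib (TB S) p. gauss_weingarten B (emb \<phi>) p X)"
proof (cases "unit_spinor_field S \<phi> \<and> symmetric_form S B")
  case True
  have "(spin_nabla S p X \<phi> = killing_rhs B \<phi> p X) \<longleftrightarrow> gauss_weingarten B (emb \<phi>) p X"
    if X: "X \<in> fib (TB S) p" for p X
  proof -
    note k = killing_iff_gauss_weingarten[OF conjunct1[OF True] _ symmetric_form_normal[OF conjunct2[OF True]] X]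
    have "spin_nabla S p X \<phi> q = 0 \<and> killing_rhs B \<phi> p X q = 0" if "q \<notin> spin_frames S p" for q
      using that by (simp add: spin_nabla_def killing_rhs_def clifford_def split_beta Let_def scaleR_fun_def)
    then have "(spin_nabla S p X \<phi> = killing_rhs B \<phi> p X) \<longleftrightarrow>
        (\<forall>q\<in>spin_frames S p. spin_nabla S p X \<phi> q = killing_rhs B \<phi> p X q)"
      by (metis ext)
    then show ?thesis using k spin_frames_nonempty by blast
  qed
  then show ?thesis
    unfolding killing_solution_def killing_rhs_def[symmetric] by blast
next
  case False
  then show ?thesis unfolding killing_solution_def by blast
qed

end

lemma bounded_bilinear_ip22: "bounded_bilinear ip22"
proof -
  have "linear (\<lambda>x. ip22 x y)" "linear (\<lambda>y. ip22 x y)" for x y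
    by (rule linearI; simp add: ip22_def algebra_simps)+
  then show ?thesis by (simp add: bilinear_conv_bounded_bilinear[symmetric] bilinear_def)
qed

context spin_surface
begin

lemma clifford_frame:
  "q \<in> spin_frames S p \<Longrightarrow> clifford S p w f q = ascale a_sigma_i (iota (cvec p w q) \<odot> qhat (f q))"
  by (simp add: clifford_def vec_coord_cvec)

lemma dirac_frame:
  assumes \<phi>: "unit_spinor_field S \<phi>" and q: "(q1, q2) \<in> spin_frames S p"
  shows "dirac S \<phi> p (q1, q2) = ascale a_sigma_i
    (- (ascale a_i q_J \<odot> qhat (spin_nabla S p (fst (sframe (PM S) q2)) \<phi> (q1, q2)))
     + q_K \<odot> qhat (spin_nabla S p (snd (sframe (PM S) q2)) \<phi> (q1, q2)))"
proof -
  let ?q = "(q1, q2)"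
  let ?f = "\<lambda>X Y. clifford S p (0, X) (spin_nabla S p Y \<phi>) ?q"
  note fr = spin_framesD(4)[OF q]
  have sf: "spinor_field S \<phi>" using \<phi> by (simp add: unit_spinor_field_def)
  have Y0: "(0, Y) \<in> fibre p" if "Y \<in> fib (TB S) p" for Y
    using that by (simp add: fibre_def PE.fib_closed)
  have "dirac S \<phi> p ?q = - ?f (fst (tframe S p)) (fst (tframe S p)) + ?f (snd (tframe S p)) (snd (tframe S p))"
    by (simp add: dirac_def split_beta Let_def)
  also have "\<dots> = - ?f (fst (sframe (PM S) q2)) (fst (sframe (PM S) q2)) + ?f (snd (sframe (PM S) q2)) (snd (sframe (PM S) q2))"
  proof (rule TT.trace_frame_independent[where f = ?f, OF fr tframe_on])
    fix u v w and r :: real assume uvw: "u \<in> fib (TB S) p" "w \<in> fib (TB S) p"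
    show "?f (r *\<^sub>R u) w = r *\<^sub>R ?f u w"
      using cvec_linear(2)[OF q Y0[OF uvw(1)], of r]
      by (simp add: clifford_frame[OF q] iota_simps qmul_simps ascale_simps)
    show "?f w (r *\<^sub>R u) = r *\<^sub>R ?f w u"
      by (simp add: clifford_frame[OF q] spin_nabla_linear(2)[OF sf q uvw(1,1)] qhat_linear qmul_simps ascale_simps)
    assume v: "v \<in> fib (TB S) p"
    show "?f (u + v) w = ?f u w + ?f v w"
      using cvec_linear(1)[OF q Y0[OF uvw(1)] Y0[OF v]]
      by (simp add: clifford_frame[OF q] iota_simps qmul_simps ascale_simps)
    show "?f w (u + v) = ?f w u + ?f w v"
      by (simp add: clifford_frame[OF q] spin_nabla_linear(1)[OF sf q uvw(1) v] qhat_linear qmul_simps ascale_simps)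
  qed
  finally show ?thesis
    by (simp add: clifford_frame[OF q] cvec_simps(1,2)[OF q] iota_axes ascale_simps)
qed

text \<open>The coordinate of \<open>\<phi>\<close> is invertible and cancels, so the Dirac equation is an equation between
  elements of the Clifford algebra.\<close>

lemma dirac_iff:
  assumes \<phi>: "unit_spinor_field S \<phi>" and q: "(q1, q2) \<in> spin_frames S p" and v: "v \<in> fib (EB S) p"
    and D2: "spin_nabla S p (fst (sframe (PM S) q2)) \<phi> (q1, q2) = h0 0 0 a1 b1 a2 b2 a3 b3 \<odot> \<phi> p (q1, q2)"
    and D3: "spin_nabla S p (snd (sframe (PM S) q2)) \<phi> (q1, q2) = h0 0 0 c1 d1 c2 d2 c3 d3 \<odot> \<phi> p (q1, q2)"
  shows "dirac S \<phi> p (q1, q2) = clifford S p (v, 0) (\<phi> p) (q1, q2) \<longleftrightarrow>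
    a1 = 0 \<and> b1 = 0 \<and> c1 = 0 \<and> d1 = 0 \<and> d3 - b2 = cvec p (v, 0) (q1, q2) $ 0 \<and> a2 = c3
    \<and> a3 - c2 = cvec p (v, 0) (q1, q2) $ 1 \<and> b3 = d2"
proof -
  let ?u = "\<phi> p (q1, q2)" and ?x = "cvec p (v, 0) (q1, q2)"
  let ?l = "- (ascale a_i q_J \<odot> qhat (h0 0 0 a1 b1 a2 b2 a3 b3)) + q_K \<odot> qhat (h0 0 0 c1 d1 c2 d2 c3 d3)"
  note u = unit_spinorD(2)[OF \<phi> q]
  have x: "quad (?x $ 0) (?x $ 1) 0 0 = ?x" using cvec_simps(5,6)[OF q v] by (simp add: vec4_eq)
  have inj: "ascale a_sigma_i y = ascale a_sigma_i z \<longleftrightarrow> y = z" for y z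
    by (metis amul_sigma_i(1) ascale_ascale ascale_one(2) neg_equal_iff_equal)
  have "dirac S \<phi> p (q1, q2) = ascale a_sigma_i (?l \<odot> qhat ?u)"
    unfolding dirac_frame[OF \<phi> q] D2 D3 by (simp add: qhat_qmul qmul_simps)
  then have "dirac S \<phi> p (q1, q2) = clifford S p (v, 0) (\<phi> p) (q1, q2) \<longleftrightarrow> ?l \<odot> qhat ?u = iota ?x \<odot> qhat ?u"
    by (simp only: clifford_frame[OF q] inj)
  also have "\<dots> \<longleftrightarrow> ?l = iota ?x"
  proof
    assume "?l \<odot> qhat ?u = iota ?x \<odot> qhat ?u"
    then have "?l \<odot> qhat ?u \<odot> qconj (qhat ?u) = iota ?x \<odot> qhat ?u \<odot> qconj (qhat ?u)" by simp
    then show "?l = iota ?x" using u by (simp only: qmul_assoc unitH0_simps qmul_one)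
  qed simp
  also have "\<dots> \<longleftrightarrow> ?l = iota (quad (?x $ 0) (?x $ 1) 0 0)" by (simp only: x)
  finally show ?thesis by (simp only: dirac_element)
qed

lemma dirac_outside: "q \<notin> spin_frames S p \<Longrightarrow> dirac S \<phi> p q = 0" "q \<notin> spin_frames S p \<Longrightarrow> clifford S p w f q = 0"
  by (simp_all add: dirac_def clifford_def split_beta Let_def)

text \<open>The components prescribed by \<open>killing_rhs_frame\<close> satisfy the equations of \<open>dirac_iff\<close>: \<open>B\<close> is symmetric,
  and its half trace is \<open>h p\<close>.\<close>

lemma killing_imp_dirac:
  assumes k: "killing_solution S h B \<phi>" and h: "\<And>p. h p \<in> fib (EB S) p"
  shows "dirac_solution S h \<phi>"
  unfolding dirac_solution_def
proof (intro conjI allI ext)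
  show \<phi>: "unit_spinor_field S \<phi>" using k by (simp add: killing_solution_def)
  fix p q
  show "dirac S \<phi> p q = clifford S p (h p, 0) (\<phi> p) q"
  proof (cases "q \<in> spin_frames S p")
    case True
    obtain q1 q2 where q': "q = (q1, q2)" by (cases q)
    note q = True[unfolded q']
    have B: "normal_form B p" using k symmetric_form_normal by (simp add: killing_solution_def)
    let ?e2 = "fst (sframe (PM S) q2)" and ?e3 = "snd (sframe (PM S) q2)"
    note f = TT.on_framesD[OF spin_framesD(4)[OF q]]
    have kX: "spin_nabla S p X \<phi> = killing_rhs B \<phi> p X" if "X \<in> fib (TB S) p" for X
      using k that unfolding killing_solution_def killing_rhs_def by blast
    let ?b = "\<lambda>X Y. cvec p (B p X Y, 0) (q1, q2)"
    have hp: "h p = (1/2) *\<^sub>R (- B p ?e2 ?e2 + B p ?e3 ?e3)"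
      using k metric_trace_frame[OF B spin_framesD(4)[OF q]] unfolding killing_solution_def by metis
    have BB: "B p ?e2 ?e2 \<in> fib (EB S) p" "B p ?e3 ?e3 \<in> fib (EB S) p"
      using normal_formD(1)[OF B] f by auto
    have hc: "cvec p (h p, 0) (q1, q2) $ j = (?b ?e3 ?e3 $ j - ?b ?e2 ?e2 $ j) / 2" for j
    proof -
      have fb: "(B p ?e2 ?e2, 0) \<in> fibre p" "(B p ?e3 ?e3, 0) \<in> fibre p"
        using BB by (simp_all add: fibre_def TT.fib_closed)
      have "(h p, 0 :: 'm tvec) = (1/2) *\<^sub>R ((-1) *\<^sub>R (B p ?e2 ?e2, 0) + (B p ?e3 ?e3, 0))" by (simp add: hp)
      then have "cvec p (h p, 0) (q1, q2) = (1/2) *\<^sub>R ((-1) *\<^sub>R ?b ?e2 ?e2 + ?b ?e3 ?e3)"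
        using fb by (simp only: cvec_linear[OF q] fibre_closed)
      then show ?thesis by simp
    qed
    have "dirac S \<phi> p (q1, q2) = clifford S p (h p, 0) (\<phi> p) (q1, q2)"
      unfolding dirac_iff[OF \<phi> q h trans[OF fun_cong[OF kX[OF f(2)]] killing_rhs_frame[OF q B f(2)]]
          trans[OF fun_cong[OF kX[OF f(3)]] killing_rhs_frame[OF q B f(3)]]] hc
      using normal_formD(2)[OF B f(2,3)] by simp
    then show ?thesis by (simp add: q')
  qed (simp add: dirac_outside)
qed

text \<open>The coefficients of \<open>b\<close> in a local frame are inner products of smooth functions with values in
  \<open>\<real>\<^sup>2\<^sup>,\<^sup>2\<close>.\<close>

lemma smooth_section_from_emb:
  assumes \<phi>: "unit_spinor_field S \<phi>" and U: "open U" and b: "\<And>x. x \<in> U \<Longrightarrow> b x \<in> fib (EB S) x"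
    and sm: "smooth_fun (atl S) U (\<lambda>x. emb \<phi> x (b x, 0))"
  shows "smooth_section (atl S) (EB S) U b"
proof (rule PE.smooth_section_local)
  fix p assume p: "p \<in> U"
  obtain W s where s: "(W, s) \<in> ssec (PE S)" "p \<in> W" using PE.ssec_cover by blast
  let ?e0 = "\<lambda>x. fst (sframe (PE S) (s x))" and ?e1 = "\<lambda>x. snd (sframe (PE S) (s x))"
  let ?W = "U \<inter> W"
  have o: "open ?W" using U PE.ssec_proj(1)[OF s(1)] by auto
  have fr: "(?e0 x, ?e1 x) \<in> on_frames (EB S) x" if "x \<in> W" for x
    using PE.frame_on[of "s x"] PE.ssec_proj(2)[OF s(1) that] by simp
  have e: "smooth_section (atl S) (EB S) ?W ?e0" "smooth_section (atl S) (EB S) ?W ?e1"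
    by (rule PE.smooth_section_subset[OF PE.ssec_frame_smooth(1)[OF s(1)]], blast)
      (rule PE.smooth_section_subset[OF PE.ssec_frame_smooth(2)[OF s(1)]], blast)
  have m: "smooth_fun (atl S) ?W (\<lambda>x. met (EB S) x (b x) (k x))" if k: "smooth_section (atl S) (EB S) ?W k" for k
  proof (rule smooth_fun_cong[OF o])
    show "smooth_fun (atl S) ?W (\<lambda>x. ip22 (emb \<phi> x (b x, 0)) (emb \<phi> x (k x, 0)))"
      by (intro smooth_fun_bilinear[OF bounded_bilinear_ip22 o] emb_smooth[OF \<phi> o k TT.zero_section(1)[OF o]]
          smooth_fun_subset[OF sm]) auto
    fix x assume x: "x \<in> ?W"
    show "ip22 (emb \<phi> x (b x, 0)) (emb \<phi> x (k x, 0)) = met (EB S) x (b x) (k x)"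
      using emb_isometry[OF \<phi>, of "b x" 0 x "k x" 0] b x PE.smooth_section_fib[OF k x]
      by (simp add: fibre_def TT.fib_closed TT.met_zero)
  qed
  have sm': "smooth_section (atl S) (EB S) ?W (\<lambda>x. (- met (EB S) x (b x) (?e0 x)) *\<^sub>R ?e0 x + met (EB S) x (b x) (?e1 x) *\<^sub>R ?e1 x)"
    by (intro PE.smooth_section_combination smooth_fun_minus o e m)
  have eq: "(- met (EB S) x (b x) (?e0 x)) *\<^sub>R ?e0 x + met (EB S) x (b x) (?e1 x) *\<^sub>R ?e1 x = b x" if "x \<in> ?W" for x
    using PE.frame_expansion[OF fr, of x "b x"] b that by simp
  have "smooth_section (atl S) (EB S) ?W b" by (rule PE.smooth_section_cong[OF eq sm'])
  then show "\<exists>W. open W \<and> p \<in> W \<and> smooth_section (atl S) (EB S) W b" using o p s(2) by blast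
qed

text \<open>At each point the components of the spinor derivative determine the bilinear form, and the Dirac
  equation says that it is symmetric with half trace \<open>h p\<close>. Smoothness then follows from the Gauss
  formula, by which \<open>B(X, Y)\<close> is the derivative of the tangential field \<open>Y\<close> minus its tangential part.\<close>

lemma dirac_imp_killing:
  assumes d: "dirac_solution S h \<phi>" and h: "\<And>p. h p \<in> fib (EB S) p"
  shows "\<exists>B. killing_solution S h B \<phi>"
proof -
  have \<phi>: "unit_spinor_field S \<phi>" and D: "dirac S \<phi> p = clifford S p (h p, 0) (\<phi> p)" for p
    using d by (auto simp: dirac_solution_def)
  have sf: "spinor_field S \<phi>" using \<phi> by (simp add: unit_spinor_field_def)
  have "\<exists>\<beta>. normal_form (\<lambda>_. \<beta>) p \<and> (1/2) *\<^sub>R metric_trace S (\<lambda>_. \<beta>) p = h p \<and>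
      (\<forall>X\<in>fib (TB S) p. gauss_weingarten (\<lambda>_. \<beta>) (emb \<phi>) p X)" for p
  proof -
    obtain q1 q2 where q: "(q1, q2) \<in> spin_frames S p" using spin_frames_nonempty[of p] by auto
    let ?e0 = "fst (sframe (PE S) q1)" and ?e1 = "snd (sframe (PE S) q1)"
    let ?e2 = "fst (sframe (PM S) q2)" and ?e3 = "snd (sframe (PM S) q2)"
    note frE = spin_framesD(3)[OF q] and frT = spin_framesD(4)[OF q]
    note f = PE.on_framesD[OF frE] TT.on_framesD[OF frT]
    obtain a1 b1 a2 b2 a3 b3 where A2: "spin_nabla S p ?e2 \<phi> (q1, q2) = h0 0 0 a1 b1 a2 b2 a3 b3 \<odot> \<phi> p (q1, q2)"
      by (rule spin_derivative[OF \<phi> q f(9)])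
    obtain c1 d1 c2 d2 c3 d3 where A3: "spin_nabla S p ?e3 \<phi> (q1, q2) = h0 0 0 c1 d1 c2 d2 c3 d3 \<odot> \<phi> p (q1, q2)"
      by (rule spin_derivative[OF \<phi> q f(10)])
    let ?h = "cvec p (h p, 0) (q1, q2)"
    have r: "a1 = 0" "b1 = 0" "c1 = 0" "d1 = 0" "d3 - b2 = ?h $ 0" "a2 = c3" "a3 - c2 = ?h $ 1" "b3 = d2"
      using D[of p] unfolding dirac_iff[OF \<phi> q h A2 A3, symmetric] fun_eq_iff
      using dirac_iff[OF \<phi> q h A2 A3] by simp_all
    define y2 where "y2 X = - met (TB S) p X ?e2" for X
    define y3 where "y3 X = met (TB S) p X ?e3" for X
    have ylin: "y2 (X + Y) = y2 X + y2 Y" "y3 (X + Y) = y3 X + y3 Y" "y2 (r *\<^sub>R X) = r * y2 X" "y3 (r *\<^sub>R X) = r * y3 X"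
      if "X \<in> fib (TB S) p" "Y \<in> fib (TB S) p" for X Y r
      using that f by (simp_all add: y2_def y3_def TT.met_simps)
    \<comment> \<open>The values of the form on the frame, obtained by comparing the components with
      \<open>killing_rhs_frame\<close>; \<open>B23\<close> may be read off from the derivative along \<open>e2\<close> or from that along \<open>e3\<close>.\<close>
    define B22 where "B22 = (2 * b2) *\<^sub>R ?e0 + (- 2 * a3) *\<^sub>R ?e1"
    define B23 where "B23 = (2 * b3) *\<^sub>R ?e0 + (- 2 * a2) *\<^sub>R ?e1"
    define B33 where "B33 = (2 * d3) *\<^sub>R ?e0 + (- 2 * c2) *\<^sub>R ?e1"
    have Bfib: "B22 \<in> fib (EB S) p" "B23 \<in> fib (EB S) p" "B33 \<in> fib (EB S) p"
      unfolding B22_def B23_def B33_def by (intro PE.fib_closed(1,2) f)+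
    define \<beta> where "\<beta> X Y = (y2 X * y2 Y) *\<^sub>R B22 + (y2 X * y3 Y + y3 X * y2 Y) *\<^sub>R B23 + (y3 X * y3 Y) *\<^sub>R B33"
      for X Y
    have n: "normal_form (\<lambda>_. \<beta>) p"
      unfolding normal_form_def
    proof (intro ballI allI conjI)
      fix X Y Z and r :: real assume X: "X \<in> fib (TB S) p" and Y: "Y \<in> fib (TB S) p"
      show "\<beta> X Y \<in> fib (EB S) p" unfolding \<beta>_def by (intro PE.fib_closed(1,2) Bfib)
      show "\<beta> X Y = \<beta> Y X" by (simp add: \<beta>_def mult.commute add.commute)
      show "\<beta> (X + Y) Z = \<beta> X Z + \<beta> Y Z" by (simp add: \<beta>_def ylin[OF X Y] algebra_simps)
      show "\<beta> (r *\<^sub>R X) Z = r *\<^sub>R \<beta> X Z" by (simp add: \<beta>_def ylin[OF X Y] algebra_simps)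
    qed
    have ye: "y2 ?e2 = 1" "y3 ?e2 = 0" "y2 ?e3 = 0" "y3 ?e3 = 1" using f by (simp_all add: y2_def y3_def)
    have "(1/2) *\<^sub>R metric_trace S (\<lambda>_. \<beta>) p = (d3 - b2) *\<^sub>R ?e0 + (a3 - c2) *\<^sub>R ?e1"
      unfolding metric_trace_frame[OF n frT] by (simp add: \<beta>_def ye B22_def B33_def algebra_simps)
    also have "\<dots> = h p"
      unfolding r(5,7) using PE.frame_expansion[OF frE h] by (simp add: cvec_def)
    finally have tr: "(1/2) *\<^sub>R metric_trace S (\<lambda>_. \<beta>) p = h p" .
    have gw: "gauss_weingarten (\<lambda>_. \<beta>) (emb \<phi>) p X" if X: "X \<in> fib (TB S) p" for X
    proof -
      have c0: "cvec p (x *\<^sub>R ?e0 + y *\<^sub>R ?e1, 0) (q1, q2) = quad x y 0 0" for x y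
        using cvec_expand(3)[OF q, of x y 0 0] by simp
      have b2: "\<beta> X ?e2 = (2 * (b2 * y2 X + d2 * y3 X)) *\<^sub>R ?e0 + (- 2 * (a3 * y2 X + a2 * y3 X)) *\<^sub>R ?e1"
        by (simp add: \<beta>_def ye B22_def B23_def r(8) algebra_simps)
      have b3: "\<beta> X ?e3 = (2 * (b3 * y2 X + d3 * y3 X)) *\<^sub>R ?e0 + (- 2 * (a2 * y2 X + c2 * y3 X)) *\<^sub>R ?e1"
        by (simp add: \<beta>_def ye B33_def B23_def algebra_simps)
      have "X = y2 X *\<^sub>R ?e2 + y3 X *\<^sub>R ?e3"
        using TT.frame_expansion[OF frT X] by (simp add: y2_def y3_def)
      then have "spin_nabla S p X \<phi> (q1, q2) = spin_nabla S p (y2 X *\<^sub>R ?e2 + y3 X *\<^sub>R ?e3) \<phi> (q1, q2)" by simp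
      also have "\<dots> = y2 X *\<^sub>R (h0 0 0 a1 b1 a2 b2 a3 b3 \<odot> \<phi> p (q1, q2)) + y3 X *\<^sub>R (h0 0 0 c1 d1 c2 d2 c3 d3 \<odot> \<phi> p (q1, q2))"
        unfolding spin_nabla_linear(1)[OF sf q TT.fib_closed(2)[OF f(9)] TT.fib_closed(2)[OF f(10)]]
          spin_nabla_linear(2)[OF sf q f(9,9)] spin_nabla_linear(2)[OF sf q f(10,10)] A2 A3 ..
      also have "\<dots> = (y2 X *\<^sub>R h0 0 0 a1 b1 a2 b2 a3 b3 + y3 X *\<^sub>R h0 0 0 c1 d1 c2 d2 c3 d3) \<odot> \<phi> p (q1, q2)"
        by (simp add: qmul_simps)
      also have "y2 X *\<^sub>R h0 0 0 a1 b1 a2 b2 a3 b3 + y3 X *\<^sub>R h0 0 0 c1 d1 c2 d2 c3 d3 =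
        h0 0 0 0 0 (y2 X * a2 + y3 X * c2) (y2 X * b2 + y3 X * d2) (y2 X * a3 + y3 X * c3) (y2 X * b3 + y3 X * d3)"
        by (simp add: h0_ops(1,3) r)
      also have "\<dots> \<odot> \<phi> p (q1, q2) = killing_rhs (\<lambda>_. \<beta>) \<phi> p X (q1, q2)"
        unfolding killing_rhs_frame[OF q n X] b2 b3 c0
          by (rule arg_cong[where f = "\<lambda>a. a \<odot> \<phi> p (q1, q2)"]) (simp add: h0_inject r field_simps)
      finally show ?thesis using killing_iff_gauss_weingarten[OF \<phi> q n X] by simp
    qed
    show ?thesis using n tr gw by blast
  qed
  then obtain B where B: "\<And>p. normal_form (\<lambda>_. B p) p" "\<And>p. (1/2) *\<^sub>R metric_trace S (\<lambda>_. B p) p = h p"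
      "\<And>p X. X \<in> fib (TB S) p \<Longrightarrow> gauss_weingarten (\<lambda>_. B p) (emb \<phi>) p X" by metis
  have n: "normal_form B p" for p using B(1) by (simp add: normal_form_def)
  have tr: "(1/2) *\<^sub>R metric_trace S B p = h p" for p using B(2) by (simp add: metric_trace_def)
  have gw: "gauss_weingarten B (emb \<phi>) p X" if "X \<in> fib (TB S) p" for p X
    using B(3)[OF that] by (simp add: gauss_weingarten_def)
  have sm: "smooth_section (atl S) (EB S) U (\<lambda>p. B p (X p) (Y p))"
    if U: "open U" and XY: "smooth_section (atl S) (TB S) U X" "smooth_section (atl S) (TB S) U Y" for U X Y
  proof (rule smooth_section_from_emb[OF \<phi> U])
    show "B x (X x) (Y x) \<in> fib (EB S) x" if "x \<in> U" for x
      by (rule normal_formD(1)[OF n TT.smooth_section_fib[OF XY(1) that] TT.smooth_section_fib[OF XY(2) that]])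
    show "smooth_fun (atl S) U (\<lambda>x. emb \<phi> x (B x (X x) (Y x), 0))"
    proof (rule smooth_fun_cong[OF U])
      show "smooth_fun (atl S) U (\<lambda>x. mdiff (atl S) (\<lambda>x. emb \<phi> x (0, Y x)) x (X x)
          - emb \<phi> x (0, nab (TB S) x (X x) Y))"
        by (intro smooth_fun_diff U mdiff_along_smooth emb_smooth[OF \<phi>] PE.zero_section(1) XY TT.nab_smooth)
      fix x assume x: "x \<in> U"
      note Xx = TT.smooth_section_fib[OF XY(1) x]
      note nY = TT.nab_fib[OF U XY(2) x Xx]
      note Bx = normal_formD(1)[OF n Xx TT.smooth_section_fib[OF XY(2) x]]
      have "mdiff (atl S) (\<lambda>x. emb \<phi> x (0, Y x)) x (X x) = emb \<phi> x (B x (X x) (Y x), nab (TB S) x (X x) Y)"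
        using gw[OF Xx, unfolded gauss_weingarten_def, THEN conjunct1, THEN spec[of _ U], THEN spec[of _ Y]] U x XY(2)
        by blast
      also have "(B x (X x) (Y x), nab (TB S) x (X x) Y) = (B x (X x) (Y x), 0) + (0, nab (TB S) x (X x) Y)" by simp
      also have "emb \<phi> x \<dots> = emb \<phi> x (B x (X x) (Y x), 0) + emb \<phi> x (0, nab (TB S) x (X x) Y)"
        by (rule emb_add[OF \<phi>]) (use Bx nY in \<open>auto simp: fibre_def PE.fib_closed TT.fib_closed\<close>)
      finally show "mdiff (atl S) (\<lambda>x. emb \<phi> x (0, Y x)) x (X x) - emb \<phi> x (0, nab (TB S) x (X x) Y)
          = emb \<phi> x (B x (X x) (Y x), 0)" by simp
    qed
  qed
  have "symmetric_form S B"
    unfolding symmetric_form_def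
  proof (intro conjI allI impI; (elim conjE)?)
    fix p
    show "\<forall>X\<in>fib (TB S) p. \<forall>Y\<in>fib (TB S) p. \<forall>Z\<in>fib (TB S) p. \<forall>r.
       B p X Y \<in> fib (EB S) p \<and> B p X Y = B p Y X \<and>
       B p (X + Y) Z = B p X Z + B p Y Z \<and> B p (r *\<^sub>R X) Z = r *\<^sub>R B p X Z"
      using n[of p] unfolding normal_form_def .
  qed (rule sm)
  then show ?thesis using \<phi> tr gw unfolding killing_solution_iff by blast
qed

end

section \<open>From spinors to immersions\<close>

lemma ip22_linear:
  "ip22 (x + y) z = ip22 x z + ip22 y z" "ip22 z (x + y) = ip22 z x + ip22 z y"
  "ip22 (x - y) z = ip22 x z - ip22 y z" "ip22 z (x - y) = ip22 z x - ip22 z y"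
  "ip22 (r *\<^sub>R x) z = r * ip22 x z" "ip22 z (r *\<^sub>R x) = r * ip22 z x" "ip22 x y = ip22 y x"
  by (simp_all add: ip22_def algebra_simps)

context spin_surface
begin

lemma met_nondegenerate_T:
  assumes "Z \<in> fib (TB S) p" "\<And>Y. Y \<in> fib (TB S) p \<Longrightarrow> met (TB S) p Z Y = 0"
  shows "Z = 0"
  using TT.frame_expansion[OF tframe_on assms(1)] assms(2) TT.on_framesD[OF tframe_on[of p]] by simp

text \<open>The decomposition into tangential and normal part is unique since the metric of \<open>TM\<close> is
  nondegenerate.\<close>

lemma normal_part_eq:
  assumes F: "isometric_immersion S F" and n: "n \<in> normal_space S F p" and X: "X \<in> fib (TB S) p"
  shows "normal_part S F p (mdiff (atl S) F p X + n) = n"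
  unfolding normal_part_def
proof (rule the_equality)
  show "n \<in> normal_space S F p \<and> (\<exists>Xa\<in>fib (TB S) p. mdiff (atl S) F p X + n = mdiff (atl S) F p Xa + n)"
    using n X by blast
  fix n' assume "n' \<in> normal_space S F p \<and> (\<exists>Xa\<in>fib (TB S) p. mdiff (atl S) F p X + n = mdiff (atl S) F p Xa + n')"
  then obtain X' where n': "n' \<in> normal_space S F p" and X': "X' \<in> fib (TB S) p"
    "mdiff (atl S) F p X + n = mdiff (atl S) F p X' + n'" by blast
  have Z: "X - X' \<in> fib (TB S) p" using X X'(1) by (rule TT.fib_closed(3))
  have ip: "ip22 (mdiff (atl S) F p Y) (mdiff (atl S) F p Y') = met (TB S) p Y Y'"
    if "Y \<in> fib (TB S) p" "Y' \<in> fib (TB S) p" for Y Y'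
    using F that by (simp add: isometric_immersion_def)
  have "met (TB S) p (X - X') Y = 0" if Y: "Y \<in> fib (TB S) p" for Y
  proof -
    have "met (TB S) p X Y = met (TB S) p X' Y"
    proof -
      have "ip22 (mdiff (atl S) F p X + n) (mdiff (atl S) F p Y) = met (TB S) p X Y"
        using n X Y by (simp add: ip22_linear ip normal_space_def)
      moreover have "ip22 (mdiff (atl S) F p X' + n') (mdiff (atl S) F p Y) = met (TB S) p X' Y"
        using n' X' Y by (simp add: ip22_linear ip normal_space_def)
      ultimately show ?thesis using X'(2) by simp
    qed
    moreover have "X = (X - X') + X'" by simp
    ultimately show ?thesis using TT.met_add[OF Z X'(1) Y] by (metis add_cancel_left_left)
  qed
  then have "X - X' = 0" by (rule met_nondegenerate_T[OF Z])
  then show "n' = n" using X'(2) by simp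
qed

lemma xi_emb:
  assumes "unit_spinor_field S \<phi>" "X \<in> fib (TB S) p"
  shows "xi_form S \<phi> p X = iota (emb \<phi> p (0, X))"
  unfolding xi_form_def
  by (rule qpair_emb(2)[OF unit_spinorD(1)[OF assms(1)]]) (simp add: fibre_def assms PE.fib_closed)

lemma gaussD:
  assumes "gauss_weingarten B \<Phi> p X" "open U" "p \<in> U" "smooth_section (atl S) (TB S) U Y"
  shows "mdiff (atl S) (\<lambda>x. \<Phi> x (0, Y x)) p X = \<Phi> p (B p X (Y p), nab (TB S) p X Y)"
  using assms(1)[unfolded gauss_weingarten_def, THEN conjunct1, THEN spec[of _ U], THEN spec[of _ Y]] assms(2-4)
  by blast

lemma weingartenD:
  assumes "gauss_weingarten B \<Phi> p X" "open U" "p \<in> U" "smooth_section (atl S) (EB S) U v"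
  shows "\<exists>W\<in>fib (TB S) p. mdiff (atl S) (\<lambda>x. \<Phi> x (v x, 0)) p X = \<Phi> p (nab (EB S) p X v, W)"
  using assms(1)[unfolded gauss_weingarten_def, THEN conjunct2, THEN spec[of _ U], THEN spec[of _ v]] assms(2-4)
  by blast

lemma torsion_bracket:
  assumes "open U" "p \<in> U" "smooth_section (atl S) (TB S) U X" "smooth_section (atl S) (TB S) U Y"
  shows "lie_bracket (atl S) X Y p = nab (TB S) p (X p) Y - nab (TB S) p (Y p) X"
proof -
  have "torsion_free (atl S) (TB S)" using tangent_bundle by (simp add: oriented_lorentz_tangent_bundle_def)
  from this[unfolded torsion_free_def, THEN spec[of _ U], THEN spec[of _ X], THEN spec[of _ Y]] assms
  show ?thesis by simp
qed

lemma fibre_pairs: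
  "v \<in> fib (EB S) p \<Longrightarrow> (v, 0) \<in> fibre p" "X \<in> fib (TB S) p \<Longrightarrow> (0, X) \<in> fibre p"
  by (simp_all add: fibre_def PE.fib_closed TT.fib_closed)

lemma emb_pair:
  assumes \<phi>: "unit_spinor_field S \<phi>" and "v \<in> fib (EB S) p" "X \<in> fib (TB S) p"
  shows "emb \<phi> p (v, X) = emb \<phi> p (v, 0) + emb \<phi> p (0, X)"
  using emb_add[OF \<phi> fibre_pairs(1)[OF assms(2)] fibre_pairs(2)[OF assms(3)]] by simp

text \<open>By the Gauss formula the exterior derivative of \<open>\<xi>\<close> at \<open>(X, Y)\<close> is the value of \<open>emb \<phi>\<close> at
  \<open>(B(X, Y) - B(Y, X), \<nabla>\<^sub>XY - \<nabla>\<^sub>YX - [X, Y])\<close>.\<close>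

lemma xi_closed:
  assumes k: "killing_solution S h B \<phi>"
  shows "closed_form S (xi_form S \<phi>)"
proof -
  have \<phi>: "unit_spinor_field S \<phi>" and B: "symmetric_form S B"
    and gw: "\<And>p X. X \<in> fib (TB S) p \<Longrightarrow> gauss_weingarten B (emb \<phi>) p X"
    using k unfolding killing_solution_iff by auto
  note n = symmetric_form_normal[OF B]
  note xi = xi_emb[OF \<phi>]
  have lin: "\<forall>p. \<forall>X\<in>fib (TB S) p. \<forall>Y\<in>fib (TB S) p. \<forall>r.
       xi_form S \<phi> p (X + Y) = xi_form S \<phi> p X + xi_form S \<phi> p Y \<and> xi_form S \<phi> p (r *\<^sub>R X) = r *\<^sub>R xi_form S \<phi> p X"
  proof (intro allI ballI conjI)
    fix p X Y and r :: real assume X: "X \<in> fib (TB S) p" and Y: "Y \<in> fib (TB S) p"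
    show "xi_form S \<phi> p (X + Y) = xi_form S \<phi> p X + xi_form S \<phi> p Y"
      using emb_add[OF \<phi> fibre_pairs(2)[OF X] fibre_pairs(2)[OF Y]] X Y by (simp add: xi TT.fib_closed iota_simps)
    show "xi_form S \<phi> p (r *\<^sub>R X) = r *\<^sub>R xi_form S \<phi> p X"
      using emb_scale[OF \<phi> fibre_pairs(2)[OF X], of r] X by (simp add: xi TT.fib_closed iota_simps)
  qed
  have smE: "smooth_fun (atl S) U (\<lambda>p. emb \<phi> p (0, X p))"
    if "open U" "smooth_section (atl S) (TB S) U X" for U X
    by (rule emb_smooth[OF \<phi> that(1) PE.zero_section(1)[OF that(1)] that(2)])
  have smX: "smooth_fun (atl S) U (\<lambda>p. xi_form S \<phi> p (X p))"
    if U: "open U" and X: "smooth_section (atl S) (TB S) U X" for U X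
    by (rule smooth_fun_cong[OF U _ smooth_fun_linear[OF bounded_linear_iota U smE[OF U X]]])
      (simp add: xi TT.smooth_section_fib[OF X])
  have d: "mdiff (atl S) (\<lambda>q. xi_form S \<phi> q (Y q)) p Z = iota (emb \<phi> p (B p Z (Y p), nab (TB S) p Z Y))"
    if U: "open U" "p \<in> U" and Y: "smooth_section (atl S) (TB S) U Y" and Z: "Z \<in> fib (TB S) p" for U p Y Z
  proof -
    have "mdiff (atl S) (\<lambda>q. xi_form S \<phi> q (Y q)) p Z = mdiff (atl S) (\<lambda>q. iota (emb \<phi> q (0, Y q))) p Z"
      by (rule mdiff_cong[OF U]) (simp add: xi TT.smooth_section_fib[OF Y])
    also have "\<dots> = iota (mdiff (atl S) (\<lambda>q. emb \<phi> q (0, Y q)) p Z)"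
      by (rule mdiff_linear_comp[OF bounded_linear_iota smE[OF U(1) Y] U(2)])
    also have "mdiff (atl S) (\<lambda>q. emb \<phi> q (0, Y q)) p Z = emb \<phi> p (B p Z (Y p), nab (TB S) p Z Y)"
      by (rule gaussD[OF gw[OF Z] U Y])
    finally show ?thesis .
  qed
  have "mdiff (atl S) (\<lambda>q. xi_form S \<phi> q (Y q)) p (X p) - mdiff (atl S) (\<lambda>q. xi_form S \<phi> q (X q)) p (Y p)
          - xi_form S \<phi> p (lie_bracket (atl S) X Y p) = 0"
    if U: "open U" "p \<in> U" and X: "smooth_section (atl S) (TB S) U X" and Y: "smooth_section (atl S) (TB S) U Y"
    for U X Y p
  proof -
    note Xp = TT.smooth_section_fib[OF X U(2)] and Yp = TT.smooth_section_fib[OF Y U(2)]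
    note nY = TT.nab_fib[OF U(1) Y U(2) Xp] and nX = TT.nab_fib[OF U(1) X U(2) Yp]
    note BXY = normal_formD(1)[OF n Xp Yp]
    let ?l = "lie_bracket (atl S) X Y p"
    have l: "?l = nab (TB S) p (X p) Y - nab (TB S) p (Y p) X" by (rule torsion_bracket[OF U X Y])
    then have lf: "?l \<in> fib (TB S) p" using TT.fib_closed(3)[OF nY nX] by simp
    have "(B p (X p) (Y p), nab (TB S) p (X p) Y) = (B p (Y p) (X p), nab (TB S) p (Y p) X) + (0, ?l)"
      using normal_formD(2)[OF n Xp Yp] by (simp add: l)
    then have eq: "emb \<phi> p (B p (X p) (Y p), nab (TB S) p (X p) Y)
        = emb \<phi> p (B p (Y p) (X p), nab (TB S) p (Y p) X) + emb \<phi> p (0, ?l)"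
      using emb_add[OF \<phi>, of "(B p (Y p) (X p), nab (TB S) p (Y p) X)" p "(0, ?l)"]
        normal_formD(1)[OF n Yp Xp] nX lf by (simp add: fibre_def PE.fib_closed)
    show ?thesis
      unfolding d[OF U Y Xp] d[OF U X Yp] xi[OF lf] eq iota_simps(1) by simp
  qed
  note cl' = this
  have cl: "\<forall>U X Y. open U \<and> smooth_section (atl S) (TB S) U X \<and> smooth_section (atl S) (TB S) U Y \<longrightarrow>
       (\<forall>p\<in>U. mdiff (atl S) (\<lambda>q. xi_form S \<phi> q (Y q)) p (X p) - mdiff (atl S) (\<lambda>q. xi_form S \<phi> q (X q)) p (Y p)
          - xi_form S \<phi> p (lie_bracket (atl S) X Y p) = 0)"
    by (intro allI impI ballI; elim conjE) (rule cl')
  show ?thesis unfolding closed_form_def by (intro conjI lin cl) (simp add: smX)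
qed

lemma killing_integral:
  assumes sc: "simply_connected (UNIV :: 'm set)" and k: "killing_solution S h B \<phi>"
  shows "\<exists>F. is_integral S F (xi_form S \<phi>)"
proof -
  have \<phi>: "unit_spinor_field S \<phi>" and B: "symmetric_form S B"
    and gw: "\<And>p X. X \<in> fib (TB S) p \<Longrightarrow> gauss_weingarten B (emb \<phi>) p X"
    using k unfolding killing_solution_iff by auto
  note n = symmetric_form_normal[OF B]
  have "\<exists>F. smooth_fun (atl S) UNIV F \<and> (\<forall>p. \<forall>X\<in>fib (TB S) p. mdiff (atl S) F p X = emb \<phi> p (0, X))"
  proof (rule closed_form_primitive[OF sc])
    fix p X Y and r :: real assume X: "X \<in> fib (TB S) p"
    show "emb \<phi> p (0, r *\<^sub>R X) = r *\<^sub>R emb \<phi> p (0, X)"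
      using emb_scale[OF \<phi> fibre_pairs(2)[OF X], of r] by simp
    assume Y: "Y \<in> fib (TB S) p"
    show "emb \<phi> p (0, X + Y) = emb \<phi> p (0, X) + emb \<phi> p (0, Y)"
      using emb_add[OF \<phi> fibre_pairs(2)[OF X] fibre_pairs(2)[OF Y]] by simp
  next
    fix U X assume "open U" "smooth_section (atl S) (TB S) U X"
    then show "smooth_fun (atl S) U (\<lambda>p. emb \<phi> p (0, X p))"
      using emb_smooth[OF \<phi> _ PE.zero_section(1)] by blast
  next
    fix c p v w assume c: "c \<in> atl S" "p \<in> fst c"
    note o = chart_open[OF c(1)] and s = chart_vec_smooth[OF c(1)] and f = chart_vec_fib[OF c]
    show "mdiff (atl S) (\<lambda>q. emb \<phi> q (0, chart_vec c v q)) p (chart_vec c w p) =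
          mdiff (atl S) (\<lambda>q. emb \<phi> q (0, chart_vec c w q)) p (chart_vec c v p)"
      unfolding gaussD[OF gw[OF f] o c(2) s] lie_bracket_chart_vec(2)[OF c, of v w]
      using normal_formD(2)[OF n f f] by metis
  qed
  then show ?thesis using xi_emb[OF \<phi>] by (auto simp: is_integral_def)
qed

text \<open>Since \<open>dF\<close> is the tangential part of \<open>emb \<phi>\<close> and \<open>emb \<phi> p\<close> is an isometry onto \<open>\<real>\<^sup>2\<^sup>,\<^sup>2\<close>, its normal part
  is an isometry onto the normal spaces; the Gauss and Weingarten formulas say that it takes \<open>B\<close> to the
  second fundamental form and the connection of \<open>E\<close> to the normal connection.\<close>

lemma killing_immersion:
  assumes k: "killing_solution S h B \<phi>" and F: "is_integral S F (xi_form S \<phi>)"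
  shows "immersion_with S h B F (\<lambda>p v. emb \<phi> p (v, 0))"
proof -
  have \<phi>: "unit_spinor_field S \<phi>" and B: "symmetric_form S B"
    and tr: "\<forall>p. (1/2) *\<^sub>R metric_trace S B p = h p"
    and gw: "\<And>p X. X \<in> fib (TB S) p \<Longrightarrow> gauss_weingarten B (emb \<phi>) p X"
    using k unfolding killing_solution_iff by auto
  note n = symmetric_form_normal[OF B]
  have Fs: "smooth_fun (atl S) UNIV F" using F by (simp add: is_integral_def)
  have dF: "mdiff (atl S) F p X = emb \<phi> p (0, X)" if "X \<in> fib (TB S) p" for p X
  proof -
    have "iota (mdiff (atl S) F p X) = iota (emb \<phi> p (0, X))"
      using F that xi_emb[OF \<phi> that] by (simp add: is_integral_def)
    then show ?thesis by (simp only: iota_inject)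
  qed
  have im: "isometric_immersion S F"
    unfolding isometric_immersion_def
  proof (intro conjI allI ballI Fs)
    fix p
    show "inj_on (mdiff (atl S) F p) (fib (TB S) p)"
      using emb_inj[OF \<phi> fibre_pairs(2) fibre_pairs(2)] by (auto simp: inj_on_def dF)
    fix X Y assume "X \<in> fib (TB S) p" "Y \<in> fib (TB S) p"
    then show "ip22 (mdiff (atl S) F p X) (mdiff (atl S) F p Y) = met (TB S) p X Y"
      using emb_isometry[OF \<phi>, of 0 X p 0 Y] by (simp add: dF fibre_pairs PE.met_zero PE.fib_closed)
  qed
  have normal: "emb \<phi> p (v, 0) \<in> normal_space S F p" if "v \<in> fib (EB S) p" for v p
    using emb_isometry[OF \<phi>, of v 0 p 0] that
    by (auto simp: normal_space_def dF fibre_pairs PE.met_zero TT.met_zero)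
  have surj: "\<exists>v\<in>fib (EB S) p. x = emb \<phi> p (v, 0)" if x: "x \<in> normal_space S F p" for x p
  proof -
    obtain v Z where vZ: "(v, Z) \<in> fibre p" "emb \<phi> p (v, Z) = x"
      using emb_surj[OF \<phi>, of p x] by (metis surj_pair)
    have Zf: "Z \<in> fib (TB S) p" and vf: "v \<in> fib (EB S) p" using vZ(1) by (auto simp: fibre_def)
    have "met (TB S) p Z Y = 0" if Y: "Y \<in> fib (TB S) p" for Y
      using emb_isometry[OF \<phi> vZ(1) fibre_pairs(2)[OF Y]] x Y vZ(2) vf
      by (simp add: normal_space_def dF PE.met_zero)
    then have "Z = 0" by (rule met_nondegenerate_T[OF Zf])
    then show ?thesis using vZ(2) vf by blast
  qed
  have np: "normal_part S F p (emb \<phi> p (v, W)) = emb \<phi> p (v, 0)"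
    if "v \<in> fib (EB S) p" "W \<in> fib (TB S) p" for v W p
    using normal_part_eq[OF im normal[OF that(1)] that(2)] emb_pair[OF \<phi> that] by (simp add: dF that add.commute)
  show ?thesis
    unfolding immersion_with_def
  proof (intro conjI)
    show "\<forall>p. bij_betw (\<lambda>v. emb \<phi> p (v, 0)) (fib (EB S) p) (normal_space S F p)"
    proof
      fix p
      have "inj_on (\<lambda>v. emb \<phi> p (v, 0)) (fib (EB S) p)"
        using emb_inj[OF \<phi> fibre_pairs(1) fibre_pairs(1)] by (auto simp: inj_on_def)
      moreover have "(\<lambda>v. emb \<phi> p (v, 0)) ` fib (EB S) p = normal_space S F p"
        using normal surj by blast
      ultimately show "bij_betw (\<lambda>v. emb \<phi> p (v, 0)) (fib (EB S) p) (normal_space S F p)"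
        by (simp add: bij_betw_def)
    qed
    show "\<forall>p. \<forall>v\<in>fib (EB S) p. \<forall>w\<in>fib (EB S) p. \<forall>r.
       emb \<phi> p (v + w, 0) = emb \<phi> p (v, 0) + emb \<phi> p (w, 0) \<and> emb \<phi> p (r *\<^sub>R v, 0) = r *\<^sub>R emb \<phi> p (v, 0) \<and>
       ip22 (emb \<phi> p (v, 0)) (emb \<phi> p (w, 0)) = met (EB S) p v w"
    proof (intro allI ballI conjI)
      fix p v w and r :: real assume v: "v \<in> fib (EB S) p" and w: "w \<in> fib (EB S) p"
      show "emb \<phi> p (v + w, 0) = emb \<phi> p (v, 0) + emb \<phi> p (w, 0)"
        using emb_add[OF \<phi> fibre_pairs(1)[OF v] fibre_pairs(1)[OF w]] by simp
      show "emb \<phi> p (r *\<^sub>R v, 0) = r *\<^sub>R emb \<phi> p (v, 0)"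
        using emb_scale[OF \<phi> fibre_pairs(1)[OF v], of r] by simp
      show "ip22 (emb \<phi> p (v, 0)) (emb \<phi> p (w, 0)) = met (EB S) p v w"
        using emb_isometry[OF \<phi> fibre_pairs(1)[OF v] fibre_pairs(1)[OF w]] by (simp add: TT.met_zero TT.fib_closed)
    qed
    show "\<forall>U s. open U \<and> smooth_section (atl S) (EB S) U s \<longrightarrow>
       smooth_fun (atl S) U (\<lambda>p. emb \<phi> p (s p, 0)) \<and>
       (\<forall>p\<in>U. \<forall>X\<in>fib (TB S) p. emb \<phi> p (nab (EB S) p X s, 0) =
          normal_part S F p (mdiff (atl S) (\<lambda>q. emb \<phi> q (s q, 0)) p X))"
    proof (intro allI impI; elim conjE; intro conjI ballI)
      fix U s assume U: "open U" and s: "smooth_section (atl S) (EB S) U s"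
      show "smooth_fun (atl S) U (\<lambda>p. emb \<phi> p (s p, 0))"
        by (rule emb_smooth[OF \<phi> U s TT.zero_section(1)[OF U]])
      fix p X assume p: "p \<in> U" and X: "X \<in> fib (TB S) p"
      obtain W where "W \<in> fib (TB S) p" "mdiff (atl S) (\<lambda>x. emb \<phi> x (s x, 0)) p X = emb \<phi> p (nab (EB S) p X s, W)"
        using weingartenD[OF gw[OF X] U p s] by blast
      then show "emb \<phi> p (nab (EB S) p X s, 0) = normal_part S F p (mdiff (atl S) (\<lambda>q. emb \<phi> q (s q, 0)) p X)"
        using np[OF PE.nab_fib[OF U s p X]] by simp
    qed
    show "\<forall>U Y. open U \<and> smooth_section (atl S) (TB S) U Y \<longrightarrow>
       (\<forall>p\<in>U. \<forall>X\<in>fib (TB S) p. emb \<phi> p (B p X (Y p), 0) =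
          normal_part S F p (mdiff (atl S) (\<lambda>q. mdiff (atl S) F q (Y q)) p X))"
    proof (intro allI impI; elim conjE; intro ballI)
      fix U Y p X assume U: "open U" and Y: "smooth_section (atl S) (TB S) U Y" and p: "p \<in> U" and X: "X \<in> fib (TB S) p"
      have "mdiff (atl S) (\<lambda>q. mdiff (atl S) F q (Y q)) p X = mdiff (atl S) (\<lambda>q. emb \<phi> q (0, Y q)) p X"
        by (rule mdiff_cong[OF U p]) (simp add: dF TT.smooth_section_fib[OF Y])
      also have "\<dots> = emb \<phi> p (B p X (Y p), nab (TB S) p X Y)" by (rule gaussD[OF gw[OF X] U p Y])
      finally show "emb \<phi> p (B p X (Y p), 0) = normal_part S F p (mdiff (atl S) (\<lambda>q. mdiff (atl S) F q (Y q)) p X)"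
        using np[OF normal_formD(1)[OF n X TT.smooth_section_fib[OF Y p]] TT.nab_fib[OF U Y p X]] by simp
    qed
  qed (use im B tr in auto)
qed

end

section \<open>Lifting frames of \<open>\<real>\<^sup>2\<^sup>,\<^sup>2\<close> to the spin group\<close>

text \<open>
  The real span of \<open>1\<close>, \<open>i I\<close>, \<open>J\<close>, \<open>i K\<close> is the algebra of split quaternions, and \<open>\<real>\<^sup>2\<^sup>,\<^sup>2\<close> is this
  space with the negative of its norm form (\<open>vec_quat\<close>). Since \<open>(1 + \<sigma>) / 2\<close> and \<open>(1 - \<sigma>) / 2\<close> are
  orthogonal idempotents, pairs \<open>(a, b)\<close> of split quaternions give elements \<open>join a b\<close> of \<open>H0\<close> that
  are multiplied componentwise, and they act by \<open>m \<mapsto> qconj a m b\<close>. To lift an orthonormal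
  frame \<open>t\<close> therefore means to find \<open>a\<close> and \<open>b\<close> of norm one with
  \<open>vec_quat (t $ j) = qconj a (vec_quat (axis j 1)) b\<close> for all \<open>j\<close>.

  The ratios \<open>f j\<close> of \<open>vec_quat (t $ j)\<close> and \<open>vec_quat (t $ 0)\<close> do not involve \<open>b\<close>, and \<open>a\<close> has to conjugate
  them to the corresponding units \<open>F j\<close> of the standard frame. Both systems anticommute and have the same
  squares, so averaging over the group generated by \<open>F 1\<close> and \<open>F 2\<close> gives an element \<open>G\<close> with
  \<open>f j G = G (F j)\<close> for \<open>j = 1, 2\<close>. If its norm is positive, it can be normalised to \<open>qconj a\<close>. The third
  unit is then determined up to sign, and the sign is tested by \<open>frame_sign\<close>.
\<close>

definition split_quat :: "real \<Rightarrow> real \<Rightarrow> real \<Rightarrow> real \<Rightarrow> HAC"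
  where "split_quat a b c d = h0 a 0 b 0 c 0 d 0"

lemma split_quat_ops:
  "split_quat a0 a1 a2 a3 \<odot> split_quat b0 b1 b2 b3 = split_quat (a0*b0 + a1*b1 - a2*b2 + a3*b3) (a0*b1 + a1*b0 + a2*b3 - a3*b2)
    (a0*b2 + a1*b3 + a2*b0 - a3*b1) (a0*b3 + a1*b2 - a2*b1 + a3*b0)"
  "split_quat a0 a1 a2 a3 + split_quat b0 b1 b2 b3 = split_quat (a0 + b0) (a1 + b1) (a2 + b2) (a3 + b3)"
  "split_quat a0 a1 a2 a3 - split_quat b0 b1 b2 b3 = split_quat (a0 - b0) (a1 - b1) (a2 - b2) (a3 - b3)"
  "- split_quat a0 a1 a2 a3 = split_quat (- a0) (- a1) (- a2) (- a3)"
  "r *\<^sub>R split_quat a0 a1 a2 a3 = split_quat (r * a0) (r * a1) (r * a2) (r * a3)"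
  "qconj (split_quat a0 a1 a2 a3) = split_quat a0 (- a1) (- a2) (- a3)"
  "qhat (split_quat a0 a1 a2 a3) = split_quat a0 a1 a2 a3"
  "q_one = split_quat 1 0 0 0"
  unfolding diff_conv_add_uminus by (simp_all add: split_quat_def h0_mult h0_ops)

lemma split_quat_inject: "split_quat a0 a1 a2 a3 = split_quat b0 b1 b2 b3 \<longleftrightarrow> a0 = b0 \<and> a1 = b1 \<and> a2 = b2 \<and> a3 = b3"
  by (simp add: split_quat_def h0_inject)

definition split_quats :: "HAC set" where "split_quats = {split_quat a b c d | a b c d. True}"

lemma split_quat_in: "split_quat a b c d \<in> split_quats" by (auto simp: split_quats_def)

lemma split_quats_closed: "x \<in> split_quats \<Longrightarrow> y \<in> split_quats \<Longrightarrow> x \<odot> y \<in> split_quats" "x \<in> split_quats \<Longrightarrow> y \<in> split_quats \<Longrightarrow> x + y \<in> split_quats"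
  "x \<in> split_quats \<Longrightarrow> y \<in> split_quats \<Longrightarrow> x - y \<in> split_quats"
  "x \<in> split_quats \<Longrightarrow> qconj x \<in> split_quats" "x \<in> split_quats \<Longrightarrow> r *\<^sub>R x \<in> split_quats" "x \<in> split_quats \<Longrightarrow> - x \<in> split_quats" "q_one \<in> split_quats"
  unfolding split_quats_def by (auto simp: split_quat_ops) blast+

lemma split_quats_hat: "x \<in> split_quats \<Longrightarrow> qhat x = x"
  by (auto simp: split_quats_def split_quat_ops)

lemma split_quats_H0: "x \<in> split_quats \<Longrightarrow> x \<in> H0"
  by (auto simp: split_quats_def split_quat_def)

definition scal :: "HAC \<Rightarrow> real" where "scal z = Re (fst (fst z))"

lemma scal_split_quat [simp]: "scal (split_quat a b c d) = a"
  by (simp add: scal_def split_quat_def h0_def)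

lemma bounded_linear_scal: "bounded_linear scal"
  unfolding linear_conv_bounded_linear[symmetric] by (rule linearI) (simp_all add: scal_def)

lemma split_quats_norm: "x \<in> split_quats \<Longrightarrow> qconj x \<odot> x = scal (qconj x \<odot> x) *\<^sub>R q_one"
    "x \<in> split_quats \<Longrightarrow> x \<odot> qconj x = scal (qconj x \<odot> x) *\<^sub>R q_one"
  by (auto simp: split_quats_def split_quat_ops split_quat_inject algebra_simps)

definition vec_quat :: "real^4 \<Rightarrow> HAC" where "vec_quat x = split_quat (x $ 0) (- x $ 1) (x $ 2) (- x $ 3)"

lemma vec_quat_split: "vec_quat x \<in> split_quats" by (simp add: vec_quat_def split_quat_in)

lemma bounded_linear_vec_quat: "bounded_linear vec_quat"
  unfolding linear_conv_bounded_linear[symmetric] by (rule linearI) (simp_all add: vec_quat_def split_quat_ops)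

lemma vec_quat_polar: "vec_quat x \<odot> qconj (vec_quat y) + vec_quat y \<odot> qconj (vec_quat x) = (- 2 * ip22 x y) *\<^sub>R q_one"
  by (simp add: vec_quat_def split_quat_ops split_quat_inject ip22_def algebra_simps)

lemma vec_quat_norm: "vec_quat x \<odot> qconj (vec_quat x) = (- ip22 x x) *\<^sub>R q_one" "qconj (vec_quat x) \<odot> vec_quat x = (- ip22 x x) *\<^sub>R q_one"
  by (simp_all add: vec_quat_def split_quat_ops split_quat_inject ip22_def algebra_simps)

text \<open>The element with components \<open>a\<close> and \<open>b\<close> with respect to the idempotents \<open>(1 + \<sigma>) / 2\<close> and
  \<open>(1 - \<sigma>) / 2\<close>.\<close>

definition join :: "HAC \<Rightarrow> HAC \<Rightarrow> HAC"
  where "join a b = (1/2) *\<^sub>R (a + b) + (1/2) *\<^sub>R ascale (0, 1) (a - b)"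

lemma ascale_sigma: "ascale (0, 1) (ascale (0, 1) x) = x" "qconj (ascale (0, 1) x) = ascale (0, 1) (qconj x)"
  "qhat (ascale (0, 1) x) = - ascale (0, 1) (qhat x)" "x \<in> H0 \<Longrightarrow> ascale (0, 1) x \<in> H0"
proof -
  show "ascale (0, 1) (ascale (0, 1) x) = x" "qconj (ascale (0, 1) x) = ascale (0, 1) (qconj x)"
    by (simp_all add: ascale_ascale amul_pair ascale_one ascale_conj)
  have "ahat (0, 1) = - (0, 1)" by (simp add: ahat_def)
  then show "qhat (ascale (0, 1) x) = - ascale (0, 1) (qhat x)"
    by (simp only: ascale_hat ascale_one)
  show "x \<in> H0 \<Longrightarrow> ascale (0, 1) x \<in> H0"
  proof (elim H0E)
    fix u0 v0 u1 v1 u2 v2 u3 v3 assume "x = h0 u0 v0 u1 v1 u2 v2 u3 v3"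
    then have "ascale (0, 1) x = h0 v0 u0 v1 u1 v2 u2 v3 u3" by (simp add: h0_def amul_pair)
    then show ?thesis by simp
  qed
qed

lemma join_mult: "join a b \<odot> join c d = join (a \<odot> c) (b \<odot> d)"
  by (simp add: join_def qmul_simps ascale_qmul ascale_simps ascale_sigma algebra_simps)
    (simp flip: scaleR_add_left scaleR_diff_left add: algebra_simps)

lemma join_conj: "qconj (join a b) = join (qconj a) (qconj b)"
  by (simp add: join_def qconj_linear ascale_sigma)

lemma join_hat: "a \<in> split_quats \<Longrightarrow> b \<in> split_quats \<Longrightarrow> qhat (join a b) = join b a"
  by (simp add: join_def qhat_linear ascale_sigma split_quats_hat ascale_simps algebra_simps)

lemma join_H0: "a \<in> split_quats \<Longrightarrow> b \<in> split_quats \<Longrightarrow> join a b \<in> H0"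
  unfolding join_def by (intro H0_closed ascale_sigma split_quats_H0 split_quats_closed)

lemma join_one: "join q_one q_one = q_one"
  by (simp add: join_def ascale_simps flip: scaleR_2)

lemma iota_join: "iota x = ascale a_i (join (vec_quat x) (- qconj (vec_quat x)))"
  by (simp add: iota_eq join_def vec_quat_def split_quat_ops) (simp add: split_quat_def h0_def a_i_def amul_pair zero_prod_def complex_eq_iff)

lemma join_action:
  assumes ab: "a \<in> split_quats" "b \<in> split_quats" and eq: "vec_quat y = qconj a \<odot> vec_quat x \<odot> b"
  shows "iota y = qconj (join a b) \<odot> iota x \<odot> qhat (join a b)"
proof -
  have "qconj (join a b) \<odot> iota x \<odot> qhat (join a b) =
      ascale a_i (join (qconj a \<odot> vec_quat x \<odot> b) (- (qconj b \<odot> qconj (vec_quat x) \<odot> a)))"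
    unfolding iota_join[of x] join_conj join_hat[OF ab] ascale_qmul join_mult
    by (simp add: qmul_simps)
  also have "qconj b \<odot> qconj (vec_quat x) \<odot> a = qconj (vec_quat y)"
    by (simp add: eq qconj_qmul qmul_assoc)
  finally show ?thesis unfolding eq[symmetric] iota_join[of y] by simp
qed

definition orthonormal :: "real^4^4 \<Rightarrow> bool"
  where "orthonormal t \<longleftrightarrow> (\<forall>i j. ip22 (t $ i) (t $ j) = ip22 (axis i 1) (axis j 1))"

definition std_frame :: "real^4^4" where "std_frame = (\<chi> j. axis j 1)"

definition frame_ratio :: "4 \<Rightarrow> real^4^4 \<Rightarrow> HAC" where "frame_ratio j t = vec_quat (t $ j) \<odot> qconj (vec_quat (t $ 0))"

text \<open>The sum of the products \<open>f(g) g\<inverse>\<close> over \<open>g = 1, F 1, F 2, F 1 F 2\<close>, where \<open>f\<close> takes \<open>F j\<close> to \<open>f j\<close>.\<close>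

definition intertwiner :: "real^4^4 \<Rightarrow> HAC"
  where "intertwiner t = q_one + frame_ratio 1 t \<odot> split_quat 0 (-1) 0 0 - frame_ratio 2 t \<odot> split_quat 0 0 1 0 + frame_ratio 1 t \<odot> frame_ratio 2 t \<odot> split_quat 0 0 0 (-1)"

definition intertwiner_norm :: "real^4^4 \<Rightarrow> real" where "intertwiner_norm t = scal (qconj (intertwiner t) \<odot> intertwiner t)"

definition frame_sign :: "real^4^4 \<Rightarrow> real" where "frame_sign t = scal (frame_ratio 3 t \<odot> frame_ratio 1 t \<odot> frame_ratio 2 t)"

text \<open>Two open conditions that hold for the standard frame; an orthonormal frame that satisfies them has
  the lift \<open>spin_lift t\<close>.\<close>

definition near_id :: "real^4^4 \<Rightarrow> bool" where "near_id t \<longleftrightarrow> intertwiner_norm t > 0 \<and> frame_sign t > 0"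

text \<open>The outer factor \<open>\<sigma>\<close> compensates the sign in the definition of \<open>rho\<close>, because \<open>qhat\<close> changes the sign
  of \<open>\<sigma>\<close>.\<close>

definition spin_lift :: "real^4^4 \<Rightarrow> HAC"
  where "spin_lift t = ascale (0, 1) (join ((1 / sqrt (intertwiner_norm t)) *\<^sub>R qconj (intertwiner t))
    ((1 / sqrt (intertwiner_norm t)) *\<^sub>R qconj (intertwiner t) \<odot> vec_quat (t $ 0)))"

definition lift_of :: "HAC \<Rightarrow> real^4^4 \<Rightarrow> bool"
  where "lift_of u t \<longleftrightarrow> unitH0 u \<and> (\<forall>j. rho u (axis j 1) = t $ j)"

lemma orthonormalD:
  assumes "orthonormal t"
  shows "ip22 (t $ 0) (t $ 0) = -1" "ip22 (t $ 1) (t $ 1) = 1" "ip22 (t $ 2) (t $ 2) = -1" "ip22 (t $ 3) (t $ 3) = 1"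
    "ip22 (t $ 0) (t $ 1) = 0" "ip22 (t $ 0) (t $ 2) = 0" "ip22 (t $ 0) (t $ 3) = 0"
    "ip22 (t $ 1) (t $ 2) = 0" "ip22 (t $ 1) (t $ 3) = 0" "ip22 (t $ 2) (t $ 3) = 0"
  using assms unfolding orthonormal_def by (simp_all add: axis4 ip22_def)

lemma near_id_lift:
  assumes t: "orthonormal t" and n: "near_id t"
  shows "lift_of (spin_lift t) t"
proof -
  note o = orthonormalD[OF t]
  define m0 where "m0 = vec_quat (t $ 0)"
  have m0: "m0 \<in> split_quats" "qconj m0 \<odot> m0 = q_one" "m0 \<odot> qconj m0 = q_one" "qconj m0 \<odot> (m0 \<odot> x) = x" for x
    using vec_quat_norm[of "t $ 0"] o
    by (simp_all add: m0_def vec_quat_split) (simp flip: qmul_assoc)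
  define f where "f j = frame_ratio j t" for j
  have fr: "f j \<in> split_quats" for j unfolding f_def frame_ratio_def by (intro split_quats_closed vec_quat_split)
  have ff: "f i \<odot> qconj (f j) = vec_quat (t $ i) \<odot> qconj (vec_quat (t $ j))" for i j
    unfolding f_def frame_ratio_def m0_def[symmetric] by (simp add: qconj_qmul qmul_assoc m0(4))
  have fc: "qconj (f j) = - f j" if "ip22 (t $ 0) (t $ j) = 0" for j
  proof -
    have "f j + qconj (f j) = 0"
      using vec_quat_polar[of "t $ 0" "t $ j"] that unfolding f_def frame_ratio_def by (simp add: qconj_qmul add.commute)
    then show ?thesis by (simp add: eq_neg_iff_add_eq_0 add.commute)
  qed
  note c = fc[OF o(5)] fc[OF o(6)] fc[OF o(7)]
  have fsq: "f j \<odot> f j = ip22 (t $ j) (t $ j) *\<^sub>R q_one" if "ip22 (t $ 0) (t $ j) = 0" for j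
    using ff[of j j] fc[OF that] vec_quat_norm(1)[of "t $ j"] by (simp add: qmul.minus_right)
  have sq: "f 1 \<odot> f 1 = q_one" "f 2 \<odot> f 2 = - q_one" "f 3 \<odot> f 3 = q_one"
    using fsq[OF o(5)] fsq[OF o(6)] fsq[OF o(7)] o by simp_all
  have ac: "f i \<odot> f j = - (f j \<odot> f i)" if "qconj (f i) = - f i" "qconj (f j) = - f j" "ip22 (t $ i) (t $ j) = 0" for i j
  proof -
    have "- (f i \<odot> f j + f j \<odot> f i) = f i \<odot> qconj (f j) + f j \<odot> qconj (f i)"
      by (simp add: that(1,2) qmul.minus_right)
    also have "\<dots> = 0" unfolding ff vec_quat_polar by (simp add: that(3))
    finally have "f i \<odot> f j + f j \<odot> f i = 0" by (simp only: neg_equal_0_iff_equal)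
    then show ?thesis by (simp only: eq_neg_iff_add_eq_0)
  qed
  have a12: "f 2 \<odot> f 1 = - (f 1 \<odot> f 2)" by (rule ac[OF c(2,1)]) (simp only: o ip22_linear(7)[of "t $ 2"])
  have a31: "f 3 \<odot> f 1 = - (f 1 \<odot> f 3)" by (rule ac[OF c(3,1)]) (simp only: o ip22_linear(7)[of "t $ 3"])
  have a32: "f 3 \<odot> f 2 = - (f 2 \<odot> f 3)" by (rule ac[OF c(3,2)]) (simp only: o ip22_linear(7)[of "t $ 3"])
  have sq': "f 1 \<odot> (f 1 \<odot> x) = x" "f 2 \<odot> (f 2 \<odot> x) = - x" "f 2 \<odot> (f 1 \<odot> x) = - (f 1 \<odot> (f 2 \<odot> x))" for x
    by (simp_all add: qmul_assoc[symmetric] sq a12 qmul.minus_left)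
  define F1 F2 F3 where "F1 = split_quat 0 (-1) 0 0" and "F2 = split_quat 0 0 1 0" and "F3 = split_quat 0 0 0 (-1)"
  have F: "F1 \<odot> F1 = q_one" "F2 \<odot> F2 = - q_one" "F1 \<odot> F2 = F3" "F2 \<odot> F1 = - F3" "F3 \<odot> F1 = - F2" "F3 \<odot> F2 = - F1"
    by (simp_all add: F1_def F2_def F3_def split_quat_ops split_quat_inject)
  have FR: "F1 \<in> split_quats" "F2 \<in> split_quats" "F3 \<in> split_quats" by (simp_all add: F1_def F2_def F3_def split_quat_in)
  define G where "G = intertwiner t"
  have G: "G = q_one + f 1 \<odot> F1 - f 2 \<odot> F2 + f 1 \<odot> (f 2 \<odot> F3)"
    by (simp add: G_def intertwiner_def f_def F1_def F2_def F3_def qmul_assoc)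
  have GR: "G \<in> split_quats" unfolding G by (intro split_quats_closed fr FR)
  have G1: "f 1 \<odot> G = G \<odot> F1"
    unfolding G by (simp add: qmul_simps F sq' sq algebra_simps)
  have G2: "f 2 \<odot> G = G \<odot> F2"
    unfolding G by (simp add: qmul_simps F sq' sq algebra_simps)
  define N where "N = intertwiner_norm t"
  have N: "N > 0" "qconj G \<odot> G = N *\<^sub>R q_one" "G \<odot> qconj G = N *\<^sub>R q_one"
    using n split_quats_norm[OF GR] by (simp_all add: near_id_def N_def intertwiner_norm_def G_def)
  define a where "a = (1 / sqrt N) *\<^sub>R qconj G"
  have aR: "a \<in> split_quats" unfolding a_def by (intro split_quats_closed GR)
  have s2: "1 / sqrt N * (1 / sqrt N) * N = 1" using N(1) by (simp add: field_simps)
  have au: "qconj a \<odot> a = q_one" "a \<odot> qconj a = q_one"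
    using s2 by (simp_all add: a_def qconj_linear qmul.scaleR_left qmul.scaleR_right N)
  have au': "qconj a \<odot> (a \<odot> x) = x" "a \<odot> (qconj a \<odot> x) = x" for x
    by (simp_all add: qmul_assoc[symmetric] au)
  have conj_f: "f j = qconj a \<odot> F \<odot> a" if "f j \<odot> G = G \<odot> F" for j F
  proof -
    have "qconj a \<odot> F \<odot> a = (1 / sqrt N) *\<^sub>R (G \<odot> F \<odot> a)"
      by (simp add: a_def qconj_linear qmul.scaleR_left)
    also have "\<dots> = f j \<odot> ((1 / sqrt N) *\<^sub>R G) \<odot> a"
      by (simp add: that[symmetric] qmul_simps)
    also have "\<dots> = f j" using au(1) by (simp add: qmul_assoc a_def qconj_linear)
    finally show ?thesis by simp
  qed
  note f1 = conj_f[OF G1] and f2 = conj_f[OF G2]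
  define k where "k = a \<odot> f 3 \<odot> qconj a"
  have kR: "k \<in> split_quats" unfolding k_def by (intro split_quats_closed aR fr)
  then obtain k0 k1 k2 k3 where k: "k = split_quat k0 k1 k2 k3" by (auto simp: split_quats_def)
  have f3: "f 3 = qconj a \<odot> k \<odot> a" by (simp add: k_def qmul_assoc au' au)
  \<comment> \<open>The third ratio, conjugated back, anticommutes with \<open>F1\<close> and \<open>F2\<close> and has square one; so it is
    \<open>F3\<close> or \<open>- F3\<close>.\<close>
  have kk: "k \<odot> F1 = - (F1 \<odot> k)" "k \<odot> F2 = - (F2 \<odot> k)"
  proof -
    have e: "a \<odot> f 1 \<odot> qconj a = F1" "a \<odot> f 2 \<odot> qconj a = F2"
      by (simp_all add: f1 f2 qmul_assoc au' au)
    have "k \<odot> F1 = a \<odot> (f 3 \<odot> f 1) \<odot> qconj a" "F1 \<odot> k = a \<odot> (f 1 \<odot> f 3) \<odot> qconj a"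
      unfolding e[symmetric] k_def by (simp_all add: qmul_assoc au')
    then show "k \<odot> F1 = - (F1 \<odot> k)" by (simp add: a31 qmul.minus_left qmul.minus_right)
    have "k \<odot> F2 = a \<odot> (f 3 \<odot> f 2) \<odot> qconj a" "F2 \<odot> k = a \<odot> (f 2 \<odot> f 3) \<odot> qconj a"
      unfolding e[symmetric] k_def by (simp_all add: qmul_assoc au')
    then show "k \<odot> F2 = - (F2 \<odot> k)" by (simp add: a32 qmul.minus_left qmul.minus_right)
  qed
  have "k \<odot> k = q_one" unfolding k_def by (simp add: qmul_assoc au') (simp add: qmul_assoc[symmetric] sq au)
  then have kz: "k = split_quat 0 0 0 k3" "k3 * k3 = 1"
    using kk unfolding k F1_def F2_def by (auto simp: split_quat_ops split_quat_inject)
  have "f 3 \<odot> f 1 \<odot> f 2 = qconj a \<odot> (k \<odot> F1 \<odot> F2) \<odot> a"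
    unfolding f1 f2 f3 by (simp add: qmul_assoc au')
  also have "k \<odot> F1 \<odot> F2 = (- k3) *\<^sub>R q_one"
    by (simp add: kz(1) F1_def F2_def split_quat_ops split_quat_inject)
  finally have "f 3 \<odot> f 1 \<odot> f 2 = (- k3) *\<^sub>R q_one" by (simp add: qmul_simps au)
  then have "scal (f 3 \<odot> f 1 \<odot> f 2) = - k3" by (simp add: split_quat_ops)
  moreover have "scal (f 3 \<odot> f 1 \<odot> f 2) > 0" using n by (simp add: near_id_def frame_sign_def f_def)
  ultimately have "k3 < 0" by simp
  with kz(2) have "k3 = -1" by (simp add: square_eq_1_iff)
  then have kF: "k = F3" by (simp add: kz(1) F3_def)
  define b where "b = a \<odot> m0"
  have bR: "b \<in> split_quats" unfolding b_def by (intro split_quats_closed aR m0)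
  have bu: "qconj b \<odot> b = q_one" "b \<odot> qconj b = q_one"
  proof -
    show "qconj b \<odot> b = q_one" by (simp add: b_def qconj_qmul qmul_assoc au' m0)
    have "b \<odot> qconj b = a \<odot> (m0 \<odot> qconj m0) \<odot> qconj a" by (simp add: b_def qconj_qmul qmul_assoc)
    then show "b \<odot> qconj b = q_one" by (simp add: m0 au)
  qed
  let ?g = "join a b"
  have g: "?g \<in> H0" by (rule join_H0[OF aR bR])
  have gu: "qconj ?g \<odot> ?g = q_one" "?g \<odot> qconj ?g = q_one"
    unfolding join_conj join_mult au bu by (rule join_one)+
  have lf: "spin_lift t = ascale (0, 1) ?g"
    by (simp add: spin_lift_def a_def b_def N_def G_def m0_def)
  have u: "unitH0 (spin_lift t)"
    unfolding lf by (rule unitH0I) (simp_all add: ascale_sigma g ascale_qmul gu)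
  have fm: "vec_quat (t $ j) = f j \<odot> m0" for j
    by (simp add: f_def frame_ratio_def m0_def[symmetric] qmul_assoc m0)
  have act: "vec_quat (t $ j) = qconj a \<odot> vec_quat (axis j 1) \<odot> b" for j
  proof -
    have m: "vec_quat (axis 0 1) = q_one" "vec_quat (axis 1 1) = F1" "vec_quat (axis 2 1) = F2" "vec_quat (axis 3 1) = F3"
      by (simp_all add: axis4 vec_quat_def F1_def F2_def F3_def split_quat_ops)
    have "vec_quat (t $ 0) = qconj a \<odot> vec_quat (axis 0 1) \<odot> b"
      unfolding m m0_def[symmetric] b_def by (simp add: au')
    moreover have "vec_quat (t $ 1) = qconj a \<odot> vec_quat (axis 1 1) \<odot> b"
      unfolding m fm[of 1] b_def f1 by (simp add: qmul_assoc)
    moreover have "vec_quat (t $ 2) = qconj a \<odot> vec_quat (axis 2 1) \<odot> b"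
      unfolding m fm[of 2] b_def f2 by (simp add: qmul_assoc)
    moreover have "vec_quat (t $ 3) = qconj a \<odot> vec_quat (axis 3 1) \<odot> b"
      unfolding m fm[of 3] b_def f3 kF by (simp add: qmul_assoc)
    ultimately show ?thesis
      using forall_index4[of "\<lambda>j. vec_quat (t $ j) = qconj a \<odot> vec_quat (axis j 1) \<odot> b"] by blast
  qed
  have "iota (rho (spin_lift t) (axis j 1)) = iota (t $ j)" for j
    using iota_rho[OF unitH0_H0[OF u], of "axis j 1"] join_action[OF aR bR act[of j]]
    unfolding lf by (simp add: ascale_sigma ascale_qmul ascale_simps qmul.minus_right flip: qmul_assoc)
  then show ?thesis using u by (simp only: lift_of_def iota_inject simp_thms)
qed

lemma unitH0_sigma: "unitH0 u \<Longrightarrow> unitH0 (ascale (0, 1) u)"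
  by (rule unitH0I) (simp_all add: ascale_sigma unitH0_H0 ascale_qmul)

lemma rho_compose:
  assumes "unitH0 u" "unitH0 v"
  shows "rho u (rho v x) = rho (ascale (0, 1) (v \<odot> u)) x"
proof -
  note w = unitH0_sigma[OF unitH0_closed(1)[OF assms(2,1)]]
  have "iota (rho u (rho v x)) = iota (rho (ascale (0, 1) (v \<odot> u)) x)"
    unfolding iota_rho[OF unitH0_H0[OF assms(1)]] iota_rho[OF unitH0_H0[OF assms(2)]] iota_rho[OF unitH0_H0[OF w]]
    by (simp add: qmul_simps ascale_sigma ascale_qmul ascale_simps qconj_qmul qhat_qmul)
  then show ?thesis by (simp only: iota_inject)
qed

lemma rho_minus: "rho (- u) x = rho u x"
  by (simp add: rho_def qconj_linear qhat_linear qmul_simps)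

text \<open>If \<open>u\<close> and \<open>v\<close> act alike, then \<open>k = v \<odot> qconj u\<close> satisfies \<open>k \<odot> x = x \<odot> qhat k\<close> for all \<open>x\<close> in \<open>\<real>\<^sup>2\<^sup>,\<^sup>2\<close>. Inserting
  three basis vectors shows that \<open>k\<close> is real, and a real unit is \<open>\<plusminus>1\<close>.\<close>

lemma rho_eq_sign:
  assumes u: "unitH0 u" and v: "unitH0 v" and eq: "\<And>x. rho u x = rho v x"
  shows "u = v \<or> u = - v"
proof -
  define k where "k = v \<odot> qconj u"
  have k: "unitH0 k" unfolding k_def by (intro unitH0_closed u v)
  have kX: "k \<odot> iota x = iota x \<odot> qhat k" for x
  proof -
    have "qconj u \<odot> iota x \<odot> qhat u = qconj v \<odot> iota x \<odot> qhat v"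
      using arg_cong[OF eq[of x], of iota] by (simp add: iota_rho unitH0_H0 u v)
    then have "v \<odot> (qconj u \<odot> iota x \<odot> qhat u) \<odot> qconj (qhat u) = v \<odot> (qconj v \<odot> iota x \<odot> qhat v) \<odot> qconj (qhat u)"
      by simp
    then show ?thesis using u v by (simp add: k_def qmul_assoc qhat_qmul qhat_qconj)
  qed
  obtain u0 v0 u1 v1 u2 v2 u3 v3 where kc: "k = h0 u0 v0 u1 v1 u2 v2 u3 v3" using unitH0_H0[OF k] by (rule H0E)
  have i: "iota (quad 1 0 0 0) = ascale a_i (h0 0 1 0 0 0 0 0 0)" "iota (quad 0 1 0 0) = ascale a_i (h0 0 0 (-1) 0 0 0 0 0)"
    "iota (quad 0 0 0 1) = ascale a_i (h0 0 0 0 0 0 0 (-1) 0)"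
    by (simp_all add: iota_eq h0_def a_i_def amul_pair complex_eq_iff)
  have inj: "ascale a_i y = ascale a_i z \<longleftrightarrow> y = z" for y z
    by (metis amul_sigma_i(2) ascale_ascale ascale_one(2) neg_equal_iff_equal)
  have "k = h0 u0 0 0 0 0 0 0 0"
    using kX[of "quad 1 0 0 0"] kX[of "quad 0 1 0 0"] kX[of "quad 0 0 0 1"]
    unfolding i kc ascale_qmul inj by (simp add: h0_mult h0_ops h0_inject)
  moreover have "qconj k \<odot> k = q_one" using k by simp
  ultimately have "u0 = 1 \<or> u0 = -1" by (simp add: h0_mult h0_ops h0_inject square_eq_1_iff)
  then have "k = q_one \<or> k = - q_one"
    using \<open>k = h0 u0 0 0 0 0 0 0 0\<close> by (auto simp: h0_ops)
  moreover have "v = k \<odot> u" using u by (simp add: k_def qmul_assoc)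
  ultimately show ?thesis by (auto simp: qmul.minus_left)
qed

text \<open>The coordinates of \<open>t\<close> with respect to the orthonormal frame \<open>t'\<close>. If \<open>t'\<close> has the lift \<open>u\<close>, this is
  the frame \<open>t\<close> moved by the inverse of \<open>rho u\<close>; it is close to the standard frame if \<open>t\<close> is close to \<open>t'\<close>.\<close>

definition relative_frame :: "real^4^4 \<Rightarrow> real^4^4 \<Rightarrow> real^4^4"
  where "relative_frame t' t = (\<chi> j. quad (- ip22 (t' $ 0) (t $ j)) (ip22 (t' $ 1) (t $ j)) (- ip22 (t' $ 2) (t $ j)) (ip22 (t' $ 3) (t $ j)))"

lemma relative_frame_lift:
  assumes "lift_of u t'"
  shows "relative_frame t' t $ j = rho (qconj u) (t $ j)"
proof -
  let ?y = "rho (qconj u) (t $ j)"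
  have u: "unitH0 u" and t': "t' $ i = rho u (axis i 1)" for i using assms by (auto simp: lift_of_def)
  have "ip22 (t' $ i) (t $ j) = ip22 (axis i 1) ?y" for i
    using rho_isometry[OF u, of "axis i 1" ?y] by (simp add: t' rho_inverse[OF u])
  then show ?thesis
    by (simp add: relative_frame_def vec4_eq) (simp add: ip22_def axis4)
qed

lemma orthonormal_relative_frame:
  assumes l: "lift_of u t'" and t: "orthonormal t"
  shows "orthonormal (relative_frame t' t)"
proof -
  have "unitH0 (qconj u)" using l unitH0_closed(2) unfolding lift_of_def by blast
  note i = rho_isometry[OF this]
  show ?thesis using t unfolding orthonormal_def relative_frame_lift[OF l] i .
qed

lemma ip22_axis: "ip22 (axis 0 1) x = - x $ 0" "ip22 (axis 1 1) x = x $ 1" "ip22 (axis 2 1) x = - x $ 2"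
  "ip22 (axis 3 1) x = x $ 3"
  by (simp_all add: axis4 ip22_def)

lemma relative_frame_self:
  assumes "orthonormal t"
  shows "relative_frame t t = std_frame"
proof -
  have "relative_frame t t $ j = std_frame $ j" for j
    unfolding relative_frame_def std_frame_def vec_lambda_beta assms[unfolded orthonormal_def, rule_format]
    by (simp add: vec4_eq ip22_axis)
  then show ?thesis by (simp add: vec_eq_iff)
qed

lemma near_id_std_frame: "near_id std_frame"
proof -
  have f: "frame_ratio 0 std_frame = split_quat 1 0 0 0" "frame_ratio 1 std_frame = split_quat 0 (-1) 0 0" "frame_ratio 2 std_frame = split_quat 0 0 1 0" "frame_ratio 3 std_frame = split_quat 0 0 0 (-1)"
    by (simp_all add: frame_ratio_def std_frame_def axis4 vec_quat_def split_quat_ops)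
  show ?thesis
    by (simp add: near_id_def intertwiner_norm_def frame_sign_def intertwiner_def f split_quat_ops)
qed

lemma lift_from_relative:
  assumes l: "lift_of u t'" and t: "orthonormal t" and n: "near_id (relative_frame t' t)"
  shows "lift_of (ascale (0, 1) (spin_lift (relative_frame t' t) \<odot> u)) t"
proof -
  have u: "unitH0 u" using l by (simp add: lift_of_def)
  have v: "lift_of (spin_lift (relative_frame t' t)) (relative_frame t' t)" by (rule near_id_lift[OF orthonormal_relative_frame[OF l t] n])
  then have vu: "unitH0 (spin_lift (relative_frame t' t))" by (simp add: lift_of_def)
  have "rho (ascale (0, 1) (spin_lift (relative_frame t' t) \<odot> u)) (axis j 1) = t $ j" for j
    unfolding rho_compose[OF u vu, symmetric]
    using v relative_frame_lift[OF l, of t j] u by (simp add: lift_of_def rho_inverse)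
  then show ?thesis using unitH0_sigma[OF unitH0_closed(1)[OF vu u]] by (simp add: lift_of_def)
qed

lemma liftable_near:
  assumes "orthonormal t" "orthonormal t'" "near_id (relative_frame t t')" "near_id (relative_frame t' t)"
  shows "(\<exists>u. lift_of u t) \<longleftrightarrow> (\<exists>u. lift_of u t')"
  using lift_from_relative assms by blast

lemma near_id_continuous:
  "continuous_on UNIV (\<lambda>p. intertwiner_norm (relative_frame (fst p) (snd p)))" "continuous_on UNIV (\<lambda>p. frame_sign (relative_frame (fst p) (snd p)))"
proof -
  have ip: "continuous_on UNIV (\<lambda>p::(real^4^4) \<times> (real^4^4). ip22 (fst p $ i) (snd p $ j))" for i j
    unfolding ip22_def by (intro continuous_intros)
  have r: "continuous_on UNIV (\<lambda>p. relative_frame (fst p) (snd p) $ j)" for j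
    unfolding relative_frame_def vec_lambda_beta
      quad_linear_comb[of "- ip22 (fst p $ 0) (snd p $ j)" "ip22 (fst p $ 1) (snd p $ j)"
        "- ip22 (fst p $ 2) (snd p $ j)" "ip22 (fst p $ 3) (snd p $ j)" for p]
    by (intro continuous_intros ip)
  have f: "continuous_on UNIV (\<lambda>p. frame_ratio j (relative_frame (fst p) (snd p)))" for j
    unfolding frame_ratio_def by (intro bounded_bilinear.continuous_on[OF bounded_bilinear_qmul]
        bounded_linear.continuous_on[OF bounded_linear_vec_quat] bounded_linear.continuous_on[OF bounded_linear_qconj] r)
  have G: "continuous_on UNIV (\<lambda>p. intertwiner (relative_frame (fst p) (snd p)))"
    unfolding intertwiner_def by (intro continuous_intros bounded_bilinear.continuous_on[OF bounded_bilinear_qmul] f)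
  show "continuous_on UNIV (\<lambda>p. intertwiner_norm (relative_frame (fst p) (snd p)))"
    unfolding intertwiner_norm_def by (intro bounded_linear.continuous_on[OF bounded_linear_scal]
        bounded_bilinear.continuous_on[OF bounded_bilinear_qmul] bounded_linear.continuous_on[OF bounded_linear_qconj] G)
  show "continuous_on UNIV (\<lambda>p. frame_sign (relative_frame (fst p) (snd p)))"
    unfolding frame_sign_def by (intro bounded_linear.continuous_on[OF bounded_linear_scal]
        bounded_bilinear.continuous_on[OF bounded_bilinear_qmul] f)
qed

lemma open_near: "open {p. near_id (relative_frame (fst p) (snd p))}"
proof -
  have "open {p. 0 < intertwiner_norm (relative_frame (fst p) (snd p))}" "open {p. 0 < frame_sign (relative_frame (fst p) (snd p))}"
    using near_id_continuous by (auto intro!: open_Collect_less)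
  then have "open ({p. 0 < intertwiner_norm (relative_frame (fst p) (snd p))} \<inter> {p. 0 < frame_sign (relative_frame (fst p) (snd p))})"
    by (rule open_Int)
  then show ?thesis by (simp add: near_id_def Collect_conj_eq)
qed

lemma near_neighbourhood:
  assumes "orthonormal t"
  obtains N where "open N" "t \<in> N" "\<And>t'. t' \<in> N \<Longrightarrow> near_id (relative_frame t t') \<and> near_id (relative_frame t' t)"
proof -
  define N1 where "N1 = (\<lambda>t'. (t, t')) -` {p. near_id (relative_frame (fst p) (snd p))}"
  define N2 where "N2 = (\<lambda>t'. (t', t)) -` {p. near_id (relative_frame (fst p) (snd p))}"
  have "open N1" unfolding N1_def
    by (rule open_vimage[OF open_near continuous_on_Pair[OF continuous_on_const continuous_on_id]])
  moreover have "open N2" unfolding N2_def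
    by (rule open_vimage[OF open_near continuous_on_Pair[OF continuous_on_id continuous_on_const]])
  ultimately have o: "open (N1 \<inter> N2)" by (rule open_Int)
  have N: "t' \<in> N1 \<inter> N2 \<longleftrightarrow> near_id (relative_frame t t') \<and> near_id (relative_frame t' t)" for t'
    by (simp only: N1_def N2_def Int_iff vimage_eq mem_Collect_eq fst_conv snd_conv)
  have "near_id (relative_frame t t)" unfolding relative_frame_self[OF assms] by (rule near_id_std_frame)
  then have "t \<in> N1 \<inter> N2" unfolding N by (simp only: simp_thms)
  then show ?thesis
    using that[OF o] N by blast
qed

lemma lift_of_std_frame: "lift_of (ascale (0, 1) q_one) std_frame"
proof -
  have u: "unitH0 (ascale (0, 1) q_one)" by (intro unitH0_sigma unitH0_closed)
  have "iota (rho (ascale (0, 1) q_one) x) = iota x" for x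
    by (simp add: iota_rho[OF unitH0_H0[OF u]] ascale_sigma ascale_qmul ascale_simps qmul_simps)
  then show ?thesis using u by (simp add: lift_of_def std_frame_def iota_inject)
qed

lemma isometry_orthonormal: "R \<in> isometries22 \<Longrightarrow> orthonormal (\<chi> j. R *v axis j 1)"
  by (simp add: isometries22_def orthonormal_def)

text \<open>Liftability is a locally constant property of orthonormal frames by \<open>liftable_near\<close>, and the standard
  frame has a lift.\<close>

lemma identity_component_liftable:
  assumes "R \<in> connected_component_set isometries22 (mat 1)"
  shows "\<exists>u. lift_of u (\<chi> j. R *v axis j 1)"
proof -
  let ?K = "connected_component_set isometries22 (mat 1)"
  let ?t = "\<lambda>R::real^4^4. (\<chi> j. R *v axis j 1) :: real^4^4"
  have sub: "?K \<subseteq> isometries22" by (rule connected_component_subset)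
  have one: "mat 1 \<in> isometries22" by (simp add: isometries22_def)
  have cont: "continuous_on UNIV ?t"
  proof -
    have "linear ?t" by (rule linearI) (simp_all add: vec_eq_iff matrix_vector_mult_add_rdistrib scaleR_matrix_vector_assoc)
    then show ?thesis by (simp add: linear_continuous_on linear_conv_bounded_linear)
  qed
  have "(\<exists>u. lift_of u (?t (mat 1))) = (\<exists>u. lift_of u (?t R))"
  proof (rule connected_local_const[where A = ?K and f = "\<lambda>R. \<exists>u. lift_of u (?t R)"])
    show "connected ?K" by (rule connected_connected_component)
    show "mat 1 \<in> ?K" using one by (simp add: connected_component_refl)
    show "\<forall>a\<in>?K. \<forall>\<^sub>F b in at a within ?K. (\<exists>u. lift_of u (?t a)) = (\<exists>u. lift_of u (?t b))"
    proof
      fix a assume a: "a \<in> ?K"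
      then have oa: "orthonormal (?t a)" using sub isometry_orthonormal by blast
      obtain N where N: "open N" "?t a \<in> N" "\<And>t'. t' \<in> N \<Longrightarrow> near_id (relative_frame (?t a) t') \<and> near_id (relative_frame t' (?t a))"
        using near_neighbourhood[OF oa] by metis
      have o: "open (?t -` N)" using cont N(1) by (simp add: open_vimage)
      have "(\<exists>u. lift_of u (?t a)) = (\<exists>u. lift_of u (?t b))" if "b \<in> ?t -` N" "b \<in> ?K" for b
        using liftable_near[OF oa isometry_orthonormal] N(3)[of "?t b"] that sub by blast
      then show "\<forall>\<^sub>F b in at a within ?K. (\<exists>u. lift_of u (?t a)) = (\<exists>u. lift_of u (?t b))"
        unfolding eventually_at_topological using o N(2) by blast
    qed
  qed (rule assms)
  moreover have e: "?t (mat 1) = std_frame" by (simp only: std_frame_def matrix_vector_mul_lid)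
  moreover have "\<exists>u. lift_of u (?t (mat 1))" unfolding e by (rule exI) (rule lift_of_std_frame)
  ultimately show ?thesis by (simp only: simp_thms)
qed

lemma (in atlas) spin_lift_smooth:
  assumes U: "open U" and t: "\<And>j. smooth_fun A U (\<lambda>x. t x $ j)" and n: "\<And>x. x \<in> U \<Longrightarrow> near_id (t x)"
  shows "smooth_fun A U (\<lambda>x. spin_lift (t x))"
proof -
  note b = smooth_fun_bilinear[OF bounded_bilinear_qmul U]
  have q: "smooth_fun A U (\<lambda>x. qconj (f x))" if "smooth_fun A U f" for f
    by (rule smooth_fun_linear[OF bounded_linear_qconj U that])
  have m: "smooth_fun A U (\<lambda>x. vec_quat (t x $ j))" for j
    by (rule smooth_fun_linear[OF bounded_linear_vec_quat U t])
  have f: "smooth_fun A U (\<lambda>x. frame_ratio j (t x))" for j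
    unfolding frame_ratio_def by (intro b q m)
  have G: "smooth_fun A U (\<lambda>x. intertwiner (t x))"
    unfolding intertwiner_def by (intro smooth_fun_add smooth_fun_diff smooth_fun_const U b f)
  have N: "smooth_fun A U (\<lambda>x. intertwiner_norm (t x))"
    unfolding intertwiner_norm_def by (intro smooth_fun_linear[OF bounded_linear_scal U] b q G)
  have s: "smooth_fun A U (\<lambda>x. 1 / sqrt (intertwiner_norm (t x)))"
    by (rule smooth_fun_inverse_sqrt[OF U _ N]) (use n in \<open>simp add: near_id_def\<close>)
  have asc: "bounded_linear (ascale c)" for c
    using ascale_linear by (simp add: linear_conv_bounded_linear)
  show ?thesis
    unfolding spin_lift_def join_def
    by (intro smooth_fun_linear[OF asc U] smooth_fun_add smooth_fun_diff smooth_fun_scaleR smooth_fun_const U b s q G m)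
qed

section \<open>Spinor fields from isometries\<close>

lemma sign_by_norm:
  fixes a b :: "'a::real_normed_vector"
  assumes "b \<noteq> 0" "a = b \<or> a = - b"
  shows "a = b \<longleftrightarrow> norm (a - b) < norm (a + b)" "a \<noteq> b \<longleftrightarrow> norm (a + b) < norm (a - b)"
proof -
  have "b + b \<noteq> 0" using assms(1) by (simp add: scaleR_2[symmetric])
  moreover from this have "- b \<noteq> b" by (metis add.left_inverse)
  moreover have "- b - b = - (b + b)" by simp
  ultimately show "a = b \<longleftrightarrow> norm (a - b) < norm (a + b)" "a \<noteq> b \<longleftrightarrow> norm (a + b) < norm (a - b)"
    using assms(2) by (auto simp del: minus_add_distrib)
qed

context spin_surface
begin

lemma spinor_eqI:
  assumes f: "f \<in> spinors S p" and f': "f' \<in> spinors S p" and q: "q \<in> spin_frames S p" and eq: "f q = f' q"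
  shows "f = f'"
proof
  fix r
  show "f r = f' r"
  proof (cases "r \<in> spin_frames S p")
    case True
    obtain q1 q2 r1 r2 where q': "q = (q1, q2)" "r = (r1, r2)" by (cases q, cases r)
    obtain g1 g2 where g: "g1 \<in> Spin1" "g2 \<in> Spin2" "q1 = sact (PE S) r1 g1" "q2 = sact (PM S) r2 g2"
      using spin_frames_action True q unfolding q' by metis
    show ?thesis
      using spinor_action[OF f True[unfolded q'] g(1,2)] spinor_action[OF f' True[unfolded q'] g(1,2)] eq g
      by (simp add: q')
  next
    case False
    then show ?thesis using spinor_zero f f' by metis
  qed
qed

text \<open>The spin groups act simply transitively on the spin frames over a point, so the value at one frame
  extends to a unique equivariant function.\<close>

lemma spinor_with_value:
  assumes q: "q \<in> spin_frames S p" and u: "u \<in> H0"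
  shows "\<exists>f\<in>spinors S p. f q = u"
proof -
  obtain q01 q02 where q': "q = (q01, q02)" by (cases q)
  note q0 = spin_framesD(1,2)[OF q[unfolded q']]
  define G1 where "G1 q = (SOME g. g \<in> Spin1 \<and> q01 = sact (PE S) q g)" for q
  have "G1 q \<in> Spin1 \<and> q01 = sact (PE S) q (G1 q)" if q: "sproj (PE S) q = p" for q
    unfolding G1_def by (rule someI_ex) (rule bexE[OF PE.sact_transitive[of q q01]], simp only: q q0, blast)
  then have G1: "sproj (PE S) q = p \<Longrightarrow> G1 q \<in> Spin1" "sproj (PE S) q = p \<Longrightarrow> q01 = sact (PE S) q (G1 q)" for q
    by (blast, blast)
  define G2 where "G2 q = (SOME g. g \<in> Spin2 \<and> q02 = sact (PM S) q g)" for q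
  have "G2 q \<in> Spin2 \<and> q02 = sact (PM S) q (G2 q)" if q: "sproj (PM S) q = p" for q
    unfolding G2_def by (rule someI_ex) (rule bexE[OF PM.sact_transitive[of q q02]], simp only: q q0, blast)
  then have G2: "sproj (PM S) q = p \<Longrightarrow> G2 q \<in> Spin2" "sproj (PM S) q = p \<Longrightarrow> q02 = sact (PM S) q (G2 q)" for q
    by (blast, blast)
  have S1: "G1 q1 = h \<odot> G1 (sact (PE S) q1 h)" if "sproj (PE S) q1 = p" "h \<in> Spin1" for q1 h
  proof (rule PE.sact_inject)
    have p: "sproj (PE S) (sact (PE S) q1 h) = p" using PE.sact_proj that by simp
    show "G1 q1 \<in> Spin1" "h \<odot> G1 (sact (PE S) q1 h) \<in> Spin1" using G1(1) that p by (auto intro: Spin_mult)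
    show "sact (PE S) q1 (G1 q1) = sact (PE S) q1 (h \<odot> G1 (sact (PE S) q1 h))"
      using G1(2)[OF that(1)] G1(2)[OF p] PE.sact_mult[OF that(2) G1(1)[OF p], of q1] by simp
  qed
  have S2: "G2 q2 = h \<odot> G2 (sact (PM S) q2 h)" if "sproj (PM S) q2 = p" "h \<in> Spin2" for q2 h
  proof (rule PM.sact_inject)
    have p: "sproj (PM S) (sact (PM S) q2 h) = p" using PM.sact_proj that by simp
    show "G2 q2 \<in> Spin2" "h \<odot> G2 (sact (PM S) q2 h) \<in> Spin2" using G2(1) that p by (auto intro: Spin_mult)
    show "sact (PM S) q2 (G2 q2) = sact (PM S) q2 (h \<odot> G2 (sact (PM S) q2 h))"
      using G2(2)[OF that(1)] G2(2)[OF p] PM.sact_mult[OF that(2) G2(1)[OF p], of q2] by simp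
  qed
  have 1: "G1 q01 = q_one" "G2 q02 = q_one"
    using PE.sact_inject[OF G1(1) Spin_one(1), of q01 q01] PM.sact_inject[OF G2(1) Spin_one(2), of q02 q02]
      G1(2)[of q01] G2(2)[of q02] q0 PE.sact_one PM.sact_one by auto
  define f where "f r = (if r \<in> spin_frames S p then G1 (fst r) \<odot> G2 (snd r) \<odot> u else 0)" for r
  have "f \<in> spinors S p"
    unfolding spinors_def
  proof (intro CollectI conjI allI impI ballI, goal_cases)
    case (1 r) then show ?case by (simp only: f_def if_False)
  next
    case (2 r)
    then have "G1 (fst r) \<in> Spin1" "G2 (snd r) \<in> Spin2" using G1 G2 by (auto simp: spin_frames_def)
    then show ?case using 2 u Spin_unit by (simp add: f_def H0_closed unitH0_H0)
  next
    case (3 r)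
    obtain q1 q2 where r: "r = (q1, q2)" by (cases r)
    have p: "sproj (PE S) q1 = p" "sproj (PM S) q2 = p" using 3 unfolding r by (auto simp: spin_frames_def)
    have "f (q1, q2) = g1 \<odot> g2 \<odot> f (sact (PE S) q1 g1, sact (PM S) q2 g2)" if g: "g1 \<in> Spin1" "g2 \<in> Spin2" for g1 g2
    proof -
      let ?k1 = "G1 (sact (PE S) q1 g1)" and ?k2 = "G2 (sact (PM S) q2 g2)"
      have p': "sproj (PE S) (sact (PE S) q1 g1) = p" "sproj (PM S) (sact (PM S) q2 g2) = p"
        using p g PE.sact_proj PM.sact_proj by auto
      have "f (q1, q2) = G1 q1 \<odot> G2 q2 \<odot> u" using p by (simp add: f_def spin_frames_def)
      also have "\<dots> = g1 \<odot> (?k1 \<odot> g2) \<odot> ?k2 \<odot> u"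
        by (subst S1[OF p(1) g(1)], subst S2[OF p(2) g(2)]) (simp only: qmul_assoc)
      also have "?k1 \<odot> g2 = g2 \<odot> ?k1" by (rule Spin_commute[OF G1(1)[OF p'(1)] g(2)])
      also have "g1 \<odot> (g2 \<odot> ?k1) \<odot> ?k2 \<odot> u = g1 \<odot> g2 \<odot> f (sact (PE S) q1 g1, sact (PM S) q2 g2)"
        using p' by (simp add: f_def spin_frames_def qmul_assoc)
      finally show ?thesis .
    qed
    then show ?case unfolding r by simp
  qed
  moreover have "f q = u" using q by (simp add: f_def q' 1)
  ultimately show ?thesis by blast
qed

text \<open>The inverse of \<open>w \<mapsto> cvec p w q\<close>.\<close>

definition frame_comb :: "'qe \<times> 'qm \<Rightarrow> real^4 \<Rightarrow> 'e \<times> 'm tvec"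
  where "frame_comb q x = (x $ 0 *\<^sub>R fst (sframe (PE S) (fst q)) + x $ 1 *\<^sub>R snd (sframe (PE S) (fst q)),
    x $ 2 *\<^sub>R fst (sframe (PM S) (snd q)) + x $ 3 *\<^sub>R snd (sframe (PM S) (snd q)))"

lemma frame_comb:
  assumes q: "q \<in> spin_frames S p"
  shows "frame_comb q x \<in> fibre p" "cvec p (frame_comb q x) q = x" "w \<in> fibre p \<Longrightarrow> frame_comb q (cvec p w q) = w"
proof -
  have q': "(fst q, snd q) \<in> spin_frames S p" using q by simp
  show f: "frame_comb q x \<in> fibre p" and c: "cvec p (frame_comb q x) q = x" for x
    using cvec_expand(1)[OF q', of "x $ 0" "x $ 1"] cvec_expand(2)[OF q', of "x $ 2" "x $ 3"]
      cvec_expand(3)[OF q', of "x $ 0" "x $ 1" "x $ 2" "x $ 3"] quad_eta[of x]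
    by (auto simp: frame_comb_def fibre_def)
  show "w \<in> fibre p \<Longrightarrow> frame_comb q (cvec p w q) = w"
    by (rule cvec_inj[OF q f _ c])
qed

lemma frame_comb_linear: "frame_comb q (x + y) = frame_comb q x + frame_comb q y"
  "frame_comb q (r *\<^sub>R x) = r *\<^sub>R frame_comb q x"
  by (simp_all add: frame_comb_def scaleR_add_left scaleR_add_right add_ac)

end

text \<open>A smooth field of linear isometries \<open>E\<^sub>p \<oplus> T\<^sub>pM \<rightarrow> \<real>\<^sup>2\<^sup>,\<^sup>2\<close>, to be written as \<open>emb \<phi>\<close>. A spinor at \<open>p\<close> with
  this property is the same as a lift of the image of one spin frame; see \<open>lift_image_frame\<close>.\<close>

locale isometry_field = spin_surface S
  for S :: "('m::{t2_space, second_countable_topology}, 'e::real_vector, 'qe, 'qm) spin_surface" +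
  fixes \<Omega> :: "'m \<Rightarrow> 'e \<times> 'm tvec \<Rightarrow> real^4"
  assumes add: "w \<in> fibre p \<Longrightarrow> w' \<in> fibre p \<Longrightarrow> \<Omega> p (w + w') = \<Omega> p w + \<Omega> p w'"
    and scale: "w \<in> fibre p \<Longrightarrow> \<Omega> p (r *\<^sub>R w) = r *\<^sub>R \<Omega> p w"
    and isometry: "(v, X) \<in> fibre p \<Longrightarrow> (v', X') \<in> fibre p \<Longrightarrow>
      ip22 (\<Omega> p (v, X)) (\<Omega> p (v', X')) = met (EB S) p v v' + met (TB S) p X X'"
    and smooth: "open U \<Longrightarrow> smooth_section (atl S) (EB S) U s \<Longrightarrow> smooth_section (atl S) (TB S) U Y \<Longrightarrow>
      smooth_fun (atl S) U (\<lambda>x. \<Omega> x (s x, Y x))"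
begin

definition image_frame :: "'m \<Rightarrow> 'qe \<times> 'qm \<Rightarrow> real^4^4"
  where "image_frame p q = (\<chi> j. \<Omega> p (frame_comb q (axis j 1)))"

lemma orthonormal_image_frame:
  assumes q: "q \<in> spin_frames S p"
  shows "orthonormal (image_frame p q)"
proof -
  have "ip22 (\<Omega> p (frame_comb q x)) (\<Omega> p (frame_comb q y)) = ip22 x y" for x y
  proof -
    obtain q1 q2 where q': "q = (q1, q2)" by (cases q)
    obtain v X v' X' where w: "frame_comb q x = (v, X)" "frame_comb q y = (v', X')" by fastforce
    have f: "(v, X) \<in> fibre p" "(v', X') \<in> fibre p" using frame_comb(1)[OF q] w by metis+
    have "ip22 (\<Omega> p (v, X)) (\<Omega> p (v', X')) = ip22 (cvec p (v, X) q) (cvec p (v', X') q)"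
      using isometry[OF f] cvec_ip[OF q[unfolded q'] f] by (simp only: q')
    then show ?thesis by (simp only: w[symmetric] frame_comb(2)[OF q])
  qed
  then show ?thesis by (simp add: orthonormal_def image_frame_def)
qed

lemma lift_image_frame:
  assumes q: "q \<in> spin_frames S p"
  shows "lift_of u (image_frame p q) \<longleftrightarrow> unitH0 u \<and> (\<forall>w\<in>fibre p. rho u (cvec p w q) = \<Omega> p w)"
proof
  assume l: "lift_of u (image_frame p q)"
  have "rho u y = \<Omega> p (frame_comb q y)" for y
  proof -
    have "rho u = (\<lambda>y. \<Omega> p (frame_comb q y))"
    proof (rule linear_eq_stdbasis)
      show "linear (rho u)" by (rule linearI) (simp_all add: rho_simps)
      show "linear (\<lambda>y. \<Omega> p (frame_comb q y))"
        by (rule linearI) (simp_all add: frame_comb_linear add scale frame_comb(1)[OF q])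
      show "rho u b = \<Omega> p (frame_comb q b)" if "b \<in> Basis" for b
        using that l unfolding lift_of_def by (auto simp: Basis_vec_def image_frame_def)
    qed
    then show ?thesis by (rule fun_cong)
  qed
  then have "\<forall>w\<in>fibre p. rho u (cvec p w q) = \<Omega> p w" using frame_comb(3)[OF q] by simp
  moreover have "unitH0 u" using l unfolding lift_of_def by blast
  ultimately show "unitH0 u \<and> (\<forall>w\<in>fibre p. rho u (cvec p w q) = \<Omega> p w)" by blast
next
  assume a: "unitH0 u \<and> (\<forall>w\<in>fibre p. rho u (cvec p w q) = \<Omega> p w)"
  have "rho u (axis j 1) = image_frame p q $ j" for j
    using a frame_comb(1,2)[OF q, of "axis j 1"] by (metis image_frame_def vec_lambda_beta)
  then show "lift_of u (image_frame p q)" using a unfolding lift_of_def by blast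
qed

lemma image_frame_smooth:
  assumes U: "open U" and s: "smooth_spin_section (atl S) Spin1 (PE S) U s1"
    "smooth_spin_section (atl S) Spin2 (PM S) U s2"
  shows "smooth_fun (atl S) U (\<lambda>x. image_frame x (s1 x, s2 x) $ j)"
  unfolding image_frame_def frame_comb_def vec_lambda_beta fst_conv snd_conv
  by (intro smooth U PE.smooth_section_combination TT.smooth_section_combination smooth_fun_const
      PE.spin_section_frame[OF s(1) U] PM.spin_section_frame[OF s(2) U])

definition spin_lifts :: "'m \<Rightarrow> ('qe, 'qm) spinor set"
  where "spin_lifts p = {f \<in> spinors S p. \<forall>q\<in>spin_frames S p. lift_of (f q) (image_frame p q)}"

lemma spin_liftsI:
  assumes f: "f \<in> spinors S p" and q: "q \<in> spin_frames S p" and l: "lift_of (f q) (image_frame p q)"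
  shows "f \<in> spin_lifts p"
proof -
  have a: "unitH0 (f q)" "\<forall>w\<in>fibre p. rho (f q) (cvec p w q) = \<Omega> p w" using l lift_image_frame[OF q] by blast+
  have "lift_of (f r) (image_frame p r)" if r: "r \<in> spin_frames S p" for r
    unfolding lift_image_frame[OF r] using spinor_unit_frames[OF f r q a(1)] rho_frame_independent[OF f r q] a(2) by simp
  then show ?thesis using f unfolding spin_lifts_def by blast
qed

lemma spin_liftsD:
  assumes "f \<in> spin_lifts p"
  shows "f \<in> spinors S p" "q \<in> spin_frames S p \<Longrightarrow> lift_of (f q) (image_frame p q)"
  using assms unfolding spin_lifts_def by blast+

lemma spin_lifts_nonempty_iff:
  assumes q: "q \<in> spin_frames S p"
  shows "(\<exists>f. f \<in> spin_lifts p) \<longleftrightarrow> (\<exists>u. lift_of u (image_frame p q))"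
proof
  show "\<exists>f. f \<in> spin_lifts p \<Longrightarrow> \<exists>u. lift_of u (image_frame p q)" using spin_liftsD(2)[OF _ q] by blast
  assume "\<exists>u. lift_of u (image_frame p q)"
  then obtain u where u: "lift_of u (image_frame p q)" by blast
  then have "u \<in> H0" using unitH0_H0 unfolding lift_of_def by blast
  then obtain f where f: "f \<in> spinors S p" "f q = u" using spinor_with_value[OF q] by blast
  have "f \<in> spin_lifts p" by (rule spin_liftsI[OF f(1) q]) (unfold f(2), rule u)
  then show "\<exists>f. f \<in> spin_lifts p" by blast
qed

lemma spinor_minus: "f \<in> spinors S p \<Longrightarrow> - f \<in> spinors S p"
  by (auto simp: spinors_def H0_closed qmul.minus_right)

lemma spin_lifts_sign:
  assumes "f \<in> spin_lifts p" "f' \<in> spin_lifts p"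
  shows "f' = f \<or> f' = - f"
proof -
  obtain q where q: "q \<in> spin_frames S p" using spin_frames_nonempty by blast
  have l: "unitH0 (f q) \<and> (\<forall>w\<in>fibre p. rho (f q) (cvec p w q) = \<Omega> p w)"
    "unitH0 (f' q) \<and> (\<forall>w\<in>fibre p. rho (f' q) (cvec p w q) = \<Omega> p w)"
    using spin_liftsD(2)[OF assms(1) q] spin_liftsD(2)[OF assms(2) q] unfolding lift_image_frame[OF q] by blast+
  have "rho (f q) x = rho (f' q) x" for x using cvec_surj[OF q, of x] l by metis
  then have "f q = f' q \<or> f q = - f' q" using rho_eq_sign l by blast
  then have "f' q = f q \<or> f' q = (- f) q" by (auto simp only: fun_Compl_def minus_minus)
  then show ?thesis
    using spinor_eqI[OF spin_liftsD(1)[OF assms(2)] spin_liftsD(1)[OF assms(1)] q]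
      spinor_eqI[OF spin_liftsD(1)[OF assms(2)] spinor_minus[OF spin_liftsD(1)[OF assms(1)]] q] by blast
qed

text \<open>The family to which \<open>global_section\<close> is applied.\<close>

definition local_lifts :: "('m set \<times> ('m \<Rightarrow> ('qe, 'qm) spinor)) set"
  where "local_lifts = {(U, \<phi>). open U \<and> (\<forall>p\<in>U. \<phi> p \<in> spin_lifts p) \<and>
    (\<forall>(V1, t1)\<in>ssec (PE S). \<forall>(V2, t2)\<in>ssec (PM S). smooth_fun (atl S) (U \<inter> (V1 \<inter> V2)) (\<lambda>x. \<phi> x (t1 x, t2 x)))}"

lemma local_liftsI:
  assumes "open U" "\<And>p. p \<in> U \<Longrightarrow> \<phi> p \<in> spin_lifts p"
    "\<And>V1 t1 V2 t2. (V1, t1) \<in> ssec (PE S) \<Longrightarrow> (V2, t2) \<in> ssec (PM S) \<Longrightarrow>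
      smooth_fun (atl S) (U \<inter> (V1 \<inter> V2)) (\<lambda>x. \<phi> x (t1 x, t2 x))"
  shows "(U, \<phi>) \<in> local_lifts"
  unfolding local_lifts_def by (intro CollectI case_prodI conjI ballI assms(1)) (auto intro: assms)

lemma local_liftsD:
  assumes "(U, \<phi>) \<in> local_lifts"
  shows "open U" "p \<in> U \<Longrightarrow> \<phi> p \<in> spin_lifts p"
    "(V1, t1) \<in> ssec (PE S) \<Longrightarrow> (V2, t2) \<in> ssec (PM S) \<Longrightarrow>
      smooth_fun (atl S) (U \<inter> (V1 \<inter> V2)) (\<lambda>x. \<phi> x (t1 x, t2 x))"
  using assms unfolding local_lifts_def by blast+

lemma near_sections:
  obtains U s1 s2 where "open U" "p \<in> U" "path_connected U"
    "smooth_spin_section (atl S) Spin1 (PE S) U s1" "smooth_spin_section (atl S) Spin2 (PM S) U s2"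
    "\<forall>x\<in>U. near_id (relative_frame (image_frame p (s1 p, s2 p)) (image_frame x (s1 x, s2 x))) \<and> near_id (relative_frame (image_frame x (s1 x, s2 x)) (image_frame p (s1 p, s2 p)))"
proof -
  obtain q where "q \<in> spin_frames S p" using spin_frames_nonempty by blast
  then obtain U0 s1 s2 where s: "open U0" "p \<in> U0" "smooth_spin_section (atl S) Spin1 (PE S) U0 s1"
    "smooth_spin_section (atl S) Spin2 (PM S) U0 s2"
    by (rule spin_nabla_section)
  let ?t = "\<lambda>x. image_frame x (s1 x, s2 x)"
  have fr: "x \<in> U0 \<Longrightarrow> (s1 x, s2 x) \<in> spin_frames S x" for x by (rule spin_frame_sections(1)[OF s(1,3,4)])
  obtain N where N: "open N" "?t p \<in> N" "\<And>t'. t' \<in> N \<Longrightarrow> near_id (relative_frame (?t p) t') \<and> near_id (relative_frame t' (?t p))"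
    using near_neighbourhood[OF orthonormal_image_frame[OF fr[OF s(2)]]] by metis
  have "continuous_on U0 (\<lambda>x. \<chi> j. ?t x $ j)"
    by (intro continuous_on_vec_lambda smooth_fun_continuous[OF s(1) image_frame_smooth[OF s(1,3,4)]])
  then have "continuous_on U0 ?t" by (simp only: vec_lambda_eta)
  then have o: "open (?t -` N \<inter> U0)" by (simp only: continuous_on_open_vimage[OF s(1)] N(1))
  have pi: "p \<in> ?t -` N \<inter> U0" using N(2) s(2) by blast
  obtain c where c: "c \<in> atl S" "p \<in> fst c" using chart_at charts_atD by metis
  obtain r where r: "open (chart_inv c ` ball (snd c p) r)" "p \<in> chart_inv c ` ball (snd c p) r"
    "chart_inv c ` ball (snd c p) r \<subseteq> (?t -` N \<inter> U0) \<inter> fst c" "path_connected (chart_inv c ` ball (snd c p) r)"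
    by (rule chart_ball[OF o pi c])
  let ?U = "chart_inv c ` ball (snd c p) r"
  have sub: "?U \<subseteq> U0" using r(3) by blast
  show ?thesis
  proof (rule that[OF r(1,2,4)])
    show "smooth_spin_section (atl S) Spin1 (PE S) ?U s1"
      by (rule PE.spin_section_subset[OF s(3) sub])
    show "smooth_spin_section (atl S) Spin2 (PM S) ?U s2"
      by (rule PM.spin_section_subset[OF s(4) sub])
    show "\<forall>x\<in>?U. near_id (relative_frame (?t p) (?t x)) \<and> near_id (relative_frame (?t x) (?t p))"
    proof
      fix x assume "x \<in> ?U"
      then have "?t x \<in> N" using r(3) by blast
      then show "near_id (relative_frame (?t p) (?t x)) \<and> near_id (relative_frame (?t x) (?t p))" by (rule N(3))
    qed
  qed
qed

text \<open>Near \<open>p\<close> the frame \<open>image_frame x (s1 x, s2 x)\<close> is close to its value at \<open>p\<close>, and a lift of the latter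
  is continued by \<open>spin_lift\<close> of the relative frame. A given value at another point of the neighbourhood
  is attained by this smooth spinor field or by its negative.\<close>

lemma local_extension:
  "\<exists>U. open U \<and> p \<in> U \<and> path_connected U \<and> (\<forall>p'\<in>U. \<forall>v\<in>spin_lifts p'. \<exists>f. (U, f) \<in> local_lifts \<and> f p' = v)"
proof -
  obtain U s1 s2 where U: "open U" "p \<in> U" "path_connected U"
    and s: "smooth_spin_section (atl S) Spin1 (PE S) U s1" "smooth_spin_section (atl S) Spin2 (PM S) U s2"
    and near: "\<forall>x\<in>U. near_id (relative_frame (image_frame p (s1 p, s2 p)) (image_frame x (s1 x, s2 x))) \<and> near_id (relative_frame (image_frame x (s1 x, s2 x)) (image_frame p (s1 p, s2 p)))"
    by (rule near_sections[where p = p])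
  have n: "near_id (relative_frame (image_frame p (s1 p, s2 p)) (image_frame x (s1 x, s2 x)))" "near_id (relative_frame (image_frame x (s1 x, s2 x)) (image_frame p (s1 p, s2 p)))"
    if "x \<in> U" for x using bspec[OF near that] by (simp_all only: simp_thms)
  let ?q = "\<lambda>x. (s1 x, s2 x)"
  let ?t = "\<lambda>x. image_frame x (?q x)"
  have fr: "?q x \<in> spin_frames S x" if "x \<in> U" for x by (rule spin_frame_sections(1)[OF U(1) s that])
  note ot = orthonormal_image_frame[OF fr]
  have "\<exists>f. (U, f) \<in> local_lifts \<and> f p' = v" if p': "p' \<in> U" and v: "v \<in> spin_lifts p'" for p' v
  proof -
    have "\<exists>u. lift_of u (?t p')" using spin_liftsD(2)[OF v fr[OF p']] by blast
    then have "\<exists>u. lift_of u (?t p)" using liftable_near[OF ot[OF U(2)] ot[OF p'] n(1)[OF p'] n(2)[OF p']] by blast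
    then obtain u0 where u0: "lift_of u0 (?t p)" by blast
    define u where "u x = ascale (0, 1) (spin_lift (relative_frame (?t p) (?t x)) \<odot> u0)" for x
    have ul: "lift_of (u x) (?t x)" if "x \<in> U" for x
      unfolding u_def by (rule lift_from_relative[OF u0 ot[OF that] n(1)[OF that]])
    have uH: "u x \<in> H0" if "x \<in> U" for x using ul[OF that] unitH0_H0 unfolding lift_of_def by blast
    have "\<forall>x. \<exists>f. x \<in> U \<longrightarrow> f \<in> spinors S x \<and> f (?q x) = u x"
      using spinor_with_value[OF fr uH] by blast
    then obtain \<phi> where \<phi>: "\<And>x. x \<in> U \<Longrightarrow> \<phi> x \<in> spinors S x" "\<And>x. x \<in> U \<Longrightarrow> \<phi> x (?q x) = u x" by metis
    have \<phi>v: "\<phi> x \<in> spin_lifts x" if "x \<in> U" for x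
      by (rule spin_liftsI[OF \<phi>(1)[OF that] fr[OF that]]) (unfold \<phi>(2)[OF that], rule ul[OF that])
    have us: "smooth_fun (atl S) U u"
    proof -
      have r: "smooth_fun (atl S) U (\<lambda>x. relative_frame (?t p) (?t x) $ j)" for j
        unfolding relative_frame_def vec_lambda_beta
        by (intro smooth_fun_quad smooth_fun_minus U smooth_fun_linear[OF bounded_bilinear.bounded_linear_right[OF bounded_bilinear_ip22]]
            image_frame_smooth[OF U(1) s])
      have a: "bounded_linear (\<lambda>z. ascale (0, 1) (z \<odot> u0))"
        using bounded_linear_compose[OF _ bounded_bilinear.bounded_linear_left[OF bounded_bilinear_qmul], of "ascale (0, 1)"]
          ascale_linear by (simp add: linear_conv_bounded_linear)
      show ?thesis
        unfolding u_def by (rule smooth_fun_linear[OF a U(1) spin_lift_smooth[OF U(1) r n(1)]])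
    qed
    have \<phi>F: "(U, \<phi>) \<in> local_lifts"
    proof (rule local_liftsI[OF U(1) \<phi>v])
      fix V1 t1 V2 t2 assume t: "(V1, t1) \<in> ssec (PE S)" "(V2, t2) \<in> ssec (PM S)"
      obtain g1 where g1: "smooth_fun (atl S) (U \<inter> V1) g1" "\<forall>x\<in>U \<inter> V1. g1 x \<in> Spin1 \<and> s1 x = sact (PE S) (t1 x) (g1 x)"
        using PE.spin_sectionD(2)[OF s(1) t(1)] by blast
      obtain g2 where g2: "smooth_fun (atl S) (U \<inter> V2) g2" "\<forall>x\<in>U \<inter> V2. g2 x \<in> Spin2 \<and> s2 x = sact (PM S) (t2 x) (g2 x)"
        using PM.spin_sectionD(2)[OF s(2) t(2)] by blast
      have o: "open (U \<inter> (V1 \<inter> V2))" using U(1) PE.ssec_proj(1)[OF t(1)] PM.ssec_proj(1)[OF t(2)] by blast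
      have sm: "smooth_fun (atl S) (U \<inter> (V1 \<inter> V2)) (\<lambda>x. g1 x \<odot> g2 x \<odot> u x)"
        by (intro smooth_fun_bilinear[OF bounded_bilinear_qmul o] smooth_fun_subset[OF g1(1)]
            smooth_fun_subset[OF g2(1)] smooth_fun_subset[OF us]) auto
      show "smooth_fun (atl S) (U \<inter> (V1 \<inter> V2)) (\<lambda>x. \<phi> x (t1 x, t2 x))"
      proof (rule smooth_fun_cong[OF o _ sm])
        fix x assume x: "x \<in> U \<inter> (V1 \<inter> V2)"
        have tx: "(t1 x, t2 x) \<in> spin_frames S x"
          using PE.ssec_proj(2)[OF t(1)] PM.ssec_proj(2)[OF t(2)] x by (simp add: spin_frames_def)
        have g: "g1 x \<in> Spin1" "g2 x \<in> Spin2" "s1 x = sact (PE S) (t1 x) (g1 x)" "s2 x = sact (PM S) (t2 x) (g2 x)"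
          using g1(2) g2(2) x by blast+
        have xU: "x \<in> U" using x by blast
        show "g1 x \<odot> g2 x \<odot> u x = \<phi> x (t1 x, t2 x)"
          using spinor_action[OF \<phi>(1)[OF xU] tx g(1,2)] \<phi>(2)[OF xU] g(3,4) by simp
      qed
    qed
    have m: "(U, \<lambda>x. - \<phi> x) \<in> local_lifts"
    proof (rule local_liftsI[OF U(1)])
      show "- \<phi> x \<in> spin_lifts x" if "x \<in> U" for x
      proof (rule spin_liftsI[OF spinor_minus[OF \<phi>(1)[OF that]] fr[OF that]])
        have "lift_of (\<phi> x (?q x)) (?t x)" by (rule spin_liftsD(2)[OF \<phi>v[OF that] fr[OF that]])
        then have "lift_of (- \<phi> x (?q x)) (?t x)" by (simp only: lift_of_def unitH0_closed(3) rho_minus simp_thms)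
        then show "lift_of ((- \<phi> x) (?q x)) (?t x)" by (simp only: fun_Compl_def)
      qed
      fix V1 t1 V2 t2 assume t: "(V1, t1) \<in> ssec (PE S)" "(V2, t2) \<in> ssec (PM S)"
      have o: "open (U \<inter> (V1 \<inter> V2))" using U(1) PE.ssec_proj(1)[OF t(1)] PM.ssec_proj(1)[OF t(2)] by blast
      show "smooth_fun (atl S) (U \<inter> (V1 \<inter> V2)) (\<lambda>x. (- \<phi> x) (t1 x, t2 x))"
        using smooth_fun_minus[OF o local_liftsD(3)[OF \<phi>F t]] by (simp only: fun_Compl_def)
    qed
    show ?thesis
      using spin_lifts_sign[OF \<phi>v[OF p'] v] \<phi>F m by blast
  qed
  then show ?thesis using U by blast
qed

lemma local_lifts_agree:
  assumes F: "(U, f) \<in> local_lifts" "(V, g) \<in> local_lifts" and p: "p \<in> U" "p \<in> V"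
  shows "\<exists>W. open W \<and> p \<in> W \<and> W \<subseteq> U \<inter> V \<and> (\<forall>x\<in>W. (f x = g x) = (f p = g p))"
proof -
  obtain V1 t1 where t1: "(V1, t1) \<in> ssec (PE S)" "p \<in> V1" using PE.ssec_cover by blast
  obtain V2 t2 where t2: "(V2, t2) \<in> ssec (PM S)" "p \<in> V2" using PM.ssec_cover by blast
  let ?q = "\<lambda>x. (t1 x, t2 x)"
  define D where "D = U \<inter> V \<inter> (V1 \<inter> V2)"
  have D: "open D" "p \<in> D" unfolding D_def
    using local_liftsD(1)[OF F(1)] local_liftsD(1)[OF F(2)] PE.ssec_proj(1)[OF t1(1)] PM.ssec_proj(1)[OF t2(1)] p t1 t2 by auto
  have c: "continuous_on D (\<lambda>x. f x (?q x))" "continuous_on D (\<lambda>x. g x (?q x))"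
    by (intro smooth_fun_continuous[OF D(1)] smooth_fun_subset[OF local_liftsD(3)[OF F(1) t1(1) t2(1)]]
        smooth_fun_subset[OF local_liftsD(3)[OF F(2) t1(1) t2(1)]]; auto simp: D_def)+
  have q: "?q x \<in> spin_frames S x" if "x \<in> D" for x
    using PE.ssec_proj(2)[OF t1(1)] PM.ssec_proj(2)[OF t2(1)] that by (simp add: spin_frames_def D_def)
  have v: "f x \<in> spin_lifts x" "g x \<in> spin_lifts x" if "x \<in> D" for x
    using local_liftsD(2)[OF F(1)] local_liftsD(2)[OF F(2)] that by (auto simp: D_def)
  have nz: "g x (?q x) \<noteq> 0" if "x \<in> D" for x
  proof
    assume z: "g x (?q x) = 0"
    have "unitH0 (g x (?q x))" using spin_liftsD(2)[OF v(2)[OF that] q[OF that]] unfolding lift_of_def by blast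
    then have "qconj (g x (?q x)) \<odot> g x (?q x) = q_one" by (rule unitH0_simps)
    then show False unfolding z qmul.zero_right by (simp add: q_one_def zero_prod_def)
  qed
  \<comment> \<open>Since \<open>f x = g x\<close> or \<open>f x = - g x\<close>, equality amounts to a strict inequality of norms.\<close>
  have alt: "f x = g x \<longleftrightarrow> norm (f x (?q x) - g x (?q x)) < norm (f x (?q x) + g x (?q x))"
    "f x \<noteq> g x \<longleftrightarrow> norm (f x (?q x) + g x (?q x)) < norm (f x (?q x) - g x (?q x))" if x: "x \<in> D" for x
  proof -
    have "f x = g x \<or> f x = - g x" by (rule spin_lifts_sign[OF v(2)[OF x] v(1)[OF x]])
    then have "f x (?q x) = g x (?q x) \<or> f x (?q x) = - g x (?q x)"
      by (rule disj_forward) (simp_all only: fun_Compl_def)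
    note n = sign_by_norm[OF nz[OF x] this]
    have e: "f x = g x \<longleftrightarrow> f x (?q x) = g x (?q x)"
    proof
      show "f x (?q x) = g x (?q x)" if "f x = g x" by (simp only: that)
      show "f x = g x" if "f x (?q x) = g x (?q x)"
        by (rule spinor_eqI[OF spin_liftsD(1)[OF v(1)[OF x]] spin_liftsD(1)[OF v(2)[OF x]] q[OF x] that])
    qed
    show "f x = g x \<longleftrightarrow> norm (f x (?q x) - g x (?q x)) < norm (f x (?q x) + g x (?q x))"
      "f x \<noteq> g x \<longleftrightarrow> norm (f x (?q x) + g x (?q x)) < norm (f x (?q x) - g x (?q x))"
      unfolding e by (rule n)+
  qed
  let ?a = "\<lambda>x. norm (f x (?q x) - g x (?q x))" and ?b = "\<lambda>x. norm (f x (?q x) + g x (?q x))"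
  have cab: "continuous_on D ?a" "continuous_on D ?b" using c by (auto intro!: continuous_intros)
  have lt: "open {x\<in>D. h x < k x}" if "continuous_on D h" "continuous_on D k" for h k :: "'m \<Rightarrow> real"
  proof -
    have "open ((\<lambda>x. k x - h x) -` {0<..} \<inter> D)"
      using continuous_on_open_vimage[OF D(1), of "\<lambda>x. k x - h x"] continuous_on_diff[OF that(2,1)] open_greaterThan by blast
    moreover have "(\<lambda>x. k x - h x) -` {0<..} \<inter> D = {x\<in>D. h x < k x}" by auto
    ultimately show ?thesis by simp
  qed
  have sub: "D \<subseteq> U \<inter> V" by (auto simp: D_def)
  show ?thesis
  proof (cases "f p = g p")
    case True
    have "p \<in> {x\<in>D. ?a x < ?b x}" using alt(1)[OF D(2)] True D(2) by blast
    moreover have "\<forall>x\<in>{x\<in>D. ?a x < ?b x}. (f x = g x) = (f p = g p)" using alt(1) True by blast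
    ultimately show ?thesis using lt[OF cab] sub by blast
  next
    case False
    have "p \<in> {x\<in>D. ?b x < ?a x}" using alt(2)[OF D(2)] False D(2) by blast
    moreover have "\<forall>x\<in>{x\<in>D. ?b x < ?a x}. (f x = g x) = (f p = g p)" using alt(2) False by blast
    ultimately show ?thesis using lt[OF cab(2,1)] sub by blast
  qed
qed

text \<open>The lifts at a point differ by sign, so the local lifts form a double covering of the surface. A lift
  at one point therefore extends to a global one.\<close>

theorem spinor_of_isometry:
  assumes sc: "simply_connected (UNIV :: 'm set)"
    and l: "q0 \<in> spin_frames S p0" "lift_of u0 (image_frame p0 q0)"
  shows "\<exists>\<phi>. unit_spinor_field S \<phi> \<and> (\<forall>p. \<forall>w\<in>fibre p. emb \<phi> p w = \<Omega> p w)"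
proof -
  interpret local_sections local_lifts spin_lifts
  proof
    show "open U" if "(U, f) \<in> local_lifts" for U f by (rule local_liftsD(1)[OF that])
    show "f p \<in> spin_lifts p" if "(U, f) \<in> local_lifts" "p \<in> U" for U f p by (rule local_liftsD(2)[OF that])
    show "\<exists>U. open U \<and> p \<in> U \<and> path_connected U \<and> (\<forall>p'\<in>U. \<forall>v\<in>spin_lifts p'. \<exists>f. (U, f) \<in> local_lifts \<and> f p' = v)" for p
      by (rule local_extension)
    show "\<exists>W. open W \<and> p \<in> W \<and> W \<subseteq> U \<inter> V \<and> (\<forall>q\<in>W. (f q = g q) = (f p = g p))"
      if "(U, f) \<in> local_lifts" "(V, g) \<in> local_lifts" "p \<in> U" "p \<in> V" for U f V g p
      by (rule local_lifts_agree[OF that])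
  qed
  have "\<exists>f. f \<in> spin_lifts p0" unfolding spin_lifts_nonempty_iff[OF l(1)] by (rule exI, rule l(2))
  then obtain v0 where v0: "v0 \<in> spin_lifts p0" by blast
  obtain \<phi> where \<phi>: "\<And>p. \<exists>U f. (U, f) \<in> local_lifts \<and> p \<in> U \<and> (\<forall>x\<in>U. \<phi> x = f x)"
    by (rule global_section[OF sc v0]) (rule that, assumption)
  have \<phi>v: "\<phi> p \<in> spin_lifts p" for p
  proof -
    obtain U f where "(U, f) \<in> local_lifts" "p \<in> U" "\<phi> p = f p" using \<phi>[of p] by blast
    then show ?thesis using local_liftsD(2) by metis
  qed
  have sm: "smooth_fun (atl S) (V1 \<inter> V2) (\<lambda>x. \<phi> x (t1 x, t2 x))"
    if t: "(V1, t1) \<in> ssec (PE S)" "(V2, t2) \<in> ssec (PM S)" for V1 t1 V2 t2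
  proof (rule smooth_fun_local)
    fix p assume p: "p \<in> V1 \<inter> V2"
    obtain U f where U: "(U, f) \<in> local_lifts" "p \<in> U" "\<forall>x\<in>U. \<phi> x = f x" using \<phi>[of p] by blast
    have o: "open (U \<inter> (V1 \<inter> V2))"
      using local_liftsD(1)[OF U(1)] PE.ssec_proj(1)[OF t(1)] PM.ssec_proj(1)[OF t(2)] by blast
    have "smooth_fun (atl S) (U \<inter> (V1 \<inter> V2)) (\<lambda>x. \<phi> x (t1 x, t2 x))"
      by (rule smooth_fun_cong[OF o _ local_liftsD(3)[OF U(1) t]]) (use U(3) in simp)
    then show "\<exists>W. open W \<and> p \<in> W \<and> smooth_fun (atl S) W (\<lambda>x. \<phi> x (t1 x, t2 x))"
      using o p U(2) by blast
  qed
  have u: "unitH0 (\<phi> p q)" "\<forall>w\<in>fibre p. rho (\<phi> p q) (cvec p w q) = \<Omega> p w" if q: "q \<in> spin_frames S p" for p q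
    using spin_liftsD(2)[OF \<phi>v q] unfolding lift_image_frame[OF q] by blast+
  have "unit_spinor_field S \<phi>"
    unfolding unit_spinor_field_def spinor_field_def
    using spin_liftsD(1)[OF \<phi>v] Hpair_unit[OF spin_liftsD(1)[OF \<phi>v]] u(1) sm by auto
  moreover have "emb \<phi> p w = \<Omega> p w" if w: "w \<in> fibre p" for p w
  proof -
    obtain q where q: "q \<in> spin_frames S p" using spin_frames_nonempty by blast
    show ?thesis using qpair_emb(1)[where \<phi> = \<phi>, OF spin_liftsD(1)[OF \<phi>v] w q] u(2)[OF q] w by simp
  qed
  ultimately show ?thesis by blast
qed

end

section \<open>From immersions to spinors\<close>

lemma ip22_nondegenerate:
  assumes "\<And>z. ip22 x z = 0"
  shows "x = 0"
proof -
  have "ip22 x (axis i 1) = 0" for i by (rule assms)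
  then show ?thesis
    using ip22_linear(7)[of x] ip22_axis[of x] by (simp add: vec4_eq)
qed

lemma ip22_zero [simp]: "ip22 0 x = 0" "ip22 x 0 = 0"
  by (simp_all add: ip22_def)

lemma isometry_inj:
  assumes R: "R \<in> isometries22" and eq: "R *v x = R *v y"
  shows "x = y"
proof -
  have "ip22 (x - y) z = 0" for z
  proof -
    have "ip22 (x - y) z = ip22 (R *v (x - y)) (R *v z)" using R by (simp add: isometries22_def)
    also have "R *v (x - y) = 0" using eq by (simp add: matrix_vector_mult_diff_distrib)
    finally show ?thesis by simp
  qed
  then have "x - y = 0" by (rule ip22_nondegenerate)
  then show ?thesis by simp
qed

text \<open>The matrix with columns \<open>t $ j\<close> preserves the metric; so it is injective, and its inverse is the
  isometry sought.\<close>

lemma orthonormal_standardize: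
  assumes "orthonormal t"
  shows "\<exists>R\<in>isometries22. \<forall>j. R *v (t $ j) = axis j 1"
proof -
  define T where "T = transpose t"
  have sum4: "(\<Sum>j\<in>UNIV. g j) = g 0 + g 1 + g 2 + g (3::4)" for g :: "4 \<Rightarrow> real"
  proof -
    have "(4::4) = 0" by simp
    then have "g 4 = g 0" by (rule arg_cong)
    then show ?thesis by (simp only: sum_4 add_ac)
  qed
  have T: "T *v x = x $ 0 *\<^sub>R t $ 0 + x $ 1 *\<^sub>R t $ 1 + x $ 2 *\<^sub>R t $ 2 + x $ 3 *\<^sub>R t $ 3" for x
    unfolding T_def by (simp add: vec_eq_iff matrix_vector_mult_def transpose_def sum4 mult.commute)
  have Ta: "T *v axis j 1 = t $ j" for j
    using forall_index4[of "\<lambda>j. T *v axis j 1 = t $ j"] by (simp add: T axis4)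
  have iso: "ip22 (T *v x) (T *v y) = ip22 x y" for x y
    unfolding T ip22_linear(1,2,5,6)
    unfolding assms[unfolded orthonormal_def, rule_format]
    by (simp add: ip22_axis axis4) (simp add: ip22_def)
  then have "T \<in> isometries22" by (simp add: isometries22_def)
  then have "inj ((*v) T)" using isometry_inj by (auto simp: inj_on_def)
  then obtain R where R: "R ** T = mat 1" using matrix_left_invertible_injective by blast
  then have R': "T ** R = mat 1" by (simp add: matrix_left_right_inverse)
  have "ip22 (R *v x) (R *v y) = ip22 x y" for x y
    using iso[of "R *v x" "R *v y"] by (simp add: matrix_vector_mul_assoc R')
  moreover have "R *v (t $ j) = axis j 1" for j
    unfolding Ta[symmetric] by (simp only: matrix_vector_mul_assoc R matrix_vector_mul_lid)
  moreover have "R \<in> isometries22" using calculation(1) by (simp add: isometries22_def)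
  ultimately show ?thesis by blast
qed

context spin_surface
begin

text \<open>The difference \<open>K u v w\<close> of the two sides is symmetric in \<open>u\<close> and \<open>v\<close>, since second derivatives commute
  and coordinate fields have symmetric covariant derivatives, and antisymmetric in \<open>v\<close> and \<open>w\<close>, since both
  connections are metric. A trilinear expression with these two symmetries is zero.\<close>

lemma coordinate_gauss:
  assumes F: "isometric_immersion S F" and c: "c \<in> atl S" "p \<in> fst c"
  shows "ip22 (mdiff (atl S) (\<lambda>x. mdiff (atl S) F x (chart_vec c v x)) p (chart_vec c u p))
      (mdiff (atl S) F p (chart_vec c w p)) =
    met (TB S) p (nab (TB S) p (chart_vec c u p) (chart_vec c v)) (chart_vec c w p)"
proof -
  define D where "D v q = mdiff (atl S) F q (chart_vec c v q)" for v q
  define K where "K u v w = ip22 (mdiff (atl S) (D v) p (chart_vec c u p)) (D w p)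
    - met (TB S) p (nab (TB S) p (chart_vec c u p) (chart_vec c v)) (chart_vec c w p)" for u v w
  have Fs: "smooth_fun (atl S) UNIV F" using F by (simp add: isometric_immersion_def)
  have iso: "ip22 (mdiff (atl S) F q X) (mdiff (atl S) F q Y) = met (TB S) q X Y"
    if "X \<in> fib (TB S) q" "Y \<in> fib (TB S) q" for q X Y
    using F that unfolding isometric_immersion_def by blast
  note o = chart_open[OF c(1)] and s = chart_vec_smooth[OF c(1)] and f = chart_vec_fib[OF c(1)]
  note fp = f[OF c(2)]
  have Ds: "smooth_fun (atl S) (fst c) (D v)" for v
    unfolding D_def by (rule mdiff_along_smooth[OF smooth_fun_subset[OF Fs subset_UNIV] o s])
  have sym: "K u v w = K v u w" for u v w
    unfolding K_def D_def using mdiff_mixed[OF Fs open_UNIV UNIV_I c] lie_bracket_chart_vec(2)[OF c] by simp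
  have anti: "K u v w = - K u w v" for u v w
  proof -
    have "mdiff (atl S) (\<lambda>q. ip22 (D v q) (D w q)) p (chart_vec c u p) =
        mdiff (atl S) (\<lambda>q. met (TB S) q (chart_vec c v q) (chart_vec c w q)) p (chart_vec c u p)"
      by (rule mdiff_cong[OF o c(2)]) (simp add: D_def iso f)
    also have "\<dots> = met (TB S) p (nab (TB S) p (chart_vec c u p) (chart_vec c v)) (chart_vec c w p)
        + met (TB S) p (chart_vec c v p) (nab (TB S) p (chart_vec c u p) (chart_vec c w))"
      by (rule TT.nab_metric[OF o s s c(2) fp])
    finally show ?thesis
      unfolding mdiff_bilinear[OF bounded_bilinear_ip22 Ds Ds c(2)] K_def
      using ip22_linear(7)[of "D v p" "mdiff (atl S) (D w) p (chart_vec c u p)"]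
        TT.met_sym[OF fp TT.nab_fib[OF o s c(2) fp], of v u w] by simp
  qed
  have "K u v w = - K u v w"
    using sym[of u v w] sym[of u w v] sym[of v w u] anti[of u v w] anti[of v u w] anti[of w u v] by simp
  then show ?thesis unfolding K_def D_def by simp
qed

text \<open>Both sides satisfy the product rule in \<open>Y\<close>, so the case of coordinate fields suffices.\<close>

lemma tangential_derivative:
  assumes F: "isometric_immersion S F" and U: "open U" "p \<in> U" and Y: "smooth_section (atl S) (TB S) U Y"
    and X: "X \<in> fib (TB S) p" and W: "W \<in> fib (TB S) p"
  shows "ip22 (mdiff (atl S) (\<lambda>x. mdiff (atl S) F x (Y x)) p X) (mdiff (atl S) F p W) =
    met (TB S) p (nab (TB S) p X Y) W"
proof -
  have Fs: "smooth_fun (atl S) UNIV F" using F by (simp add: isometric_immersion_def)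
  obtain c where c: "c \<in> atl S" "p \<in> fst c" using chart_at charts_atD by metis
  let ?V = "U \<inter> fst c"
  have V: "open ?V" "p \<in> ?V" using U c chart_open[OF c(1)] by (simp_all add: open_Int)
  obtain f1 f2 where f12: "smooth_fun (atl S) ?V f1" "smooth_fun (atl S) ?V f2"
    "\<And>q. q \<in> ?V \<Longrightarrow> Y q = f1 q *\<^sub>R coord_field (atl S) c 1 q + f2 q *\<^sub>R coord_field (atl S) c 2 q"
    using TT.smooth_section_coeffs[OF Y coord_frame[OF c(1)]] by metis
  define E1 E2 where "E1 = chart_vec c (axis 1 1)" and "E2 = chart_vec c (axis 2 1)"
  have E: "E1 q = coord_field (atl S) c 1 q" "E2 q = coord_field (atl S) c 2 q" for q
    by (simp_all add: E1_def E2_def chart_vec_def axis_def)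
  define D1 D2 where "D1 q = mdiff (atl S) F q (E1 q)" and "D2 q = mdiff (atl S) F q (E2 q)" for q
  have Es: "smooth_section (atl S) (TB S) ?V E1" "smooth_section (atl S) (TB S) ?V E2"
    unfolding E1_def E2_def by (rule TT.smooth_section_subset[OF chart_vec_smooth[OF c(1)]], blast)+
  have Ef: "E1 p \<in> fib (TB S) p" "E2 p \<in> fib (TB S) p"
    using TT.smooth_section_fib[OF Es(1) V(2)] TT.smooth_section_fib[OF Es(2) V(2)] .
  have Ds: "smooth_fun (atl S) ?V D1" "smooth_fun (atl S) ?V D2"
    unfolding D1_def D2_def
    by (rule mdiff_along_smooth[OF smooth_fun_subset[OF Fs subset_UNIV] V(1)], rule Es)+
  have G: "ip22 (mdiff (atl S) D1 p X) (mdiff (atl S) F p W) = met (TB S) p (nab (TB S) p X E1) W"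
      "ip22 (mdiff (atl S) D2 p X) (mdiff (atl S) F p W) = met (TB S) p (nab (TB S) p X E2) W"
    using coordinate_gauss[OF F c, of "axis 1 1" "X c" "W c"] coordinate_gauss[OF F c, of "axis 2 1" "X c" "W c"]
    unfolding tangent_expansion[OF c X, symmetric] tangent_expansion[OF c W, symmetric]
    by (simp_all add: D1_def[abs_def] D2_def[abs_def] E1_def E2_def)
  have FW: "ip22 (D1 p) (mdiff (atl S) F p W) = met (TB S) p (E1 p) W"
      "ip22 (D2 p) (mdiff (atl S) F p W) = met (TB S) p (E2 p) W"
    using F Ef W unfolding isometric_immersion_def D1_def D2_def by blast+
  have "mdiff (atl S) (\<lambda>x. mdiff (atl S) F x (Y x)) p X = mdiff (atl S) (\<lambda>q. f1 q *\<^sub>R D1 q + f2 q *\<^sub>R D2 q) p X"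
    by (rule mdiff_cong[OF V]) (simp add: f12(3) E[symmetric] D1_def D2_def mdiff_direction[OF Fs UNIV_I])
  also have "\<dots> = (f1 p *\<^sub>R mdiff (atl S) D1 p X + mdiff (atl S) f1 p X *\<^sub>R D1 p)
      + (f2 p *\<^sub>R mdiff (atl S) D2 p X + mdiff (atl S) f2 p X *\<^sub>R D2 p)"
    using mdiff_add[OF smooth_fun_scaleR[OF V(1) f12(1) Ds(1)] smooth_fun_scaleR[OF V(1) f12(2) Ds(2)] V(2)]
      mdiff_scaleR[OF f12(1) Ds(1) V(2)] mdiff_scaleR[OF f12(2) Ds(2) V(2)] by simp
  finally have l: "ip22 (mdiff (atl S) (\<lambda>x. mdiff (atl S) F x (Y x)) p X) (mdiff (atl S) F p W) =
      f1 p * met (TB S) p (nab (TB S) p X E1) W + mdiff (atl S) f1 p X * met (TB S) p (E1 p) W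
      + (f2 p * met (TB S) p (nab (TB S) p X E2) W + mdiff (atl S) f2 p X * met (TB S) p (E2 p) W)"
    by (simp only: ip22_linear G FW)
  have fs: "smooth_section (atl S) (TB S) ?V (\<lambda>q. f1 q *\<^sub>R E1 q)" "smooth_section (atl S) (TB S) ?V (\<lambda>q. f2 q *\<^sub>R E2 q)"
    by (intro TT.smooth_section_scale V Es f12)+
  have nE: "nab (TB S) p X E1 \<in> fib (TB S) p" "nab (TB S) p X E2 \<in> fib (TB S) p"
    using TT.nab_fib[OF V(1) Es(1) V(2) X] TT.nab_fib[OF V(1) Es(2) V(2) X] .
  have "nab (TB S) p X Y = nab (TB S) p X (\<lambda>q. f1 q *\<^sub>R E1 q + f2 q *\<^sub>R E2 q)"
    by (rule TT.nab_cong[OF V(1) _ _ V(2) X])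
      (use TT.smooth_section_combination[OF V(1) Es f12(1,2)] in \<open>auto simp: f12(3) E\<close>)
  also have "\<dots> = (mdiff (atl S) f1 p X *\<^sub>R E1 p + f1 p *\<^sub>R nab (TB S) p X E1)
      + (mdiff (atl S) f2 p X *\<^sub>R E2 p + f2 p *\<^sub>R nab (TB S) p X E2)"
    using TT.nab_add[OF V(1) fs V(2) X] TT.nab_scale[OF V(1) Es(1) f12(1) V(2) X]
      TT.nab_scale[OF V(1) Es(2) f12(2) V(2) X] by simp
  finally have "met (TB S) p (nab (TB S) p X Y) W =
      (mdiff (atl S) f1 p X * met (TB S) p (E1 p) W + f1 p * met (TB S) p (nab (TB S) p X E1) W)
      + (mdiff (atl S) f2 p X * met (TB S) p (E2 p) W + f2 p * met (TB S) p (nab (TB S) p X E2) W)"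
    using Ef nE W by (simp add: TT.met_simps TT.fib_closed)
  with l show ?thesis by simp
qed

lemma isometry_field_rotate:
  assumes "isometry_field S \<Omega>" and R: "R \<in> isometries22"
  shows "isometry_field S (\<lambda>p w. R *v \<Omega> p w)"
proof -
  interpret isometry_field S \<Omega> by (rule assms(1))
  have b: "bounded_linear ((*v) R)" by (rule matrix_vector_mul_bounded_linear)
  show ?thesis
  proof
    show "R *v \<Omega> p (w + w') = R *v \<Omega> p w + R *v \<Omega> p w'" if "w \<in> fibre p" "w' \<in> fibre p" for p w w'
      by (simp only: add[OF that] matrix_vector_right_distrib)
    show "R *v \<Omega> p (r *\<^sub>R w) = r *\<^sub>R (R *v \<Omega> p w)" if "w \<in> fibre p" for p w r
      by (simp only: scale[OF that] matrix_vector_mult_scaleR)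
    show "ip22 (R *v \<Omega> p (v, X)) (R *v \<Omega> p (v', X')) = met (EB S) p v v' + met (TB S) p X X'"
      if "(v, X) \<in> fibre p" "(v', X') \<in> fibre p" for p v X v' X'
      using isometry[OF that] R by (simp add: isometries22_def)
    show "smooth_fun (atl S) U (\<lambda>x. R *v \<Omega> x (s x, Y x))"
      if "open U" "smooth_section (atl S) (EB S) U s" "smooth_section (atl S) (TB S) U Y" for U s Y
      by (rule smooth_fun_linear[OF b that(1) smooth[OF that]])
  qed
qed

text \<open>The isometries of \<open>E \<oplus> TM\<close> with \<open>\<real>\<^sup>2\<^sup>,\<^sup>2\<close> that consist of \<open>\<Psi>\<close> and \<open>dF\<close>.\<close>

definition splitting :: "('m \<Rightarrow> real^4) \<Rightarrow> ('m \<Rightarrow> 'e \<Rightarrow> real^4) \<Rightarrow> 'm \<Rightarrow> 'e \<times> 'm tvec \<Rightarrow> real^4"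
  where "splitting F \<Psi> p w = \<Psi> p (fst w) + mdiff (atl S) F p (snd w)"

lemma immersionD:
  assumes i: "immersion_with S h B F \<Psi>"
  shows "isometric_immersion S F" "symmetric_form S B" "\<And>p. (1/2) *\<^sub>R metric_trace S B p = h p"
    "\<And>p v. v \<in> fib (EB S) p \<Longrightarrow> \<Psi> p v \<in> normal_space S F p"
    "\<And>p v w. v \<in> fib (EB S) p \<Longrightarrow> w \<in> fib (EB S) p \<Longrightarrow> \<Psi> p v = \<Psi> p w \<Longrightarrow> v = w"
    "\<And>p v w. v \<in> fib (EB S) p \<Longrightarrow> w \<in> fib (EB S) p \<Longrightarrow> \<Psi> p (v + w) = \<Psi> p v + \<Psi> p w"
    "\<And>p v r. v \<in> fib (EB S) p \<Longrightarrow> \<Psi> p (r *\<^sub>R v) = r *\<^sub>R \<Psi> p v"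
    "\<And>p v w. v \<in> fib (EB S) p \<Longrightarrow> w \<in> fib (EB S) p \<Longrightarrow> ip22 (\<Psi> p v) (\<Psi> p w) = met (EB S) p v w"
    "\<And>U s. open U \<Longrightarrow> smooth_section (atl S) (EB S) U s \<Longrightarrow> smooth_fun (atl S) U (\<lambda>p. \<Psi> p (s p))"
    "\<And>U s p X. open U \<Longrightarrow> smooth_section (atl S) (EB S) U s \<Longrightarrow> p \<in> U \<Longrightarrow> X \<in> fib (TB S) p \<Longrightarrow>
      \<Psi> p (nab (EB S) p X s) = normal_part S F p (mdiff (atl S) (\<lambda>q. \<Psi> q (s q)) p X)"
    "\<And>U Y p X. open U \<Longrightarrow> smooth_section (atl S) (TB S) U Y \<Longrightarrow> p \<in> U \<Longrightarrow> X \<in> fib (TB S) p \<Longrightarrow>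
      \<Psi> p (B p X (Y p)) = normal_part S F p (mdiff (atl S) (\<lambda>q. mdiff (atl S) F q (Y q)) p X)"
proof -
  note d = i[unfolded immersion_with_def]
  note d1 = d[THEN conjunct2] note d2 = d1[THEN conjunct2] note d3 = d2[THEN conjunct2]
  note d4 = d3[THEN conjunct2] note d5 = d4[THEN conjunct2] note d6 = d5[THEN conjunct2]
  have bij: "bij_betw (\<Psi> p) (fib (EB S) p) (normal_space S F p)" for p using d2[THEN conjunct1] by blast
  show "isometric_immersion S F" by (rule d[THEN conjunct1])
  show "symmetric_form S B" by (rule d1[THEN conjunct1])
  show "(1/2) *\<^sub>R metric_trace S B p = h p" for p by (rule d6[THEN spec])
  show "\<Psi> p v \<in> normal_space S F p" if "v \<in> fib (EB S) p" for p v by (rule bij_betw_apply[OF bij that])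
  show "v = w" if "v \<in> fib (EB S) p" "w \<in> fib (EB S) p" "\<Psi> p v = \<Psi> p w" for p v w
    by (rule inj_onD[OF bij_betw_imp_inj_on[OF bij] that(3,1,2)])
  note a = d3[THEN conjunct1, THEN spec]
  show "\<Psi> p (v + w) = \<Psi> p v + \<Psi> p w" if "v \<in> fib (EB S) p" "w \<in> fib (EB S) p" for p v w
    by (rule a[THEN bspec, THEN bspec, THEN spec, THEN conjunct1, OF that])
  show "\<Psi> p (r *\<^sub>R v) = r *\<^sub>R \<Psi> p v" if "v \<in> fib (EB S) p" for p v r
    by (rule a[THEN bspec, THEN bspec, THEN spec, THEN conjunct2, THEN conjunct1, OF that that])
  show "ip22 (\<Psi> p v) (\<Psi> p w) = met (EB S) p v w" if "v \<in> fib (EB S) p" "w \<in> fib (EB S) p" for p v w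
    by (rule a[THEN bspec, THEN bspec, THEN spec, THEN conjunct2, THEN conjunct2, OF that])
  note b = d4[THEN conjunct1, THEN spec, THEN spec, THEN mp, OF conjI]
  show "smooth_fun (atl S) U (\<lambda>p. \<Psi> p (s p))" if "open U" "smooth_section (atl S) (EB S) U s" for U s
    by (rule b[THEN conjunct1, OF that])
  show "\<Psi> p (nab (EB S) p X s) = normal_part S F p (mdiff (atl S) (\<lambda>q. \<Psi> q (s q)) p X)"
    if "open U" "smooth_section (atl S) (EB S) U s" "p \<in> U" "X \<in> fib (TB S) p" for U s p X
    by (rule b[THEN conjunct2, THEN bspec, THEN bspec, OF that])
  note c = d5[THEN conjunct1, THEN spec, THEN spec, THEN mp, OF conjI]
  show "\<Psi> p (B p X (Y p)) = normal_part S F p (mdiff (atl S) (\<lambda>q. mdiff (atl S) F q (Y q)) p X)"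
    if "open U" "smooth_section (atl S) (TB S) U Y" "p \<in> U" "X \<in> fib (TB S) p" for U Y p X
    by (rule c[THEN bspec, THEN bspec, OF that])
qed

lemma splitting_isometry_field:
  assumes i: "immersion_with S h B F \<Psi>"
  shows "isometry_field S (splitting F \<Psi>)"
proof
  note d = immersionD[OF i]
  have Fs: "smooth_fun (atl S) UNIV F"
    and iso: "\<And>p X Y. X \<in> fib (TB S) p \<Longrightarrow> Y \<in> fib (TB S) p \<Longrightarrow>
      ip22 (mdiff (atl S) F p X) (mdiff (atl S) F p Y) = met (TB S) p X Y"
    using d(1) unfolding isometric_immersion_def by blast+
  show "splitting F \<Psi> p (w + w') = splitting F \<Psi> p w + splitting F \<Psi> p w'"
    if "w \<in> fibre p" "w' \<in> fibre p" for p w w'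
    using that by (auto simp: fibre_def splitting_def d(6) mdiff_direction[OF Fs UNIV_I])
  show "splitting F \<Psi> p (r *\<^sub>R w) = r *\<^sub>R splitting F \<Psi> p w" if "w \<in> fibre p" for p w r
    using that by (auto simp: fibre_def splitting_def d(7) mdiff_direction[OF Fs UNIV_I] scaleR_add_right)
  show "ip22 (splitting F \<Psi> p (v, X)) (splitting F \<Psi> p (v', X')) = met (EB S) p v v' + met (TB S) p X X'"
    if "(v, X) \<in> fibre p" "(v', X') \<in> fibre p" for p v X v' X'
  proof -
    have f: "v \<in> fib (EB S) p" "v' \<in> fib (EB S) p" "X \<in> fib (TB S) p" "X' \<in> fib (TB S) p"
      using that by (auto simp: fibre_def)
    have "ip22 (\<Psi> p v) (mdiff (atl S) F p X') = 0" "ip22 (\<Psi> p v') (mdiff (atl S) F p X) = 0"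
      using d(4)[OF f(1)] d(4)[OF f(2)] f by (simp_all add: normal_space_def)
    then show ?thesis
      using ip22_linear(7)[of "\<Psi> p v'" "mdiff (atl S) F p X"]
      by (simp add: splitting_def ip22_linear(1,2) d(8)[OF f(1,2)] iso[OF f(3,4)])
  qed
  show "smooth_fun (atl S) U (\<lambda>x. splitting F \<Psi> x (s x, Y x))"
    if "open U" "smooth_section (atl S) (EB S) U s" "smooth_section (atl S) (TB S) U Y" for U s Y
    unfolding splitting_def fst_conv snd_conv
    by (intro smooth_fun_add that d(9) mdiff_along_smooth[OF smooth_fun_subset[OF Fs subset_UNIV] that(1,3)])
qed

text \<open>The normal components are prescribed by the definition of an immersion with second fundamental form
  \<open>B\<close> and normal bundle \<open>E\<close>; the tangential component in the Gauss formula is that of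
  \<open>tangential_derivative\<close>.\<close>

lemma splitting_gauss_weingarten:
  assumes i: "immersion_with S h B F \<Psi>" and X: "X \<in> fib (TB S) p"
    and surj: "\<And>x. \<exists>w\<in>fibre p. splitting F \<Psi> p w = x"
  shows "gauss_weingarten B (splitting F \<Psi>) p X"
  unfolding gauss_weingarten_def
proof (intro conjI allI impI; elim conjE)
  note d = immersionD[OF i]
  interpret isometry_field S "splitting F \<Psi>" by (rule splitting_isometry_field[OF i])
  have \<Psi>0: "\<Psi> q 0 = 0" for q using d(7)[of 0 q 0] PE.fib_closed(5) by simp
  have Fs: "smooth_fun (atl S) UNIV F" using d(1) by (simp add: isometric_immersion_def)
  have dF0: "mdiff (atl S) F q 0 = 0" for q using mdiff_direction(2)[OF Fs UNIV_I, of q 0 0] by simp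
  have tang: "splitting F \<Psi> q (0, Y) = mdiff (atl S) F q Y" and norm: "splitting F \<Psi> q (v, 0) = \<Psi> q v" for q Y v
    by (simp_all add: splitting_def \<Psi>0 dF0)
  have part: "normal_part S F p (splitting F \<Psi> p (v, W)) = \<Psi> p v" if "(v, W) \<in> fibre p" for v W
    using normal_part_eq[OF d(1) d(4), of v p W] that by (simp add: splitting_def fibre_def add.commute)
  fix U assume U: "open U" "p \<in> U"
  {
    fix Y assume Y: "smooth_section (atl S) (TB S) U Y"
    define x where "x = mdiff (atl S) (\<lambda>q. mdiff (atl S) F q (Y q)) p X"
    obtain v W where vW: "(v, W) \<in> fibre p" "splitting F \<Psi> p (v, W) = x" using surj[of x] by (metis surj_pair)
    have f: "v \<in> fib (EB S) p" "W \<in> fib (TB S) p" using vW(1) by (auto simp: fibre_def)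
    have Yp: "Y p \<in> fib (TB S) p" and nY: "nab (TB S) p X Y \<in> fib (TB S) p"
      using TT.smooth_section_fib[OF Y U(2)] TT.nab_fib[OF U(1) Y U(2) X] .
    have BY: "B p X (Y p) \<in> fib (EB S) p" by (rule normal_formD(1)[OF symmetric_form_normal[OF d(2)] X Yp])
    have v: "B p X (Y p) = v"
      using d(11)[OF U(1) Y U(2) X] part[OF vW(1)] by (intro d(5)[OF BY f(1)]) (simp add: vW(2) x_def)
    have "W - nab (TB S) p X Y = 0"
    proof (rule met_nondegenerate_T[where p = p])
      show "W - nab (TB S) p X Y \<in> fib (TB S) p" by (rule TT.fib_closed(3)[OF f(2) nY])
      fix Z assume Z: "Z \<in> fib (TB S) p"
      have "met (TB S) p (nab (TB S) p X Y) Z = ip22 x (mdiff (atl S) F p Z)"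
        unfolding x_def by (rule tangential_derivative[OF d(1) U Y X Z, symmetric])
      also have "\<dots> = met (TB S) p W Z"
        using isometry[OF vW(1) fibre_pairs(2)[OF Z]] PE.met_zero(2)[OF f(1)] by (simp only: vW(2) tang add_0)
      finally have "met (TB S) p W Z = met (TB S) p (nab (TB S) p X Y) Z" by simp
      moreover have "met (TB S) p (W - nab (TB S) p X Y) Z + met (TB S) p (nab (TB S) p X Y) Z = met (TB S) p W Z"
        using TT.met_add[OF TT.fib_closed(3)[OF f(2) nY] nY Z] by simp
      ultimately show "met (TB S) p (W - nab (TB S) p X Y) Z = 0" by simp
    qed
    then show "mdiff (atl S) (\<lambda>x. splitting F \<Psi> x (0, Y x)) p X = splitting F \<Psi> p (B p X (Y p), nab (TB S) p X Y)"
      using vW(2) by (simp add: tang v x_def)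
  }
  {
    fix s assume s: "smooth_section (atl S) (EB S) U s"
    define x where "x = mdiff (atl S) (\<lambda>q. \<Psi> q (s q)) p X"
    obtain v W where vW: "(v, W) \<in> fibre p" "splitting F \<Psi> p (v, W) = x" using surj[of x] by (metis surj_pair)
    have f: "v \<in> fib (EB S) p" "W \<in> fib (TB S) p" using vW(1) by (auto simp: fibre_def)
    have "nab (EB S) p X s = v"
      using d(10)[OF U(1) s U(2) X] part[OF vW(1)]
      by (intro d(5)[OF PE.nab_fib[OF U(1) s U(2) X] f(1)]) (simp add: vW(2) x_def)
    then have "mdiff (atl S) (\<lambda>x. splitting F \<Psi> x (s x, 0)) p X = splitting F \<Psi> p (nab (EB S) p X s, W)"
      using vW(2) by (simp add: norm x_def)
    then show "\<exists>W\<in>fib (TB S) p. mdiff (atl S) (\<lambda>x. splitting F \<Psi> x (s x, 0)) p X = splitting F \<Psi> p (nab (EB S) p X s, W)"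
      using f(2) by blast
  }
qed

lemma gauss_weingarten_rotate:
  assumes i: "isometry_field S \<Omega>" and g: "gauss_weingarten B \<Omega> p X"
    and eq: "\<And>q w. w \<in> fibre q \<Longrightarrow> \<Phi> q w = R *v \<Omega> q w" and B: "normal_form B p" and X: "X \<in> fib (TB S) p"
  shows "gauss_weingarten B \<Phi> p X"
  unfolding gauss_weingarten_def
proof (intro conjI allI impI; elim conjE)
  interpret isometry_field S \<Omega> by (rule i)
  have b: "bounded_linear ((*v) R)" by (rule matrix_vector_mul_bounded_linear)
  fix U assume U: "open U" "p \<in> U"
  {
    fix Y assume Y: "smooth_section (atl S) (TB S) U Y"
    note Yf = TT.smooth_section_fib[OF Y]
    have "mdiff (atl S) (\<lambda>x. \<Phi> x (0, Y x)) p X = mdiff (atl S) (\<lambda>x. R *v \<Omega> x (0, Y x)) p X"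
      by (rule mdiff_cong[OF U]) (simp add: eq fibre_pairs(2)[OF Yf])
    also have "\<dots> = R *v \<Omega> p (B p X (Y p), nab (TB S) p X Y)"
      using mdiff_linear_comp[OF b smooth[OF U(1) PE.zero_section(1)[OF U(1)] Y] U(2)] gaussD[OF g U Y] by simp
    also have "\<dots> = \<Phi> p (B p X (Y p), nab (TB S) p X Y)"
      by (rule eq[symmetric]) (simp add: fibre_def normal_formD(1)[OF B X Yf[OF U(2)]] TT.nab_fib[OF U(1) Y U(2) X])
    finally show "mdiff (atl S) (\<lambda>x. \<Phi> x (0, Y x)) p X = \<Phi> p (B p X (Y p), nab (TB S) p X Y)" .
  }
  {
    fix v assume v: "smooth_section (atl S) (EB S) U v"
    obtain W where W: "W \<in> fib (TB S) p" "mdiff (atl S) (\<lambda>x. \<Omega> x (v x, 0)) p X = \<Omega> p (nab (EB S) p X v, W)"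
      using weingartenD[OF g U v] by blast
    have "mdiff (atl S) (\<lambda>x. \<Phi> x (v x, 0)) p X = mdiff (atl S) (\<lambda>x. R *v \<Omega> x (v x, 0)) p X"
      by (rule mdiff_cong[OF U]) (simp add: eq fibre_pairs(1)[OF PE.smooth_section_fib[OF v]])
    also have "\<dots> = R *v \<Omega> p (nab (EB S) p X v, W)"
      using mdiff_linear_comp[OF b smooth[OF U(1) v TT.zero_section(1)[OF U(1)]] U(2)] W(2) by simp
    also have "\<dots> = \<Phi> p (nab (EB S) p X v, W)"
      by (rule eq[symmetric]) (simp add: fibre_def PE.nab_fib[OF U(1) v U(2) X] W(1))
    finally show "\<exists>W\<in>fib (TB S) p. mdiff (atl S) (\<lambda>x. \<Phi> x (v x, 0)) p X = \<Phi> p (nab (EB S) p X v, W)"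
      using W(1) by blast
  }
qed

text \<open>For compatible orientations the frame lies in the identity component and can be lifted as it stands.
  Otherwise it is moved to the standard frame.\<close>

lemma liftable_rotation:
  assumes i: "immersion_with S h B F \<Psi>" and q: "q \<in> spin_frames S p"
  obtains R u where "R \<in> isometries22" "orientation_compatible S F \<Psi> \<longrightarrow> R = mat 1"
    "lift_of u (\<chi> j. R *v splitting F \<Psi> p (frame_comb q (axis j 1)))"
proof -
  note d = immersionD[OF i]
  interpret isometry_field S "splitting F \<Psi>" by (rule splitting_isometry_field[OF i])
  have one: "mat 1 \<in> isometries22" by (simp add: isometries22_def)
  show ?thesis
  proof (cases "orientation_compatible S F \<Psi>")
    case True
    obtain q1 q2 where q': "q = (q1, q2)" by (cases q)
    let ?e0 = "fst (sframe (PE S) q1)" and ?e1 = "snd (sframe (PE S) q1)"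
      and ?e2 = "fst (sframe (PM S) q2)" and ?e3 = "snd (sframe (PM S) q2)"
    note f = spin_framesD(3,4)[OF q[unfolded q']]
    obtain R where R: "R \<in> connected_component_set isometries22 (mat 1)"
      "\<Psi> p ?e0 = R *v axis 0 1" "\<Psi> p ?e1 = R *v axis 1 1"
      "mdiff (atl S) F p ?e2 = R *v axis 2 1" "mdiff (atl S) F p ?e3 = R *v axis 3 1"
      using True[unfolded orientation_compatible_def, THEN spec, THEN bspec, OF f(1)] f(2) by blast
    have Fs: "smooth_fun (atl S) UNIV F" using d(1) by (simp add: isometric_immersion_def)
    have z: "\<Psi> p 0 = 0" "mdiff (atl S) F p 0 = 0"
      using d(7)[of 0 p 0] PE.fib_closed(5) mdiff_direction(2)[OF Fs UNIV_I, of p 0 0] by simp_all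
    have "splitting F \<Psi> p (frame_comb q (axis j 1)) = R *v axis j 1" for j
    proof -
      have "\<forall>j. splitting F \<Psi> p (frame_comb q (axis j 1)) = R *v axis j 1"
        unfolding forall_index4 by (simp add: splitting_def frame_comb_def q' axis4 R(2-5)[unfolded axis4] z)
      then show ?thesis by blast
    qed
    then show ?thesis
      using that[OF one] identity_component_liftable[OF R(1)] by (simp only: matrix_vector_mul_lid) blast
  next
    case False
    obtain R where R: "R \<in> isometries22" "\<And>j. R *v (image_frame p q $ j) = axis j 1"
      using orthonormal_standardize[OF orthonormal_image_frame[OF q]] by blast
    have "(\<chi> j. R *v splitting F \<Psi> p (frame_comb q (axis j 1))) = std_frame"
      using R(2) by (simp only: image_frame_def vec_lambda_beta std_frame_def)
    then show ?thesis using that[OF R(1)] lift_of_std_frame False by metis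
  qed
qed

text \<open>Liftability at one point suffices for a spinor field \<open>\<phi>\<close> with \<open>emb \<phi>\<close> equal to \<open>R\<close> after the splitting
  of the immersion. The Gauss and Weingarten formulas are preserved by the constant matrix \<open>R\<close>.\<close>

theorem immersion_imp_killing:
  assumes sc: "simply_connected (UNIV :: 'm set)" and i: "immersion_with S h B F \<Psi>"
  shows "\<exists>\<phi> R. killing_solution S h B \<phi> \<and> R \<in> isometries22 \<and>
    is_integral S (\<lambda>p. R *v F p) (xi_form S \<phi>) \<and> (orientation_compatible S F \<Psi> \<longrightarrow> R = mat 1)"
proof -
  note d = immersionD[OF i]
  note field = splitting_isometry_field[OF i]
  have Fs: "smooth_fun (atl S) UNIV F" using d(1) by (simp add: isometric_immersion_def)
  fix p0 :: 'm
  obtain q0 where q0: "q0 \<in> spin_frames S p0" using spin_frames_nonempty by blast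
  obtain R u where R: "R \<in> isometries22" "orientation_compatible S F \<Psi> \<longrightarrow> R = mat 1"
    and u: "lift_of u (\<chi> j. R *v splitting F \<Psi> p0 (frame_comb q0 (axis j 1)))"
    by (rule liftable_rotation[OF i q0])
  interpret isometry_field S "\<lambda>p w. R *v splitting F \<Psi> p w" by (rule isometry_field_rotate[OF field R(1)])
  obtain \<phi> where \<phi>: "unit_spinor_field S \<phi>" "\<And>p w. w \<in> fibre p \<Longrightarrow> emb \<phi> p w = R *v splitting F \<Psi> p w"
    using spinor_of_isometry[OF sc q0] u unfolding image_frame_def by blast
  have surj: "\<exists>w\<in>fibre p. splitting F \<Psi> p w = x" for p x
  proof -
    obtain w where w: "w \<in> fibre p" "emb \<phi> p w = R *v x" using emb_surj[OF \<phi>(1)] by blast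
    have "splitting F \<Psi> p w = x" by (rule isometry_inj[OF R(1)]) (simp only: \<phi>(2)[OF w(1), symmetric] w(2))
    then show ?thesis using w(1) by blast
  qed
  have "gauss_weingarten B (emb \<phi>) p X" if X: "X \<in> fib (TB S) p" for p X
    by (rule gauss_weingarten_rotate[OF field splitting_gauss_weingarten[OF i X surj] \<phi>(2)
          symmetric_form_normal[OF d(2)] X])
  then have "killing_solution S h B \<phi>"
    unfolding killing_solution_iff using \<phi>(1) d(2,3) by blast
  moreover have "is_integral S (\<lambda>p. R *v F p) (xi_form S \<phi>)"
    unfolding is_integral_def
  proof (intro conjI allI ballI)
    have b: "bounded_linear ((*v) R)" by (rule matrix_vector_mul_bounded_linear)
    show "smooth_fun (atl S) UNIV (\<lambda>p. R *v F p)" by (rule smooth_fun_linear[OF b open_UNIV Fs])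
    fix p X assume X: "X \<in> fib (TB S) p"
    have "\<Psi> p 0 = 0" using d(7)[of 0 p 0] PE.fib_closed(5) by simp
    then have "mdiff (atl S) (\<lambda>p. R *v F p) p X = emb \<phi> p (0, X)"
      using \<phi>(2)[OF fibre_pairs(2)[OF X]] mdiff_linear_comp[OF b Fs UNIV_I, of p X] by (simp add: splitting_def)
    then show "iota (mdiff (atl S) (\<lambda>p. R *v F p) p X) = xi_form S \<phi> p X"
      using xi_emb[OF \<phi>(1) X] by simp
  qed
  ultimately show ?thesis using R by blast
qed

end

theorem theorem1:
  fixes S :: "('m::{t2_space, second_countable_topology}, 'e::real_vector, 'qe, 'qm) spin_surface"
    and h :: "'m \<Rightarrow> 'e"
  assumes "spin_lorentz_surface S"
    and "simply_connected (UNIV :: 'm set)"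
    and "smooth_section (atl S) (EB S) UNIV h"
  shows
    "((\<exists>\<phi>. dirac_solution S h \<phi>) \<longleftrightarrow> (\<exists>B \<phi>. killing_solution S h B \<phi>)) \<and>
     ((\<exists>B \<phi>. killing_solution S h B \<phi>) \<longleftrightarrow> (\<exists>B F \<Psi>. immersion_with S h B F \<Psi>)) \<and>
     (\<forall>\<phi>. dirac_solution S h \<phi> \<longleftrightarrow> (\<exists>B. killing_solution S h B \<phi>)) \<and>
     (\<forall>B. (\<exists>\<phi>. killing_solution S h B \<phi>) \<longleftrightarrow> (\<exists>F \<Psi>. immersion_with S h B F \<Psi>)) \<and>
     (\<forall>B \<phi>. killing_solution S h B \<phi> \<longrightarrow>
        (\<forall>p. \<forall>X\<in>fib (TB S) p. xi_form S \<phi> p X \<in> range iota) \<and>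
        closed_form S (xi_form S \<phi>) \<and>
        (\<exists>F. is_integral S F (xi_form S \<phi>)) \<and>
        (\<forall>F. is_integral S F (xi_form S \<phi>) \<longrightarrow> (\<exists>\<Psi>. immersion_with S h B F \<Psi>))) \<and>
     (\<forall>B F \<Psi>. immersion_with S h B F \<Psi> \<longrightarrow>
        (\<exists>\<phi> R. killing_solution S h B \<phi> \<and> R \<in> isometries22 \<and>
           is_integral S (\<lambda>p. R *v F p) (xi_form S \<phi>) \<and>
           (orientation_compatible S F \<Psi> \<longrightarrow> R = mat 1)))"
proof -
  interpret spin_surface S by unfold_locales (rule assms(1))
  have hf: "h p \<in> fib (EB S) p" for p by (rule PE.smooth_section_fib[OF assms(3) UNIV_I])
  have dk: "dirac_solution S h \<phi> \<longleftrightarrow> (\<exists>B. killing_solution S h B \<phi>)" for \<phi>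
    using dirac_imp_killing[OF _ hf] killing_imp_dirac[OF _ hf] by blast
  have ki: "(\<forall>p. \<forall>X\<in>fib (TB S) p. xi_form S \<phi> p X \<in> range iota) \<and> closed_form S (xi_form S \<phi>) \<and>
      (\<exists>F. is_integral S F (xi_form S \<phi>)) \<and>
      (\<forall>F. is_integral S F (xi_form S \<phi>) \<longrightarrow> (\<exists>\<Psi>. immersion_with S h B F \<Psi>))"
    if k: "killing_solution S h B \<phi>" for B \<phi>
  proof (intro conjI allI ballI impI)
    have \<phi>: "unit_spinor_field S \<phi>" using k by (simp add: killing_solution_def)
    show "xi_form S \<phi> p X \<in> range iota" if "X \<in> fib (TB S) p" for p X
      unfolding xi_emb[OF \<phi> that] by (rule rangeI)
    show "closed_form S (xi_form S \<phi>)" by (rule xi_closed[OF k])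
    show "\<exists>F. is_integral S F (xi_form S \<phi>)" by (rule killing_integral[OF assms(2) k])
    show "\<exists>\<Psi>. immersion_with S h B F \<Psi>" if "is_integral S F (xi_form S \<phi>)" for F
      by (rule exI, rule killing_immersion[OF k that])
  qed
  have ik: "\<exists>\<phi> R. killing_solution S h B \<phi> \<and> R \<in> isometries22 \<and>
      is_integral S (\<lambda>p. R *v F p) (xi_form S \<phi>) \<and> (orientation_compatible S F \<Psi> \<longrightarrow> R = mat 1)"
    if "immersion_with S h B F \<Psi>" for B F \<Psi>
    by (rule immersion_imp_killing[OF assms(2) that])
  have kiB: "(\<exists>\<phi>. killing_solution S h B \<phi>) \<longleftrightarrow> (\<exists>F \<Psi>. immersion_with S h B F \<Psi>)" for B
  proof
    assume "\<exists>\<phi>. killing_solution S h B \<phi>"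
    then show "\<exists>F \<Psi>. immersion_with S h B F \<Psi>" using ki by meson
  next
    assume "\<exists>F \<Psi>. immersion_with S h B F \<Psi>"
    then show "\<exists>\<phi>. killing_solution S h B \<phi>" using ik by meson
  qed
  show ?thesis
  proof (intro conjI)
    show "(\<exists>\<phi>. dirac_solution S h \<phi>) \<longleftrightarrow> (\<exists>B \<phi>. killing_solution S h B \<phi>)" using dk by blast
    show "(\<exists>B \<phi>. killing_solution S h B \<phi>) \<longleftrightarrow> (\<exists>B F \<Psi>. immersion_with S h B F \<Psi>)" using kiB by blast
    show "\<forall>\<phi>. dirac_solution S h \<phi> \<longleftrightarrow> (\<exists>B. killing_solution S h B \<phi>)" using dk by (rule allI)
    show "\<forall>B. (\<exists>\<phi>. killing_solution S h B \<phi>) \<longleftrightarrow> (\<exists>F \<Psi>. immersion_with S h B F \<Psi>)" using kiB by (rule allI)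
  qed (intro allI impI, erule ki, intro allI impI, erule ik)
qed

end
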